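(* Let $A$ be a self-injective Artin algebra and $n\ge 2$ an integer. Then $T_n(A)$ is CM-finite if and only if there is a $T_n(A)$-generator $M$ which is Gorenstein-projective and such that $\operatorname{gl.dim}\operatorname{End}_{T_n(A)}(M)\le 2$.
   Context: $T_n(A)$ is the algebra of upper triangular $n\times n$ matrices over $A$. For an Artin algebra $B$, $B\text{-mod}$ is the category of finitely generated left $B$-modules. A module $G\in B\text{-mod}$ is Gorenstein-projective if there is an exact sequence $\cdots\to P^{-1}\to P^0\xrightarrow{d^0}P^1\to\cdots$ of projective modules in $B\text{-mod}$ which stays exact under $\operatorname{Hom}_B(-,B)$ and with $G\cong\operatorname{Ker} d^0$. $B$ is CM-finite if there are only finitely many isomorphism classes of indecomposable Gorenstein-projective modules in $B\text{-mod}$. A module $M\in B\text{-mod}$ is a $B$-generator if each projective module in $B\text{-mod}$ is a direct summand of a finite direct sum of copies of $M$. *)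

theory Defs
  imports "HOL-Algebra.Ideal" "HOL-Algebra.Module" "HOL-Library.Extended_Nat"
begin

section \<open>Left modules over a not necessarily commutative ring\<close>

text \<open>The locale \<open>module\<close> of HOL-Algebra requires a commutative ring of scalars. The locale
  below has the same axioms over an arbitrary ring and uses the same record type, in which the
  fields \<open>mult\<close> and \<open>one\<close> are irrelevant. The library's locale \<open>submodule\<close> does not assume
  commutativity and is used as it is.\<close>

locale left_module = R?: ring R + M?: abelian_group M
  for R :: "('r, 'a) ring_scheme" (structure) and M :: "('r, 'm, 'b) module_scheme" (structure) +
  assumes smult_closed [simp, intro]:
      "\<lbrakk>a \<in> carrier R; x \<in> carrier M\<rbrakk> \<Longrightarrow> a \<odot>\<^bsub>M\<^esub> x \<in> carrier M"
    and smult_l_distr: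
      "\<lbrakk>a \<in> carrier R; b \<in> carrier R; x \<in> carrier M\<rbrakk> \<Longrightarrow>
       (a \<oplus> b) \<odot>\<^bsub>M\<^esub> x = a \<odot>\<^bsub>M\<^esub> x \<oplus>\<^bsub>M\<^esub> b \<odot>\<^bsub>M\<^esub> x"
    and smult_r_distr:
      "\<lbrakk>a \<in> carrier R; x \<in> carrier M; y \<in> carrier M\<rbrakk> \<Longrightarrow>
       a \<odot>\<^bsub>M\<^esub> (x \<oplus>\<^bsub>M\<^esub> y) = a \<odot>\<^bsub>M\<^esub> x \<oplus>\<^bsub>M\<^esub> a \<odot>\<^bsub>M\<^esub> y"
    and smult_assoc1:
      "\<lbrakk>a \<in> carrier R; b \<in> carrier R; x \<in> carrier M\<rbrakk> \<Longrightarrow>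
       (a \<otimes> b) \<odot>\<^bsub>M\<^esub> x = a \<odot>\<^bsub>M\<^esub> (b \<odot>\<^bsub>M\<^esub> x)"
    and smult_one [simp]:
      "x \<in> carrier M \<Longrightarrow> \<one> \<odot>\<^bsub>M\<^esub> x = x"

definition fin_gen :: "('r, 'a) ring_scheme \<Rightarrow> ('r, 'm, 'b) module_scheme \<Rightarrow> bool" where
  "fin_gen R M \<longleftrightarrow> (\<exists>S. finite S \<and> S \<subseteq> carrier M \<and>
     (\<forall>x \<in> carrier M. \<exists>c \<in> S \<rightarrow> carrier R. x = (\<Oplus>\<^bsub>M\<^esub>s\<in>S. c s \<odot>\<^bsub>M\<^esub> s)))"

definition fg_module :: "('r, 'a) ring_scheme \<Rightarrow> ('r, 'm, 'b) module_scheme \<Rightarrow> bool" where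
  "fg_module R M \<longleftrightarrow> left_module R M \<and> fin_gen R M"

text \<open>Homomorphisms are extensional functions, so that equality of morphisms is equality in HOL.\<close>

definition mod_hom ::
    "('r, 'a) ring_scheme \<Rightarrow> ('r, 'm, 'b) module_scheme \<Rightarrow> ('r, 'n, 'c) module_scheme \<Rightarrow> ('m \<Rightarrow> 'n) set" where
  "mod_hom R M N = {h \<in> carrier M \<rightarrow>\<^sub>E carrier N.
     (\<forall>x \<in> carrier M. \<forall>y \<in> carrier M. h (x \<oplus>\<^bsub>M\<^esub> y) = h x \<oplus>\<^bsub>N\<^esub> h y) \<and>
     (\<forall>a \<in> carrier R. \<forall>x \<in> carrier M. h (a \<odot>\<^bsub>M\<^esub> x) = a \<odot>\<^bsub>N\<^esub> h x)}"

definition mod_isomorphic ::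
    "('r, 'a) ring_scheme \<Rightarrow> ('r, 'm, 'b) module_scheme \<Rightarrow> ('r, 'n, 'c) module_scheme \<Rightarrow> bool" where
  "mod_isomorphic R M N \<longleftrightarrow> (\<exists>h \<in> mod_hom R M N. bij_betw h (carrier M) (carrier N))"

definition mod_ker :: "('r, 'm, 'b) module_scheme \<Rightarrow> ('r, 'n, 'c) module_scheme \<Rightarrow> ('m \<Rightarrow> 'n) \<Rightarrow> 'm set" where
  "mod_ker M N h = {x \<in> carrier M. h x = \<zero>\<^bsub>N\<^esub>}"

definition regular_module :: "('r, 'a) ring_scheme \<Rightarrow> ('r, 'r) module" where
  "regular_module R = \<lparr>carrier = carrier R, mult = mult R, one = one R,
     zero = zero R, add = add R, smult = mult R\<rparr>"

definition direct_power :: "('r, 'm, 'b) module_scheme \<Rightarrow> nat \<Rightarrow> ('r, nat \<Rightarrow> 'm) module" where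
  "direct_power M k = \<lparr>carrier = {..<k} \<rightarrow>\<^sub>E carrier M,
     mult = (\<lambda>_ _. undefined), one = undefined,
     zero = (\<lambda>i\<in>{..<k}. \<zero>\<^bsub>M\<^esub>),
     add = (\<lambda>f g. \<lambda>i\<in>{..<k}. f i \<oplus>\<^bsub>M\<^esub> g i),
     smult = (\<lambda>a f. \<lambda>i\<in>{..<k}. a \<odot>\<^bsub>M\<^esub> f i)\<rparr>"

definition internal_direct_sum ::
    "('r, 'a) ring_scheme \<Rightarrow> ('r, 'm, 'b) module_scheme \<Rightarrow> 'm set \<Rightarrow> 'm set \<Rightarrow> bool" where
  "internal_direct_sum R M N N' \<longleftrightarrow> submodule N R M \<and> submodule N' R M \<and>
     N \<inter> N' = {\<zero>\<^bsub>M\<^esub>} \<and> set_add M N N' = carrier M"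

definition is_direct_summand ::
    "('r, 'a) ring_scheme \<Rightarrow> ('r, 'm, 'b) module_scheme \<Rightarrow> ('r, 'n, 'c) module_scheme \<Rightarrow> bool" where
  "is_direct_summand R P X \<longleftrightarrow>
     (\<exists>N N'. internal_direct_sum R X N N' \<and> mod_isomorphic R P (X\<lparr>carrier := N\<rparr>))"

definition indecomposable_module :: "('r, 'a) ring_scheme \<Rightarrow> ('r, 'm, 'b) module_scheme \<Rightarrow> bool" where
  "indecomposable_module R M \<longleftrightarrow> left_module R M \<and> carrier M \<noteq> {\<zero>\<^bsub>M\<^esub>} \<and>
     (\<forall>N N'. internal_direct_sum R M N N' \<longrightarrow> N = {\<zero>\<^bsub>M\<^esub>} \<or> N' = {\<zero>\<^bsub>M\<^esub>})"


section \<open>The category of finitely generated modules\<close>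

text \<open>HOL cannot quantify over the carrier types of modules inside a formula. A quantifier over
  all finitely generated \<open>R\<close>-modules is therefore rendered as a quantifier over those with carrier
  in the fixed type below. Up to isomorphism these are all of them: a module with generators
  \<open>s\<^sub>0, \<dots>, s\<^sub>k\<^sub>-\<^sub>1\<close> is the quotient of the module of families \<open>nat \<Rightarrow> 'r\<close> supported below \<open>k\<close>,
  so its elements can be taken to be cosets, i.e. sets of families; see \<open>fg_module_in_universe\<close>.\<close>

type_synonym 'r fgmod = "('r, (nat \<Rightarrow> 'r) set) module"

lemma fg_module_in_universe:
  fixes R :: "('r, 'a) ring_scheme" and M :: "('r, 'm, 'b) module_scheme"
  assumes "fg_module R M"
  shows "\<exists>N :: 'r fgmod. fg_module R N \<and> mod_isomorphic R M N"
proof -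
  interpret left_module R M using assms by (simp add: fg_module_def)
  obtain S where S: "finite S" "S \<subseteq> carrier M"
    and gen: "\<And>x. x \<in> carrier M \<Longrightarrow> \<exists>c \<in> S \<rightarrow> carrier R. x = (\<Oplus>\<^bsub>M\<^esub>s\<in>S. c s \<odot>\<^bsub>M\<^esub> s)"
    using assms unfolding fg_module_def fin_gen_def by blast
  obtain ix :: "'m \<Rightarrow> nat" where ix: "inj_on ix S"
    using finite_imp_inj_to_nat_seg[OF S(1)] by blast
  define e where "e x = {c :: nat \<Rightarrow> 'r. (\<forall>s\<in>S. c (ix s) \<in> carrier R) \<and> x = (\<Oplus>\<^bsub>M\<^esub>s\<in>S. c (ix s) \<odot>\<^bsub>M\<^esub> s)}"
    for x
  have e_ne: "e x \<noteq> {}" if x: "x \<in> carrier M" for x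
  proof -
    obtain c where c: "c \<in> S \<rightarrow> carrier R" "x = (\<Oplus>\<^bsub>M\<^esub>s\<in>S. c s \<odot>\<^bsub>M\<^esub> s)" using gen[OF x] by blast
    have "(\<Oplus>\<^bsub>M\<^esub>s\<in>S. c s \<odot>\<^bsub>M\<^esub> s) = (\<Oplus>\<^bsub>M\<^esub>s\<in>S. (c \<circ> the_inv_into S ix) (ix s) \<odot>\<^bsub>M\<^esub> s)"
      using c(1) S(2) ix by (intro M.finsum_cong') (auto simp: the_inv_into_f_f Pi_iff subset_iff)
    then have "c \<circ> the_inv_into S ix \<in> e x" using c ix by (auto simp: e_def the_inv_into_f_f)
    then show ?thesis by blast
  qed
  have e: "inj_on e (carrier M)"
  proof (rule inj_onI)
    fix x y assume "x \<in> carrier M" "y \<in> carrier M" "e x = e y"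
    then obtain c where "c \<in> e x" "c \<in> e y" using e_ne by blast
    then show "x = y" by (simp add: e_def)
  qed
  define r where "r = the_inv_into (carrier M) e"
  have re[simp]: "r (e x) = x" if "x \<in> carrier M" for x
    using the_inv_into_f_f[OF e that] by (simp add: r_def)
  define N :: "'r fgmod" where "N = \<lparr>carrier = e ` carrier M,
     mult = (\<lambda>_ _. undefined), one = undefined, zero = e \<zero>\<^bsub>M\<^esub>,
     add = (\<lambda>u v. e (r u \<oplus>\<^bsub>M\<^esub> r v)), smult = (\<lambda>a u. e (a \<odot>\<^bsub>M\<^esub> r u))\<rparr>"
  have N: "carrier N = e ` carrier M" "zero N = e \<zero>\<^bsub>M\<^esub>"
    "add N = (\<lambda>u v. e (r u \<oplus>\<^bsub>M\<^esub> r v))" "smult N = (\<lambda>a u. e (a \<odot>\<^bsub>M\<^esub> r u))"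
    by (simp_all add: N_def)
  have "abelian_group N"
  proof (rule abelian_groupI)
    fix u assume "u \<in> carrier N"
    then obtain x where x: "x \<in> carrier M" "u = e x" by (auto simp: N)
    show "\<exists>v\<in>carrier N. v \<oplus>\<^bsub>N\<^esub> u = \<zero>\<^bsub>N\<^esub>"
      using x by (intro bexI[of _ "e (\<ominus>\<^bsub>M\<^esub> x)"]) (auto simp: N M.l_neg)
  qed (auto simp: N M.a_ac)
  then interpret N: abelian_group N .
  have lN: "left_module R N"
    by (unfold_locales) (auto simp: N smult_l_distr smult_r_distr smult_assoc1)
  have esum: "e (\<Oplus>\<^bsub>M\<^esub>s\<in>F. f s) = (\<Oplus>\<^bsub>N\<^esub>s\<in>F. e (f s))" if "finite F" "f \<in> F \<rightarrow> carrier M" for F :: "'m set" and f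
    using that
  proof (induction F rule: finite_induct)
    case empty then show ?case by (simp add: N)
  next
    case (insert a F)
    have "(\<lambda>s. e (f s)) \<in> F \<rightarrow> carrier N" "e (f a) \<in> carrier N"
      using insert.prems by (auto simp: N(1))
    with insert have "(\<Oplus>\<^bsub>N\<^esub>s\<in>insert a F. e (f s)) = e (f a) \<oplus>\<^bsub>N\<^esub> e (\<Oplus>\<^bsub>M\<^esub>s\<in>F. f s)"
      by (simp add: N.finsum_insert)
    also have "\<dots> = e (f a \<oplus>\<^bsub>M\<^esub> (\<Oplus>\<^bsub>M\<^esub>s\<in>F. f s))"
      using insert.prems by (simp add: N(3) Pi_iff)
    finally show ?case using insert by (simp add: Pi_iff)
  qed
  have "fin_gen R N"
    unfolding fin_gen_def
  proof (intro exI[of _ "e ` S"] conjI ballI)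
    show "finite (e ` S)" "e ` S \<subseteq> carrier N" using S by (auto simp: N)
    fix u assume "u \<in> carrier N"
    then obtain x where x: "x \<in> carrier M" "u = e x" by (auto simp: N)
    then obtain c where c: "c \<in> S \<rightarrow> carrier R" "x = (\<Oplus>\<^bsub>M\<^esub>s\<in>S. c s \<odot>\<^bsub>M\<^esub> s)" using gen by blast
    have eS: "inj_on e S" using e S(2) by (rule inj_on_subset)
    have rS: "r (e s) = s" if "s \<in> S" for s using that S(2) by auto
    have cS: "c s \<odot>\<^bsub>M\<^esub> s \<in> carrier M" if "s \<in> S" for s using that c(1) S(2) by auto
    have "u = (\<Oplus>\<^bsub>N\<^esub>s\<in>S. e (c s \<odot>\<^bsub>M\<^esub> s))"
      using x c esum[OF S(1), of "\<lambda>s. c s \<odot>\<^bsub>M\<^esub> s"] cS by auto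
    also have "\<dots> = (\<Oplus>\<^bsub>N\<^esub>s\<in>S. (c \<circ> r) (e s) \<odot>\<^bsub>N\<^esub> e s)"
      using cS rS by (intro N.finsum_cong') (auto simp: N)
    also have "\<dots> = (\<Oplus>\<^bsub>N\<^esub>v\<in>e ` S. (c \<circ> r) v \<odot>\<^bsub>N\<^esub> v)"
      using cS rS eS by (intro N.finsum_reindex[symmetric]) (auto simp: N)
    finally show "\<exists>c\<in>e ` S \<rightarrow> carrier R. u = (\<Oplus>\<^bsub>N\<^esub>s\<in>e ` S. c s \<odot>\<^bsub>N\<^esub> s)"
      using c(1) rS by (intro bexI[of _ "c \<circ> r"]) auto
  qed
  moreover have "mod_isomorphic R M N"
    unfolding mod_isomorphic_def
  proof (rule bexI[of _ "restrict e (carrier M)"])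
    show "bij_betw (restrict e (carrier M)) (carrier M) (carrier N)"
      using e by (auto simp: bij_betw_def N)
    show "restrict e (carrier M) \<in> mod_hom R M N" by (auto simp: mod_hom_def N)
  qed
  ultimately show ?thesis using lN unfolding fg_module_def by blast
qed

definition proj_module :: "('r, 'a) ring_scheme \<Rightarrow> 'r fgmod \<Rightarrow> bool" where
  "proj_module R P \<longleftrightarrow> fg_module R P \<and>
     (\<forall>(X :: 'r fgmod) (Y :: 'r fgmod) g f.
        fg_module R X \<and> fg_module R Y \<and> g \<in> mod_hom R X Y \<and> g ` carrier X = carrier Y \<and>
        f \<in> mod_hom R P Y
        \<longrightarrow> (\<exists>h \<in> mod_hom R P X. \<forall>x \<in> carrier P. g (h x) = f x))"

definition inj_module :: "('r, 'a) ring_scheme \<Rightarrow> ('r, 'm, 'b) module_scheme \<Rightarrow> bool" where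
  "inj_module R I \<longleftrightarrow> fg_module R I \<and>
     (\<forall>(X :: 'r fgmod) (Y :: 'r fgmod) g f.
        fg_module R X \<and> fg_module R Y \<and> g \<in> mod_hom R X Y \<and> inj_on g (carrier X) \<and>
        f \<in> mod_hom R X I
        \<longrightarrow> (\<exists>h \<in> mod_hom R Y I. \<forall>x \<in> carrier X. h (g x) = f x))"

definition self_injective :: "('r, 'a) ring_scheme \<Rightarrow> bool" where
  "self_injective R \<longleftrightarrow> inj_module R (regular_module R)"


section \<open>Artin algebras\<close>

definition artinian_cring :: "('k, 'a) ring_scheme \<Rightarrow> bool" where
  "artinian_cring K \<longleftrightarrow> cring K \<and>
     (\<forall>I :: nat \<Rightarrow> 'k set. (\<forall>i. ideal (I i) K \<and> I (Suc i) \<subseteq> I i) \<longrightarrow> (\<exists>m. \<forall>i\<ge>m. I i = I m))"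

text \<open>The library's locale \<open>algebra\<close> is restricted to commutative algebras. Here the ring structure
  of the algebra is that of the record \<open>A\<close> itself, and \<open>smult\<close> is the action of the base ring \<open>K\<close>.\<close>

definition artin_algebra :: "('k, 'a) ring_scheme \<Rightarrow> ('k, 'r, 'b) module_scheme \<Rightarrow> bool" where
  "artin_algebra K A \<longleftrightarrow> artinian_cring K \<and> ring A \<and> Module.module K A \<and> fin_gen K A \<and>
     (\<forall>c \<in> carrier K. \<forall>x \<in> carrier A. \<forall>y \<in> carrier A.
        (c \<odot>\<^bsub>A\<^esub> x) \<otimes>\<^bsub>A\<^esub> y = c \<odot>\<^bsub>A\<^esub> (x \<otimes>\<^bsub>A\<^esub> y) \<and>
        x \<otimes>\<^bsub>A\<^esub> (c \<odot>\<^bsub>A\<^esub> y) = c \<odot>\<^bsub>A\<^esub> (x \<otimes>\<^bsub>A\<^esub> y))"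


section \<open>Upper triangular matrices and endomorphism rings\<close>

text \<open>Rows and columns are indexed by \<open>0, \<dots>, n - 1\<close>; a matrix is a function that vanishes outside
  the index range and below the diagonal.\<close>

definition upper_triangular_ring :: "nat \<Rightarrow> ('r, 'a) ring_scheme \<Rightarrow> (nat \<Rightarrow> nat \<Rightarrow> 'r) ring" where
  "upper_triangular_ring n A = \<lparr>
     carrier = {X. \<forall>i j. if i \<le> j \<and> j < n then X i j \<in> carrier A else X i j = \<zero>\<^bsub>A\<^esub>},
     mult = (\<lambda>X Y i j. \<Oplus>\<^bsub>A\<^esub>k\<in>{..<n}. X i k \<otimes>\<^bsub>A\<^esub> Y k j),
     one = (\<lambda>i j. if i = j \<and> i < n then \<one>\<^bsub>A\<^esub> else \<zero>\<^bsub>A\<^esub>),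
     zero = (\<lambda>i j. \<zero>\<^bsub>A\<^esub>),
     add = (\<lambda>X Y i j. X i j \<oplus>\<^bsub>A\<^esub> Y i j)\<rparr>"

definition End_ring :: "('r, 'a) ring_scheme \<Rightarrow> ('r, 'm, 'b) module_scheme \<Rightarrow> ('m \<Rightarrow> 'm) ring" where
  "End_ring R M = \<lparr>
     carrier = mod_hom R M M,
     mult = compose (carrier M),
     one = (\<lambda>x\<in>carrier M. x),
     zero = (\<lambda>x\<in>carrier M. \<zero>\<^bsub>M\<^esub>),
     add = (\<lambda>f g. \<lambda>x\<in>carrier M. f x \<oplus>\<^bsub>M\<^esub> g x)\<rparr>"


section \<open>Gorenstein-projective modules\<close>

text \<open>The last conjunct is exactness of the complex obtained by applying \<open>Hom(-, R)\<close>, at the term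
  of \<open>P (i + 1)\<close>.\<close>

definition complete_proj_resolution ::
    "('r, 'a) ring_scheme \<Rightarrow> (int \<Rightarrow> 'r fgmod) \<Rightarrow> (int \<Rightarrow> (nat \<Rightarrow> 'r) set \<Rightarrow> (nat \<Rightarrow> 'r) set) \<Rightarrow> bool" where
  "complete_proj_resolution R P d \<longleftrightarrow>
     (\<forall>i. proj_module R (P i)) \<and>
     (\<forall>i. d i \<in> mod_hom R (P i) (P (i + 1))) \<and>
     (\<forall>i. d i ` carrier (P i) = mod_ker (P (i + 1)) (P (i + 2)) (d (i + 1))) \<and>
     (\<forall>i. (\<lambda>g. compose (carrier (P (i + 1))) g (d (i + 1))) `
              mod_hom R (P (i + 2)) (regular_module R) =
          {f \<in> mod_hom R (P (i + 1)) (regular_module R).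
             \<forall>x \<in> carrier (P i). f (d i x) = \<zero>\<^bsub>R\<^esub>})"

definition gorenstein_projective :: "('r, 'a) ring_scheme \<Rightarrow> 'r fgmod \<Rightarrow> bool" where
  "gorenstein_projective R G \<longleftrightarrow> fg_module R G \<and>
     (\<exists>P d. complete_proj_resolution R P d \<and>
        mod_isomorphic R G ((P 0)\<lparr>carrier := mod_ker (P 0) (P 1) (d 0)\<rparr>))"

definition CM_finite :: "('r, 'a) ring_scheme \<Rightarrow> bool" where
  "CM_finite R \<longleftrightarrow>
     (let \<G> = {G :: 'r fgmod. gorenstein_projective R G \<and> indecomposable_module R G}
      in finite (\<G> // {(G, H). G \<in> \<G> \<and> H \<in> \<G> \<and> mod_isomorphic R G H}))"

definition mod_generator :: "('r, 'a) ring_scheme \<Rightarrow> 'r fgmod \<Rightarrow> bool" where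
  "mod_generator R M \<longleftrightarrow> fg_module R M \<and>
     (\<forall>P. proj_module R P \<longrightarrow> (\<exists>k. is_direct_summand R P (direct_power M k)))"


section \<open>Global dimension\<close>

text \<open>A projective resolution \<open>0 \<rightarrow> P n \<rightarrow> \<dots> \<rightarrow> P 0 \<rightarrow> M \<rightarrow> 0\<close>: the map \<open>d 0\<close> is the augmentation
  \<open>P 0 \<rightarrow> M\<close>, and \<open>d (Suc i)\<close> is the differential \<open>P (Suc i) \<rightarrow> P i\<close>.\<close>

definition proj_resolution_of_length ::
    "('r, 'a) ring_scheme \<Rightarrow> 'r fgmod \<Rightarrow> nat \<Rightarrow> bool" where
  "proj_resolution_of_length R M n \<longleftrightarrow> (\<exists>P d.
     (\<forall>i. proj_module R (P i)) \<and> (\<forall>i>n. carrier (P i) = {\<zero>\<^bsub>P i\<^esub>}) \<and>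
     d 0 \<in> mod_hom R (P 0) M \<and> (\<forall>i. d (Suc i) \<in> mod_hom R (P (Suc i)) (P i)) \<and>
     d 0 ` carrier (P 0) = carrier M \<and>
     d 1 ` carrier (P 1) = mod_ker (P 0) M (d 0) \<and>
     (\<forall>i. d (Suc (Suc i)) ` carrier (P (Suc (Suc i))) = mod_ker (P (Suc i)) (P i) (d (Suc i))))"

definition proj_dim :: "('r, 'a) ring_scheme \<Rightarrow> 'r fgmod \<Rightarrow> enat" where
  "proj_dim R M = Inf {enat n | n. proj_resolution_of_length R M n}"

text \<open>The global dimension as used for Artin algebras: it is computed in the category of finitely
  generated left modules. The endomorphism ring of a finitely generated module over an Artin
  algebra is again an Artin algebra. For left noetherian rings the value is the same as with
  arbitrary modules, and for rings that are noetherian on both sides it does not depend on the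
  choice of left or right modules.\<close>

definition gl_dim :: "('r, 'a) ring_scheme \<Rightarrow> enat" where
  "gl_dim R = Sup {proj_dim R M | M :: 'r fgmod. fg_module R M}"

end

theory Submission
  imports Defs
begin

text \<open>Write \<open>T = T\<^sub>n(A)\<close>. First, a finitely generated \<open>T\<close>-module is Gorenstein-projective iff it is
  torsionless, i.e. embeds into a free module. A map \<open>X \<rightarrow> T\<close> is a family of \<open>A\<close>-linear functionals
  on the first component of \<open>X\<close> that vanish on the images of other components. As \<open>A\<close> is injective,
  this gives \<open>Ext\<^sup>1(X, T) = 0\<close> for torsionless \<open>X\<close>; as \<open>A\<close> also cogenerates its modules, the cokernel
  of a left approximation \<open>X \<rightarrow> P\<close> of a torsionless \<open>X\<close> by a projective \<open>P\<close> is again torsionless. Complete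
  resolutions are spliced from the resulting short exact sequences.

  Second, let \<open>E = End(M)\<close>. The global dimension is that of left \<open>E\<close>-modules, so the relevant functor is
  the contravariant \<open>H = Hom(-, M)\<close>, which identifies \<open>add M\<close> with the dual of the category of projective
  \<open>E\<close>-modules. If \<open>add M\<close> consists of all torsionless modules, the kernel of a map \<open>H(X\<^sub>1) \<rightarrow> H(X\<^sub>0)\<close> is
  \<open>H(Q)\<close> for the largest quotient \<open>Q\<close> of the cokernel of \<open>X\<^sub>0 \<rightarrow> X\<^sub>1\<close> that is cogenerated by \<open>M\<close>, so the
  global dimension is at most 2. Conversely, let the global dimension be at most 2 and \<open>X\<close> the kernel of
  a map \<open>P\<^sub>0 \<rightarrow> P\<^sub>1\<close> of projective modules. A projective presentation of \<open>X\<close> shows that \<open>H(X)\<close> is a second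
  syzygy, hence a summand of some \<open>H(Y)\<close> with \<open>Y\<close> in \<open>add M\<close>. The retraction comes from a map \<open>X \<rightarrow> Y\<close>,
  along which \<open>X \<rightarrow> P\<^sub>0\<close> extends, and this makes \<open>X\<close> a summand of \<open>Y\<close>. By Krull--Schmidt there are only
  finitely many indecomposable modules of this kind.\<close>

text \<open>A left \<open>T\<close>-module \<open>X\<close> is a chain of maps between the pieces
  \<open>eu i i X\<close>, and \<open>X\<close> is torsionless iff each composite
  \<open>eu 0 i\<close> into the piece of index 0 is injective on \<open>eu i i X\<close>
  (\<open>monic\<close>). Syzygies and cokernels are tested by this condition instead of by
  embeddings. For syzygies it yields the extension of maps into \<open>T\<close>; for cokernels it
  needs functionals that separate a point from the submodule \<open>eu 0 i Y\<close>, and this is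
  where cogeneration enters.

  Cogeneration comes from one-sided injectivity and finite length: every simple module has to embed
  into \<open>A\<close>. Annihilator conditions for finite sets provide simple left ideals, and
  counting isomorphism classes shows that all simple modules occur.

  Finite length of modules over \<open>End(M)\<close> is not read off from the structure of that
  ring: everything has finite length over the base ring \<open>K\<close>, which acts through central
  elements and hence through endomorphisms. In the converse direction \<open>X\<close> is not yet
  known to lie in \<open>add M\<close>, so that maps out of \<open>H(X)\<close> are not known to be
  induced by maps of modules; the retraction is recovered from an endomorphism of
  \<open>Y\<close>.\<close>

section \<open>Linear maps\<close>

context left_module
begin

lemma smult_l_null [simp]:
  assumes "x \<in> carrier M" shows "\<zero> \<odot>\<^bsub>M\<^esub> x = \<zero>\<^bsub>M\<^esub>"
proof -
  have "\<zero> \<odot>\<^bsub>M\<^esub> x \<oplus>\<^bsub>M\<^esub> \<zero> \<odot>\<^bsub>M\<^esub> x = \<zero> \<odot>\<^bsub>M\<^esub> x"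
    using smult_l_distr[of \<zero> \<zero> x] assms by simp
  then show ?thesis using assms by (metis M.add.r_cancel_one' R.zero_closed smult_closed)
qed

lemma smult_r_null [simp]:
  assumes "a \<in> carrier R" shows "a \<odot>\<^bsub>M\<^esub> \<zero>\<^bsub>M\<^esub> = \<zero>\<^bsub>M\<^esub>"
proof -
  have "a \<odot>\<^bsub>M\<^esub> \<zero>\<^bsub>M\<^esub> \<oplus>\<^bsub>M\<^esub> a \<odot>\<^bsub>M\<^esub> \<zero>\<^bsub>M\<^esub> = a \<odot>\<^bsub>M\<^esub> \<zero>\<^bsub>M\<^esub>"
    using smult_r_distr[of a "\<zero>\<^bsub>M\<^esub>" "\<zero>\<^bsub>M\<^esub>"] assms by simp
  then show ?thesis using assms by (metis M.add.r_cancel_one' M.zero_closed smult_closed)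
qed

lemma smult_l_minus:
  assumes "a \<in> carrier R" "x \<in> carrier M" shows "(\<ominus> a) \<odot>\<^bsub>M\<^esub> x = \<ominus>\<^bsub>M\<^esub> (a \<odot>\<^bsub>M\<^esub> x)"
  using smult_l_distr[of "\<ominus> a" a x] assms
  by (intro M.minus_equality[symmetric]) (auto simp: R.l_neg)

lemma smult_r_minus:
  assumes "a \<in> carrier R" "x \<in> carrier M" shows "a \<odot>\<^bsub>M\<^esub> (\<ominus>\<^bsub>M\<^esub> x) = \<ominus>\<^bsub>M\<^esub> (a \<odot>\<^bsub>M\<^esub> x)"
  using smult_r_distr[of a "\<ominus>\<^bsub>M\<^esub> x" x] assms
  by (intro M.minus_equality[symmetric]) (auto simp: M.l_neg)

lemma submoduleI:
  assumes "H \<subseteq> carrier M" "\<zero>\<^bsub>M\<^esub> \<in> H" "\<And>x y. x \<in> H \<Longrightarrow> y \<in> H \<Longrightarrow> x \<oplus>\<^bsub>M\<^esub> y \<in> H"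
    and sm: "\<And>a x. a \<in> carrier R \<Longrightarrow> x \<in> H \<Longrightarrow> a \<odot>\<^bsub>M\<^esub> x \<in> H"
  shows "submodule H R M"
proof -
  have "\<ominus>\<^bsub>M\<^esub> x \<in> H" if "x \<in> H" for x
    using sm[of "\<ominus> \<one>" x] that assms(1) smult_l_minus[of \<one> x] by auto
  then show ?thesis
    using assms by (intro submodule.intro subgroup.intro submodule_axioms.intro) (auto simp: a_inv_def)
qed

lemma sub_minus_cancel:
  assumes "x \<in> carrier M" "y \<in> carrier M"
  shows "x \<ominus>\<^bsub>M\<^esub> y \<oplus>\<^bsub>M\<^esub> y = x" "y \<oplus>\<^bsub>M\<^esub> (x \<ominus>\<^bsub>M\<^esub> y) = x"
  using assms by (simp_all add: M.minus_eq M.a_assoc M.l_neg M.r_neg M.a_lcomm[of y x])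

lemma diff_eq_zero_iff:
  assumes "x \<in> carrier M" "y \<in> carrier M"
  shows "x \<ominus>\<^bsub>M\<^esub> y = \<zero>\<^bsub>M\<^esub> \<longleftrightarrow> x = y"
  using assms sub_minus_cancel[of x y] by (metis M.l_zero M.minus_eq M.r_neg)

end

lemma submoduleD:
  assumes "submodule H R M"
  shows "H \<subseteq> carrier M" "x \<in> H \<Longrightarrow> x \<in> carrier M" "\<zero>\<^bsub>M\<^esub> \<in> H"
    "x \<in> H \<Longrightarrow> y \<in> H \<Longrightarrow> x \<oplus>\<^bsub>M\<^esub> y \<in> H" "x \<in> H \<Longrightarrow> \<ominus>\<^bsub>M\<^esub> x \<in> H"
    "a \<in> carrier R \<Longrightarrow> x \<in> H \<Longrightarrow> a \<odot>\<^bsub>M\<^esub> x \<in> H"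
    "x \<in> H \<Longrightarrow> y \<in> H \<Longrightarrow> x \<ominus>\<^bsub>M\<^esub> y \<in> H"
proof -
  interpret submodule H R M by fact
  show "H \<subseteq> carrier M" "\<zero>\<^bsub>M\<^esub> \<in> H" using subset one_closed by simp_all
  show "x \<in> H \<Longrightarrow> x \<in> carrier M" using subset by auto
  show "x \<in> H \<Longrightarrow> y \<in> H \<Longrightarrow> x \<oplus>\<^bsub>M\<^esub> y \<in> H" using m_closed[of x y] by simp
  show *: "x \<in> H \<Longrightarrow> \<ominus>\<^bsub>M\<^esub> x \<in> H" for x using m_inv_closed[of x] by (simp add: a_inv_def)
  show "a \<in> carrier R \<Longrightarrow> x \<in> H \<Longrightarrow> a \<odot>\<^bsub>M\<^esub> x \<in> H" by (rule smult_closed)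
  show "x \<in> H \<Longrightarrow> y \<in> H \<Longrightarrow> x \<ominus>\<^bsub>M\<^esub> y \<in> H" using m_closed[of x "\<ominus>\<^bsub>M\<^esub> y"] *[of y] by (simp add: a_minus_def)
qed

lemma submodule_carrier: "left_module R M \<Longrightarrow> submodule (carrier M) R M"
proof -
  assume "left_module R M"
  then interpret left_module R M .
  show ?thesis by (intro submoduleI) auto
qed

lemma submodule_zero: "left_module R M \<Longrightarrow> submodule {\<zero>\<^bsub>M\<^esub>} R M"
proof -
  assume "left_module R M"
  then interpret left_module R M .
  show ?thesis by (intro submoduleI) auto
qed

lemma submodule_Int:
  assumes "left_module R M" "submodule N R M" "submodule N' R M" shows "submodule (N \<inter> N') R M"
proof -
  interpret left_module R M by fact
  show ?thesis using submoduleD[OF assms(2)] submoduleD[OF assms(3)] by (intro submoduleI) auto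
qed

lemma submodule_Inter:
  assumes "left_module R M" "\<And>N. N \<in> \<N> \<Longrightarrow> submodule N R M"
  shows "submodule (carrier M \<inter> \<Inter>\<N>) R M"
proof -
  interpret left_module R M by fact
  show ?thesis using submoduleD[OF assms(2)] by (intro submoduleI) auto
qed

lemma set_add_iff: "x \<in> set_add M N N' \<longleftrightarrow> (\<exists>u\<in>N. \<exists>v\<in>N'. x = u \<oplus>\<^bsub>M\<^esub> v)"
  by (auto simp: set_add_def')

lemma submodule_set_add:
  assumes "left_module R M" "submodule N R M" "submodule N' R M" shows "submodule (set_add M N N') R M"
proof -
  interpret left_module R M by fact
  note N = submoduleD[OF assms(2)] and N' = submoduleD[OF assms(3)]
  show ?thesis
  proof (intro submoduleI)
    show "set_add M N N' \<subseteq> carrier M" using N(2) N'(2) by (auto simp: set_add_iff)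
    show "\<zero>\<^bsub>M\<^esub> \<in> set_add M N N'" using N(3) N'(3) by (force simp: set_add_iff)
    fix x y assume "x \<in> set_add M N N'" "y \<in> set_add M N N'"
    then obtain u v u' v' where *: "u \<in> N" "v \<in> N'" "u' \<in> N" "v' \<in> N'" "x = u \<oplus>\<^bsub>M\<^esub> v" "y = u' \<oplus>\<^bsub>M\<^esub> v'"
      by (auto simp: set_add_iff)
    have "x \<oplus>\<^bsub>M\<^esub> y = (u \<oplus>\<^bsub>M\<^esub> u') \<oplus>\<^bsub>M\<^esub> (v \<oplus>\<^bsub>M\<^esub> v')" using * N(2) N'(2) by (simp add: M.a_ac)
    moreover have "u \<oplus>\<^bsub>M\<^esub> u' \<in> N" "v \<oplus>\<^bsub>M\<^esub> v' \<in> N'" using * N(4) N'(4) by auto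
    ultimately show "x \<oplus>\<^bsub>M\<^esub> y \<in> set_add M N N'" unfolding set_add_iff by blast
  next
    fix a x assume a: "a \<in> carrier R" and "x \<in> set_add M N N'"
    then obtain u v where *: "u \<in> N" "v \<in> N'" "x = u \<oplus>\<^bsub>M\<^esub> v" by (auto simp: set_add_iff)
    then have "a \<odot>\<^bsub>M\<^esub> x = a \<odot>\<^bsub>M\<^esub> u \<oplus>\<^bsub>M\<^esub> a \<odot>\<^bsub>M\<^esub> v" using a N(2) N'(2) by (simp add: smult_r_distr)
    moreover have "a \<odot>\<^bsub>M\<^esub> u \<in> N" "a \<odot>\<^bsub>M\<^esub> v \<in> N'" using a * N(6) N'(6) by auto
    ultimately show "a \<odot>\<^bsub>M\<^esub> x \<in> set_add M N N'" unfolding set_add_iff by blast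
  qed
qed

lemma left_module_sub:
  assumes "left_module R M" "submodule N R M" shows "left_module R (M\<lparr>carrier := N\<rparr>)"
proof -
  interpret left_module R M by fact
  note N = submoduleD[OF assms(2)]
  have "abelian_group (M\<lparr>carrier := N\<rparr>)"
  proof (rule abelian_groupI)
    fix x assume "x \<in> carrier (M\<lparr>carrier := N\<rparr>)"
    then show "\<exists>y\<in>carrier (M\<lparr>carrier := N\<rparr>). y \<oplus>\<^bsub>M\<lparr>carrier := N\<rparr>\<^esub> x = \<zero>\<^bsub>M\<lparr>carrier := N\<rparr>\<^esub>"
      using N(2) N(5) by (intro bexI[of _ "\<ominus>\<^bsub>M\<^esub> x"]) (auto simp: M.l_neg)
  qed (use N(2-4) in \<open>auto simp: M.a_ac\<close>)
  then interpret N: abelian_group "M\<lparr>carrier := N\<rparr>" .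
  show ?thesis using N(2,6)
    by unfold_locales (auto simp: smult_l_distr smult_r_distr smult_assoc1)
qed

lemma submodule_sub_iff:
  assumes "left_module R M" "submodule N R M"
  shows "submodule H R (M\<lparr>carrier := N\<rparr>) \<longleftrightarrow> submodule H R M \<and> H \<subseteq> N"
proof -
  interpret left_module R M by fact
  interpret N: left_module R "M\<lparr>carrier := N\<rparr>" using left_module_sub[OF assms] .
  note N = submoduleD[OF assms(2)]
  show ?thesis
  proof
    assume *: "submodule H R (M\<lparr>carrier := N\<rparr>)"
    note H = submoduleD[OF *, simplified]
    have "submodule H R M" using H N by (intro submoduleI) auto
    then show "submodule H R M \<and> H \<subseteq> N" using H(1) by auto
  next
    assume *: "submodule H R M \<and> H \<subseteq> N"
    then have "submodule H R M" ..
    note H = submoduleD[OF this]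
    show "submodule H R (M\<lparr>carrier := N\<rparr>)" using H(3-) * by (intro N.submoduleI) auto
  qed
qed

text \<open>Unlike \<open>mod_hom\<close>, this does not ask for extensionality: only values on the
  carrier matter. Composites and sums of maps can then be written as plain lambda terms, and
  \<open>restrict\<close> appears only where \<open>mod_hom\<close> is required.\<close>

definition lin ::
    "('r, 'a) ring_scheme \<Rightarrow> ('r, 'x, 'b) module_scheme \<Rightarrow> ('r, 'y, 'c) module_scheme \<Rightarrow> ('x \<Rightarrow> 'y) \<Rightarrow> bool" where
  "lin R X Y f \<longleftrightarrow> (\<forall>x \<in> carrier X. f x \<in> carrier Y) \<and>
     (\<forall>x \<in> carrier X. \<forall>y \<in> carrier X. f (x \<oplus>\<^bsub>X\<^esub> y) = f x \<oplus>\<^bsub>Y\<^esub> f y) \<and>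
     (\<forall>a \<in> carrier R. \<forall>x \<in> carrier X. f (a \<odot>\<^bsub>X\<^esub> x) = a \<odot>\<^bsub>Y\<^esub> f x)"

lemma lin_mem: "lin R X Y f \<Longrightarrow> x \<in> carrier X \<Longrightarrow> f x \<in> carrier Y"
  and lin_add: "lin R X Y f \<Longrightarrow> x \<in> carrier X \<Longrightarrow> y \<in> carrier X \<Longrightarrow> f (x \<oplus>\<^bsub>X\<^esub> y) = f x \<oplus>\<^bsub>Y\<^esub> f y"
  and lin_smult: "lin R X Y f \<Longrightarrow> a \<in> carrier R \<Longrightarrow> x \<in> carrier X \<Longrightarrow> f (a \<odot>\<^bsub>X\<^esub> x) = a \<odot>\<^bsub>Y\<^esub> f x"
  by (simp_all add: lin_def)

lemma lin_zero:
  assumes "left_module R X" "left_module R Y" "lin R X Y f" shows "f \<zero>\<^bsub>X\<^esub> = \<zero>\<^bsub>Y\<^esub>"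
proof -
  interpret X: left_module R X by fact
  interpret Y: left_module R Y by fact
  show ?thesis using lin_smult[OF assms(3) X.R.zero_closed X.M.zero_closed] lin_mem[OF assms(3) X.M.zero_closed] by simp
qed

lemma lin_a_inv:
  assumes "left_module R X" "left_module R Y" "lin R X Y f" "x \<in> carrier X" shows "f (\<ominus>\<^bsub>X\<^esub> x) = \<ominus>\<^bsub>Y\<^esub> f x"
proof -
  interpret X: left_module R X by fact
  interpret Y: left_module R Y by fact
  show ?thesis
    using lin_smult[OF assms(3), of "\<ominus>\<^bsub>R\<^esub> \<one>\<^bsub>R\<^esub>" x] assms(4) lin_mem[OF assms(3,4)]
    by (simp add: X.smult_l_minus Y.smult_l_minus)
qed

lemma lin_minus:
  assumes "left_module R X" "left_module R Y" "lin R X Y f" "x \<in> carrier X" "y \<in> carrier X"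
  shows "f (x \<ominus>\<^bsub>X\<^esub> y) = f x \<ominus>\<^bsub>Y\<^esub> f y"
proof -
  interpret X: left_module R X by fact
  show ?thesis using assms by (simp add: a_minus_def lin_add lin_a_inv)
qed

lemma lin_cong:
  assumes "left_module R X" "lin R X Y f" "\<And>x. x \<in> carrier X \<Longrightarrow> g x = f x" shows "lin R X Y g"
proof -
  interpret X: left_module R X by fact
  show ?thesis using assms(2,3) by (auto simp: lin_def)
qed

lemma lin_id: "lin R X X (\<lambda>x. x)" by (simp add: lin_def)

lemma lin_comp: "lin R X Y f \<Longrightarrow> lin R Y Z g \<Longrightarrow> lin R X Z (\<lambda>x. g (f x))"
  by (simp add: lin_def)

lemma lin_const_zero: "left_module R Y \<Longrightarrow> lin R X Y (\<lambda>x. \<zero>\<^bsub>Y\<^esub>)"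
proof -
  assume "left_module R Y"
  then interpret left_module R Y .
  show ?thesis by (simp add: lin_def)
qed

lemma lin_plus:
  assumes "left_module R Y" "lin R X Y f" "lin R X Y g" shows "lin R X Y (\<lambda>x. f x \<oplus>\<^bsub>Y\<^esub> g x)"
proof -
  interpret left_module R Y by fact
  show ?thesis using assms(2,3) unfolding lin_def by (auto simp: smult_r_distr M.a_ac)
qed

lemma lin_uminus:
  assumes "left_module R Y" "lin R X Y f" shows "lin R X Y (\<lambda>x. \<ominus>\<^bsub>Y\<^esub> f x)"
proof -
  interpret left_module R Y by fact
  show ?thesis using assms(2) unfolding lin_def by (auto simp: smult_r_minus M.minus_add)
qed

lemma lin_diff:
  assumes "left_module R Y" "lin R X Y f" "lin R X Y g" shows "lin R X Y (\<lambda>x. f x \<ominus>\<^bsub>Y\<^esub> g x)"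
  using lin_plus[OF assms(1,2) lin_uminus[OF assms(1,3)]] by (simp add: a_minus_def)

lemma lin_incl:
  assumes "submodule N R X" shows "lin R (X\<lparr>carrier := N\<rparr>) X (\<lambda>x. x)"
  using submoduleD[OF assms] by (simp add: lin_def)

lemma lin_sub_dom:
  assumes "submodule N R X" "lin R X Y f" shows "lin R (X\<lparr>carrier := N\<rparr>) Y f"
  using lin_comp[OF lin_incl[OF assms(1)] assms(2)] .

lemma lin_sub_cod:
  assumes "lin R X Y f" "\<And>x. x \<in> carrier X \<Longrightarrow> f x \<in> N" shows "lin R X (Y\<lparr>carrier := N\<rparr>) f"
  using assms by (simp add: lin_def)

lemma lin_of_sub_cod:
  assumes "lin R X (Y\<lparr>carrier := N\<rparr>) f" "submodule N R Y" shows "lin R X Y f"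
  using lin_comp[OF assms(1) lin_incl[OF assms(2)]] .

lemma mod_hom_lin: "h \<in> mod_hom R X Y \<Longrightarrow> lin R X Y h"
  by (auto simp: mod_hom_def lin_def)

lemma lin_restrict: "left_module R X \<Longrightarrow> lin R X Y h \<Longrightarrow> restrict h (carrier X) \<in> mod_hom R X Y"
proof -
  assume "left_module R X"
  then interpret left_module R X .
  show "lin R X Y h \<Longrightarrow> restrict h (carrier X) \<in> mod_hom R X Y" by (auto simp: mod_hom_def lin_def)
qed

lemma submodule_preimage:
  assumes "left_module R X" "left_module R Y" "lin R X Y f" "submodule N R Y" "submodule D R X"
  shows "submodule {x \<in> D. f x \<in> N} R X"
proof -
  interpret X: left_module R X by fact
  note N = submoduleD[OF assms(4)] and D = submoduleD[OF assms(5)]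
  show ?thesis using D N lin_zero[OF assms(1-3)] lin_add[OF assms(3)] lin_smult[OF assms(3)]
    by (intro X.submoduleI) auto
qed

lemma submodule_kernel:
  assumes "left_module R X" "left_module R Y" "lin R X Y f" "submodule D R X"
  shows "submodule {x \<in> D. f x = \<zero>\<^bsub>Y\<^esub>} R X"
  using submodule_preimage[OF assms(1-3) submodule_zero[OF assms(2)] assms(4)] by simp

lemma submodule_image:
  assumes "left_module R X" "left_module R Y" "lin R X Y f" "submodule N R X"
  shows "submodule (f ` N) R Y"
proof -
  interpret Y: left_module R Y by fact
  note N = submoduleD[OF assms(4)]
  show ?thesis
  proof (intro Y.submoduleI)
    show "f ` N \<subseteq> carrier Y" using N(2) lin_mem[OF assms(3)] by auto
    show "\<zero>\<^bsub>Y\<^esub> \<in> f ` N" using N(3) lin_zero[OF assms(1-3)] by (metis image_eqI)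
    fix x y assume "x \<in> f ` N" "y \<in> f ` N"
    then obtain u v where "u \<in> N" "v \<in> N" "x = f u" "y = f v" by auto
    then show "x \<oplus>\<^bsub>Y\<^esub> y \<in> f ` N" using N(2,4) lin_add[OF assms(3), of u v] by (metis image_eqI)
  next
    fix a x assume "a \<in> carrier R" "x \<in> f ` N"
    then obtain u where "u \<in> N" "x = f u" by auto
    then show "a \<odot>\<^bsub>Y\<^esub> x \<in> f ` N" using N(2,6) \<open>a \<in> carrier R\<close> lin_smult[OF assms(3), of a u] by (metis image_eqI)
  qed
qed

lemma lin_inj_iff:
  assumes "left_module R X" "left_module R Y" "lin R X Y f"
  shows "inj_on f (carrier X) \<longleftrightarrow> (\<forall>x\<in>carrier X. f x = \<zero>\<^bsub>Y\<^esub> \<longrightarrow> x = \<zero>\<^bsub>X\<^esub>)"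
proof -
  interpret X: left_module R X by fact
  interpret Y: left_module R Y by fact
  show ?thesis
  proof
    assume "inj_on f (carrier X)"
    then show "\<forall>x\<in>carrier X. f x = \<zero>\<^bsub>Y\<^esub> \<longrightarrow> x = \<zero>\<^bsub>X\<^esub>"
      using lin_zero[OF assms] X.M.zero_closed by (metis inj_onD)
  next
    assume *: "\<forall>x\<in>carrier X. f x = \<zero>\<^bsub>Y\<^esub> \<longrightarrow> x = \<zero>\<^bsub>X\<^esub>"
    show "inj_on f (carrier X)"
    proof (rule inj_onI)
      fix x y assume xy: "x \<in> carrier X" "y \<in> carrier X" "f x = f y"
      then have "f (x \<ominus>\<^bsub>X\<^esub> y) = \<zero>\<^bsub>Y\<^esub>"
        using lin_minus[OF assms xy(1,2)] lin_mem[OF assms(3)] by (simp add: Y.diff_eq_zero_iff)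
      then show "x = y" using * xy by (auto simp: X.diff_eq_zero_iff)
    qed
  qed
qed

text \<open>Two preimages of the same element differ by an element of the kernel of
  \<open>p\<close>, so any choice of preimage gives the same value of \<open>f\<close>. Stated for
  an arbitrary surjection, since quotients are characterised below only by their projection.\<close>

lemma lin_factor_surj:
  assumes "left_module R X" "left_module R Q" "left_module R W" "lin R X Q p" "p ` carrier X = carrier Q" "lin R X W f"
    and ker: "\<And>x. x \<in> carrier X \<Longrightarrow> p x = \<zero>\<^bsub>Q\<^esub> \<Longrightarrow> f x = \<zero>\<^bsub>W\<^esub>"
  obtains g where "lin R Q W g" "\<And>x. x \<in> carrier X \<Longrightarrow> g (p x) = f x"
proof -
  interpret X: left_module R X by fact
  interpret Q: left_module R Q by fact
  interpret W: left_module R W by fact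
  define g where "g q = f (SOME x. x \<in> carrier X \<and> p x = q)" for q
  have g: "g (p x) = f x" if x: "x \<in> carrier X" for x
  proof -
    define y where "y = (SOME y. y \<in> carrier X \<and> p y = p x)"
    have y: "y \<in> carrier X" "p y = p x" using someI[of "\<lambda>y. y \<in> carrier X \<and> p y = p x" x] x by (auto simp: y_def)
    then have "p (y \<ominus>\<^bsub>X\<^esub> x) = \<zero>\<^bsub>Q\<^esub>" using x lin_mem[OF assms(4)] by (simp add: lin_minus[OF assms(1,2,4)] Q.diff_eq_zero_iff)
    then have "f (y \<ominus>\<^bsub>X\<^esub> x) = \<zero>\<^bsub>W\<^esub>" using ker x y by simp
    then have "f y = f x" using x y lin_mem[OF assms(6)] by (simp add: lin_minus[OF assms(1,3,6)] W.diff_eq_zero_iff)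
    then show ?thesis by (simp add: g_def y_def)
  qed
  have "lin R Q W g"
    unfolding lin_def assms(5)[symmetric]
    using g lin_mem[OF assms(6)] lin_add[OF assms(6)] lin_smult[OF assms(6)]
    by (auto simp: lin_add[OF assms(4), symmetric] lin_smult[OF assms(4), symmetric])
  then show ?thesis using g that by blast
qed

text \<open>The map is obtained by undoing \<open>i\<close>; it is linear because both sides of each
  law agree after applying the injective \<open>i\<close>.\<close>

lemma lin_factor_inj:
  assumes "left_module R Y" "left_module R P" "lin R Y P i" "inj_on i (carrier Y)" "left_module R X" "lin R X P f"
    and im: "\<And>x. x \<in> carrier X \<Longrightarrow> f x \<in> i ` carrier Y"
  obtains g where "lin R X Y g" "\<And>x. x \<in> carrier X \<Longrightarrow> i (g x) = f x"
proof -
  interpret Y: left_module R Y by fact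
  interpret X: left_module R X by fact
  define g where "g x = the_inv_into (carrier Y) i (f x)" for x
  have g: "i (g x) = f x" "g x \<in> carrier Y" if "x \<in> carrier X" for x
    using f_the_inv_into_f[OF assms(4) im[OF that]] the_inv_into_into[OF assms(4) im[OF that]] by (auto simp: g_def)
  have "lin R X Y g"
    unfolding lin_def
  proof (intro conjI ballI)
    fix x y assume "x \<in> carrier X" "y \<in> carrier X"
    then show "g (x \<oplus>\<^bsub>X\<^esub> y) = g x \<oplus>\<^bsub>Y\<^esub> g y"
      using g lin_add[OF assms(3)] lin_add[OF assms(6)] by (intro inj_onD[OF assms(4)]) auto
  next
    fix a x assume "a \<in> carrier R" "x \<in> carrier X"
    then show "g (a \<odot>\<^bsub>X\<^esub> x) = a \<odot>\<^bsub>Y\<^esub> g x"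
      using g lin_smult[OF assms(3)] lin_smult[OF assms(6)] by (intro inj_onD[OF assms(4)]) auto
  qed (use g in auto)
  then show ?thesis using g that by blast
qed

text \<open>The inverse is carried along as data, because it is used as a linear map as often as
  \<open>f\<close> itself.\<close>

definition isoM ::
    "('r, 'a) ring_scheme \<Rightarrow> ('r, 'x, 'b) module_scheme \<Rightarrow> ('r, 'y, 'c) module_scheme \<Rightarrow> ('x \<Rightarrow> 'y) \<Rightarrow> ('y \<Rightarrow> 'x) \<Rightarrow> bool" where
  "isoM R X Y f g \<longleftrightarrow> lin R X Y f \<and> lin R Y X g \<and> (\<forall>x\<in>carrier X. g (f x) = x) \<and> (\<forall>y\<in>carrier Y. f (g y) = y)"

lemma isoMI_bij:
  assumes "left_module R X" "left_module R Y" "lin R X Y f" "bij_betw f (carrier X) (carrier Y)"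
  obtains g where "isoM R X Y f g"
proof -
  have f: "inj_on f (carrier X)" "f ` carrier X = carrier Y" using assms(4) by (auto simp: bij_betw_def)
  obtain g where g: "lin R Y X g" "\<And>y. y \<in> carrier Y \<Longrightarrow> f (g y) = y"
    using lin_factor_inj[OF assms(1-3) f(1) assms(2) lin_id] f(2) by metis
  have "g (f x) = x" if "x \<in> carrier X" for x
    using that g lin_mem[OF g(1)] lin_mem[OF assms(3)] by (intro inj_onD[OF f(1)]) auto
  then show ?thesis using that[of g] g assms(3) by (simp add: isoM_def)
qed

lemma isoM_bij: "isoM R X Y f g \<Longrightarrow> bij_betw f (carrier X) (carrier Y)"
  by (rule bij_betw_byWitness[where f' = g]) (auto simp: isoM_def lin_def)

lemma mod_isomorphic_iff:
  assumes "left_module R X" "left_module R Y"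
  shows "mod_isomorphic R X Y \<longleftrightarrow> (\<exists>f g. isoM R X Y f g)"
proof
  assume "mod_isomorphic R X Y"
  then show "\<exists>f g. isoM R X Y f g"
    using isoMI_bij[OF assms] mod_hom_lin by (metis mod_isomorphic_def)
next
  assume "\<exists>f g. isoM R X Y f g"
  then obtain f g where "isoM R X Y f g" by blast
  then show "mod_isomorphic R X Y"
    unfolding mod_isomorphic_def using isoM_bij[of R X Y f g] lin_restrict[OF assms(1), of Y f]
    by (intro bexI[of _ "restrict f (carrier X)"]) (auto simp: isoM_def cong: bij_betw_cong)
qed

lemma isoM_sym: "isoM R X Y f g \<Longrightarrow> isoM R Y X g f"
  by (simp add: isoM_def)

lemma isoM_trans: "isoM R X Y f g \<Longrightarrow> isoM R Y Z f' g' \<Longrightarrow> isoM R X Z (\<lambda>x. f' (f x)) (\<lambda>z. g (g' z))"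
  unfolding isoM_def by (auto intro: lin_comp simp: lin_mem)

section \<open>Maps factoring through a class of modules\<close>

text \<open>These are the maps that are finite sums of composites \<open>X -> N -> Y\<close> with
  \<open>N\<close> in the given set; a map through a finite direct sum of such \<open>N\<close> has
  exactly this form. Building the sum one summand at a time avoids forming the direct sum. Both
  rules speak about values on the carrier only, so that values elsewhere have no influence.\<close>

inductive thru ::
    "('r, 'a) ring_scheme \<Rightarrow> ('r, 'm) module set \<Rightarrow> ('r, 'x, 'b) module_scheme \<Rightarrow> ('r, 'y, 'c) module_scheme \<Rightarrow> ('x \<Rightarrow> 'y) \<Rightarrow> bool"
  for R \<N> X Y where
    zero: "(\<And>x. x \<in> carrier X \<Longrightarrow> f x = \<zero>\<^bsub>Y\<^esub>) \<Longrightarrow> thru R \<N> X Y f"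
  | step: "thru R \<N> X Y f \<Longrightarrow> N \<in> \<N> \<Longrightarrow> lin R X N i \<Longrightarrow> lin R N Y p \<Longrightarrow>
      (\<And>x. x \<in> carrier X \<Longrightarrow> g x = f x \<oplus>\<^bsub>Y\<^esub> p (i x)) \<Longrightarrow> thru R \<N> X Y g"

text \<open>An equation \<open>id = sum p_k i_k\<close> makes \<open>X\<close> a retract of a finite
  direct sum of members, that is, puts \<open>X\<close> into \<open>add\<close> of the set. The
  carrier types of \<open>X\<close> and of the members may differ.\<close>

abbreviation addc :: "('r, 'a) ring_scheme \<Rightarrow> ('r, 'm) module set \<Rightarrow> ('r, 'x, 'b) module_scheme \<Rightarrow> bool" where
  "addc R \<N> X \<equiv> thru R \<N> X X (\<lambda>x. x)"

lemma thru_cong: "thru R \<N> X Y f \<Longrightarrow> (\<And>x. x \<in> carrier X \<Longrightarrow> g x = f x) \<Longrightarrow> thru R \<N> X Y g"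
  by (induction arbitrary: g rule: thru.induct) (auto intro: thru.intros)

lemma thru_lin:
  assumes "left_module R X" "left_module R Y" shows "thru R \<N> X Y f \<Longrightarrow> lin R X Y f"
proof (induction rule: thru.induct)
  case (zero f)
  show ?case by (rule lin_cong[OF assms(1) lin_const_zero[OF assms(2)]]) (simp add: zero)
next
  case (step f N i p g)
  show ?case by (rule lin_cong[OF assms(1) lin_plus[OF assms(2) step.IH lin_comp[OF step.hyps(3,4)]]]) (simp add: step)
qed

lemma thru_single:
  assumes "left_module R Y" "N \<in> \<N>" "lin R X N i" "lin R N Y p"
  shows "thru R \<N> X Y (\<lambda>x. p (i x))"
proof -
  interpret left_module R Y by fact
  have "thru R \<N> X Y (\<lambda>x. \<zero>\<^bsub>Y\<^esub>)" by (rule thru.zero) simp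
  then show ?thesis
    by (rule thru.step[OF _ assms(2-4)]) (use lin_mem[OF assms(4)] lin_mem[OF assms(3)] in simp)
qed

lemma thru_plus:
  assumes "left_module R X" "left_module R Y" "thru R \<N> X Y g"
  shows "thru R \<N> X Y f \<Longrightarrow> thru R \<N> X Y (\<lambda>x. g x \<oplus>\<^bsub>Y\<^esub> f x)"
proof (induction rule: thru.induct)
  case (zero f)
  interpret left_module R Y by fact
  show ?case by (rule thru_cong[OF assms(3)]) (use zero lin_mem[OF thru_lin[OF assms]] in simp)
next
  case (step f N i p h)
  interpret left_module R Y by fact
  show ?case
    by (rule thru.step[OF step.IH step.hyps(2-4)])
      (use step lin_mem[OF thru_lin[OF assms]] lin_mem[OF step.hyps(3)] lin_mem[OF step.hyps(4)]
          lin_mem[OF thru_lin[OF assms(1,2) step.hyps(1)]] in \<open>simp add: M.a_assoc\<close>)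
qed

lemma thru_comp_right:
  assumes "lin R V X h" shows "thru R \<N> X Y f \<Longrightarrow> thru R \<N> V Y (\<lambda>x. f (h x))"
proof (induction rule: thru.induct)
  case (zero f)
  show ?case by (rule thru.zero) (use zero lin_mem[OF assms] in simp)
next
  case (step f N i p g)
  show ?case by (rule thru.step[OF step.IH step.hyps(2) lin_comp[OF assms step.hyps(3)] step.hyps(4)])
      (use step lin_mem[OF assms] in simp)
qed

lemma thru_comp_left:
  assumes "left_module R X" "left_module R Y" "left_module R Z" "lin R Y Z h"
  shows "thru R \<N> X Y f \<Longrightarrow> thru R \<N> X Z (\<lambda>x. h (f x))"
proof (induction rule: thru.induct)
  case (zero f)
  show ?case by (rule thru.zero) (use zero lin_zero[OF assms(2-4)] in simp)
next
  case (step f N i p g)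
  show ?case by (rule thru.step[OF step.IH step.hyps(2,3) lin_comp[OF step.hyps(4) assms(4)]])
      (use step lin_add[OF assms(4)] lin_mem[OF step.hyps(3)] lin_mem[OF step.hyps(4)] lin_mem[OF thru_lin[OF assms(1,2) step.hyps(1)]] in simp)
qed

text \<open>A summand \<open>p i\<close> through \<open>N\<close> equals \<open>p id_N i\<close>,
  and \<open>id_N\<close> is a sum of composites through the second set.\<close>

lemma thru_trans:
  assumes "left_module R X" "left_module R Y" "\<And>N. N \<in> \<N> \<Longrightarrow> left_module R N \<and> addc R \<M> N"
  shows "thru R \<N> X Y f \<Longrightarrow> thru R \<M> X Y f"
proof (induction rule: thru.induct)
  case (zero f) then show ?case by (rule thru.zero)
next
  case (step f N i p g)
  have "thru R \<M> X Y (\<lambda>x. p (i x))"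
    using thru_comp_right[OF step.hyps(3) thru_comp_left[OF _ _ assms(2) step.hyps(4)]] assms(3)[OF step.hyps(2)] by auto
  from thru_plus[OF assms(1,2) step.IH this] show ?case by (rule thru_cong) (simp add: step)
qed

lemma thru_mono: "thru R \<N> X Y f \<Longrightarrow> \<N> \<subseteq> \<M> \<Longrightarrow> thru R \<M> X Y f"
  by (induction rule: thru.induct) (auto intro: thru.intros)

lemma addc_self: "left_module R N \<Longrightarrow> N \<in> \<N> \<Longrightarrow> addc R \<N> N"
  using thru_single[OF _ _ lin_id lin_id] .

lemma addc_retract:
  assumes "left_module R X" "left_module R Y" "lin R X Y i" "lin R Y X p" "\<And>x. x \<in> carrier X \<Longrightarrow> p (i x) = x" "addc R \<N> Y"
  shows "addc R \<N> X"
  using thru_comp_right[OF assms(3) thru_comp_left[OF assms(2,2,1,4,6)]] by (rule thru_cong) (simp add: assms(5))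

lemma addc_iso:
  assumes "left_module R X" "left_module R Y" "isoM R X Y f g" "addc R \<N> X" shows "addc R \<N> Y"
  using addc_retract[OF assms(2,1) _ _ _ assms(4)] assms(3) by (auto simp: isoM_def)

text \<open>Only the first halves \<open>X -> N\<close> of the summands have to be extended along
  \<open>b\<close>; the second halves are kept.\<close>

lemma thru_extend:
  assumes "left_module R X" "left_module R X'" "left_module R Y" "lin R X X' b"
    and ext: "\<And>N i. N \<in> \<N> \<Longrightarrow> lin R X N i \<Longrightarrow> \<exists>j. lin R X' N j \<and> (\<forall>x\<in>carrier X. j (b x) = i x)"
  shows "thru R \<N> X Y f \<Longrightarrow> \<exists>g. thru R \<N> X' Y g \<and> (\<forall>x\<in>carrier X. g (b x) = f x)"
proof (induction rule: thru.induct)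
  case (zero f)
  have "thru R \<N> X' Y (\<lambda>x. \<zero>\<^bsub>Y\<^esub>)" by (rule thru.zero) simp
  then show ?case using zero by auto
next
  case (step f N i p h)
  obtain g where g: "thru R \<N> X' Y g" "\<forall>x\<in>carrier X. g (b x) = f x" using step.IH by blast
  obtain j where j: "lin R X' N j" "\<forall>x\<in>carrier X. j (b x) = i x" using ext[OF step.hyps(2,3)] by blast
  have "thru R \<N> X' Y (\<lambda>x. g x \<oplus>\<^bsub>Y\<^esub> p (j x))" by (rule thru.step[OF g(1) step.hyps(2) j(1) step.hyps(4)]) simp
  then show ?case using g j step.hyps(5) by (intro exI[of _ "\<lambda>x. g x \<oplus>\<^bsub>Y\<^esub> p (j x)"]) simp
qed

text \<open>Each summand of \<open>f\<close> kills \<open>x\<close> because its first half does.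
  With \<open>f\<close> the identity: the maps into members of the set separate the points of any
  module in its \<open>add\<close>.\<close>

lemma thru_separate:
  assumes "left_module R Y" "\<And>N. N \<in> \<N> \<Longrightarrow> left_module R N" "x \<in> carrier X"
    and sep: "\<And>N i. N \<in> \<N> \<Longrightarrow> lin R X N i \<Longrightarrow> i x = \<zero>\<^bsub>N\<^esub>"
  shows "thru R \<N> X Y f \<Longrightarrow> f x = \<zero>\<^bsub>Y\<^esub>"
proof (induction rule: thru.induct)
  case (zero f) then show ?case using assms by simp
next
  case (step f N i p h)
  interpret left_module R Y by fact
  show ?case using step lin_zero[OF assms(2)[OF step.hyps(2)] assms(1) step.hyps(4)] sep[OF step.hyps(2,3)] assms(3) by simp
qed

section \<open>The regular module and lifting of maps along surjections\<close>

lemma left_module_regular: "ring R \<Longrightarrow> left_module R (regular_module R)"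
proof -
  assume "ring R"
  then interpret ring R .
  have "abelian_group (regular_module R)"
    by (rule abelian_groupI) (auto simp: regular_module_def a_ac)
  then interpret M: abelian_group "regular_module R" .
  show ?thesis
    by unfold_locales (auto simp: regular_module_def l_distr r_distr m_assoc)
qed

lemma regular_simps [simp]:
  "carrier (regular_module R) = carrier R" "zero (regular_module R) = zero R" "add (regular_module R) = add R"
  "smult (regular_module R) = mult R"
  by (simp_all add: regular_module_def)

lemma regular_a_inv [simp]: "a_inv (regular_module R) = a_inv R"
  and regular_a_minus [simp]: "a_minus (regular_module R) = a_minus R"
proof -
  have "a_inv (regular_module R) x = a_inv R x" for x by (simp add: a_inv_def m_inv_def regular_module_def)
  then show *: "a_inv (regular_module R) = a_inv R" ..
  have "a_minus (regular_module R) x y = a_minus R x y" for x y by (simp add: a_minus_def *)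
  then show "a_minus (regular_module R) = a_minus R" by blast
qed

lemma lin_from_regular:
  assumes "left_module R Y" "y \<in> carrier Y" shows "lin R (regular_module R) Y (\<lambda>r. r \<odot>\<^bsub>Y\<^esub> y)"
proof -
  interpret left_module R Y by fact
  show ?thesis using assms(2) by (simp add: lin_def smult_l_distr smult_assoc1)
qed

lemma lin_regular_eq:
  assumes "left_module R Y" "lin R (regular_module R) Y p" "r \<in> carrier R" shows "p r = r \<odot>\<^bsub>Y\<^esub> p \<one>\<^bsub>R\<^esub>"
proof -
  interpret left_module R Y by fact
  show ?thesis using lin_smult[OF assms(2), of r "\<one>\<^bsub>R\<^esub>"] assms(3) by simp
qed

text \<open>A map out of \<open>R\<close> is determined by the image of 1, so it suffices to choose
  one preimage of \<open>p 1\<close> under \<open>g\<close>; sums of lifts lift sums.\<close>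

lemma thru_regular_lift:
  assumes "left_module R P" "left_module R X" "left_module R Y" "lin R X Y g" "g ` carrier X = carrier Y"
  shows "thru R {regular_module R} P Y f \<Longrightarrow> \<exists>h. lin R P X h \<and> (\<forall>x\<in>carrier P. g (h x) = f x)"
proof (induction rule: thru.induct)
  case (zero f)
  show ?case using zero lin_const_zero[OF assms(2)] lin_zero[OF assms(2-4)] by auto
next
  case (step f N i p h)
  interpret X: left_module R X by fact
  have N: "N = regular_module R" using step by simp
  note i = step.hyps(3)[unfolded N] and p = step.hyps(4)[unfolded N]
  obtain k where k: "lin R P X k" "\<forall>x\<in>carrier P. g (k x) = f x" using step.IH by blast
  obtain x where x: "x \<in> carrier X" "g x = p \<one>\<^bsub>R\<^esub>" using assms(5) lin_mem[OF p, of "\<one>\<^bsub>R\<^esub>"] X.R.one_closed by (metis imageE regular_simps(1))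
  have 1: "lin R P X (\<lambda>u. k u \<oplus>\<^bsub>X\<^esub> i u \<odot>\<^bsub>X\<^esub> x)"
    using lin_plus[OF assms(2) k(1) lin_comp[OF i lin_from_regular[OF assms(2) x(1)]]] .
  have 2: "g (k u \<oplus>\<^bsub>X\<^esub> i u \<odot>\<^bsub>X\<^esub> x) = h u" if u: "u \<in> carrier P" for u
    using u x k(2) lin_mem[OF i u] lin_mem[OF k(1) u] step.hyps(5)[OF u] lin_regular_eq[OF assms(3) p, of "i u"]
    by (simp add: lin_add[OF assms(4)] lin_smult[OF assms(4)])
  show ?case using 1 2 by blast
qed

text \<open>Surjectivity of \<open>g\<close> is weakened to an inclusion of images by taking the
  image of \<open>g\<close> as the new codomain. In this form it applies directly at an exact place
  of a complex.\<close>

lemma addc_regular_lift: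
  assumes "left_module R P" "left_module R X" "left_module R Y" "lin R X Y g" "addc R {regular_module R} P" "lin R P Y f"
    and "\<And>x. x \<in> carrier P \<Longrightarrow> f x \<in> g ` carrier X"
  obtains h where "lin R P X h" "\<And>x. x \<in> carrier P \<Longrightarrow> g (h x) = f x"
proof -
  interpret P: left_module R P by fact
  let ?I = "Y\<lparr>carrier := g ` carrier X\<rparr>"
  have I: "left_module R ?I" using left_module_sub[OF assms(3)] submodule_image[OF assms(2-4) submodule_carrier[OF assms(2)]] .
  have f: "lin R P ?I f" using lin_sub_cod[OF assms(6,7)] by simp
  have g: "lin R X ?I g" using lin_sub_cod[OF assms(4)] by simp
  show ?thesis
    using thru_regular_lift[OF assms(1,2) I g _ thru_comp_left[OF assms(1,1) I f assms(5)]] that by auto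
qed

section \<open>Finite length\<close>

text \<open>Finite length is expressed by a strictly monotone map from submodules to numbers, which is
  all that is needed of a length function.\<close>

definition fin_len :: "('r, 'a) ring_scheme \<Rightarrow> ('r, 'm, 'b) module_scheme \<Rightarrow> 'm set \<Rightarrow> bool" where
  "fin_len R M D \<longleftrightarrow> (\<exists>\<rho> :: 'm set \<Rightarrow> nat. \<forall>C C'. submodule C R M \<longrightarrow> submodule C' R M \<longrightarrow> C \<subset> C' \<longrightarrow> C' \<subseteq> D \<longrightarrow> \<rho> C < \<rho> C')"

lemma fin_lenI:
  fixes \<rho> :: "'m set \<Rightarrow> nat" and M :: "('r, 'm, 'b) module_scheme"
  assumes "\<And>C C'. submodule C R M \<Longrightarrow> submodule C' R M \<Longrightarrow> C \<subset> C' \<Longrightarrow> C' \<subseteq> D \<Longrightarrow> \<rho> C < \<rho> C'"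
  shows "fin_len R M D"
  unfolding fin_len_def using assms by (intro exI[of _ \<rho>] allI impI)

lemma fin_lenE:
  fixes M :: "('r, 'm, 'b) module_scheme"
  assumes "fin_len R M D"
  obtains \<rho> :: "'m set \<Rightarrow> nat" where "\<And>C C'. submodule C R M \<Longrightarrow> submodule C' R M \<Longrightarrow> C \<subset> C' \<Longrightarrow> C' \<subseteq> D \<Longrightarrow> \<rho> C < \<rho> C'"
proof -
  obtain \<rho> :: "'m set \<Rightarrow> nat" where "\<forall>C C'. submodule C R M \<longrightarrow> submodule C' R M \<longrightarrow> C \<subset> C' \<longrightarrow> C' \<subseteq> D \<longrightarrow> \<rho> C < \<rho> C'"
    using assms unfolding fin_len_def by (elim exE)
  then show ?thesis by (intro that[of \<rho>]) simp
qed

lemma fin_len_mono: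
  assumes "fin_len R M D" "D' \<subseteq> D" shows "fin_len R M D'"
proof -
  obtain \<rho> :: "_ \<Rightarrow> nat" where \<rho>: "\<And>C C'. submodule C R M \<Longrightarrow> submodule C' R M \<Longrightarrow> C \<subset> C' \<Longrightarrow> C' \<subseteq> D \<Longrightarrow> \<rho> C < \<rho> C'"
    using that by (rule fin_lenE[OF assms(1)])
  show ?thesis by (rule fin_lenI[of _ _ _ \<rho>], rule \<rho>) (use assms(2) in auto)
qed

text \<open>Replaces noetherian induction. The family is indexed so that the result is an index (a
  finite subset, an exponent, a map) and not merely a submodule.\<close>

lemma fin_len_max:
  assumes "fin_len R M D" "submodule D R M" "P i\<^sub>0" "\<And>i. P i \<Longrightarrow> submodule (F i) R M" "\<And>i. P i \<Longrightarrow> F i \<subseteq> D"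
  obtains i where "P i" "\<And>j. P j \<Longrightarrow> F i \<subseteq> F j \<Longrightarrow> F j = F i"
proof -
  obtain \<rho> :: "_ \<Rightarrow> nat" where \<rho>: "\<And>C C'. submodule C R M \<Longrightarrow> submodule C' R M \<Longrightarrow> C \<subset> C' \<Longrightarrow> C' \<subseteq> D \<Longrightarrow> \<rho> C < \<rho> C'"
    using that by (rule fin_lenE[OF assms(1)])
  have "\<rho> (F i) \<le> \<rho> D" if "P i" for i
    using \<rho>[OF assms(4)[OF that] assms(2)] assms(5)[OF that] by (cases "F i = D") (auto simp: psubset_eq)
  then have "\<exists>i. P i \<and> (\<forall>j. P j \<longrightarrow> \<rho> (F j) \<le> \<rho> (F i))"
    by (intro ex_has_greatest_nat[of P i\<^sub>0 "\<lambda>i. \<rho> (F i)" "Suc (\<rho> D)"]) (simp_all add: assms(3) less_Suc_eq_le)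
  then obtain i where i: "P i" "\<And>j. P j \<Longrightarrow> \<not> \<rho> (F i) < \<rho> (F j)" by (auto simp: not_less)
  have "F j = F i" if "P j" "F i \<subseteq> F j" for j
    using \<rho>[OF assms(4)[OF i(1)] assms(4)[OF that(1)] _ assms(5)[OF that(1)]] that(2) i(2)[OF that(1)] by auto
  with i(1) show ?thesis by (rule that)
qed

lemma fin_len_min:
  assumes "fin_len R M D" "P i\<^sub>0" "\<And>i. P i \<Longrightarrow> submodule (F i) R M" "\<And>i. P i \<Longrightarrow> F i \<subseteq> D"
  obtains i where "P i" "\<And>j. P j \<Longrightarrow> F j \<subseteq> F i \<Longrightarrow> F j = F i"
proof -
  obtain \<rho> :: "_ \<Rightarrow> nat" where \<rho>: "\<And>C C'. submodule C R M \<Longrightarrow> submodule C' R M \<Longrightarrow> C \<subset> C' \<Longrightarrow> C' \<subseteq> D \<Longrightarrow> \<rho> C < \<rho> C'"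
    using that by (rule fin_lenE[OF assms(1)])
  obtain i where i: "P i" "\<And>j. P j \<Longrightarrow> \<not> \<rho> (F j) < \<rho> (F i)"
    using ex_has_least_nat[of P i\<^sub>0 "\<lambda>i. \<rho> (F i)"] assms(2) by (auto simp: not_less)
  have "F j = F i" if "P j" "F j \<subseteq> F i" for j
    using \<rho>[OF assms(3)[OF that(1)] assms(3)[OF i(1)] _ assms(4)[OF i(1)]] that(2) i(2)[OF that(1)] by auto
  with i(1) show ?thesis by (rule that)
qed

text \<open>The rank of \<open>C\<close> is the rank of \<open>f C\<close> plus the rank of
  \<open>C\<close> intersected with the kernel. If neither part grows from \<open>C\<close> to
  \<open>C'\<close>, an \<open>x\<close> in \<open>C'\<close> differs from some \<open>y\<close> in
  \<open>C\<close> by a kernel element of \<open>C'\<close>, which then belongs to \<open>C\<close>,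
  and so does \<open>x\<close>.\<close>

lemma fin_len_ext:
  assumes "left_module R X" "left_module R Y" "lin R X Y f" "submodule D R X"
    and "fin_len R Y (f ` D)" "fin_len R X {x \<in> D. f x = \<zero>\<^bsub>Y\<^esub>}"
  shows "fin_len R X D"
proof -
  interpret X: left_module R X by fact
  interpret Y: left_module R Y by fact
  let ?K = "{x \<in> D. f x = \<zero>\<^bsub>Y\<^esub>}"
  obtain \<rho> :: "_ \<Rightarrow> nat" where \<rho>: "\<And>C C'. submodule C R Y \<Longrightarrow> submodule C' R Y \<Longrightarrow> C \<subset> C' \<Longrightarrow> C' \<subseteq> f ` D \<Longrightarrow> \<rho> C < \<rho> C'"
    using that by (rule fin_lenE[OF assms(5)])
  obtain \<tau> :: "_ \<Rightarrow> nat" where \<tau>: "\<And>C C'. submodule C R X \<Longrightarrow> submodule C' R X \<Longrightarrow> C \<subset> C' \<Longrightarrow> C' \<subseteq> ?K \<Longrightarrow> \<tau> C < \<tau> C'"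
    using that by (rule fin_lenE[OF assms(6)])
  have K: "submodule ?K R X" using submodule_kernel[OF assms(1-4)] .
  have "\<rho> (f ` C) + \<tau> (C \<inter> ?K) < \<rho> (f ` C') + \<tau> (C' \<inter> ?K)"
    if C: "submodule C R X" "submodule C' R X" "C \<subset> C'" "C' \<subseteq> D" for C C'
  proof -
    have le: "f ` C \<subseteq> f ` C'" "C \<inter> ?K \<subseteq> C' \<inter> ?K" "f ` C' \<subseteq> f ` D" "C' \<inter> ?K \<subseteq> ?K" using C(3,4) by auto
    have sm: "submodule (f ` C) R Y" "submodule (f ` C') R Y" "submodule (C \<inter> ?K) R X" "submodule (C' \<inter> ?K) R X"
      using submodule_image[OF assms(1-3)] submodule_Int[OF assms(1) _ K] C(1,2) by blast+
    note \<rho>' = \<rho>[OF sm(1,2) _ le(3)] and \<tau>' = \<tau>[OF sm(3,4) _ le(4)]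
    have ne: "f ` C \<noteq> f ` C' \<or> C \<inter> ?K \<noteq> C' \<inter> ?K"
    proof (rule ccontr)
      assume "\<not> ?thesis"
      then have eq: "f ` C = f ` C'" "C \<inter> ?K = C' \<inter> ?K" by auto
      note Cs = submoduleD[OF C(1)] and Cs' = submoduleD[OF C(2)]
      obtain x where x: "x \<in> C'" "x \<notin> C" using C(3) by blast
      then obtain y where y: "y \<in> C" "f y = f x" using eq(1) by (metis imageE imageI)
      have xy: "x \<in> carrier X" "y \<in> carrier X" "y \<in> C'" using x y Cs(2) Cs'(2) C(3) by auto
      have "x \<ominus>\<^bsub>X\<^esub> y \<in> C'" using x xy Cs'(7) by blast
      moreover have "f (x \<ominus>\<^bsub>X\<^esub> y) = \<zero>\<^bsub>Y\<^esub>"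
        using xy y lin_minus[OF assms(1-3)] lin_mem[OF assms(3)] by (simp add: Y.diff_eq_zero_iff)
      ultimately have "x \<ominus>\<^bsub>X\<^esub> y \<in> C" using eq(2) C(4) by blast
      then have "x \<ominus>\<^bsub>X\<^esub> y \<oplus>\<^bsub>X\<^esub> y \<in> C" using y Cs(4) by blast
      then show False using x X.sub_minus_cancel[OF xy(1,2)] by simp
    qed
    have "\<rho> (f ` C) \<le> \<rho> (f ` C')" "\<tau> (C \<inter> ?K) \<le> \<tau> (C' \<inter> ?K)"
      using le(1,2) \<rho>' \<tau>' by (cases "f ` C = f ` C'"; cases "C \<inter> ?K = C' \<inter> ?K"; simp add: psubset_eq less_imp_le)+
    moreover have "\<rho> (f ` C) < \<rho> (f ` C') \<or> \<tau> (C \<inter> ?K) < \<tau> (C' \<inter> ?K)"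
      using ne le(1,2) \<rho>' \<tau>' by (auto simp: psubset_eq)
    ultimately show ?thesis by linarith
  qed
  then show ?thesis by (rule fin_lenI)
qed

lemma fin_len_zero:
  assumes "D \<subseteq> {\<zero>\<^bsub>M\<^esub>}" shows "fin_len R M D"
  unfolding fin_len_def
proof (intro exI[of _ "\<lambda>_. 0"] allI impI)
  fix C C' assume "submodule C R M" "submodule C' R M" "C \<subset> C'" "C' \<subseteq> D"
  then show "(0::nat) < 0" using submoduleD(3)[of C R M] assms by auto
qed

text \<open>One map is peeled off at a time: its image has finite length, and the remaining maps are
  jointly injective on its kernel. Applied to the entries of matrices and to evaluation at
  generators.\<close>

lemma fin_len_jointly_inj:
  assumes "left_module R X" "finite S" "\<And>s. s \<in> S \<Longrightarrow> left_module R (Y s) \<and> lin R X (Y s) (f s) \<and> fin_len R (Y s) (carrier (Y s))"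
    and "submodule D R X" "\<And>x. x \<in> D \<Longrightarrow> \<forall>s\<in>S. f s x = \<zero>\<^bsub>Y s\<^esub> \<Longrightarrow> x = \<zero>\<^bsub>X\<^esub>"
  shows "fin_len R X D"
  using assms(2-5)
proof (induction S arbitrary: D rule: finite_induct)
  case empty
  then show ?case by (intro fin_len_zero) auto
next
  case (insert s S)
  have s: "left_module R (Y s)" "lin R X (Y s) (f s)" "fin_len R (Y s) (carrier (Y s))" using insert.prems(1) by auto
  show ?case
  proof (rule fin_len_ext[OF assms(1) s(1,2) insert.prems(2)])
    show "fin_len R (Y s) (f s ` D)"
      using s(3) fin_len_mono lin_mem[OF s(2)] submoduleD(2)[OF insert.prems(2)] by (metis image_subsetI)
    show "fin_len R X {x \<in> D. f s x = \<zero>\<^bsub>Y s\<^esub>}"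
    proof (rule insert.IH)
      show "submodule {x \<in> D. f s x = \<zero>\<^bsub>Y s\<^esub>} R X" using submodule_kernel[OF assms(1) s(1,2) insert.prems(2)] .
    qed (use insert.prems in auto)
  qed
qed

lemma fin_len_inj:
  assumes "left_module R X" "left_module R Y" "lin R X Y f" "inj_on f (carrier X)" "fin_len R Y (carrier Y)"
  shows "fin_len R X (carrier X)"
  using fin_len_jointly_inj[of R X "{()}" "\<lambda>_. Y" "\<lambda>_. f" "carrier X"] assms submodule_carrier[OF assms(1)]
    lin_inj_iff[OF assms(1-3)] by auto

lemma fin_len_surj:
  assumes "left_module R X" "left_module R Y" "lin R X Y f" "f ` carrier X = carrier Y" "fin_len R X (carrier X)"
  shows "fin_len R Y (carrier Y)"
proof -
  interpret X: left_module R X by fact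
  obtain \<rho> :: "_ \<Rightarrow> nat" where \<rho>: "\<And>C C'. submodule C R X \<Longrightarrow> submodule C' R X \<Longrightarrow> C \<subset> C' \<Longrightarrow> C' \<subseteq> carrier X \<Longrightarrow> \<rho> C < \<rho> C'"
    using that by (rule fin_lenE[OF assms(5)])
  have "\<rho> {x \<in> carrier X. f x \<in> C} < \<rho> {x \<in> carrier X. f x \<in> C'}"
    if C: "submodule C R Y" "submodule C' R Y" "C \<subset> C'" "C' \<subseteq> carrier Y" for C C'
  proof (rule \<rho>)
    show "submodule {x \<in> carrier X. f x \<in> C} R X" "submodule {x \<in> carrier X. f x \<in> C'} R X"
      using submodule_preimage[OF assms(1-3) _ submodule_carrier[OF assms(1)]] C by auto
    obtain y where "y \<in> C'" "y \<notin> C" using C by blast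
    moreover then obtain x where "x \<in> carrier X" "f x = y" using assms(4) C(4) by (metis imageE subsetD)
    ultimately show "{x \<in> carrier X. f x \<in> C} \<subset> {x \<in> carrier X. f x \<in> C'}" using C(3) by auto
  qed auto
  then show ?thesis by (rule fin_lenI)
qed

text \<open>The submodule \<open>D\<close> is arbitrary so that the induction can pass to the kernel
  of \<open>i\<close> on \<open>D\<close>, where the last summand vanishes and \<open>g\<close>
  agrees with \<open>f\<close>.\<close>

lemma fin_len_thru:
  assumes "left_module R X" "left_module R Y" "\<And>N. N \<in> \<N> \<Longrightarrow> left_module R N \<and> fin_len R N (carrier N)"
  shows "thru R \<N> X Y f \<Longrightarrow> submodule D R X \<Longrightarrow> fin_len R X {x \<in> D. f x = \<zero>\<^bsub>Y\<^esub>} \<Longrightarrow> fin_len R X D"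
proof (induction arbitrary: D rule: thru.induct)
  case (zero f)
  then have "{x \<in> D. f x = \<zero>\<^bsub>Y\<^esub>} = D" using submoduleD(2)[OF zero(2)] by auto
  then show ?case using zero by simp
next
  case (step f N i p g)
  interpret Y: left_module R Y by fact
  have N: "left_module R N" "fin_len R N (carrier N)" using assms(3)[OF step.hyps(2)] by auto
  let ?D = "{x \<in> D. i x = \<zero>\<^bsub>N\<^esub>}"
  have D: "submodule ?D R X" using submodule_kernel[OF assms(1) N(1) step.hyps(3) step.prems(1)] .
  have "g x = \<zero>\<^bsub>Y\<^esub>" if "x \<in> ?D" "f x = \<zero>\<^bsub>Y\<^esub>" for x
    using that step.hyps(5)[of x] submoduleD(2)[OF step.prems(1)] lin_zero[OF N(1) assms(2) step.hyps(4)] by simp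
  then have "fin_len R X {x \<in> ?D. f x = \<zero>\<^bsub>Y\<^esub>}"
    by (intro fin_len_mono[OF step.prems(2)]) auto
  then have "fin_len R X ?D" by (rule step.IH[OF D])
  then show ?case
    using fin_len_ext[OF assms(1) N(1) step.hyps(3) step.prems(1)] N(2) fin_len_mono[OF N(2), of "i ` D"]
      lin_mem[OF step.hyps(3)] submoduleD(2)[OF step.prems(1)] by (metis image_subsetI)
qed

lemma fin_len_addc:
  assumes "left_module R X" "\<And>N. N \<in> \<N> \<Longrightarrow> left_module R N \<and> fin_len R N (carrier N)" "addc R \<N> X"
  shows "fin_len R X (carrier X)"
  using fin_len_thru[OF assms(1,1,2,3) submodule_carrier[OF assms(1)]] fin_len_zero[of "{x \<in> carrier X. x = \<zero>\<^bsub>X\<^esub>}"]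
  by auto

section \<open>Finitely generated modules\<close>

text \<open>Generation is expressed through the submodules that contain \<open>S\<close>, so that
  later arguments need no linear combinations.\<close>

definition spans :: "('r, 'a) ring_scheme \<Rightarrow> ('r, 'm, 'b) module_scheme \<Rightarrow> 'm set \<Rightarrow> bool" where
  "spans R M S \<longleftrightarrow> finite S \<and> S \<subseteq> carrier M \<and> (\<forall>N. submodule N R M \<longrightarrow> S \<subseteq> N \<longrightarrow> carrier M \<subseteq> N)"

lemma submodule_finsum:
  assumes "left_module R M" "submodule N R M" "finite F" "\<And>s. s \<in> F \<Longrightarrow> f s \<in> N"
  shows "finsum M f F \<in> N"
proof -
  interpret left_module R M by fact
  note N = submoduleD[OF assms(2)]
  show ?thesis using assms(3,4)
  proof (induction F rule: finite_induct)
    case empty then show ?case using N(3) by simp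
  next
    case (insert s F)
    have "f \<in> F \<rightarrow> carrier M" "f s \<in> carrier M" using insert.prems N(2) by auto
    with insert show ?case using N(4) by simp
  qed
qed

lemma (in left_module) finsum_smult_ldistr:
  assumes "finite F" "a \<in> carrier R" "f \<in> F \<rightarrow> carrier M"
  shows "a \<odot>\<^bsub>M\<^esub> (\<Oplus>\<^bsub>M\<^esub>i\<in>F. f i) = (\<Oplus>\<^bsub>M\<^esub>i\<in>F. a \<odot>\<^bsub>M\<^esub> f i)"
  using assms
proof (induction F rule: finite_induct)
  case (insert s F)
  then show ?case by (simp add: smult_r_distr Pi_iff)
qed simp

lemma fin_gen_iff_spans:
  assumes "left_module R M" shows "fin_gen R M \<longleftrightarrow> (\<exists>S. spans R M S)"
proof -
  interpret left_module R M by fact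
  show ?thesis
  proof
    assume "fin_gen R M"
    then obtain S where S: "finite S" "S \<subseteq> carrier M"
      and gen: "\<And>x. x \<in> carrier M \<Longrightarrow> \<exists>c \<in> S \<rightarrow> carrier R. x = (\<Oplus>\<^bsub>M\<^esub>s\<in>S. c s \<odot>\<^bsub>M\<^esub> s)"
      unfolding fin_gen_def by blast
    have "x \<in> N" if N: "submodule N R M" "S \<subseteq> N" and x: "x \<in> carrier M" for x N
    proof -
      obtain c where c: "c \<in> S \<rightarrow> carrier R" "x = (\<Oplus>\<^bsub>M\<^esub>s\<in>S. c s \<odot>\<^bsub>M\<^esub> s)" using gen[OF x] by blast
      show ?thesis unfolding c(2) using c(1) N submoduleD(6)[OF N(1)] by (intro submodule_finsum[OF assms N(1) S(1)]) auto
    qed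
    then show "\<exists>S. spans R M S" using S unfolding spans_def by blast
  next
    assume "\<exists>S. spans R M S"
    then obtain S where S: "finite S" "S \<subseteq> carrier M" "\<And>N. submodule N R M \<Longrightarrow> S \<subseteq> N \<Longrightarrow> carrier M \<subseteq> N"
      unfolding spans_def by blast
    define N where "N = {(\<Oplus>\<^bsub>M\<^esub>s\<in>S. c s \<odot>\<^bsub>M\<^esub> s) | c. c \<in> S \<rightarrow> carrier R}"
    have cl: "(\<lambda>s. c s \<odot>\<^bsub>M\<^esub> s) \<in> S \<rightarrow> carrier M" if "c \<in> S \<rightarrow> carrier R" for c using that S(2) by auto
    have "submodule N R M"
    proof (intro submoduleI)
      show "N \<subseteq> carrier M" using cl by (auto simp: N_def intro!: M.finsum_closed)
      have "(\<Oplus>\<^bsub>M\<^esub>s\<in>S. \<zero>\<^bsub>R\<^esub> \<odot>\<^bsub>M\<^esub> s) = (\<Oplus>\<^bsub>M\<^esub>s\<in>S. \<zero>\<^bsub>M\<^esub>)" using S(2) by (intro M.finsum_cong') auto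
      then have "(\<Oplus>\<^bsub>M\<^esub>s\<in>S. \<zero>\<^bsub>R\<^esub> \<odot>\<^bsub>M\<^esub> s) = \<zero>\<^bsub>M\<^esub>" by simp
      then show "\<zero>\<^bsub>M\<^esub> \<in> N" unfolding N_def by (intro CollectI exI[of _ "\<lambda>_. \<zero>\<^bsub>R\<^esub>"]) auto
    next
      fix x y assume "x \<in> N" "y \<in> N"
      then obtain c d where c: "c \<in> S \<rightarrow> carrier R" "x = (\<Oplus>\<^bsub>M\<^esub>s\<in>S. c s \<odot>\<^bsub>M\<^esub> s)"
        and d: "d \<in> S \<rightarrow> carrier R" "y = (\<Oplus>\<^bsub>M\<^esub>s\<in>S. d s \<odot>\<^bsub>M\<^esub> s)" unfolding N_def by blast
      have "x \<oplus>\<^bsub>M\<^esub> y = (\<Oplus>\<^bsub>M\<^esub>s\<in>S. c s \<odot>\<^bsub>M\<^esub> s \<oplus>\<^bsub>M\<^esub> d s \<odot>\<^bsub>M\<^esub> s)" using cl c d by (simp add: M.finsum_addf)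
      also have "\<dots> = (\<Oplus>\<^bsub>M\<^esub>s\<in>S. (c s \<oplus>\<^bsub>R\<^esub> d s) \<odot>\<^bsub>M\<^esub> s)"
        using c(1) d(1) S(2) by (intro M.finsum_cong') (auto simp: smult_l_distr Pi_iff subset_iff)
      finally show "x \<oplus>\<^bsub>M\<^esub> y \<in> N" unfolding N_def using c(1) d(1) by (intro CollectI exI[of _ "\<lambda>s. c s \<oplus>\<^bsub>R\<^esub> d s"]) auto
    next
      fix a x assume a: "a \<in> carrier R" and "x \<in> N"
      then obtain c where c: "c \<in> S \<rightarrow> carrier R" "x = (\<Oplus>\<^bsub>M\<^esub>s\<in>S. c s \<odot>\<^bsub>M\<^esub> s)" unfolding N_def by blast
      have "a \<odot>\<^bsub>M\<^esub> x = (\<Oplus>\<^bsub>M\<^esub>s\<in>S. a \<odot>\<^bsub>M\<^esub> (c s \<odot>\<^bsub>M\<^esub> s))" using finsum_smult_ldistr[OF S(1) a cl[OF c(1)]] c(2) by simp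
      also have "\<dots> = (\<Oplus>\<^bsub>M\<^esub>s\<in>S. (a \<otimes>\<^bsub>R\<^esub> c s) \<odot>\<^bsub>M\<^esub> s)"
        using c(1) S(2) a by (intro M.finsum_cong') (auto simp: smult_assoc1 Pi_iff subset_iff)
      finally show "a \<odot>\<^bsub>M\<^esub> x \<in> N" unfolding N_def using c(1) a by (intro CollectI exI[of _ "\<lambda>s. a \<otimes>\<^bsub>R\<^esub> c s"]) auto
    qed
    moreover have "S \<subseteq> N"
    proof
      fix s assume s: "s \<in> S"
      have "(\<Oplus>\<^bsub>M\<^esub>t\<in>S. (if s = t then \<one>\<^bsub>R\<^esub> else \<zero>\<^bsub>R\<^esub>) \<odot>\<^bsub>M\<^esub> t) = (\<Oplus>\<^bsub>M\<^esub>t\<in>S. if s = t then t else \<zero>\<^bsub>M\<^esub>)"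
        using S(2) by (intro M.finsum_cong') (auto simp: subset_iff)
      also have "\<dots> = s" using M.finsum_singleton[of s S "\<lambda>t. t"] s S(1,2) by auto
      finally show "s \<in> N" unfolding N_def by (intro CollectI exI[of _ "\<lambda>t. if s = t then \<one>\<^bsub>R\<^esub> else \<zero>\<^bsub>R\<^esub>"]) auto
    qed
    ultimately have "carrier M \<subseteq> N" by (rule S(3))
    then show "fin_gen R M" unfolding fin_gen_def N_def using S(1,2) by blast
  qed
qed

lemma fg_module_iff: "fg_module R M \<longleftrightarrow> left_module R M \<and> (\<exists>S. spans R M S)"
  using fin_gen_iff_spans by (auto simp: fg_module_def)

lemma fg_left_module: "fg_module R M \<Longrightarrow> left_module R M"
  by (simp add: fg_module_def)

lemma fg_surj:
  assumes "fg_module R X" "left_module R Y" "lin R X Y f" "f ` carrier X = carrier Y" shows "fg_module R Y"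
proof -
  have X: "left_module R X" using assms(1) by (rule fg_left_module)
  obtain S where S: "finite S" "S \<subseteq> carrier X" "\<And>N. submodule N R X \<Longrightarrow> S \<subseteq> N \<Longrightarrow> carrier X \<subseteq> N"
    using assms(1) unfolding fg_module_iff spans_def by blast
  have "carrier Y \<subseteq> N" if N: "submodule N R Y" "f ` S \<subseteq> N" for N
  proof -
    have "carrier X \<subseteq> {x \<in> carrier X. f x \<in> N}"
      using N(2) S(2) by (intro S(3) submodule_preimage[OF X assms(2,3) N(1) submodule_carrier[OF X]]) auto
    then show ?thesis unfolding assms(4)[symmetric] by auto
  qed
  then have "spans R Y (f ` S)" using S(1,2) lin_mem[OF assms(3)] unfolding spans_def by auto
  then show ?thesis using assms(2) unfolding fg_module_iff by blast
qed

lemma fg_regular: "ring R \<Longrightarrow> fg_module R (regular_module R)"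
proof -
  assume R: "ring R"
  interpret ring R by fact
  have "x \<in> N" if N: "submodule N R (regular_module R)" "\<one>\<^bsub>R\<^esub> \<in> N" and x: "x \<in> carrier R" for N x
    using submoduleD(6)[OF N(1) x N(2)] x by simp
  then have "spans R (regular_module R) {\<one>\<^bsub>R\<^esub>}" unfolding spans_def by auto
  then show ?thesis using left_module_regular[OF R] unfolding fg_module_iff by blast
qed

lemma fg_addc:
  assumes "left_module R X" "\<And>N. N \<in> \<N> \<Longrightarrow> fg_module R N" "addc R \<N> X" shows "fg_module R X"
proof -
  \<comment> \<open>For the induction the identity is generalised to \<open>f\<close>, and
    generation of \<open>X\<close> to the statement that the image of \<open>f\<close> lies in the
    submodule generated by a finite \<open>S\<close>.\<close>
  have "\<exists>S. finite S \<and> S \<subseteq> carrier X \<and> (\<forall>H. submodule H R X \<longrightarrow> S \<subseteq> H \<longrightarrow> f ` carrier X \<subseteq> H)"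
    if "thru R \<N> X X f" for f using that
  proof (induction rule: thru.induct)
    case (zero f)
    then show ?case using submoduleD(3) by (intro exI[of _ "{}"]) fastforce
  next
    case (step f N i p g)
    obtain S where S: "finite S" "S \<subseteq> carrier X" "\<And>H. submodule H R X \<Longrightarrow> S \<subseteq> H \<Longrightarrow> f ` carrier X \<subseteq> H"
      using step.IH by blast
    have N: "left_module R N" using assms(2)[OF step.hyps(2)] by (rule fg_left_module)
    obtain T where T: "finite T" "T \<subseteq> carrier N" "\<And>H. submodule H R N \<Longrightarrow> T \<subseteq> H \<Longrightarrow> carrier N \<subseteq> H"
      using assms(2)[OF step.hyps(2)] unfolding fg_module_iff spans_def by blast
    have "g x \<in> H" if H: "submodule H R X" "S \<union> p ` T \<subseteq> H" and x: "x \<in> carrier X" for x H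
    proof -
      have "carrier N \<subseteq> {y \<in> carrier N. p y \<in> H}"
        using H T(2) by (intro T(3) submodule_preimage[OF N assms(1) step.hyps(4) H(1) submodule_carrier[OF N]]) auto
      then have "p (i x) \<in> H" using lin_mem[OF step.hyps(3) x] by auto
      moreover have "f x \<in> H" using S(3)[OF H(1)] H(2) x by auto
      ultimately show ?thesis using step.hyps(5)[OF x] submoduleD(4)[OF H(1)] by simp
    qed
    then show ?case using S(1,2) T(1,2) lin_mem[OF step.hyps(4)] by (intro exI[of _ "S \<union> p ` T"]) auto
  qed
  from this[OF assms(3)] show ?thesis using assms(1) unfolding fg_module_iff spans_def by auto
qed

text \<open>Among the finite subsets of \<open>N\<close> take one whose generated submodule
  \<open>F S\<close> is maximal. Adjoining a further element of \<open>N\<close> cannot enlarge it,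
  so it contains \<open>N\<close>.\<close>

lemma fg_of_fin_len:
  assumes "left_module R M" "submodule N R M" "fin_len R M N" shows "fg_module R (M\<lparr>carrier := N\<rparr>)"
proof -
  define F where "F S = carrier M \<inter> \<Inter>{H. submodule H R M \<and> S \<subseteq> H}" for S
  have F: "submodule (F S) R M" for S unfolding F_def by (rule submodule_Inter[OF assms(1)]) simp
  note N = submoduleD[OF assms(2)]
  obtain S where S: "finite S \<and> S \<subseteq> N" "\<And>T. finite T \<and> T \<subseteq> N \<Longrightarrow> F S \<subseteq> F T \<Longrightarrow> F T = F S"
  proof (rule fin_len_max[OF assms(3,2), of "\<lambda>S. finite S \<and> S \<subseteq> N" "{}" F])
    show "F S \<subseteq> N" if "finite S \<and> S \<subseteq> N" for S using that assms(2) by (auto simp: F_def)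
  qed (use F in auto)
  have "N \<subseteq> F S"
  proof
    fix x assume x: "x \<in> N"
    have "F (insert x S) = F S" using S(1) x by (intro S(2)) (auto simp: F_def)
    moreover have "x \<in> F (insert x S)" using x N(2) by (auto simp: F_def)
    ultimately show "x \<in> F S" by simp
  qed
  then have "spans R (M\<lparr>carrier := N\<rparr>) S"
    using S(1) unfolding spans_def submodule_sub_iff[OF assms(1,2)] by (auto simp: F_def)
  then show ?thesis using left_module_sub[OF assms(1,2)] unfolding fg_module_iff by blast
qed

lemma fg_of_fin_len':
  assumes "left_module R M" "submodule N R M" "fin_len R M (carrier M)" shows "fg_module R (M\<lparr>carrier := N\<rparr>)"
  using fg_of_fin_len[OF assms(1,2) fin_len_mono[OF assms(3)]] submoduleD(1)[OF assms(2)] by blast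

text \<open>Moves a module of any carrier type into the type over which projectivity and global
  dimension quantify.\<close>

lemma universe_copy:
  fixes R :: "('r, 'a) ring_scheme"
  assumes "fg_module R M"
  obtains N :: "'r fgmod" and f g where "fg_module R N" "isoM R M N f g"
  using fg_module_in_universe[OF assms] mod_isomorphic_iff[OF fg_left_module fg_left_module] assms by metis

section \<open>Quotients and biproducts\<close>

text \<open>\<open>Q\<close> is a bare record at first; its laws are inherited from those of
  \<open>M\<close> through the surjection \<open>p\<close>.\<close>

lemma left_module_surj_image:
  assumes "left_module R M" "p ` carrier M = carrier Q" "p \<zero>\<^bsub>M\<^esub> = \<zero>\<^bsub>Q\<^esub>"
    and add: "\<And>x y. x \<in> carrier M \<Longrightarrow> y \<in> carrier M \<Longrightarrow> p (x \<oplus>\<^bsub>M\<^esub> y) = p x \<oplus>\<^bsub>Q\<^esub> p y"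
    and sm: "\<And>a x. a \<in> carrier R \<Longrightarrow> x \<in> carrier M \<Longrightarrow> p (a \<odot>\<^bsub>M\<^esub> x) = a \<odot>\<^bsub>Q\<^esub> p x"
  shows "left_module R Q"
proof -
  interpret left_module R M by fact
  have "abelian_group Q"
  proof (rule abelian_groupI, unfold assms(2)[symmetric] assms(3)[symmetric])
    fix x assume "x \<in> p ` carrier M"
    then obtain u where "u \<in> carrier M" "x = p u" by auto
    then show "\<exists>y\<in>p ` carrier M. y \<oplus>\<^bsub>Q\<^esub> x = p \<zero>\<^bsub>M\<^esub>"
      by (intro bexI[of _ "p (\<ominus>\<^bsub>M\<^esub> u)"]) (auto simp: add[symmetric] M.l_neg)
  qed (auto simp: add[symmetric] M.a_ac)
  then interpret Q: abelian_group Q .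
  show ?thesis
    by (unfold_locales, unfold assms(2)[symmetric])
      (auto simp: add[symmetric] sm[symmetric] smult_l_distr smult_r_distr smult_assoc1)
qed

text \<open>The elements of the quotient are chosen representatives rather than cosets, so that
  \<open>Q\<close> has the same element type as \<open>M\<close>; a quotient of an
  \<open>'r fgmod\<close> is then again of this type.\<close>

lemma quotient_exists:
  fixes M :: "('r, 'm, 'b) module_scheme"
  assumes "left_module R M" "submodule N R M"
  obtains Q :: "('r, 'm) module" and p where "left_module R Q" "lin R M Q p" "p ` carrier M = carrier Q"
    "\<And>x. x \<in> carrier M \<Longrightarrow> p x = \<zero>\<^bsub>Q\<^esub> \<longleftrightarrow> x \<in> N"
proof -
  interpret left_module R M by fact
  note N = submoduleD[OF assms(2)]
  define p where "p x = (SOME y. y \<in> carrier M \<and> x \<ominus>\<^bsub>M\<^esub> y \<in> N)" for x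
  have p: "p x \<in> carrier M" "x \<ominus>\<^bsub>M\<^esub> p x \<in> N" if "x \<in> carrier M" for x
    using someI[of "\<lambda>y. y \<in> carrier M \<and> x \<ominus>\<^bsub>M\<^esub> y \<in> N" x] that N(3) by (auto simp: p_def M.r_neg M.minus_eq)
  have sum: "x \<ominus>\<^bsub>M\<^esub> z = (x \<ominus>\<^bsub>M\<^esub> y) \<oplus>\<^bsub>M\<^esub> (y \<ominus>\<^bsub>M\<^esub> z)" "x \<ominus>\<^bsub>M\<^esub> y = \<ominus>\<^bsub>M\<^esub> (y \<ominus>\<^bsub>M\<^esub> x)"
    if "x \<in> carrier M" "y \<in> carrier M" "z \<in> carrier M" for x y z
    using that by (simp_all add: M.minus_eq M.minus_add M.a_ac M.r_neg2 M.r_neg1)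
  have p_eq: "p x = p y \<longleftrightarrow> x \<ominus>\<^bsub>M\<^esub> y \<in> N" if xy: "x \<in> carrier M" "y \<in> carrier M" for x y
  proof
    assume "p x = p y"
    then have "\<ominus>\<^bsub>M\<^esub> (y \<ominus>\<^bsub>M\<^esub> p x) \<in> N" "x \<ominus>\<^bsub>M\<^esub> p x \<in> N" using p[OF xy(1)] p[OF xy(2)] N(5) by auto
    then have "(x \<ominus>\<^bsub>M\<^esub> p x) \<oplus>\<^bsub>M\<^esub> (p x \<ominus>\<^bsub>M\<^esub> y) \<in> N" using N(4) sum(2)[of "p x" y] xy p(1)[OF xy(1)] by simp
    then show "x \<ominus>\<^bsub>M\<^esub> y \<in> N" using sum(1)[of x "p x" y] xy p(1)[OF xy(1)] by simp
  next
    assume *: "x \<ominus>\<^bsub>M\<^esub> y \<in> N"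
    then have **: "y \<ominus>\<^bsub>M\<^esub> x \<in> N" using N(5) sum(2)[of y x] xy by simp
    have "x \<ominus>\<^bsub>M\<^esub> z \<in> N \<longleftrightarrow> y \<ominus>\<^bsub>M\<^esub> z \<in> N" if "z \<in> carrier M" for z
      using sum(1)[of x y z] sum(1)[of y x z] xy that N(4) * ** by metis
    \<comment> \<open>Congruent elements have the same set of admissible representatives, hence the
      same choice.\<close>
    then show "p x = p y" unfolding p_def by (intro arg_cong[of _ _ Eps]) blast
  qed
  have pp: "p x \<ominus>\<^bsub>M\<^esub> x \<in> N" if "x \<in> carrier M" for x
    using p[OF that] N(5) sum(2)[of "p x" x x] that by simp
  define Q :: "('r, 'm) module" where "Q = \<lparr>carrier = p ` carrier M, mult = undefined, one = undefined,
     zero = p \<zero>\<^bsub>M\<^esub>, add = (\<lambda>u v. p (u \<oplus>\<^bsub>M\<^esub> v)), smult = (\<lambda>a u. p (a \<odot>\<^bsub>M\<^esub> u))\<rparr>"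
  have add: "p (x \<oplus>\<^bsub>M\<^esub> y) = p (p x \<oplus>\<^bsub>M\<^esub> p y)" if xy: "x \<in> carrier M" "y \<in> carrier M" for x y
  proof -
    have "(x \<oplus>\<^bsub>M\<^esub> y) \<ominus>\<^bsub>M\<^esub> (p x \<oplus>\<^bsub>M\<^esub> p y) = (x \<ominus>\<^bsub>M\<^esub> p x) \<oplus>\<^bsub>M\<^esub> (y \<ominus>\<^bsub>M\<^esub> p y)"
      using xy p(1)[OF xy(1)] p(1)[OF xy(2)] by (simp add: M.minus_eq M.minus_add M.a_ac)
    also have "\<dots> \<in> N" using p(2)[OF xy(1)] p(2)[OF xy(2)] N(4) by blast
    finally show ?thesis using xy p(1) by (subst p_eq) auto
  qed
  have sm: "p (a \<odot>\<^bsub>M\<^esub> x) = p (a \<odot>\<^bsub>M\<^esub> p x)" if ax: "a \<in> carrier R" "x \<in> carrier M" for a x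
  proof -
    have "a \<odot>\<^bsub>M\<^esub> x \<ominus>\<^bsub>M\<^esub> a \<odot>\<^bsub>M\<^esub> p x = a \<odot>\<^bsub>M\<^esub> (x \<ominus>\<^bsub>M\<^esub> p x)"
      using ax p(1)[OF ax(2)] by (simp add: M.minus_eq smult_r_distr smult_r_minus)
    also have "\<dots> \<in> N" using p(2)[OF ax(2)] N(6) ax(1) by blast
    finally show ?thesis using ax p(1) by (subst p_eq) auto
  qed
  have Q: "left_module R Q"
    by (rule left_module_surj_image[OF assms(1), of p]) (simp_all add: Q_def add[symmetric] sm[symmetric])
  moreover have "lin R M Q p" unfolding lin_def by (auto simp: Q_def add[symmetric] sm[symmetric])
  moreover have "p x = \<zero>\<^bsub>Q\<^esub> \<longleftrightarrow> x \<in> N" if "x \<in> carrier M" for x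
  proof -
    have z: "\<ominus>\<^bsub>M\<^esub> \<zero>\<^bsub>M\<^esub> = \<zero>\<^bsub>M\<^esub>" by (rule M.minus_equality) auto
    show ?thesis using p_eq[of x "\<zero>\<^bsub>M\<^esub>"] that by (simp add: Q_def M.minus_eq z)
  qed
  moreover have "p ` carrier M = carrier Q" by (simp add: Q_def)
  ultimately show ?thesis by (intro that[of Q p])
qed

section \<open>Biproducts\<close>

definition dsum :: "('r, 'x, 'b) module_scheme \<Rightarrow> ('r, 'y, 'c) module_scheme \<Rightarrow> ('r, 'x \<times> 'y) module" where
  "dsum X Y = \<lparr>carrier = carrier X \<times> carrier Y, mult = undefined, one = undefined, zero = (\<zero>\<^bsub>X\<^esub>, \<zero>\<^bsub>Y\<^esub>),
     add = (\<lambda>(x, y) (x', y'). (x \<oplus>\<^bsub>X\<^esub> x', y \<oplus>\<^bsub>Y\<^esub> y')), smult = (\<lambda>a (x, y). (a \<odot>\<^bsub>X\<^esub> x, a \<odot>\<^bsub>Y\<^esub> y))\<rparr>"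

text \<open>A direct sum is described by its four structure maps, because \<open>dsum\<close> lives
  on pairs and has to be replaced by a copy in the fixed carrier type.\<close>

definition biprod where
  "biprod R X Y Z i\<^sub>1 i\<^sub>2 p\<^sub>1 p\<^sub>2 \<longleftrightarrow> lin R X Z i\<^sub>1 \<and> lin R Y Z i\<^sub>2 \<and> lin R Z X p\<^sub>1 \<and> lin R Z Y p\<^sub>2 \<and>
     (\<forall>x\<in>carrier X. p\<^sub>1 (i\<^sub>1 x) = x \<and> p\<^sub>2 (i\<^sub>1 x) = \<zero>\<^bsub>Y\<^esub>) \<and> (\<forall>y\<in>carrier Y. p\<^sub>2 (i\<^sub>2 y) = y \<and> p\<^sub>1 (i\<^sub>2 y) = \<zero>\<^bsub>X\<^esub>) \<and>
     (\<forall>z\<in>carrier Z. i\<^sub>1 (p\<^sub>1 z) \<oplus>\<^bsub>Z\<^esub> i\<^sub>2 (p\<^sub>2 z) = z)"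

lemma left_module_dsum:
  assumes "left_module R X" "left_module R Y" shows "left_module R (dsum X Y)"
proof -
  interpret X: left_module R X by fact
  interpret Y: left_module R Y by fact
  have "abelian_group (dsum X Y)"
  proof (rule abelian_groupI)
    fix x assume "x \<in> carrier (dsum X Y)"
    then show "\<exists>y\<in>carrier (dsum X Y). y \<oplus>\<^bsub>dsum X Y\<^esub> x = \<zero>\<^bsub>dsum X Y\<^esub>"
      by (intro bexI[of _ "(\<ominus>\<^bsub>X\<^esub> fst x, \<ominus>\<^bsub>Y\<^esub> snd x)"]) (auto simp: dsum_def X.M.l_neg Y.M.l_neg)
  qed (auto simp: dsum_def X.M.a_ac Y.M.a_ac)
  then interpret D: abelian_group "dsum X Y" .
  show ?thesis
    by unfold_locales (auto simp: dsum_def X.smult_l_distr X.smult_r_distr X.smult_assoc1 Y.smult_l_distr Y.smult_r_distr Y.smult_assoc1)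
qed

lemma biprod_dsum:
  assumes "left_module R X" "left_module R Y"
  shows "biprod R X Y (dsum X Y) (\<lambda>x. (x, \<zero>\<^bsub>Y\<^esub>)) (\<lambda>y. (\<zero>\<^bsub>X\<^esub>, y)) fst snd"
proof -
  interpret X: left_module R X by fact
  interpret Y: left_module R Y by fact
  show ?thesis by (auto simp: biprod_def dsum_def lin_def)
qed

lemma fg_biprod:
  assumes "fg_module R X" "fg_module R Y" "left_module R Z" and bp: "biprod R X Y Z i\<^sub>1 i\<^sub>2 p\<^sub>1 p\<^sub>2"
  shows "fg_module R Z"
proof -
  have X: "left_module R X" and Y: "left_module R Y" using assms(1,2) by (auto intro: fg_left_module)
  have l: "lin R X Z i\<^sub>1" "lin R Y Z i\<^sub>2" "lin R Z X p\<^sub>1" "lin R Z Y p\<^sub>2" using bp by (auto simp: biprod_def)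
  obtain S where S: "finite S" "S \<subseteq> carrier X" "\<And>N. submodule N R X \<Longrightarrow> S \<subseteq> N \<Longrightarrow> carrier X \<subseteq> N"
    using assms(1) unfolding fg_module_iff spans_def by blast
  obtain T where T: "finite T" "T \<subseteq> carrier Y" "\<And>N. submodule N R Y \<Longrightarrow> T \<subseteq> N \<Longrightarrow> carrier Y \<subseteq> N"
    using assms(2) unfolding fg_module_iff spans_def by blast
  have "z \<in> N" if N: "submodule N R Z" "i\<^sub>1 ` S \<union> i\<^sub>2 ` T \<subseteq> N" and z: "z \<in> carrier Z" for N z
  proof -
    have "carrier X \<subseteq> {x \<in> carrier X. i\<^sub>1 x \<in> N}"
      using N S(2) by (intro S(3) submodule_preimage[OF X assms(3) l(1) N(1) submodule_carrier[OF X]]) auto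
    moreover have "carrier Y \<subseteq> {x \<in> carrier Y. i\<^sub>2 x \<in> N}"
      using N T(2) by (intro T(3) submodule_preimage[OF Y assms(3) l(2) N(1) submodule_carrier[OF Y]]) auto
    ultimately have "i\<^sub>1 (p\<^sub>1 z) \<oplus>\<^bsub>Z\<^esub> i\<^sub>2 (p\<^sub>2 z) \<in> N"
      using lin_mem[OF l(3) z] lin_mem[OF l(4) z] by (intro submoduleD(4)[OF N(1)]) auto
    then show ?thesis using bp z by (simp add: biprod_def)
  qed
  then have "spans R Z (i\<^sub>1 ` S \<union> i\<^sub>2 ` T)"
    using S(1,2) T(1,2) lin_mem[OF l(1)] lin_mem[OF l(2)] unfolding spans_def by blast
  then show ?thesis using assms(3) unfolding fg_module_iff by blast
qed

lemma biprod_exists: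
  fixes R :: "('r, 'a) ring_scheme"
  assumes "fg_module R X" "fg_module R Y"
  obtains Z :: "'r fgmod" and i\<^sub>1 i\<^sub>2 p\<^sub>1 p\<^sub>2 where "fg_module R Z" "biprod R X Y Z i\<^sub>1 i\<^sub>2 p\<^sub>1 p\<^sub>2"
proof -
  have X: "left_module R X" and Y: "left_module R Y" using assms(1,2) by (auto intro: fg_left_module)
  note D = left_module_dsum[OF X Y] and bp = biprod_dsum[OF X Y]
  obtain Z :: "'r fgmod" and f g where Z: "fg_module R Z" "isoM R (dsum X Y) Z f g"
    using universe_copy[OF fg_biprod[OF assms D bp]] .
  have l: "lin R (dsum X Y) Z f" "lin R Z (dsum X Y) g" using Z(2) by (auto simp: isoM_def)
  have b: "lin R X (dsum X Y) (\<lambda>x. (x, \<zero>\<^bsub>Y\<^esub>))" "lin R Y (dsum X Y) (\<lambda>y. (\<zero>\<^bsub>X\<^esub>, y))" "lin R (dsum X Y) X fst" "lin R (dsum X Y) Y snd"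
    using bp by (auto simp: biprod_def)
  have "f (fst (g z), \<zero>\<^bsub>Y\<^esub>) \<oplus>\<^bsub>Z\<^esub> f (\<zero>\<^bsub>X\<^esub>, snd (g z)) = z" if z: "z \<in> carrier Z" for z
  proof -
    have gz: "g z \<in> carrier (dsum X Y)" using lin_mem[OF l(2) z] .
    have "f (fst (g z), \<zero>\<^bsub>Y\<^esub>) \<oplus>\<^bsub>Z\<^esub> f (\<zero>\<^bsub>X\<^esub>, snd (g z)) = f ((fst (g z), \<zero>\<^bsub>Y\<^esub>) \<oplus>\<^bsub>dsum X Y\<^esub> (\<zero>\<^bsub>X\<^esub>, snd (g z)))"
      using lin_add[OF l(1)] lin_mem[OF b(1)] lin_mem[OF b(2)] lin_mem[OF b(3) gz] lin_mem[OF b(4) gz] by simp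
    also have "\<dots> = z" using bp gz Z(2) z by (simp add: biprod_def isoM_def)
    finally show ?thesis .
  qed
  then have "biprod R X Y Z (\<lambda>x. f (x, \<zero>\<^bsub>Y\<^esub>)) (\<lambda>y. f (\<zero>\<^bsub>X\<^esub>, y)) (\<lambda>z. fst (g z)) (\<lambda>z. snd (g z))"
    using lin_comp[OF b(1) l(1)] lin_comp[OF b(2) l(1)] lin_comp[OF l(2) b(3)] lin_comp[OF l(2) b(4)] Z(2) lin_mem[OF b(1)] lin_mem[OF b(2)]
    by (simp add: biprod_def isoM_def)
  then show ?thesis using that Z(1) by blast
qed

lemma addc_biprod:
  assumes "left_module R X" "left_module R Y" "left_module R Z" "biprod R X Y Z i\<^sub>1 i\<^sub>2 p\<^sub>1 p\<^sub>2" "addc R \<N> X" "addc R \<N> Y"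
  shows "addc R \<N> Z"
proof -
  have l: "lin R X Z i\<^sub>1" "lin R Y Z i\<^sub>2" "lin R Z X p\<^sub>1" "lin R Z Y p\<^sub>2" using assms(4) by (auto simp: biprod_def)
  have "thru R \<N> Z Z (\<lambda>z. i\<^sub>1 (p\<^sub>1 z) \<oplus>\<^bsub>Z\<^esub> i\<^sub>2 (p\<^sub>2 z))"
    using thru_plus[OF assms(3,3) thru_comp_right[OF l(3) thru_comp_left[OF assms(1,1,3) l(1) assms(5)]]
        thru_comp_right[OF l(4) thru_comp_left[OF assms(2,2,3) l(2) assms(6)]]] .
  then show ?thesis by (rule thru_cong) (use assms(4) in \<open>simp add: biprod_def\<close>)
qed

section \<open>Projective modules\<close>

text \<open>No minimality is claimed: starting from one copy of \<open>R\<close>, a further copy is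
  added for each generator of \<open>M\<close> and mapped onto the multiples of that
  generator.\<close>

lemma projective_cover_exists:
  fixes R :: "('r, 'a) ring_scheme"
  assumes "fg_module R M"
  obtains P :: "'r fgmod" and g where "fg_module R P" "addc R {regular_module R} P" "lin R P M g" "g ` carrier P = carrier M"
proof -
  have M: "left_module R M" using assms by (rule fg_left_module)
  interpret M: left_module R M by fact
  have R: "ring R" ..
  obtain S where S: "finite S" "S \<subseteq> carrier M" "\<And>N. submodule N R M \<Longrightarrow> S \<subseteq> N \<Longrightarrow> carrier M \<subseteq> N"
    using assms unfolding fg_module_iff spans_def by blast
  note reg = left_module_regular[OF R]
  obtain F :: "'r fgmod" and a b where F: "fg_module R F" "isoM R (regular_module R) F a b"
    using universe_copy[OF fg_regular[OF R]] .
  have Fl: "left_module R F" using F(1) by (rule fg_left_module)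
  have aF: "addc R {regular_module R} F" using addc_iso[OF reg Fl F(2) addc_self[OF reg]] by simp
  have ab: "lin R (regular_module R) F a" "lin R F (regular_module R) b" "\<And>x. x \<in> carrier R \<Longrightarrow> b (a x) = x"
    using F(2) by (auto simp: isoM_def)
  have "\<exists>(P :: 'r fgmod) g. fg_module R P \<and> addc R {regular_module R} P \<and> lin R P M g \<and> S \<subseteq> g ` carrier P"
    using S(1,2)
  proof (induction S rule: finite_induct)
    case empty
    then show ?case using F(1) aF lin_const_zero[OF M] by blast
  next
    case (insert s S)
    then obtain P :: "'r fgmod" and g where P: "fg_module R P" "addc R {regular_module R} P" "lin R P M g" "S \<subseteq> g ` carrier P"
      by auto
    have s: "s \<in> carrier M" using insert.prems by simp
    obtain Z :: "'r fgmod" and i\<^sub>1 i\<^sub>2 p\<^sub>1 p\<^sub>2 where Z: "fg_module R Z" "biprod R P F Z i\<^sub>1 i\<^sub>2 p\<^sub>1 p\<^sub>2"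
      using biprod_exists[OF P(1) F(1)] .
    have l: "lin R P Z i\<^sub>1" "lin R F Z i\<^sub>2" "lin R Z P p\<^sub>1" "lin R Z F p\<^sub>2" using Z(2) by (auto simp: biprod_def)
    define h where "h z = g (p\<^sub>1 z) \<oplus>\<^bsub>M\<^esub> b (p\<^sub>2 z) \<odot>\<^bsub>M\<^esub> s" for z
    have h: "lin R Z M h"
      unfolding h_def using lin_plus[OF M lin_comp[OF l(3) P(3)] lin_comp[OF lin_comp[OF l(4) ab(2)] lin_from_regular[OF M s]]] .
    have "s \<in> h ` carrier Z"
    proof (rule image_eqI)
      show "i\<^sub>2 (a \<one>\<^bsub>R\<^esub>) \<in> carrier Z" using lin_mem[OF l(2)] lin_mem[OF ab(1)] by simp
      show "s = h (i\<^sub>2 (a \<one>\<^bsub>R\<^esub>))"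
        using Z(2) lin_mem[OF ab(1), of "\<one>\<^bsub>R\<^esub>"] lin_zero[OF fg_left_module[OF P(1)] M P(3)] s ab(3) by (simp add: h_def biprod_def)
    qed
    moreover have "S \<subseteq> h ` carrier Z"
    proof
      fix t assume "t \<in> S"
      then obtain x where x: "x \<in> carrier P" "t = g x" using P(4) by auto
      have "t = h (i\<^sub>1 x)" using Z(2) x lin_zero[OF Fl reg ab(2)] s lin_mem[OF P(3)] by (simp add: h_def biprod_def)
      then show "t \<in> h ` carrier Z" using lin_mem[OF l(1) x(1)] by blast
    qed
    moreover have "addc R {regular_module R} Z"
      using addc_biprod[OF fg_left_module[OF P(1)] Fl fg_left_module[OF Z(1)] Z(2) P(2) aF] .
    ultimately show ?case using Z(1) h by blast
  qed
  then obtain P :: "'r fgmod" and g where P: "fg_module R P" "addc R {regular_module R} P" "lin R P M g" "S \<subseteq> g ` carrier P"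
    by blast
  have "carrier M \<subseteq> g ` carrier P"
    by (rule S(3)[OF submodule_image[OF fg_left_module[OF P(1)] M P(3) submodule_carrier[OF fg_left_module[OF P(1)]]] P(4)])
  then have "g ` carrier P = carrier M" using lin_mem[OF P(3)] by auto
  then show ?thesis using that P by blast
qed

text \<open>Lifting the identity along a surjection from a sum of copies of \<open>R\<close> splits
  that surjection. From here on projectivity is membership in \<open>add R\<close>, which makes
  sense for modules of any carrier type.\<close>

lemma proj_module_iff:
  fixes P :: "'r fgmod"
  shows "proj_module R P \<longleftrightarrow> fg_module R P \<and> addc R {regular_module R} P"
proof
  assume *: "proj_module R P"
  then have P: "fg_module R P" by (simp add: proj_module_def)
  have Pl: "left_module R P" using P by (rule fg_left_module)
  obtain Q :: "'r fgmod" and g where Q: "fg_module R Q" "addc R {regular_module R} Q" "lin R Q P g" "g ` carrier Q = carrier P"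
    using projective_cover_exists[OF P] .
  have Ql: "left_module R Q" using Q(1) by (rule fg_left_module)
  have 1: "restrict g (carrier Q) \<in> mod_hom R Q P" using lin_restrict[OF Ql Q(3)] .
  have 2: "restrict (\<lambda>x. x) (carrier P) \<in> mod_hom R P P" using lin_restrict[OF Pl lin_id] .
  have 3: "restrict g (carrier Q) ` carrier Q = carrier P" using Q(4) by simp
  have "\<exists>h\<in>mod_hom R P Q. \<forall>x\<in>carrier P. restrict g (carrier Q) (h x) = restrict (\<lambda>x. x) (carrier P) x"
    by (rule *[unfolded proj_module_def, THEN conjunct2, rule_format, of Q P]) (use Q(1) P 1 2 3 in blast)
  then obtain h where h: "h \<in> mod_hom R P Q" "\<And>x. x \<in> carrier P \<Longrightarrow> restrict g (carrier Q) (h x) = x" by auto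
  have hl: "lin R P Q h" using mod_hom_lin[OF h(1)] .
  have "addc R {regular_module R} P"
    by (rule addc_retract[OF Pl Ql hl Q(3) _ Q(2)]) (use h(2) lin_mem[OF hl] in auto)
  then show "fg_module R P \<and> addc R {regular_module R} P" using P by blast
next
  assume *: "fg_module R P \<and> addc R {regular_module R} P"
  then have Pl: "left_module R P" by (auto intro: fg_left_module)
  show "proj_module R P"
    unfolding proj_module_def
  proof (intro conjI allI impI)
    show "fg_module R P" using * ..
    fix X Y :: "'r fgmod" and g f
    assume A: "fg_module R X \<and> fg_module R Y \<and> g \<in> mod_hom R X Y \<and> g ` carrier X = carrier Y \<and> f \<in> mod_hom R P Y"
    then have X: "left_module R X" and Y: "left_module R Y" by (auto intro: fg_left_module)
    have g: "lin R X Y g" and f: "lin R P Y f" using A by (auto intro: mod_hom_lin)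
    obtain h where h: "lin R P X h" "\<And>x. x \<in> carrier P \<Longrightarrow> g (h x) = f x"
      using addc_regular_lift[OF Pl X Y g _ f] * A lin_mem[OF f] by metis
    show "\<exists>h\<in>mod_hom R P X. \<forall>x\<in>carrier P. g (h x) = f x"
      by (rule bexI[OF _ lin_restrict[OF Pl h(1)]]) (simp add: h(2))
  qed
qed

section \<open>Direct summands and generators\<close>

text \<open>Components are unique because the two submodules meet in zero, so choosing them gives
  linear projections; this is the form in which decompositions enter \<open>thru\<close>.\<close>

lemma internal_direct_sum_projections:
  assumes "left_module R X" "internal_direct_sum R X N N'"
  obtains e e' where "lin R X (X\<lparr>carrier := N\<rparr>) e" "lin R X (X\<lparr>carrier := N'\<rparr>) e'"
    "\<And>x. x \<in> carrier X \<Longrightarrow> e x \<oplus>\<^bsub>X\<^esub> e' x = x" "\<And>x. x \<in> N \<Longrightarrow> e x = x"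
proof -
  interpret left_module R X by fact
  have N: "submodule N R X" and N': "submodule N' R X" and int: "N \<inter> N' = {\<zero>\<^bsub>X\<^esub>}" and sum: "set_add X N N' = carrier X"
    using assms(2) by (auto simp: internal_direct_sum_def)
  note Ns = submoduleD[OF N] and Ns' = submoduleD[OF N']
  have uniq: "u = u' \<and> v = v'" if "u \<in> N" "u' \<in> N" "v \<in> N'" "v' \<in> N'" "u \<oplus>\<^bsub>X\<^esub> v = u' \<oplus>\<^bsub>X\<^esub> v'" for u u' v v'
  proof -
    have c: "u \<in> carrier X" "u' \<in> carrier X" "v \<in> carrier X" "v' \<in> carrier X" using that Ns(2) Ns'(2) by auto
    have "u \<ominus>\<^bsub>X\<^esub> u' = (u \<oplus>\<^bsub>X\<^esub> v) \<oplus>\<^bsub>X\<^esub> (\<ominus>\<^bsub>X\<^esub> v \<oplus>\<^bsub>X\<^esub> \<ominus>\<^bsub>X\<^esub> u')"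
      using c by (simp add: M.minus_eq M.a_assoc M.r_neg2)
    also have "\<dots> = (v' \<oplus>\<^bsub>X\<^esub> u') \<oplus>\<^bsub>X\<^esub> (\<ominus>\<^bsub>X\<^esub> u' \<oplus>\<^bsub>X\<^esub> \<ominus>\<^bsub>X\<^esub> v)"
      using c unfolding that(5) by (simp add: M.a_comm[of u' v'] M.a_comm[of "\<ominus>\<^bsub>X\<^esub> v"])
    also have "\<dots> = v' \<ominus>\<^bsub>X\<^esub> v" using c by (simp add: M.minus_eq M.a_assoc M.r_neg2)
    finally have *: "u \<ominus>\<^bsub>X\<^esub> u' = v' \<ominus>\<^bsub>X\<^esub> v" .
    then have "u \<ominus>\<^bsub>X\<^esub> u' \<in> N \<inter> N'" using Ns(7)[OF that(1,2)] Ns'(7)[OF that(4,3)] by auto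
    then show ?thesis using int * c diff_eq_zero_iff[of u u'] diff_eq_zero_iff[of v' v] by auto
  qed
  define e where "e x = (SOME u. u \<in> N \<and> (\<exists>v\<in>N'. x = u \<oplus>\<^bsub>X\<^esub> v))" for x
  define e' where "e' x = (SOME v. v \<in> N' \<and> x = e x \<oplus>\<^bsub>X\<^esub> v)" for x
  have e: "e x \<in> N \<and> (\<exists>v\<in>N'. x = e x \<oplus>\<^bsub>X\<^esub> v)" if "x \<in> carrier X" for x
    unfolding e_def by (rule someI_ex) (use that in \<open>unfold sum[symmetric] set_add_iff, blast\<close>)
  have e': "e' x \<in> N' \<and> x = e x \<oplus>\<^bsub>X\<^esub> e' x" if "x \<in> carrier X" for x
    unfolding e'_def by (rule someI_ex) (use e[OF that] in blast)
  have ee: "e x = u \<and> e' x = v" if "u \<in> N" "v \<in> N'" "x = u \<oplus>\<^bsub>X\<^esub> v" for x u v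
  proof -
    have x: "x \<in> carrier X" using that Ns(2) Ns'(2) by simp
    have "e x \<oplus>\<^bsub>X\<^esub> e' x = u \<oplus>\<^bsub>X\<^esub> v" using e'[OF x] that(3) by simp
    then show ?thesis using uniq[of "e x" u "e' x" v] e[OF x] e'[OF x] that(1,2) by blast
  qed
  have add: "e (x \<oplus>\<^bsub>X\<^esub> y) = e x \<oplus>\<^bsub>X\<^esub> e y \<and> e' (x \<oplus>\<^bsub>X\<^esub> y) = e' x \<oplus>\<^bsub>X\<^esub> e' y" if x: "x \<in> carrier X" and y: "y \<in> carrier X" for x y
  proof (rule ee)
    have c: "e x \<in> carrier X" "e' x \<in> carrier X" "e y \<in> carrier X" "e' y \<in> carrier X"
      using e[OF x] e[OF y] e'[OF x] e'[OF y] Ns(2) Ns'(2) by auto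
    have "x \<oplus>\<^bsub>X\<^esub> y = (e x \<oplus>\<^bsub>X\<^esub> e' x) \<oplus>\<^bsub>X\<^esub> (e y \<oplus>\<^bsub>X\<^esub> e' y)" using e'[OF x] e'[OF y] by simp
    also have "\<dots> = e x \<oplus>\<^bsub>X\<^esub> e y \<oplus>\<^bsub>X\<^esub> (e' x \<oplus>\<^bsub>X\<^esub> e' y)" using c by (simp add: M.a_ac)
    finally show "x \<oplus>\<^bsub>X\<^esub> y = e x \<oplus>\<^bsub>X\<^esub> e y \<oplus>\<^bsub>X\<^esub> (e' x \<oplus>\<^bsub>X\<^esub> e' y)" .
  qed (use e[OF x] e[OF y] e'[OF x] e'[OF y] Ns(4) Ns'(4) in auto)
  have sm: "e (a \<odot>\<^bsub>X\<^esub> x) = a \<odot>\<^bsub>X\<^esub> e x \<and> e' (a \<odot>\<^bsub>X\<^esub> x) = a \<odot>\<^bsub>X\<^esub> e' x" if x: "x \<in> carrier X" and a: "a \<in> carrier R" for a x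
  proof (rule ee)
    have c: "e x \<in> carrier X" "e' x \<in> carrier X" using e[OF x] e'[OF x] Ns(2) Ns'(2) by auto
    have "a \<odot>\<^bsub>X\<^esub> x = a \<odot>\<^bsub>X\<^esub> (e x \<oplus>\<^bsub>X\<^esub> e' x)" using e'[OF x] by simp
    then show "a \<odot>\<^bsub>X\<^esub> x = a \<odot>\<^bsub>X\<^esub> e x \<oplus>\<^bsub>X\<^esub> a \<odot>\<^bsub>X\<^esub> e' x" using c a by (simp add: smult_r_distr)
  qed (use e[OF x] e'[OF x] Ns(6) Ns'(6) a in auto)
  have "lin R X (X\<lparr>carrier := N\<rparr>) e" "lin R X (X\<lparr>carrier := N'\<rparr>) e'"
    unfolding lin_def using e e' add sm by auto
  moreover have "e x = x" if "x \<in> N" for x using ee[of x "\<zero>\<^bsub>X\<^esub>" x] that Ns'(3) Ns(2) by simp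
  ultimately show ?thesis using that e' by metis
qed

lemma internal_direct_sum_retract:
  assumes "left_module R P" "left_module R X" "lin R P X i" "lin R X P p" "\<And>x. x \<in> carrier P \<Longrightarrow> p (i x) = x"
  shows "internal_direct_sum R X (i ` carrier P) {x \<in> carrier X. p x = \<zero>\<^bsub>P\<^esub>}"
proof -
  interpret P: left_module R P by fact
  interpret X: left_module R X by fact
  have "x \<in> set_add X (i ` carrier P) {x \<in> carrier X. p x = \<zero>\<^bsub>P\<^esub>}" if x: "x \<in> carrier X" for x
  proof -
    have px: "p x \<in> carrier P" "i (p x) \<in> carrier X" using lin_mem[OF assms(4) x] lin_mem[OF assms(3)] by auto
    have "p (x \<ominus>\<^bsub>X\<^esub> i (p x)) = \<zero>\<^bsub>P\<^esub>"
      using px x assms(5) by (simp add: lin_minus[OF assms(2,1,4)] P.diff_eq_zero_iff)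
    moreover have "x = i (p x) \<oplus>\<^bsub>X\<^esub> (x \<ominus>\<^bsub>X\<^esub> i (p x))" using X.sub_minus_cancel x px by simp
    moreover have "x \<ominus>\<^bsub>X\<^esub> i (p x) \<in> carrier X" using x px by simp
    ultimately show ?thesis using px(1) unfolding set_add_iff by blast
  qed
  moreover have "set_add X (i ` carrier P) {x \<in> carrier X. p x = \<zero>\<^bsub>P\<^esub>} \<subseteq> carrier X"
    using lin_mem[OF assms(3)] by (auto simp: set_add_iff)
  moreover have "i ` carrier P \<inter> {x \<in> carrier X. p x = \<zero>\<^bsub>P\<^esub>} = {\<zero>\<^bsub>X\<^esub>}"
  proof
    show "i ` carrier P \<inter> {x \<in> carrier X. p x = \<zero>\<^bsub>P\<^esub>} \<subseteq> {\<zero>\<^bsub>X\<^esub>}"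
      using assms(5) lin_zero[OF assms(1-3)] by auto
    have "\<zero>\<^bsub>X\<^esub> \<in> i ` carrier P" using lin_zero[OF assms(1-3)] P.M.zero_closed by (metis image_eqI)
    then show "{\<zero>\<^bsub>X\<^esub>} \<subseteq> i ` carrier P \<inter> {x \<in> carrier X. p x = \<zero>\<^bsub>P\<^esub>}"
      using lin_zero[OF assms(2,1,4)] by auto
  qed
  ultimately show ?thesis
    unfolding internal_direct_sum_def
    using submodule_image[OF assms(1-3) submodule_carrier[OF assms(1)]] submodule_kernel[OF assms(2,1,4) submodule_carrier[OF assms(2)]]
    by blast
qed

section \<open>Finite powers of a module and their summands\<close>

lemma left_module_direct_power:
  assumes "left_module R M" shows "left_module R (direct_power M k)"
proof -
  interpret left_module R M by fact
  have "abelian_group (direct_power M k)"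
  proof (rule abelian_groupI)
    fix x assume "x \<in> carrier (direct_power M k)"
    then show "\<exists>y\<in>carrier (direct_power M k). y \<oplus>\<^bsub>direct_power M k\<^esub> x = \<zero>\<^bsub>direct_power M k\<^esub>"
      by (intro bexI[of _ "\<lambda>i\<in>{..<k}. \<ominus>\<^bsub>M\<^esub> x i"]) (auto simp: direct_power_def M.l_neg PiE_iff)
  next
    fix x assume "x \<in> carrier (direct_power M k)"
    then show "\<zero>\<^bsub>direct_power M k\<^esub> \<oplus>\<^bsub>direct_power M k\<^esub> x = x"
      by (auto simp: direct_power_def PiE_iff extensional_def)
  qed (auto simp: direct_power_def M.a_ac PiE_iff)
  then interpret D: abelian_group "direct_power M k" .
  show ?thesis
  proof (unfold_locales, goal_cases)
    case (5 x)
    then show ?case by (auto simp: direct_power_def PiE_iff extensional_def)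
  qed (auto simp: direct_power_def smult_l_distr smult_r_distr smult_assoc1 PiE_iff)
qed

text \<open>A sum of \<open>k\<close> composites through \<open>M\<close> is a single composite
  through the \<open>k\<close>-th power; each step appends its summand as the last
  coordinate.\<close>

lemma thru_direct_power:
  assumes "left_module R X" "left_module R Y" "left_module R M"
  shows "thru R {M} X Y f \<Longrightarrow> \<exists>k i p. lin R X (direct_power M k) i \<and> lin R (direct_power M k) Y p \<and> (\<forall>x\<in>carrier X. p (i x) = f x)"
proof (induction rule: thru.induct)
  case (zero f)
  have "lin R X (direct_power M 0) (\<lambda>x. \<zero>\<^bsub>direct_power M 0\<^esub>)" "lin R (direct_power M 0) Y (\<lambda>x. \<zero>\<^bsub>Y\<^esub>)"
    using lin_const_zero[OF left_module_direct_power[OF assms(3)]] lin_const_zero[OF assms(2)] .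
  then show ?case using zero by force
next
  case (step f N j q g)
  have N: "N = M" using step by simp
  note j = step.hyps(3)[unfolded N] and q = step.hyps(4)[unfolded N]
  obtain k i p where IH: "lin R X (direct_power M k) i" "lin R (direct_power M k) Y p" "\<forall>x\<in>carrier X. p (i x) = f x"
    using step.IH by blast
  let ?i = "\<lambda>x. \<lambda>l\<in>{..<Suc k}. if l < k then i x l else j x"
  let ?p = "\<lambda>c. p (restrict c {..<k}) \<oplus>\<^bsub>Y\<^esub> q (c k)"
  have 1: "lin R X (direct_power M (Suc k)) ?i"
    using IH(1) j unfolding lin_def by (auto simp: direct_power_def PiE_iff extensional_def fun_eq_iff)
  have r: "lin R (direct_power M (Suc k)) (direct_power M k) (\<lambda>c. restrict c {..<k})"
    unfolding lin_def by (auto simp: direct_power_def PiE_iff fun_eq_iff)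
  have e: "lin R (direct_power M (Suc k)) M (\<lambda>c. c k)"
    unfolding lin_def by (auto simp: direct_power_def PiE_iff)
  have 2: "lin R (direct_power M (Suc k)) Y ?p" using lin_plus[OF assms(2) lin_comp[OF r IH(2)] lin_comp[OF e q]] .
  have "restrict (?i x) {..<k} = i x" if "x \<in> carrier X" for x
    using lin_mem[OF IH(1) that] by (auto simp: direct_power_def PiE_iff extensional_def fun_eq_iff)
  then have "\<forall>x\<in>carrier X. ?p (?i x) = g x" using IH(3) step.hyps(5) by simp
  then show ?case using 1 2 by blast
qed

lemma addc_direct_power:
  assumes "left_module R M" shows "addc R {M} (direct_power M k)"
proof -
  interpret left_module R M by fact
  let ?D = "direct_power M k"
  have D: "left_module R ?D" using left_module_direct_power[OF assms] .
  \<comment> \<open>Truncation to the first \<open>l\<close> coordinates is a sum of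
    \<open>l\<close> composites through \<open>M\<close>; at \<open>l = k\<close> it is the
    identity.\<close>
  have "thru R {M} ?D ?D (\<lambda>c. \<lambda>j\<in>{..<k}. if j < l then c j else \<zero>\<^bsub>M\<^esub>)" if "l \<le> k" for l using that
  proof (induction l)
    case 0
    show ?case by (rule thru.zero) (simp add: direct_power_def restrict_def)
  next
    case (Suc l)
    have 1: "lin R ?D M (\<lambda>c. c l)" using Suc.prems unfolding lin_def by (auto simp: direct_power_def PiE_iff)
    have 2: "lin R M ?D (\<lambda>x. \<lambda>j\<in>{..<k}. if j = l then x else \<zero>\<^bsub>M\<^esub>)"
      unfolding lin_def by (auto simp: direct_power_def PiE_iff fun_eq_iff)
    show ?case
      by (rule thru.step[OF Suc.IH _ 1 2]) (use Suc.prems in \<open>auto simp: direct_power_def PiE_iff fun_eq_iff\<close>)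
  qed
  from this[of k, OF order_refl] show ?thesis
    by (rule thru_cong) (auto simp: direct_power_def PiE_iff extensional_def fun_eq_iff)
qed

lemma is_direct_summand_power_iff:
  assumes "left_module R P" "left_module R M"
  shows "(\<exists>k. is_direct_summand R P (direct_power M k)) \<longleftrightarrow> addc R {M} P"
proof
  assume "\<exists>k. is_direct_summand R P (direct_power M k)"
  then obtain k N N' where *: "internal_direct_sum R (direct_power M k) N N'" "mod_isomorphic R P (direct_power M k\<lparr>carrier := N\<rparr>)"
    unfolding is_direct_summand_def by blast
  let ?D = "direct_power M k"
  have D: "left_module R ?D" using left_module_direct_power[OF assms(2)] .
  have N: "submodule N R ?D" using *(1) by (simp add: internal_direct_sum_def)
  obtain e e' where e: "lin R ?D (?D\<lparr>carrier := N\<rparr>) e" "\<And>x. x \<in> N \<Longrightarrow> e x = x"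
    using internal_direct_sum_projections[OF D *(1)] by metis
  obtain f g where fg: "isoM R P (?D\<lparr>carrier := N\<rparr>) f g"
    using *(2) mod_isomorphic_iff[OF assms(1) left_module_sub[OF D N]] by blast
  have "addc R {M} (?D\<lparr>carrier := N\<rparr>)"
    by (rule addc_retract[OF left_module_sub[OF D N] D lin_incl[OF N] e(1) _ addc_direct_power[OF assms(2)]]) (simp add: e(2))
  then show "addc R {M} P" by (rule addc_iso[OF left_module_sub[OF D N] assms(1) isoM_sym[OF fg]])
next
  assume "addc R {M} P"
  then obtain k i p where ip: "lin R P (direct_power M k) i" "lin R (direct_power M k) P p" "\<And>x. x \<in> carrier P \<Longrightarrow> p (i x) = x"
    using thru_direct_power[OF assms(1,1,2) \<open>addc R {M} P\<close>] by auto
  let ?D = "direct_power M k"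
  have D: "left_module R ?D" using left_module_direct_power[OF assms(2)] .
  have I: "submodule (i ` carrier P) R ?D" using submodule_image[OF assms(1) D ip(1) submodule_carrier[OF assms(1)]] .
  have "isoM R P (?D\<lparr>carrier := i ` carrier P\<rparr>) i p"
    unfolding isoM_def using lin_sub_cod[OF ip(1)] lin_sub_dom[OF I ip(2)] ip(3) by auto
  then show "\<exists>k. is_direct_summand R P (direct_power M k)"
    unfolding is_direct_summand_def
    using internal_direct_sum_retract[OF assms(1) D ip(1,2)] ip(3) mod_isomorphic_iff[OF assms(1) left_module_sub[OF D I]] by blast
qed

text \<open>Testing the regular module suffices, since all projectives lie in its
  \<open>add\<close>. In the proof a copy \<open>F\<close> stands in for it, because the quantifier
  in \<open>mod_generator\<close> ranges over the fixed carrier type.\<close>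

lemma mod_generator_iff:
  fixes M :: "'r fgmod"
  shows "mod_generator R M \<longleftrightarrow> fg_module R M \<and> addc R {M} (regular_module R)"
proof (cases "fg_module R M")
  case True
  then have M: "left_module R M" by (rule fg_left_module)
  interpret left_module R M by fact
  have R: "ring R" ..
  note reg = left_module_regular[OF R]
  obtain F :: "'r fgmod" and a b where F: "fg_module R F" "isoM R (regular_module R) F a b"
    using universe_copy[OF fg_regular[OF R]] .
  have Fl: "left_module R F" using F(1) by (rule fg_left_module)
  show ?thesis
  proof
    assume *: "mod_generator R M"
    have "proj_module R F" unfolding proj_module_iff using F(1) addc_iso[OF reg Fl F(2) addc_self[OF reg]] by simp
    then have "addc R {M} F" using * is_direct_summand_power_iff[OF Fl M] by (simp add: mod_generator_def)
    then show "fg_module R M \<and> addc R {M} (regular_module R)" using True addc_iso[OF Fl reg isoM_sym[OF F(2)]] by blast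
  next
    assume *: "fg_module R M \<and> addc R {M} (regular_module R)"
    have "\<exists>k. is_direct_summand R P (direct_power M k)" if P: "proj_module R P" for P
    proof -
      have Pl: "left_module R P" "addc R {regular_module R} P" using P unfolding proj_module_iff by (auto intro: fg_left_module)
      have "addc R {M} P" by (rule thru_trans[OF Pl(1,1) _ Pl(2)]) (use * reg in auto)
      then show ?thesis using is_direct_summand_power_iff[OF Pl(1) M] by blast
    qed
    then show "mod_generator R M" using True by (simp add: mod_generator_def)
  qed
qed (simp add: mod_generator_def)

section \<open>Krull--Schmidt\<close>

lemma lin_funpow: "lin R X X f \<Longrightarrow> lin R X X (f ^^ n)"
proof (induction n)
  case 0 then show ?case by (simp add: lin_def)
next
  case (Suc n)
  show ?case using lin_comp[OF Suc.IH[OF Suc.prems] Suc.prems] by (simp add: comp_def)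
qed

text \<open>The images of the powers of \<open>f\<close> become stable, and from
  \<open>f^n X = f^(n+1) X\<close> the injective \<open>f^n\<close> can be cancelled.\<close>

lemma fin_len_inj_imp_surj:
  assumes "left_module R X" "fin_len R X (carrier X)" "lin R X X f" "inj_on f (carrier X)"
  shows "f ` carrier X = carrier X"
proof -
  have sub: "submodule ((f ^^ n) ` carrier X) R X" for n
    using submodule_image[OF assms(1,1) lin_funpow[OF assms(3)] submodule_carrier[OF assms(1)]] .
  have cl: "(f ^^ n) x \<in> carrier X" if "x \<in> carrier X" for n x using lin_mem[OF lin_funpow[OF assms(3)] that] .
  obtain n where n: "\<And>j. (f ^^ j) ` carrier X \<subseteq> (f ^^ n) ` carrier X \<Longrightarrow> (f ^^ j) ` carrier X = (f ^^ n) ` carrier X"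
    by (rule fin_len_min[OF assms(2), of "\<lambda>_. True" 0 "\<lambda>n. (f ^^ n) ` carrier X"]) (use sub submoduleD(1)[OF sub] in auto)
  have inj: "inj_on (f ^^ k) (carrier X)" for k
  proof (induction k)
    case (Suc k)
    show ?case unfolding funpow.simps by (rule comp_inj_on[OF Suc inj_on_subset[OF assms(4)]]) (use cl in auto)
  qed simp
  have "y \<in> f ` carrier X" if y: "y \<in> carrier X" for y
  proof -
    have "(f ^^ Suc n) ` carrier X \<subseteq> (f ^^ n) ` carrier X" using lin_mem[OF assms(3)] by (auto simp: funpow_swap1)
    then have "(f ^^ n) y \<in> (f ^^ Suc n) ` carrier X" using n y by blast
    then obtain z where z: "z \<in> carrier X" "(f ^^ n) y = (f ^^ n) (f z)" by (auto simp: funpow_swap1)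
    then have "y = f z" using inj_onD[OF inj, of n y "f z"] y lin_mem[OF assms(3)] by blast
    then show ?thesis using z(1) by blast
  qed
  then show ?thesis using lin_mem[OF assms(3)] by blast
qed

text \<open>Once the kernels and the images of the powers are stable, \<open>X\<close> is the direct
  sum of the image and the kernel of \<open>f^N\<close>; indecomposability makes one of them
  zero.\<close>

lemma fitting:
  assumes "indecomposable_module R X" "fin_len R X (carrier X)" "lin R X X f"
  shows "inj_on f (carrier X) \<or> (\<exists>n. \<forall>x\<in>carrier X. (f ^^ n) x = \<zero>\<^bsub>X\<^esub>)"
proof -
  have X: "left_module R X" using assms(1) by (simp add: indecomposable_module_def)
  interpret left_module R X by fact
  note fl = lin_funpow[OF assms(3)]
  define F where "F n = {x \<in> carrier X. (f ^^ n) x = \<zero>\<^bsub>X\<^esub>}" for n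
  define G where "G n = (f ^^ n) ` carrier X" for n
  have F: "submodule (F n) R X" "F n \<subseteq> carrier X" for n
    unfolding F_def using submodule_kernel[OF X X fl submodule_carrier[OF X]] by auto
  have G: "submodule (G n) R X" "G n \<subseteq> carrier X" for n
    unfolding G_def using submodule_image[OF X X fl submodule_carrier[OF X]] lin_mem[OF fl] by auto
  have Fm: "F i \<subseteq> F (i + k)" for i k
  proof
    fix x assume x: "x \<in> F i"
    then have "(f ^^ (k + i)) x = (f ^^ k) \<zero>\<^bsub>X\<^esub>" by (simp add: funpow_add F_def)
    then show "x \<in> F (i + k)" using x lin_zero[OF X X fl] by (simp add: F_def add.commute)
  qed
  have Gm: "G (i + k) \<subseteq> G i" for i k using lin_mem[OF fl] by (auto simp: G_def funpow_add)
  obtain n where n: "\<And>j. F n \<subseteq> F j \<Longrightarrow> F j = F n"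
    by (rule fin_len_max[OF assms(2) submodule_carrier[OF X], of "\<lambda>_. True" 0 F]) (use F in auto)
  obtain m where m: "\<And>j. G j \<subseteq> G m \<Longrightarrow> G j = G m"
    by (rule fin_len_min[OF assms(2), of "\<lambda>_. True" 0 G]) (use G in auto)
  \<comment> \<open>This lies beyond both points of stabilisation; the \<open>Suc\<close> makes the
    kernel of \<open>f\<close> itself part of \<open>F N\<close>, even when
    \<open>n = m = 0\<close>.\<close>
  define N where "N = Suc (n + m)"
  have FN: "F (N + N) = F N" using n[of "N + N"] n[of N] Fm[of n "Suc m"] Fm[of N N] by (simp add: N_def)
  have GN: "G (N + N) = G N" using m[of "N + N"] m[of N] Gm[of m "Suc n"] Gm[of N N] by (simp add: N_def add.commute)
  have "internal_direct_sum R X (G N) (F N)"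
    unfolding internal_direct_sum_def
  proof (intro conjI F G)
    have "y = \<zero>\<^bsub>X\<^esub>" if y: "y \<in> G N \<inter> F N" for y
    proof -
      obtain x where x: "x \<in> carrier X" "y = (f ^^ N) x" using y by (auto simp: G_def)
      have "x \<in> F (N + N)" using x y by (auto simp: F_def funpow_add)
      then have "x \<in> F N" using FN by simp
      then show ?thesis using x by (simp add: F_def)
    qed
    then show "G N \<inter> F N = {\<zero>\<^bsub>X\<^esub>}" using submoduleD(3)[OF F(1)] submoduleD(3)[OF G(1)] by auto
    have "x \<in> set_add X (G N) (F N)" if x: "x \<in> carrier X" for x
    proof -
      have "(f ^^ N) x \<in> G (N + N)" using x GN by (auto simp: G_def)
      then obtain z where z: "z \<in> carrier X" "(f ^^ N) x = (f ^^ N) ((f ^^ N) z)" by (auto simp: G_def funpow_add)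
      let ?u = "(f ^^ N) z"
      have u: "?u \<in> carrier X" using lin_mem[OF fl z(1)] .
      have "(f ^^ N) (x \<ominus>\<^bsub>X\<^esub> ?u) = \<zero>\<^bsub>X\<^esub>"
        using z u x lin_mem[OF fl] by (simp add: lin_minus[OF X X fl] diff_eq_zero_iff)
      then have "x \<ominus>\<^bsub>X\<^esub> ?u \<in> F N" using x u by (simp add: F_def)
      moreover have "?u \<in> G N" using z(1) by (simp add: G_def)
      moreover have "x = ?u \<oplus>\<^bsub>X\<^esub> (x \<ominus>\<^bsub>X\<^esub> ?u)" using sub_minus_cancel(2)[OF x u] by simp
      ultimately show ?thesis unfolding set_add_iff by blast
    qed
    moreover have "set_add X (G N) (F N) \<subseteq> carrier X" using subsetD[OF F(2)] subsetD[OF G(2)] by (auto simp: set_add_iff)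
    ultimately show "set_add X (G N) (F N) = carrier X" by blast
  qed
  then have "G N = {\<zero>\<^bsub>X\<^esub>} \<or> F N = {\<zero>\<^bsub>X\<^esub>}" using assms(1) by (auto simp: indecomposable_module_def)
  then show ?thesis
  proof
    assume "G N = {\<zero>\<^bsub>X\<^esub>}"
    then show ?thesis by (auto simp: G_def)
  next
    assume *: "F N = {\<zero>\<^bsub>X\<^esub>}"
    have "x = \<zero>\<^bsub>X\<^esub>" if "x \<in> carrier X" "f x = \<zero>\<^bsub>X\<^esub>" for x
    proof -
      have "x \<in> F 1" using that by (simp add: F_def)
      then show ?thesis using Fm[of 1 "n + m"] * by (auto simp: N_def)
    qed
    then show ?thesis using lin_inj_iff[OF X X assms(3)] by blast
  qed
qed

text \<open>This is locality of the endomorphism ring. With the inverse \<open>v\<close> of the sum,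
  \<open>v f + v g = id\<close>. If \<open>v f\<close> is not injective it is nilpotent; a point
  killed by \<open>g\<close> is fixed by \<open>v f\<close>, hence zero.\<close>

lemma indecomposable_inj_plus:
  assumes "indecomposable_module R X" "fin_len R X (carrier X)" "lin R X X f" "lin R X X g"
    and "inj_on (\<lambda>x. f x \<oplus>\<^bsub>X\<^esub> g x) (carrier X)"
  shows "inj_on f (carrier X) \<or> inj_on g (carrier X)"
proof (rule ccontr)
  assume no: "\<not> ?thesis"
  have X: "left_module R X" using assms(1) by (simp add: indecomposable_module_def)
  interpret left_module R X by fact
  let ?u = "\<lambda>x. f x \<oplus>\<^bsub>X\<^esub> g x"
  have u: "lin R X X ?u" using lin_plus[OF X assms(3,4)] .
  obtain v where v: "isoM R X X ?u v"
    using isoMI_bij[OF X X u] assms(5) fin_len_inj_imp_surj[OF X assms(2) u assms(5)] unfolding bij_betw_def by blast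
  then have vl: "lin R X X v" and vu: "\<And>x. x \<in> carrier X \<Longrightarrow> v (f x \<oplus>\<^bsub>X\<^esub> g x) = x"
    and vi: "inj_on v (carrier X)" using isoM_bij[OF isoM_sym[OF v]] by (auto simp: isoM_def bij_betw_def)
  let ?h = "\<lambda>x. v (f x)"
  have h: "lin R X X ?h" using lin_comp[OF assms(3) vl] .
  have "\<not> inj_on ?h (carrier X)" using no unfolding inj_on_def by metis
  then obtain n where n: "\<And>x. x \<in> carrier X \<Longrightarrow> (?h ^^ n) x = \<zero>\<^bsub>X\<^esub>" using fitting[OF assms(1,2) h] by blast
  have "x = \<zero>\<^bsub>X\<^esub>" if x: "x \<in> carrier X" "g x = \<zero>\<^bsub>X\<^esub>" for x
  proof -
    have "?h x = x" using vu[OF x(1)] x lin_mem[OF assms(3)] by simp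
    then have "(?h ^^ k) x = x" for k by (induction k) simp_all
    then show ?thesis using n[OF x(1)] by simp
  qed
  then show False using no lin_inj_iff[OF X X assms(4)] by blast
qed

text \<open>Locality is applied at each addition: if the whole sum is injective, so is the new
  summand or the earlier partial sum. The empty sum is excluded because \<open>X\<close> is
  nonzero.\<close>

lemma indecomposable_thru_inj:
  assumes "indecomposable_module R X" "fin_len R X (carrier X)" "\<And>N. N \<in> \<N> \<Longrightarrow> left_module R N"
  shows "thru R \<N> X X f \<Longrightarrow> inj_on f (carrier X) \<Longrightarrow>
    \<exists>N\<in>\<N>. \<exists>i p. lin R X N i \<and> lin R N X p \<and> inj_on (\<lambda>x. p (i x)) (carrier X)"
proof (induction rule: thru.induct)
  case (zero f)
  have X: "left_module R X" "carrier X \<noteq> {\<zero>\<^bsub>X\<^esub>}" using assms(1) by (auto simp: indecomposable_module_def)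
  interpret left_module R X by fact
  have "x = \<zero>\<^bsub>X\<^esub>" if "x \<in> carrier X" for x using zero that M.zero_closed by (auto simp: inj_on_def)
  then show ?case using X(2) M.zero_closed by blast
next
  case (step f N i p g)
  have X: "left_module R X" using assms(1) by (simp add: indecomposable_module_def)
  have pi: "lin R X X (\<lambda>x. p (i x))" using lin_comp[OF step.hyps(3,4)] .
  have "inj_on (\<lambda>x. f x \<oplus>\<^bsub>X\<^esub> p (i x)) (carrier X)" using step.prems step.hyps(5) by (simp cong: inj_on_cong)
  from indecomposable_inj_plus[OF assms(1,2) thru_lin[OF X X step.hyps(1)] pi this]
  show ?case using step.IH step.hyps(2-4) by blast
qed

text \<open>An injective \<open>p i\<close> is invertible by finite length, so \<open>i\<close>
  splits; as \<open>N\<close> is indecomposable too, the complement of the image of \<open>X\<close>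
  in \<open>N\<close> vanishes.\<close>

lemma indecomposable_addc_iso:
  assumes "indecomposable_module R X" "fin_len R X (carrier X)" "\<And>N. N \<in> \<N> \<Longrightarrow> indecomposable_module R N" "addc R \<N> X"
  obtains N f g where "N \<in> \<N>" "isoM R X N f g"
proof -
  have X: "left_module R X" "carrier X \<noteq> {\<zero>\<^bsub>X\<^esub>}" using assms(1) by (auto simp: indecomposable_module_def)
  have "\<And>N. N \<in> \<N> \<Longrightarrow> left_module R N" using assms(3) by (auto simp: indecomposable_module_def)
  from indecomposable_thru_inj[OF assms(1,2) this assms(4)] obtain N i p
    where N: "N \<in> \<N>" "lin R X N i" "lin R N X p" "inj_on (\<lambda>x. p (i x)) (carrier X)" by auto
  have Nl: "left_module R N" using assms(3)[OF N(1)] by (simp add: indecomposable_module_def)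
  interpret X: left_module R X by fact
  interpret N: left_module R N by fact
  have pi: "lin R X X (\<lambda>x. p (i x))" using lin_comp[OF N(2,3)] .
  obtain v where v: "isoM R X X (\<lambda>x. p (i x)) v"
    using isoMI_bij[OF X(1) X(1) pi] N(4) fin_len_inj_imp_surj[OF X(1) assms(2) pi N(4)] unfolding bij_betw_def by blast
  define q where "q y = v (p y)" for y
  have q: "lin R N X q" "\<And>x. x \<in> carrier X \<Longrightarrow> q (i x) = x"
    using lin_comp[OF N(3), of X v] v unfolding q_def by (auto simp: isoM_def)
  have "i ` carrier X = {\<zero>\<^bsub>N\<^esub>} \<or> {y \<in> carrier N. q y = \<zero>\<^bsub>X\<^esub>} = {\<zero>\<^bsub>N\<^esub>}"
    using assms(3)[OF N(1)] internal_direct_sum_retract[OF X(1) Nl N(2) q] by (simp add: indecomposable_module_def)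
  moreover have "i ` carrier X \<noteq> {\<zero>\<^bsub>N\<^esub>}"
  proof
    assume *: "i ` carrier X = {\<zero>\<^bsub>N\<^esub>}"
    have "x = \<zero>\<^bsub>X\<^esub>" if "x \<in> carrier X" for x
    proof -
      have "i x = \<zero>\<^bsub>N\<^esub>" using * that by blast
      then show ?thesis using q(2)[OF that] lin_zero[OF Nl X(1) q(1)] by simp
    qed
    then show False using X(2) X.M.zero_closed by blast
  qed
  ultimately have "{y \<in> carrier N. q y = \<zero>\<^bsub>X\<^esub>} = {\<zero>\<^bsub>N\<^esub>}" by blast
  then have inj: "inj_on q (carrier N)" using lin_inj_iff[OF Nl X(1) q(1)] by blast
  have "i (q y) = y" if "y \<in> carrier N" for y
    using that q lin_mem[OF q(1)] lin_mem[OF N(2)] by (intro inj_onD[OF inj]) auto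
  then have "isoM R X N i q" using N(2) q by (simp add: isoM_def)
  then show ?thesis using that N(1) by blast
qed

text \<open>A decomposable submodule splits into two of smaller rank. The pieces remain submodules
  of \<open>X\<close>, hence of the same type, and the decomposition is recorded as membership in
  \<open>add\<close>, the form in which \<open>indecomposable_addc_iso\<close> compares it with
  other modules.\<close>

lemma decomposition_exists:
  fixes X :: "('r, 'm) module"
  assumes "left_module R X" "fin_len R X (carrier X)"
  obtains \<N> where "finite \<N>" "\<And>N. N \<in> \<N> \<Longrightarrow> indecomposable_module R N \<and> (\<exists>H. submodule H R X \<and> N = X\<lparr>carrier := H\<rparr>)" "addc R \<N> X"
proof -
  interpret left_module R X by fact
  obtain \<rho> :: "_ \<Rightarrow> nat" where \<rho>: "\<And>C C'. submodule C R X \<Longrightarrow> submodule C' R X \<Longrightarrow> C \<subset> C' \<Longrightarrow> C' \<subseteq> carrier X \<Longrightarrow> \<rho> C < \<rho> C'"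
    using that by (rule fin_lenE[OF assms(2)])
  have "\<exists>\<N>. finite \<N> \<and> (\<forall>N\<in>\<N>. indecomposable_module R N \<and> (\<exists>H. submodule H R X \<and> N = X\<lparr>carrier := H\<rparr>)) \<and>
      addc R \<N> (X\<lparr>carrier := D\<rparr>)" if "submodule D R X" for D
    using that
  proof (induction "\<rho> D" arbitrary: D rule: less_induct)
    case less
    let ?D = "X\<lparr>carrier := D\<rparr>"
    have D: "left_module R ?D" using left_module_sub[OF assms(1) less.prems] .
    note Ds = submoduleD[OF less.prems]
    show ?case
    proof (cases "indecomposable_module R ?D")
      case True
      then show ?thesis using addc_self[OF D, of "{?D}"] less.prems by (intro exI[of _ "{?D}"]) auto
    next
      case False
      show ?thesis
      proof (cases "D = {\<zero>\<^bsub>X\<^esub>}")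
        case True
        have "thru R {} ?D ?D (\<lambda>x. x)" by (rule thru.zero) (simp add: True)
        then show ?thesis by blast
      next
        case nz: False
        then obtain N N' where ids: "internal_direct_sum R ?D N N'" and ne: "N \<noteq> {\<zero>\<^bsub>X\<^esub>}" "N' \<noteq> {\<zero>\<^bsub>X\<^esub>}"
          using \<open>\<not> indecomposable_module R ?D\<close> D unfolding indecomposable_module_def by auto
        have sub: "submodule N R X" "N \<subseteq> D" "submodule N' R X" "N' \<subseteq> D" "N \<inter> N' = {\<zero>\<^bsub>X\<^esub>}"
          using ids unfolding internal_direct_sum_def submodule_sub_iff[OF assms(1) less.prems] by auto
        have "N \<subset> D" "N' \<subset> D" using sub ne by blast+
        then have lt: "\<rho> N < \<rho> D" "\<rho> N' < \<rho> D" using \<rho>[OF sub(1) less.prems] \<rho>[OF sub(3) less.prems] Ds(1) by auto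
        obtain \<N>\<^sub>1 where N1: "finite \<N>\<^sub>1" "\<forall>N\<in>\<N>\<^sub>1. indecomposable_module R N \<and> (\<exists>H. submodule H R X \<and> N = X\<lparr>carrier := H\<rparr>)"
          "addc R \<N>\<^sub>1 (X\<lparr>carrier := N\<rparr>)" using less.hyps[OF lt(1) sub(1)] by blast
        obtain \<N>\<^sub>2 where N2: "finite \<N>\<^sub>2" "\<forall>N\<in>\<N>\<^sub>2. indecomposable_module R N \<and> (\<exists>H. submodule H R X \<and> N = X\<lparr>carrier := H\<rparr>)"
          "addc R \<N>\<^sub>2 (X\<lparr>carrier := N'\<rparr>)" using less.hyps[OF lt(2) sub(3)] by blast
        let ?N = "X\<lparr>carrier := N\<rparr>" and ?N' = "X\<lparr>carrier := N'\<rparr>" and ?\<N> = "\<N>\<^sub>1 \<union> \<N>\<^sub>2"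
        have l: "left_module R ?N" "left_module R ?N'" using left_module_sub[OF assms(1)] sub by auto
        obtain e e' where e: "lin R ?D (?D\<lparr>carrier := N\<rparr>) e" "lin R ?D (?D\<lparr>carrier := N'\<rparr>) e'"
          "\<And>x. x \<in> carrier ?D \<Longrightarrow> e x \<oplus>\<^bsub>?D\<^esub> e' x = x" using internal_direct_sum_projections[OF D ids] by metis
        have e': "lin R ?D ?N e" "lin R ?D ?N' e'" using e(1,2) by simp_all
        have i: "lin R ?N ?D (\<lambda>x. x)" "lin R ?N' ?D (\<lambda>x. x)" using sub by (auto simp: lin_def)
        have "thru R ?\<N> ?D ?D e"
          using thru_comp_right[OF e'(1) thru_comp_left[OF l(1) l(1) D i(1) thru_mono[OF N1(3)]]] by auto
        moreover have "thru R ?\<N> ?D ?D e'"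
          using thru_comp_right[OF e'(2) thru_comp_left[OF l(2) l(2) D i(2) thru_mono[OF N2(3)]]] by auto
        ultimately have "thru R ?\<N> ?D ?D (\<lambda>x. e x \<oplus>\<^bsub>?D\<^esub> e' x)" using thru_plus[OF D D] by blast
        then have "addc R ?\<N> ?D" by (rule thru_cong) (use e(3) in simp)
        then show ?thesis using N1(1,2) N2(1,2) by (intro exI[of _ ?\<N>]) auto
      qed
    qed
  qed
  from this[OF submodule_carrier[OF assms(1)]] show ?thesis using that by auto
qed

section \<open>Endomorphism rings and the contravariant Hom functor\<close>

definition hom_module ::
    "('r, 'a) ring_scheme \<Rightarrow> ('r, 'm, 'b) module_scheme \<Rightarrow> ('r, 'x, 'c) module_scheme \<Rightarrow> ('m \<Rightarrow> 'm, 'x \<Rightarrow> 'm) module" where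
  "hom_module R M X = \<lparr>carrier = mod_hom R X M, mult = undefined, one = undefined,
     zero = (\<lambda>x\<in>carrier X. \<zero>\<^bsub>M\<^esub>), add = (\<lambda>f g. \<lambda>x\<in>carrier X. f x \<oplus>\<^bsub>M\<^esub> g x),
     smult = (\<lambda>e f. compose (carrier X) e f)\<rparr>"

text \<open>\<open>M\<close> as a left module over its own endomorphism ring. Finite length is
  imposed on this module and carried from it to the modules \<open>Hom(X, M)\<close>.\<close>

definition eval_module :: "('r, 'm, 'b) module_scheme \<Rightarrow> ('m \<Rightarrow> 'm, 'm) module" where
  "eval_module M = \<lparr>carrier = carrier M, mult = undefined, one = undefined,
     zero = \<zero>\<^bsub>M\<^esub>, add = add M, smult = (\<lambda>e x. e x)\<rparr>"

lemma mod_hom_iff: "h \<in> mod_hom R X Y \<longleftrightarrow> lin R X Y h \<and> h \<in> extensional (carrier X)"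
  by (auto simp: mod_hom_def lin_def PiE_iff)

lemma mod_hom_eqI:
  "f \<in> mod_hom R X Y \<Longrightarrow> g \<in> mod_hom R X Y \<Longrightarrow> (\<And>x. x \<in> carrier X \<Longrightarrow> f x = g x) \<Longrightarrow> f = g"
  unfolding mod_hom_iff by (blast intro: extensionalityI)

lemma mod_hom_compose:
  "left_module R X \<Longrightarrow> lin R X Y f \<Longrightarrow> lin R Y Z g \<Longrightarrow> compose (carrier X) g f \<in> mod_hom R X Z"
  using lin_restrict[OF _ lin_comp] by (auto simp: compose_def)

lemma compose_apply: "x \<in> A \<Longrightarrow> compose A g f x = g (f x)"
  by (simp add: compose_def)

lemma mod_hom_mem: "h \<in> mod_hom R X Y \<Longrightarrow> x \<in> carrier X \<Longrightarrow> h x \<in> carrier Y"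
  using lin_mem[OF mod_hom_lin] .

locale hom_functor =
  fixes R :: "('r, 'a) ring_scheme" and M :: "('r, 'm) module"
  assumes M: "left_module R M"
begin

abbreviation "E \<equiv> End_ring R M"
abbreviation "H \<equiv> hom_module R M"

lemma E_simps [simp]:
  "carrier E = mod_hom R M M" "mult E = compose (carrier M)" "one E = (\<lambda>x\<in>carrier M. x)"
  "zero E = (\<lambda>x\<in>carrier M. \<zero>\<^bsub>M\<^esub>)" "add E = (\<lambda>f g. \<lambda>x\<in>carrier M. f x \<oplus>\<^bsub>M\<^esub> g x)"
  by (simp_all add: End_ring_def)

lemma H_simps [simp]:
  "carrier (H X) = mod_hom R X M" "zero (H X) = (\<lambda>x\<in>carrier X. \<zero>\<^bsub>M\<^esub>)"
  "add (H X) = (\<lambda>f g. \<lambda>x\<in>carrier X. f x \<oplus>\<^bsub>M\<^esub> g x)" "smult (H X) = (\<lambda>e f. compose (carrier X) e f)"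
  by (simp_all add: hom_module_def)

lemma hom_zero: "left_module R X \<Longrightarrow> (\<lambda>x\<in>carrier X. \<zero>\<^bsub>M\<^esub>) \<in> mod_hom R X M"
  using lin_restrict[OF _ lin_const_zero[OF M]] .

lemma hom_add: "left_module R X \<Longrightarrow> f \<in> mod_hom R X M \<Longrightarrow> g \<in> mod_hom R X M \<Longrightarrow>
    (\<lambda>x\<in>carrier X. f x \<oplus>\<^bsub>M\<^esub> g x) \<in> mod_hom R X M"
  using lin_restrict[OF _ lin_plus[OF M mod_hom_lin mod_hom_lin]] .

lemma hom_id: "(\<lambda>x\<in>carrier M. x) \<in> mod_hom R M M"
  using lin_restrict[OF M lin_id] .

text \<open>Stated for any record with these fields, so that it covers both the ring
  \<open>E\<close> and the modules \<open>H X\<close>.\<close>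

lemma abelian_group_hom:
  assumes "left_module R X"
    and "carrier G = mod_hom R X M" "zero G = (\<lambda>x\<in>carrier X. \<zero>\<^bsub>M\<^esub>)" "add G = (\<lambda>f g. \<lambda>x\<in>carrier X. f x \<oplus>\<^bsub>M\<^esub> g x)"
  shows "abelian_group G"
proof -
  interpret M: left_module R M by (rule M)
  note hc = hom_zero[OF assms(1)] hom_add[OF assms(1)]
  show ?thesis
  proof (rule abelian_groupI, unfold assms(2-4))
    fix f g h assume f: "f \<in> mod_hom R X M" and g: "g \<in> mod_hom R X M"
    show "(\<lambda>x\<in>carrier X. f x \<oplus>\<^bsub>M\<^esub> g x) \<in> mod_hom R X M" using hc f g by blast
    show "(\<lambda>x\<in>carrier X. f x \<oplus>\<^bsub>M\<^esub> g x) = (\<lambda>x\<in>carrier X. g x \<oplus>\<^bsub>M\<^esub> f x)"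
      using mod_hom_mem[OF f] mod_hom_mem[OF g] by (intro restrict_ext) (simp add: M.M.a_comm)
    assume h: "h \<in> mod_hom R X M"
    show "(\<lambda>x\<in>carrier X. (\<lambda>x\<in>carrier X. f x \<oplus>\<^bsub>M\<^esub> g x) x \<oplus>\<^bsub>M\<^esub> h x) = (\<lambda>x\<in>carrier X. f x \<oplus>\<^bsub>M\<^esub> (\<lambda>x\<in>carrier X. g x \<oplus>\<^bsub>M\<^esub> h x) x)"
      using mod_hom_mem[OF f] mod_hom_mem[OF g] mod_hom_mem[OF h] by (intro restrict_ext) (simp add: M.M.a_assoc)
  next
    fix f assume f: "f \<in> mod_hom R X M"
    show "(\<lambda>x\<in>carrier X. (\<lambda>x\<in>carrier X. \<zero>\<^bsub>M\<^esub>) x \<oplus>\<^bsub>M\<^esub> f x) = f"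
      using mod_hom_mem[OF f] f by (intro extensionalityI[of _ "carrier X"]) (auto simp: mod_hom_iff)
    have "(\<lambda>x\<in>carrier X. \<ominus>\<^bsub>M\<^esub> f x) \<in> mod_hom R X M" using lin_restrict[OF assms(1) lin_uminus[OF M mod_hom_lin[OF f]]] .
    moreover have "(\<lambda>x\<in>carrier X. (\<lambda>x\<in>carrier X. \<ominus>\<^bsub>M\<^esub> f x) x \<oplus>\<^bsub>M\<^esub> f x) = (\<lambda>x\<in>carrier X. \<zero>\<^bsub>M\<^esub>)"
      using mod_hom_mem[OF f] by (intro restrict_ext) (simp add: M.M.l_neg)
    ultimately show "\<exists>g\<in>mod_hom R X M. (\<lambda>x\<in>carrier X. g x \<oplus>\<^bsub>M\<^esub> f x) = (\<lambda>x\<in>carrier X. \<zero>\<^bsub>M\<^esub>)" by blast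
  qed (use hc in auto)
qed

lemma ring_E: "ring E"
proof (rule ringI)
  show "abelian_group E" by (rule abelian_group_hom[OF M]) simp_all
  show "monoid E"
  proof (rule monoidI)
    fix f g h assume fgh: "f \<in> carrier E" "g \<in> carrier E" "h \<in> carrier E"
    then have "h \<in> carrier M \<rightarrow> carrier M" using mod_hom_mem by auto
    then show "(f \<otimes>\<^bsub>E\<^esub> g) \<otimes>\<^bsub>E\<^esub> h = f \<otimes>\<^bsub>E\<^esub> (g \<otimes>\<^bsub>E\<^esub> h)" using compose_assoc[of h "carrier M" "carrier M" f g] by simp
  next
    fix f g assume "f \<in> carrier E" "g \<in> carrier E"
    then show "f \<otimes>\<^bsub>E\<^esub> g \<in> carrier E" using mod_hom_compose[OF M mod_hom_lin mod_hom_lin] by simp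
  next
    fix f assume f: "f \<in> carrier E"
    show "\<one>\<^bsub>E\<^esub> \<otimes>\<^bsub>E\<^esub> f = f" "f \<otimes>\<^bsub>E\<^esub> \<one>\<^bsub>E\<^esub> = f"
      using f mod_hom_mem[of f R M M] by (auto intro!: extensionalityI[of _ "carrier M"] simp: compose_def mod_hom_iff)
  qed (use hom_id in simp)
next
  fix f g h assume fgh: "f \<in> carrier E" "g \<in> carrier E" "h \<in> carrier E"
  show "(f \<oplus>\<^bsub>E\<^esub> g) \<otimes>\<^bsub>E\<^esub> h = f \<otimes>\<^bsub>E\<^esub> h \<oplus>\<^bsub>E\<^esub> g \<otimes>\<^bsub>E\<^esub> h"
    using fgh mod_hom_mem[of h R M M] by (auto simp: compose_def fun_eq_iff)
  show "h \<otimes>\<^bsub>E\<^esub> (f \<oplus>\<^bsub>E\<^esub> g) = h \<otimes>\<^bsub>E\<^esub> f \<oplus>\<^bsub>E\<^esub> h \<otimes>\<^bsub>E\<^esub> g"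
    using fgh mod_hom_mem[of f R M M] mod_hom_mem[of g R M M] lin_add[OF mod_hom_lin[of h R M M]] by (auto simp: compose_def fun_eq_iff)
qed

lemma left_module_H:
  assumes "left_module R X" shows "left_module E (H X)"
proof -
  interpret E: ring E by (rule ring_E)
  interpret G: abelian_group "H X" by (rule abelian_group_hom[OF assms]) simp_all
  show ?thesis
  proof
    fix a f assume a: "a \<in> carrier E" and f: "f \<in> carrier (H X)"
    show "a \<odot>\<^bsub>H X\<^esub> f \<in> carrier (H X)" using mod_hom_compose[OF assms mod_hom_lin mod_hom_lin] a f by simp
  next
    fix a b f assume a: "a \<in> carrier E" "b \<in> carrier E" and f: "f \<in> carrier (H X)"
    show "(a \<oplus>\<^bsub>E\<^esub> b) \<odot>\<^bsub>H X\<^esub> f = a \<odot>\<^bsub>H X\<^esub> f \<oplus>\<^bsub>H X\<^esub> b \<odot>\<^bsub>H X\<^esub> f"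
      using a f mod_hom_mem[of f R X M] by (auto simp: compose_def fun_eq_iff)
    show "(a \<otimes>\<^bsub>E\<^esub> b) \<odot>\<^bsub>H X\<^esub> f = a \<odot>\<^bsub>H X\<^esub> (b \<odot>\<^bsub>H X\<^esub> f)"
      using a f mod_hom_mem[of f R X M] by (auto simp: compose_def fun_eq_iff)
  next
    fix a f g assume a: "a \<in> carrier E" and f: "f \<in> carrier (H X)" "g \<in> carrier (H X)"
    show "a \<odot>\<^bsub>H X\<^esub> (f \<oplus>\<^bsub>H X\<^esub> g) = a \<odot>\<^bsub>H X\<^esub> f \<oplus>\<^bsub>H X\<^esub> a \<odot>\<^bsub>H X\<^esub> g"
      using a f mod_hom_mem[of f R X M] mod_hom_mem[of g R X M] lin_add[OF mod_hom_lin[of a R M M]] by (auto simp: compose_def fun_eq_iff)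
  next
    fix f assume f: "f \<in> carrier (H X)"
    show "\<one>\<^bsub>E\<^esub> \<odot>\<^bsub>H X\<^esub> f = f"
      using f mod_hom_mem[of f R X M] by (auto intro!: extensionalityI[of _ "carrier X"] simp: compose_def mod_hom_iff)
  qed
qed

text \<open>\<open>H M\<close> has the same carrier, addition and scalar action as the regular
  module: it is \<open>E\<close> itself.\<close>

lemma lin_regular_E_iff: "lin E (regular_module E) Y f \<longleftrightarrow> lin E (H M) Y f" "lin E Y (regular_module E) g \<longleftrightarrow> lin E Y (H M) g"
  by (simp_all add: lin_def)

lemma lin_precompose:
  assumes "left_module R X" "left_module R Y" "lin R Y X b"
  shows "lin E (H X) (H Y) (\<lambda>g. compose (carrier Y) g b)"
  unfolding lin_def
proof (intro conjI ballI)
  fix g assume "g \<in> carrier (H X)"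
  then show "compose (carrier Y) g b \<in> carrier (H Y)" using mod_hom_compose[OF assms(2,3) mod_hom_lin] by simp
qed (use lin_mem[OF assms(3)] in \<open>auto simp: compose_def fun_eq_iff\<close>)

text \<open>A composite \<open>X -> M -> Y\<close> becomes \<open>H Y -> H M -> H X\<close>, and
  \<open>H M\<close> is \<open>E\<close>. Hence \<open>H\<close> carries \<open>add M\<close> into
  \<open>add E\<close>.\<close>

lemma thru_H:
  assumes "left_module R X" "left_module R Y"
  shows "thru R {M} X Y f \<Longrightarrow> thru E {regular_module E} (H Y) (H X) (\<lambda>g. compose (carrier X) g f)"
proof (induction rule: thru.induct)
  case (zero f)
  have "compose (carrier X) g f = \<zero>\<^bsub>H X\<^esub>" if "g \<in> carrier (H Y)" for g
    using that zero lin_zero[OF assms(2) M mod_hom_lin[of g]] by (auto simp: compose_def fun_eq_iff)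
  then show ?case by (rule thru.zero)
next
  case (step f N i p h)
  have N: "N = M" using step by simp
  note i = step.hyps(3)[unfolded N] and p = step.hyps(4)[unfolded N]
  have fl: "lin R X Y f" using thru_lin[OF assms step.hyps(1)] .
  show ?case
  proof (rule thru.step[OF step.IH])
    show "lin E (H Y) (regular_module E) (\<lambda>g. compose (carrier M) g p)"
      unfolding lin_regular_E_iff by (rule lin_precompose[OF assms(2) M p])
    show "lin E (regular_module E) (H X) (\<lambda>g. compose (carrier X) g i)"
      unfolding lin_regular_E_iff by (rule lin_precompose[OF M assms(1) i])
    fix g assume g: "g \<in> carrier (H Y)"
    show "compose (carrier X) g h = compose (carrier X) g f \<oplus>\<^bsub>H X\<^esub> compose (carrier X) (compose (carrier M) g p) i"
      using g step.hyps(5) lin_mem[OF fl] lin_mem[OF i] lin_mem[OF p] lin_add[OF mod_hom_lin[of g R Y M]]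
      by (auto simp: compose_def fun_eq_iff)
  qed simp
qed

lemma compose_id: "g \<in> mod_hom R X M \<Longrightarrow> compose (carrier X) g (\<lambda>x. x) = g"
  by (auto simp: compose_def mod_hom_iff intro: extensionalityI)

lemma addc_H:
  assumes "left_module R X" "addc R {M} X" shows "addc E {regular_module E} (H X)"
  using thru_H[OF assms(1,1,2)] by (rule thru_cong) (simp add: compose_id)

text \<open>Write \<open>id_X = sum p_k i_k\<close> through \<open>M\<close>. Then
  \<open>g = sum (g p_k) i_k\<close> with \<open>g p_k\<close> in \<open>E\<close>, so linearity
  gives \<open>\<beta> g = sum g p_k \<beta>(i_k)\<close>, which is composition of \<open>g\<close>
  with \<open>b = sum p_k \<beta>(i_k)\<close>.\<close>

lemma H_full:
  assumes "left_module R X" "left_module R Y" "addc R {M} X" "lin E (H X) (H Y) \<beta>"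
  obtains b where "lin R Y X b" "\<And>g. g \<in> mod_hom R X M \<Longrightarrow> \<beta> g = compose (carrier Y) g b"
proof -
  note HX = left_module_H[OF assms(1)] and HY = left_module_H[OF assms(2)]
  \<comment> \<open>The induction runs over partial sums \<open>f\<close> of the identity, with
    \<open>\<beta> g\<close> replaced by \<open>\<beta> (g f)\<close>.\<close>
  have "\<exists>b. lin R Y X b \<and> (\<forall>g\<in>mod_hom R X M. \<beta> (compose (carrier X) g f) = compose (carrier Y) g b)"
    if "thru R {M} X X f" for f using that
  proof (induction rule: thru.induct)
    case (zero f)
    have "\<beta> (compose (carrier X) g f) = compose (carrier Y) g (\<lambda>x. \<zero>\<^bsub>X\<^esub>)" if g: "g \<in> mod_hom R X M" for g
    proof -
      have "compose (carrier X) g f = \<zero>\<^bsub>H X\<^esub>"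
        using zero lin_zero[OF assms(1) M mod_hom_lin[OF g]] by (auto simp: compose_def fun_eq_iff)
      then have "\<beta> (compose (carrier X) g f) = \<zero>\<^bsub>H Y\<^esub>" using lin_zero[OF HX HY assms(4)] by simp
      then show ?thesis using lin_zero[OF assms(1) M mod_hom_lin[OF g]] by (auto simp: compose_def fun_eq_iff)
    qed
    then show ?case using lin_const_zero[OF assms(1)] by blast
  next
    case (step f N i p h)
    have N: "N = M" using step by simp
    note i = step.hyps(3)[unfolded N] and p = step.hyps(4)[unfolded N]
    have fl: "lin R X X f" using thru_lin[OF assms(1,1) step.hyps(1)] .
    obtain b where b: "lin R Y X b" "\<And>g. g \<in> mod_hom R X M \<Longrightarrow> \<beta> (compose (carrier X) g f) = compose (carrier Y) g b"
      using step.IH by blast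
    let ?i = "restrict i (carrier X)"
    have i': "?i \<in> mod_hom R X M" using lin_restrict[OF assms(1) i] .
    have \<beta>i: "\<beta> ?i \<in> mod_hom R Y M" using lin_mem[OF assms(4), of ?i] i' by simp
    have new: "lin R Y X (\<lambda>y. b y \<oplus>\<^bsub>X\<^esub> p (\<beta> ?i y))" using lin_plus[OF assms(1) b(1) lin_comp[OF mod_hom_lin[OF \<beta>i] p]] .
    have "\<beta> (compose (carrier X) g h) = compose (carrier Y) g (\<lambda>y. b y \<oplus>\<^bsub>X\<^esub> p (\<beta> ?i y))" if g: "g \<in> mod_hom R X M" for g
    proof -
      let ?e = "compose (carrier M) g p"
      have e: "?e \<in> carrier E" using mod_hom_compose[OF M p mod_hom_lin[OF g]] by simp
      have f': "compose (carrier X) g f \<in> carrier (H X)" using mod_hom_compose[OF assms(1) fl mod_hom_lin[OF g]] by simp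
      have "compose (carrier X) g h = compose (carrier X) g f \<oplus>\<^bsub>H X\<^esub> ?e \<odot>\<^bsub>H X\<^esub> ?i"
        using step.hyps(5) lin_mem[OF fl] lin_mem[OF i] lin_mem[OF p] lin_add[OF mod_hom_lin[OF g]]
        by (auto simp: compose_def fun_eq_iff)
      moreover have "?e \<odot>\<^bsub>H X\<^esub> ?i \<in> carrier (H X)" using left_module.smult_closed[OF HX e, of ?i] i' by simp
      ultimately have "\<beta> (compose (carrier X) g h) = \<beta> (compose (carrier X) g f) \<oplus>\<^bsub>H Y\<^esub> ?e \<odot>\<^bsub>H Y\<^esub> \<beta> ?i"
        using lin_add[OF assms(4) f'] lin_smult[OF assms(4) e, of ?i] i' by simp
      also have "\<dots> = compose (carrier Y) g (\<lambda>y. b y \<oplus>\<^bsub>X\<^esub> p (\<beta> ?i y))"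
        using b(2)[OF g] lin_mem[OF b(1)] lin_mem[OF p] mod_hom_mem[OF \<beta>i] lin_add[OF mod_hom_lin[OF g]]
        by (auto simp: compose_def fun_eq_iff)
      finally show ?thesis .
    qed
    then show ?case using new by blast
  qed
  from this[OF assms(3)] show ?thesis using that by (auto simp: compose_id)
qed

lemma left_module_eval: "left_module E (eval_module M)"
proof -
  interpret M: left_module R M by (rule M)
  interpret E: ring E by (rule ring_E)
  have "abelian_group (eval_module M)"
    by (rule abelian_groupI) (auto simp: eval_module_def M.M.a_ac intro: exI[of _ "\<ominus>\<^bsub>M\<^esub> _"] M.M.l_neg)
  then interpret G: abelian_group "eval_module M" .
  show ?thesis
    by unfold_locales (auto simp: eval_module_def mod_hom_mem lin_add[OF mod_hom_lin] compose_def)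
qed

lemma lin_eval:
  assumes "x \<in> carrier X" shows "lin E (H X) (eval_module M) (\<lambda>f. f x)"
  using assms by (auto simp: lin_def eval_module_def mod_hom_mem compose_def)

text \<open>A map out of \<open>X\<close> is determined by its values on finitely many generators,
  and evaluation at a generator is \<open>E\<close>-linear.\<close>

lemma fin_len_H:
  assumes "fg_module R X" "fin_len E (eval_module M) (carrier M)" shows "fin_len E (H X) (carrier (H X))"
proof -
  have X: "left_module R X" using assms(1) by (rule fg_left_module)
  obtain S where S: "finite S" "S \<subseteq> carrier X" "\<And>N. submodule N R X \<Longrightarrow> S \<subseteq> N \<Longrightarrow> carrier X \<subseteq> N"
    using assms(1) unfolding fg_module_iff spans_def by blast
  have HX: "left_module E (H X)" using left_module_H[OF X] .
  show ?thesis
  proof (rule fin_len_jointly_inj[OF HX S(1), of "\<lambda>_. eval_module M" "\<lambda>s f. f s"])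
    fix s assume "s \<in> S"
    then show "left_module E (eval_module M) \<and> lin E (H X) (eval_module M) (\<lambda>f. f s) \<and> fin_len E (eval_module M) (carrier (eval_module M))"
      using left_module_eval lin_eval[of s X] S(2) assms(2) by (auto simp: eval_module_def)
  next
    fix f assume f: "f \<in> carrier (H X)" "\<forall>s\<in>S. f s = \<zero>\<^bsub>eval_module M\<^esub>"
    have fl: "lin R X M f" using f mod_hom_lin by auto
    have "carrier X \<subseteq> {x \<in> carrier X. f x = \<zero>\<^bsub>M\<^esub>}"
      using f(2) S(2) by (intro S(3) submodule_kernel[OF X M fl submodule_carrier[OF X]]) (auto simp: eval_module_def)
    then show "f = \<zero>\<^bsub>H X\<^esub>" using f(1) by (auto intro!: extensionalityI[of _ "carrier X"] simp: mod_hom_iff)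
  qed (rule submodule_carrier[OF HX])
qed

end

locale fg_hom_functor = hom_functor R M for R :: "('r, 'a) ring_scheme" and M :: "'r fgmod" +
  assumes fgM: "fg_module R M"
begin

text \<open>A sum of composites through \<open>E = H M\<close> is one composite through
  \<open>H X\<close> with \<open>X\<close> in \<open>add M\<close>: each new summand enlarges
  \<open>X\<close> by a copy of \<open>M\<close>. For \<open>f\<close> the identity this makes
  \<open>P\<close> a retract of \<open>H X\<close>.\<close>

lemma thru_E_factors:
  assumes "left_module E P" "left_module E W"
  shows "thru E {regular_module E} P W f \<Longrightarrow> \<exists>(X :: 'r fgmod) a b. fg_module R X \<and> addc R {M} X \<and>
    lin E P (H X) a \<and> lin E (H X) W b \<and> (\<forall>x\<in>carrier P. b (a x) = f x)"
proof (induction rule: thru.induct)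
  case (zero f)
  have "lin E P (H M) (\<lambda>x. \<zero>\<^bsub>H M\<^esub>)" "lin E (H M) W (\<lambda>x. \<zero>\<^bsub>W\<^esub>)"
    using lin_const_zero left_module_H[OF M] assms(2) by blast+
  moreover have "\<forall>x\<in>carrier P. (\<lambda>x. \<zero>\<^bsub>W\<^esub>) ((\<lambda>x. \<zero>\<^bsub>H M\<^esub>) x) = f x" using zero by simp
  ultimately show ?case using fgM addc_self[OF M, of "{M}"] by blast
next
  case (step f N j q h)
  have N: "N = regular_module E" using step by simp
  note j = step.hyps(3)[unfolded N lin_regular_E_iff] and q = step.hyps(4)[unfolded N lin_regular_E_iff]
  obtain X :: "'r fgmod" and a b where X: "fg_module R X" "addc R {M} X" "lin E P (H X) a" "lin E (H X) W b"
    "\<And>x. x \<in> carrier P \<Longrightarrow> b (a x) = f x" using step.IH by blast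
  have Xl: "left_module R X" using X(1) by (rule fg_left_module)
  obtain Z :: "'r fgmod" and i\<^sub>1 i\<^sub>2 p\<^sub>1 p\<^sub>2 where Z: "fg_module R Z" "biprod R X M Z i\<^sub>1 i\<^sub>2 p\<^sub>1 p\<^sub>2"
    using biprod_exists[OF X(1) fgM] .
  have Zl: "left_module R Z" using Z(1) by (rule fg_left_module)
  have l: "lin R X Z i\<^sub>1" "lin R M Z i\<^sub>2" "lin R Z X p\<^sub>1" "lin R Z M p\<^sub>2" using Z(2) by (auto simp: biprod_def)
  define a' where "a' x = compose (carrier Z) (a x) p\<^sub>1 \<oplus>\<^bsub>H Z\<^esub> compose (carrier Z) (j x) p\<^sub>2" for x
  define b' where "b' g = b (compose (carrier X) g i\<^sub>1) \<oplus>\<^bsub>W\<^esub> q (compose (carrier M) g i\<^sub>2)" for g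
  have a': "lin E P (H Z) a'" unfolding a'_def
    by (rule lin_plus[OF left_module_H[OF Zl] lin_comp[OF X(3) lin_precompose[OF Xl Zl l(3)]] lin_comp[OF j lin_precompose[OF M Zl l(4)]]])
  have b': "lin E (H Z) W b'" unfolding b'_def
    by (rule lin_plus[OF assms(2) lin_comp[OF lin_precompose[OF Zl Xl l(1)] X(4)] lin_comp[OF lin_precompose[OF Zl M l(2)] q]])
  have "b' (a' x) = h x" if x: "x \<in> carrier P" for x
  proof -
    interpret M: left_module R M by (rule M)
    have ax: "a x \<in> mod_hom R X M" "j x \<in> mod_hom R M M" using lin_mem[OF X(3) x] lin_mem[OF j x] by auto
    have "compose (carrier X) (a' x) i\<^sub>1 = a x"
    proof (rule mod_hom_eqI[OF _ ax(1)])
      show "compose (carrier X) (a' x) i\<^sub>1 \<in> mod_hom R X M"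
        using mod_hom_compose[OF Xl l(1) mod_hom_lin] lin_mem[OF a' x] by simp
      fix u assume u: "u \<in> carrier X"
      then have "i\<^sub>1 u \<in> carrier Z" "p\<^sub>1 (i\<^sub>1 u) = u" "p\<^sub>2 (i\<^sub>1 u) = \<zero>\<^bsub>M\<^esub>" using Z(2) lin_mem[OF l(1)] by (auto simp: biprod_def)
      then show "compose (carrier X) (a' x) i\<^sub>1 u = a x u"
        using u lin_zero[OF M M mod_hom_lin[OF ax(2)]] mod_hom_mem[OF ax(1) u] by (simp add: a'_def compose_apply)
    qed
    moreover have "compose (carrier M) (a' x) i\<^sub>2 = j x"
    proof (rule mod_hom_eqI[OF _ ax(2)])
      show "compose (carrier M) (a' x) i\<^sub>2 \<in> mod_hom R M M"
        using mod_hom_compose[OF M l(2) mod_hom_lin] lin_mem[OF a' x] by simp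
      fix u assume u: "u \<in> carrier M"
      then have "i\<^sub>2 u \<in> carrier Z" "p\<^sub>2 (i\<^sub>2 u) = u" "p\<^sub>1 (i\<^sub>2 u) = \<zero>\<^bsub>X\<^esub>" using Z(2) lin_mem[OF l(2)] by (auto simp: biprod_def)
      then show "compose (carrier M) (a' x) i\<^sub>2 u = j x u"
        using u lin_zero[OF Xl M mod_hom_lin[OF ax(1)]] mod_hom_mem[OF ax(2) u] by (simp add: a'_def compose_apply)
    qed
    ultimately show ?thesis using X(5)[OF x] step.hyps(5)[OF x] by (simp add: b'_def)
  qed
  then show ?case using Z(1) addc_biprod[OF Xl M Zl Z(2) X(2) addc_self[OF M]] a' b' by blast
qed

lemma H_cover:
  assumes "fg_module E N"
  obtains X :: "'r fgmod" and p where "fg_module R X" "addc R {M} X" "lin E (H X) N p" "p ` carrier (H X) = carrier N"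
proof -
  obtain P :: "((nat \<Rightarrow> 'r) set \<Rightarrow> (nat \<Rightarrow> 'r) set) fgmod" and g
    where P: "fg_module E P" "addc E {regular_module E} P" "lin E P N g" "g ` carrier P = carrier N"
    using projective_cover_exists[OF assms] .
  have Pl: "left_module E P" using P(1) by (rule fg_left_module)
  obtain X :: "'r fgmod" and a b where X: "fg_module R X" "addc R {M} X" "lin E P (H X) a" "lin E (H X) P b"
    "\<And>x. x \<in> carrier P \<Longrightarrow> b (a x) = x" using thru_E_factors[OF Pl Pl P(2)] by auto
  have "y \<in> (\<lambda>x. g (b x)) ` carrier (H X)" if y: "y \<in> carrier N" for y
  proof -
    obtain x where x: "x \<in> carrier P" "y = g x" using y unfolding P(4)[symmetric] by blast
    then show ?thesis using X(5)[OF x(1)] lin_mem[OF X(3) x(1)] by (intro image_eqI[of _ _ "a x"]) auto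
  qed
  then have "(\<lambda>x. g (b x)) ` carrier (H X) = carrier N" using lin_mem[OF lin_comp[OF X(4) P(3)]] by auto
  then show ?thesis using that[OF X(1,2) lin_comp[OF X(4) P(3)]] by blast
qed

end

section \<open>Projective resolutions of length two\<close>

lemma zero_module_exists:
  fixes R :: "('r, 'a) ring_scheme"
  assumes "ring R"
  obtains Z :: "'r fgmod" where "fg_module R Z" "addc R {regular_module R} Z" "carrier Z = {\<zero>\<^bsub>Z\<^esub>}"
proof -
  let ?F = "regular_module R"
  have F: "left_module R ?F" using left_module_regular[OF assms] .
  let ?O = "?F\<lparr>carrier := {\<zero>\<^bsub>?F\<^esub>}\<rparr>"
  have O: "left_module R ?O" using left_module_sub[OF F submodule_zero[OF F]] .
  have "spans R ?O {}" unfolding spans_def using submoduleD(3)[of _ R ?O] by auto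
  then have fg: "fg_module R ?O" using O unfolding fg_module_iff by blast
  have ad: "addc R {?F} ?O" by (rule thru.zero) simp
  obtain Z :: "'r fgmod" and f g where Z: "fg_module R Z" "isoM R ?O Z f g" using universe_copy[OF fg] .
  have Zl: "left_module R Z" using Z(1) by (rule fg_left_module)
  have "carrier Z = f ` {\<zero>\<^bsub>?F\<^esub>}" using isoM_bij[OF Z(2)] by (simp add: bij_betw_def)
  then have "carrier Z = {\<zero>\<^bsub>Z\<^esub>}" using submoduleD(3)[OF submodule_carrier[OF Zl]] by auto
  then show ?thesis using that Z(1) addc_iso[OF O Zl Z(2) ad] by blast
qed

text \<open>Exactness for modules of arbitrary carrier types is translated into the format of a
  resolution: the terms are copied to the fixed type, the maps are made extensional, and the tail is
  filled with zero modules.\<close>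

lemma proj_resolution_of_length_2I:
  fixes N :: "'r fgmod"
  assumes N: "left_module R N"
    and fg: "fg_module R A\<^sub>0" "fg_module R A\<^sub>1" "fg_module R A\<^sub>2"
    and ad: "addc R {regular_module R} A\<^sub>0" "addc R {regular_module R} A\<^sub>1" "addc R {regular_module R} A\<^sub>2"
    and d: "lin R A\<^sub>0 N d\<^sub>0" "lin R A\<^sub>1 A\<^sub>0 d\<^sub>1" "lin R A\<^sub>2 A\<^sub>1 d\<^sub>2"
    and ex: "d\<^sub>0 ` carrier A\<^sub>0 = carrier N" "d\<^sub>1 ` carrier A\<^sub>1 = {x \<in> carrier A\<^sub>0. d\<^sub>0 x = \<zero>\<^bsub>N\<^esub>}"
      "d\<^sub>2 ` carrier A\<^sub>2 = {x \<in> carrier A\<^sub>1. d\<^sub>1 x = \<zero>\<^bsub>A\<^sub>0\<^esub>}" "inj_on d\<^sub>2 (carrier A\<^sub>2)"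
  shows "proj_resolution_of_length R N 2"
proof -
  interpret N: left_module R N by fact
  have R: "ring R" ..
  have A: "left_module R A\<^sub>0" "left_module R A\<^sub>1" "left_module R A\<^sub>2" using fg by (auto intro: fg_left_module)
  obtain Z :: "'r fgmod" where Z: "fg_module R Z" "addc R {regular_module R} Z" "carrier Z = {\<zero>\<^bsub>Z\<^esub>}"
    using zero_module_exists[OF R] .
  have Zl: "left_module R Z" using Z(1) by (rule fg_left_module)
  obtain U\<^sub>0 :: "'r fgmod" and f\<^sub>0 g\<^sub>0 where U0: "fg_module R U\<^sub>0" "isoM R A\<^sub>0 U\<^sub>0 f\<^sub>0 g\<^sub>0" using universe_copy[OF fg(1)] .
  obtain U\<^sub>1 :: "'r fgmod" and f\<^sub>1 g\<^sub>1 where U1: "fg_module R U\<^sub>1" "isoM R A\<^sub>1 U\<^sub>1 f\<^sub>1 g\<^sub>1" using universe_copy[OF fg(2)] .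
  obtain U\<^sub>2 :: "'r fgmod" and f\<^sub>2 g\<^sub>2 where U2: "fg_module R U\<^sub>2" "isoM R A\<^sub>2 U\<^sub>2 f\<^sub>2 g\<^sub>2" using universe_copy[OF fg(3)] .
  have U: "left_module R U\<^sub>0" "left_module R U\<^sub>1" "left_module R U\<^sub>2" using U0(1) U1(1) U2(1) by (auto intro: fg_left_module)
  have l: "lin R A\<^sub>0 U\<^sub>0 f\<^sub>0" "lin R U\<^sub>0 A\<^sub>0 g\<^sub>0" "lin R A\<^sub>1 U\<^sub>1 f\<^sub>1" "lin R U\<^sub>1 A\<^sub>1 g\<^sub>1" "lin R A\<^sub>2 U\<^sub>2 f\<^sub>2" "lin R U\<^sub>2 A\<^sub>2 g\<^sub>2"
    using U0(2) U1(2) U2(2) by (auto simp: isoM_def)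
  have gi: "g\<^sub>0 ` carrier U\<^sub>0 = carrier A\<^sub>0" "g\<^sub>1 ` carrier U\<^sub>1 = carrier A\<^sub>1" "g\<^sub>2 ` carrier U\<^sub>2 = carrier A\<^sub>2"
    "inj_on g\<^sub>0 (carrier U\<^sub>0)" "inj_on g\<^sub>1 (carrier U\<^sub>1)" "inj_on g\<^sub>2 (carrier U\<^sub>2)" "inj_on f\<^sub>0 (carrier A\<^sub>0)" "inj_on f\<^sub>1 (carrier A\<^sub>1)"
    using isoM_bij[OF isoM_sym[OF U0(2)]] isoM_bij[OF isoM_sym[OF U1(2)]] isoM_bij[OF isoM_sym[OF U2(2)]]
      isoM_bij[OF U0(2)] isoM_bij[OF U1(2)] by (auto simp: bij_betw_def)
  define P where "P i = (if i = 0 then U\<^sub>0 else if i = 1 then U\<^sub>1 else if i = 2 then U\<^sub>2 else Z)" for i :: nat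
  have P: "P 0 = U\<^sub>0" "P (Suc 0) = U\<^sub>1" "P (Suc (Suc 0)) = U\<^sub>2" "P (Suc (Suc (Suc i))) = Z" for i by (simp_all add: P_def)
  define d where "d i = (if i = 0 then restrict (\<lambda>x. d\<^sub>0 (g\<^sub>0 x)) (carrier U\<^sub>0)
      else if i = 1 then restrict (\<lambda>x. f\<^sub>0 (d\<^sub>1 (g\<^sub>1 x))) (carrier U\<^sub>1)
      else if i = 2 then restrict (\<lambda>x. f\<^sub>1 (d\<^sub>2 (g\<^sub>2 x))) (carrier U\<^sub>2)
      else restrict (\<lambda>x. zero (P (i - 1))) (carrier Z))" for i :: nat
  have dd: "d 0 = restrict (\<lambda>x. d\<^sub>0 (g\<^sub>0 x)) (carrier U\<^sub>0)" "d (Suc 0) = restrict (\<lambda>x. f\<^sub>0 (d\<^sub>1 (g\<^sub>1 x))) (carrier U\<^sub>1)"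
    "d (Suc (Suc 0)) = restrict (\<lambda>x. f\<^sub>1 (d\<^sub>2 (g\<^sub>2 x))) (carrier U\<^sub>2)"
    "d (Suc (Suc (Suc i))) = restrict (\<lambda>x. zero (P (Suc (Suc i)))) (carrier Z)" for i by (simp_all add: d_def)
  have Pp: "proj_module R (P i)" "left_module R (P i)" for i
    using U0 U1 U2 Z addc_iso[OF A(1) U(1) U0(2) ad(1)] addc_iso[OF A(2) U(2) U1(2) ad(2)] addc_iso[OF A(3) U(3) U2(2) ad(3)] U Zl
    by (auto simp: P_def proj_module_iff)
  have d0: "d 0 \<in> mod_hom R (P 0) N" unfolding dd P by (rule lin_restrict[OF U(1) lin_comp[OF l(2) d(1)]])
  have dS: "d (Suc i) \<in> mod_hom R (P (Suc i)) (P i)" for i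
  proof (cases i rule: nat.exhaust)
    case zero
    show ?thesis unfolding zero dd P by (rule lin_restrict[OF U(2) lin_comp[OF lin_comp[OF l(4) d(2)] l(1)]])
  next
    case (Suc j)
    show ?thesis
    proof (cases j)
      case 0
      show ?thesis unfolding Suc 0 dd P by (rule lin_restrict[OF U(3) lin_comp[OF lin_comp[OF l(6) d(3)] l(3)]])
    next
      case S2: (Suc k)
      show ?thesis unfolding Suc S2 dd(4) P(4) by (rule lin_restrict[OF Zl lin_const_zero[OF Pp(2)]])
    qed
  qed
  have ex0: "d 0 ` carrier (P 0) = carrier N"
  proof -
    have "d 0 ` carrier (P 0) = d\<^sub>0 ` g\<^sub>0 ` carrier U\<^sub>0" by (simp add: dd P image_image)
    then show ?thesis unfolding gi ex .
  qed
  have ex1: "d 1 ` carrier (P 1) = mod_ker (P 0) N (d 0)"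
  proof -
    have "d 1 ` carrier (P 1) = f\<^sub>0 ` d\<^sub>1 ` g\<^sub>1 ` carrier U\<^sub>1" by (simp add: dd P image_image)
    also have "\<dots> = f\<^sub>0 ` {x \<in> carrier A\<^sub>0. d\<^sub>0 x = \<zero>\<^bsub>N\<^esub>}" unfolding gi ex ..
    also have "\<dots> = {x \<in> carrier U\<^sub>0. d\<^sub>0 (g\<^sub>0 x) = \<zero>\<^bsub>N\<^esub>}"
    proof
      show "{x \<in> carrier U\<^sub>0. d\<^sub>0 (g\<^sub>0 x) = \<zero>\<^bsub>N\<^esub>} \<subseteq> f\<^sub>0 ` {x \<in> carrier A\<^sub>0. d\<^sub>0 x = \<zero>\<^bsub>N\<^esub>}"
        using U0(2) lin_mem[OF l(2)] by (auto simp: isoM_def intro!: image_eqI[of _ _ "g\<^sub>0 _"])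
    qed (use U0(2) lin_mem[OF l(1)] in \<open>auto simp: isoM_def\<close>)
    finally show ?thesis by (auto simp: mod_ker_def dd P)
  qed
  have ex2: "d 2 ` carrier (P 2) = mod_ker (P 1) (P 0) (d 1)"
  proof -
    have P2: "P 2 = U\<^sub>2" "P 1 = U\<^sub>1" "d 2 = restrict (\<lambda>x. f\<^sub>1 (d\<^sub>2 (g\<^sub>2 x))) (carrier U\<^sub>2)" by (simp_all add: P_def d_def)
    have f0: "f\<^sub>0 y = \<zero>\<^bsub>U\<^sub>0\<^esub> \<longleftrightarrow> y = \<zero>\<^bsub>A\<^sub>0\<^esub>" if "y \<in> carrier A\<^sub>0" for y
      using that lin_inj_iff[OF A(1) U(1) l(1)] gi(7) lin_zero[OF A(1) U(1) l(1)] by blast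
    have "d 2 ` carrier (P 2) = f\<^sub>1 ` d\<^sub>2 ` g\<^sub>2 ` carrier U\<^sub>2" by (simp add: P2 image_image)
    also have "\<dots> = f\<^sub>1 ` {x \<in> carrier A\<^sub>1. d\<^sub>1 x = \<zero>\<^bsub>A\<^sub>0\<^esub>}" unfolding gi ex ..
    also have "\<dots> = {x \<in> carrier U\<^sub>1. d\<^sub>1 (g\<^sub>1 x) = \<zero>\<^bsub>A\<^sub>0\<^esub>}"
    proof
      show "{x \<in> carrier U\<^sub>1. d\<^sub>1 (g\<^sub>1 x) = \<zero>\<^bsub>A\<^sub>0\<^esub>} \<subseteq> f\<^sub>1 ` {x \<in> carrier A\<^sub>1. d\<^sub>1 x = \<zero>\<^bsub>A\<^sub>0\<^esub>}"
        using U1(2) lin_mem[OF l(4)] by (auto simp: isoM_def intro!: image_eqI[of _ _ "g\<^sub>1 _"])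
    qed (use U1(2) lin_mem[OF l(3)] in \<open>auto simp: isoM_def\<close>)
    finally show ?thesis using f0 lin_mem[OF lin_comp[OF l(4) d(2)]] by (auto simp: mod_ker_def dd P P2)
  qed
  have exS: "d (Suc (Suc i)) ` carrier (P (Suc (Suc i))) = mod_ker (P (Suc i)) (P i) (d (Suc i))" for i
  proof (cases i rule: nat.exhaust)
    case zero
    show ?thesis using ex2 zero by (simp add: numeral_2_eq_2)
  next
    case (Suc j)
    note Sj = Suc
    show ?thesis
    proof (cases j)
      case 0
      \<comment> \<open>The next term is zero, so exactness at index 2 is injectivity of
        \<open>d\<^sub>2\<close>.\<close>
      have f1: "f\<^sub>1 (d\<^sub>2 (g\<^sub>2 x)) = \<zero>\<^bsub>U\<^sub>1\<^esub> \<longleftrightarrow> x = \<zero>\<^bsub>U\<^sub>2\<^esub>" if x: "x \<in> carrier U\<^sub>2" for x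
      proof -
        have "f\<^sub>1 (d\<^sub>2 (g\<^sub>2 x)) = \<zero>\<^bsub>U\<^sub>1\<^esub> \<Longrightarrow> d\<^sub>2 (g\<^sub>2 x) = \<zero>\<^bsub>A\<^sub>1\<^esub>"
          using x lin_inj_iff[OF A(2) U(2) l(3)] gi(8) lin_mem[OF lin_comp[OF l(6) d(3)]] by blast
        moreover have "d\<^sub>2 (g\<^sub>2 x) = \<zero>\<^bsub>A\<^sub>1\<^esub> \<Longrightarrow> g\<^sub>2 x = \<zero>\<^bsub>A\<^sub>2\<^esub>"
          using x lin_inj_iff[OF A(3,2) d(3)] ex(4) lin_mem[OF l(6)] by blast
        moreover have "g\<^sub>2 x = \<zero>\<^bsub>A\<^sub>2\<^esub> \<Longrightarrow> x = \<zero>\<^bsub>U\<^sub>2\<^esub>"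
          using x lin_inj_iff[OF U(3) A(3) l(6)] gi(6) by blast
        moreover have "f\<^sub>1 (d\<^sub>2 (g\<^sub>2 \<zero>\<^bsub>U\<^sub>2\<^esub>)) = \<zero>\<^bsub>U\<^sub>1\<^esub>"
          using lin_zero[OF U(3) U(2) lin_comp[OF lin_comp[OF l(6) d(3)] l(3)]] by simp
        ultimately show ?thesis by blast
      qed
      have "\<zero>\<^bsub>U\<^sub>2\<^esub> \<in> carrier U\<^sub>2" using submoduleD(3)[OF submodule_carrier[OF U(3)]] .
      then show ?thesis using f1 Z(3) by (auto simp: mod_ker_def dd P Sj 0)
    next
      case S2: (Suc k)
      have "mod_ker (P (Suc i)) (P i) (d (Suc i)) = {\<zero>\<^bsub>Z\<^esub>}"
        using Z(3) by (auto simp: mod_ker_def dd P Sj S2)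
      then show ?thesis using Z(3) by (simp add: dd P Sj S2)
    qed
  qed
  show ?thesis
    unfolding proj_resolution_of_length_def
  proof (intro exI[of _ P] exI[of _ d] conjI allI impI)
    show "carrier (P i) = {\<zero>\<^bsub>P i\<^esub>}" if "2 < i" for i using that Z(3) by (simp add: P_def)
  qed (use Pp d0 dS ex0 ex1 exS in auto)
qed

lemma proj_resolution_length_le_2E:
  fixes N :: "'r fgmod"
  assumes "proj_resolution_of_length R N n" "n \<le> 2" "left_module R N"
  obtains P\<^sub>0 P\<^sub>1 P\<^sub>2 :: "'r fgmod" and d\<^sub>0 d\<^sub>1 d\<^sub>2 where
    "left_module R P\<^sub>0" "left_module R P\<^sub>1" "left_module R P\<^sub>2"
    "addc R {regular_module R} P\<^sub>0" "addc R {regular_module R} P\<^sub>1" "addc R {regular_module R} P\<^sub>2"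
    "lin R P\<^sub>0 N d\<^sub>0" "lin R P\<^sub>1 P\<^sub>0 d\<^sub>1" "lin R P\<^sub>2 P\<^sub>1 d\<^sub>2"
    "d\<^sub>0 ` carrier P\<^sub>0 = carrier N" "d\<^sub>1 ` carrier P\<^sub>1 = {x \<in> carrier P\<^sub>0. d\<^sub>0 x = \<zero>\<^bsub>N\<^esub>}"
    "d\<^sub>2 ` carrier P\<^sub>2 = {x \<in> carrier P\<^sub>1. d\<^sub>1 x = \<zero>\<^bsub>P\<^sub>0\<^esub>}" "inj_on d\<^sub>2 (carrier P\<^sub>2)"
proof -
  obtain P d where *: "\<forall>i. proj_module R (P i)" "\<forall>i>n. carrier (P i) = {\<zero>\<^bsub>P i\<^esub>}"
     "d 0 \<in> mod_hom R (P 0) N" "\<forall>i. d (Suc i) \<in> mod_hom R (P (Suc i)) (P i)"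
     "d 0 ` carrier (P 0) = carrier N" "d 1 ` carrier (P 1) = mod_ker (P 0) N (d 0)"
     "\<forall>i. d (Suc (Suc i)) ` carrier (P (Suc (Suc i))) = mod_ker (P (Suc i)) (P i) (d (Suc i))"
    using assms(1) unfolding proj_resolution_of_length_def by (elim exE conjE) (rule that; assumption)
  have P: "left_module R (P i)" "addc R {regular_module R} (P i)" for i
    using *(1) by (auto simp: proj_module_iff intro: fg_left_module)
  have l: "lin R (P (Suc i)) (P i) (d (Suc i))" for i using *(4) mod_hom_lin by blast
  have z: "carrier (P (Suc (Suc (Suc 0)))) = {\<zero>\<^bsub>P (Suc (Suc (Suc 0)))\<^esub>}" using *(2) assms(2) by simp
  \<comment> \<open>As \<open>n \<le> 2\<close>, the term with index 3 vanishes; shorter resolutions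
    are included, with zero terms at the end.\<close>
  have "mod_ker (P (Suc (Suc 0))) (P (Suc 0)) (d (Suc (Suc 0))) = {\<zero>\<^bsub>P (Suc (Suc 0))\<^esub>}"
    using *(7)[rule_format, of "Suc 0"] z lin_zero[OF P(1) P(1) l] by simp
  then have inj: "inj_on (d (Suc (Suc 0))) (carrier (P (Suc (Suc 0))))"
    using lin_inj_iff[OF P(1) P(1) l] by (auto simp: mod_ker_def)
  show ?thesis
    by (rule that[of "P 0" "P (Suc 0)" "P (Suc (Suc 0))" "d 0" "d (Suc 0)" "d (Suc (Suc 0))"])
      (use P l *(5,6,7) inj mod_hom_lin[OF *(3)] in \<open>auto simp: mod_ker_def\<close>)
qed

text \<open>Comparing two resolutions of \<open>N\<close> by homotopies, the identity of the second syzygy \<open>L\<close> becomes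
  a sum of a map through \<open>P\<^sub>2\<close> and one through \<open>Q\<^sub>1\<close>.\<close>

lemma second_syzygy_projective:
  fixes N :: "'r fgmod" and Q\<^sub>0 :: "('r, 'x) module" and Q\<^sub>1 :: "('r, 'y) module"
  assumes "proj_resolution_of_length R N n" "n \<le> 2" and N: "left_module R N"
    and Q: "left_module R Q\<^sub>0" "left_module R Q\<^sub>1" and aQ: "addc R {regular_module R} Q\<^sub>0" "addc R {regular_module R} Q\<^sub>1"
    and e: "lin R Q\<^sub>0 N \<epsilon>" "lin R Q\<^sub>1 Q\<^sub>0 \<delta>" "\<epsilon> ` carrier Q\<^sub>0 = carrier N" "\<delta> ` carrier Q\<^sub>1 = {x \<in> carrier Q\<^sub>0. \<epsilon> x = \<zero>\<^bsub>N\<^esub>}"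
  shows "addc R {regular_module R} (Q\<^sub>1\<lparr>carrier := {x \<in> carrier Q\<^sub>1. \<delta> x = \<zero>\<^bsub>Q\<^sub>0\<^esub>}\<rparr>)"
proof -
  obtain P\<^sub>0 P\<^sub>1 P\<^sub>2 :: "'r fgmod" and d\<^sub>0 d\<^sub>1 d\<^sub>2 where P: "left_module R P\<^sub>0" "left_module R P\<^sub>1" "left_module R P\<^sub>2"
    and aP: "addc R {regular_module R} P\<^sub>0" "addc R {regular_module R} P\<^sub>1" "addc R {regular_module R} P\<^sub>2"
    and d: "lin R P\<^sub>0 N d\<^sub>0" "lin R P\<^sub>1 P\<^sub>0 d\<^sub>1" "lin R P\<^sub>2 P\<^sub>1 d\<^sub>2"
    and ex: "d\<^sub>0 ` carrier P\<^sub>0 = carrier N" "d\<^sub>1 ` carrier P\<^sub>1 = {x \<in> carrier P\<^sub>0. d\<^sub>0 x = \<zero>\<^bsub>N\<^esub>}"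
      "d\<^sub>2 ` carrier P\<^sub>2 = {x \<in> carrier P\<^sub>1. d\<^sub>1 x = \<zero>\<^bsub>P\<^sub>0\<^esub>}" "inj_on d\<^sub>2 (carrier P\<^sub>2)"
    using proj_resolution_length_le_2E[OF assms(1,2) N] .
  interpret N: left_module R N by fact
  interpret Q0: left_module R Q\<^sub>0 by fact
  interpret Q1: left_module R Q\<^sub>1 by fact
  let ?K = "{x \<in> carrier Q\<^sub>1. \<delta> x = \<zero>\<^bsub>Q\<^sub>0\<^esub>}" and ?L = "Q\<^sub>1\<lparr>carrier := {x \<in> carrier Q\<^sub>1. \<delta> x = \<zero>\<^bsub>Q\<^sub>0\<^esub>}\<rparr>"
  have K: "submodule ?K R Q\<^sub>1" using submodule_kernel[OF Q(2,1) e(2) submodule_carrier[OF Q(2)]] .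
  have L: "left_module R ?L" using left_module_sub[OF Q(2) K] .
  have i: "lin R ?L Q\<^sub>1 (\<lambda>x. x)" using lin_incl[OF K] .
  have \<epsilon>\<delta>: "\<epsilon> (\<delta> x) = \<zero>\<^bsub>N\<^esub>" if "x \<in> carrier Q\<^sub>1" for x using e(4) that by auto
  have dd: "d\<^sub>0 (d\<^sub>1 x) = \<zero>\<^bsub>N\<^esub>" if "x \<in> carrier P\<^sub>1" for x using ex(2) that by auto
  have dd': "d\<^sub>1 (d\<^sub>2 x) = \<zero>\<^bsub>P\<^sub>0\<^esub>" if "x \<in> carrier P\<^sub>2" for x using ex(3) that by auto
  obtain f\<^sub>0 where f0: "lin R Q\<^sub>0 P\<^sub>0 f\<^sub>0" "\<And>x. x \<in> carrier Q\<^sub>0 \<Longrightarrow> d\<^sub>0 (f\<^sub>0 x) = \<epsilon> x"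
    using addc_regular_lift[OF Q(1) P(1) N d(1) aQ(1) e(1)] ex(1) lin_mem[OF e(1)] by blast
  obtain g\<^sub>0 where g0: "lin R P\<^sub>0 Q\<^sub>0 g\<^sub>0" "\<And>x. x \<in> carrier P\<^sub>0 \<Longrightarrow> \<epsilon> (g\<^sub>0 x) = d\<^sub>0 x"
    using addc_regular_lift[OF P(1) Q(1) N e(1) aP(1) d(1)] e(3) lin_mem[OF d(1)] by blast
  have "\<delta> x \<in> carrier Q\<^sub>0" if "x \<in> carrier Q\<^sub>1" for x using lin_mem[OF e(2) that] .
  then have "f\<^sub>0 (\<delta> x) \<in> d\<^sub>1 ` carrier P\<^sub>1" if "x \<in> carrier Q\<^sub>1" for x
    unfolding ex(2) using that f0(2) \<epsilon>\<delta> lin_mem[OF f0(1)] by simp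
  then obtain f\<^sub>1 where f1: "lin R Q\<^sub>1 P\<^sub>1 f\<^sub>1" "\<And>x. x \<in> carrier Q\<^sub>1 \<Longrightarrow> d\<^sub>1 (f\<^sub>1 x) = f\<^sub>0 (\<delta> x)"
    using addc_regular_lift[OF Q(2) P(2) P(1) d(2) aQ(2) lin_comp[OF e(2) f0(1)]] by blast
  have "g\<^sub>0 (d\<^sub>1 x) \<in> \<delta> ` carrier Q\<^sub>1" if "x \<in> carrier P\<^sub>1" for x
    unfolding e(4) using that g0(2) dd lin_mem[OF g0(1)] lin_mem[OF d(2)] by simp
  then obtain g\<^sub>1 where g1: "lin R P\<^sub>1 Q\<^sub>1 g\<^sub>1" "\<And>x. x \<in> carrier P\<^sub>1 \<Longrightarrow> \<delta> (g\<^sub>1 x) = g\<^sub>0 (d\<^sub>1 x)"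
    using addc_regular_lift[OF P(2) Q(2) Q(1) e(2) aP(2) lin_comp[OF d(2) g0(1)]] by blast
  have "f\<^sub>1 x \<in> d\<^sub>2 ` carrier P\<^sub>2" if "x \<in> carrier ?L" for x
    unfolding ex(3) using that f1(2) lin_zero[OF Q(1) P(1) f0(1)] lin_mem[OF f1(1)] by simp
  then obtain f\<^sub>2 where f2: "lin R ?L P\<^sub>2 f\<^sub>2" "\<And>x. x \<in> carrier ?L \<Longrightarrow> d\<^sub>2 (f\<^sub>2 x) = f\<^sub>1 x"
    using lin_factor_inj[OF P(3,2) d(3) ex(4) L lin_sub_dom[OF K f1(1)]] by blast
  have "\<delta> (g\<^sub>1 (d\<^sub>2 x)) = \<zero>\<^bsub>Q\<^sub>0\<^esub>" if "x \<in> carrier P\<^sub>2" for x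
    using that g1(2) dd' lin_mem[OF d(3)] lin_zero[OF P(1) Q(1) g0(1)] by simp
  then have g2: "lin R P\<^sub>2 ?L (\<lambda>x. g\<^sub>1 (d\<^sub>2 x))"
    using lin_mem[OF lin_comp[OF d(3) g1(1)]] by (intro lin_sub_cod[OF lin_comp[OF d(3) g1(1)]]) simp
  \<comment> \<open>Both the identity and \<open>g\<^sub>0 f\<^sub>0\<close> are compatible with
    \<open>\<epsilon>\<close>, so their difference lands in the image of \<open>\<delta>\<close> and
    lifts to a homotopy \<open>s\<close>.\<close>
  let ?t = "\<lambda>x. x \<ominus>\<^bsub>Q\<^sub>0\<^esub> g\<^sub>0 (f\<^sub>0 x)"
  have t: "lin R Q\<^sub>0 Q\<^sub>0 ?t" using lin_diff[OF Q(1) lin_id lin_comp[OF f0(1) g0(1)]] .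
  have "?t x \<in> \<delta> ` carrier Q\<^sub>1" if x: "x \<in> carrier Q\<^sub>0" for x
  proof -
    have "\<epsilon> (?t x) = \<zero>\<^bsub>N\<^esub>"
      using x f0(2) g0(2) lin_mem[OF f0(1)] lin_mem[OF g0(1)] lin_mem[OF e(1)] by (simp add: lin_minus[OF Q(1) N e(1)] N.diff_eq_zero_iff)
    then show ?thesis unfolding e(4) using lin_mem[OF t x] by simp
  qed
  then obtain s where s: "lin R Q\<^sub>0 Q\<^sub>1 s" "\<And>x. x \<in> carrier Q\<^sub>0 \<Longrightarrow> \<delta> (s x) = ?t x"
    using addc_regular_lift[OF Q(1,2,1) e(2) aQ(1) t] by blast
  \<comment> \<open>The defect of the next homotopy equation takes values in the kernel
    \<open>?L\<close> of \<open>\<delta>\<close>. On \<open>?L\<close> the term with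
    \<open>s\<close> vanishes and \<open>f\<^sub>1\<close> equals
    \<open>d\<^sub>2 f\<^sub>2\<close>, so that
    \<open>id = g\<^sub>1 d\<^sub>2 f\<^sub>2 + ?w\<close> there.\<close>
  let ?w = "\<lambda>x. (x \<ominus>\<^bsub>Q\<^sub>1\<^esub> g\<^sub>1 (f\<^sub>1 x)) \<ominus>\<^bsub>Q\<^sub>1\<^esub> s (\<delta> x)"
  have w: "lin R Q\<^sub>1 Q\<^sub>1 ?w" using lin_diff[OF Q(2) lin_diff[OF Q(2) lin_id lin_comp[OF f1(1) g1(1)]] lin_comp[OF e(2) s(1)]] .
  have w': "lin R Q\<^sub>1 ?L ?w"
  proof (rule lin_sub_cod[OF w])
    fix x assume x: "x \<in> carrier Q\<^sub>1"
    have m: "g\<^sub>1 (f\<^sub>1 x) \<in> carrier Q\<^sub>1" "s (\<delta> x) \<in> carrier Q\<^sub>1" "\<delta> x \<in> carrier Q\<^sub>0" "f\<^sub>1 x \<in> carrier P\<^sub>1"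
      using x lin_mem[OF f1(1)] lin_mem[OF g1(1)] lin_mem[OF s(1)] lin_mem[OF e(2)] by auto
    have m': "g\<^sub>0 (f\<^sub>0 (\<delta> x)) \<in> carrier Q\<^sub>0" using m lin_mem[OF f0(1)] lin_mem[OF g0(1)] by simp
    have "\<delta> (?w x) = \<zero>\<^bsub>Q\<^sub>0\<^esub>"
      using x m m' s(2) f1(2) g1(2) by (simp add: lin_minus[OF Q(2,1) e(2)] Q0.diff_eq_zero_iff)
    then show "?w x \<in> ?K" using lin_mem[OF w x] by simp
  qed
  have "thru R {regular_module R} ?L ?L (\<lambda>x. g\<^sub>1 (d\<^sub>2 (f\<^sub>2 x)))"
    using thru_comp_right[OF f2(1) thru_comp_left[OF P(3,3) L g2 aP(3)]] .
  moreover have "thru R {regular_module R} ?L ?L ?w"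
    using thru_comp_right[OF i thru_comp_left[OF Q(2,2) L w' aQ(2)]] .
  ultimately have "thru R {regular_module R} ?L ?L (\<lambda>x. g\<^sub>1 (d\<^sub>2 (f\<^sub>2 x)) \<oplus>\<^bsub>?L\<^esub> ?w x)" using thru_plus[OF L L] by blast
  then show ?thesis
  proof (rule thru_cong)
    fix x assume x: "x \<in> carrier ?L"
    then have m: "x \<in> carrier Q\<^sub>1" "g\<^sub>1 (f\<^sub>1 x) \<in> carrier Q\<^sub>1" using lin_mem[OF f1(1)] lin_mem[OF g1(1)] by auto
    have "s (\<delta> x) = \<zero>\<^bsub>Q\<^sub>1\<^esub>" using x lin_zero[OF Q(1,2) s(1)] by simp
    then have "?w x = x \<ominus>\<^bsub>Q\<^sub>1\<^esub> g\<^sub>1 (f\<^sub>1 x)" using m Q1.diff_eq_zero_iff[of "\<zero>\<^bsub>Q\<^sub>1\<^esub>" "\<zero>\<^bsub>Q\<^sub>1\<^esub>"] by (simp add: a_minus_def)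
    then show "x = g\<^sub>1 (d\<^sub>2 (f\<^sub>2 x)) \<oplus>\<^bsub>?L\<^esub> ?w x" using f2(2)[OF x] m Q1.sub_minus_cancel by simp
  qed
qed

section \<open>Auslander's correspondence\<close>

lemma proj_dim_le_iff: "proj_dim R N \<le> enat k \<longleftrightarrow> (\<exists>n\<le>k. proj_resolution_of_length R N n)"
proof
  assume *: "proj_dim R N \<le> enat k"
  let ?S = "{enat n | n. proj_resolution_of_length R N n}"
  have "?S \<noteq> {}"
  proof
    assume "?S = {}"
    then have "proj_dim R N = \<infinity>" unfolding proj_dim_def by (simp only: Inf_enat_def) simp
    then show False using * by simp
  qed
  then have "Inf ?S \<in> ?S" by (auto simp: Inf_enat_def intro: LeastI)
  then show "\<exists>n\<le>k. proj_resolution_of_length R N n" using * by (auto simp: proj_dim_def)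
next
  assume "\<exists>n\<le>k. proj_resolution_of_length R N n"
  then obtain n where "n \<le> k" "proj_resolution_of_length R N n" by blast
  then show "proj_dim R N \<le> enat k" unfolding proj_dim_def by (intro Inf_lower2[of "enat n"]) auto
qed

lemma gl_dim_le_2_iff:
  fixes R :: "('r, 'a) ring_scheme"
  shows "gl_dim R \<le> 2 \<longleftrightarrow> (\<forall>N :: 'r fgmod. fg_module R N \<longrightarrow> (\<exists>n\<le>2. proj_resolution_of_length R N n))"
proof -
  have "(2::enat) = enat 2" by (simp add: numeral_eq_enat)
  then have "gl_dim R \<le> 2 \<longleftrightarrow> (\<forall>N :: 'r fgmod. fg_module R N \<longrightarrow> proj_dim R N \<le> enat 2)"
    unfolding gl_dim_def Sup_le_iff by auto
  then show ?thesis unfolding proj_dim_le_iff .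
qed

text \<open>The elementwise form of an embedding into a product of copies of \<open>M\<close>; no
  product is formed.\<close>

definition cogenerated ::
    "('r, 'a) ring_scheme \<Rightarrow> ('r, 'm, 'b) module_scheme \<Rightarrow> ('r, 'x, 'c) module_scheme \<Rightarrow> bool" where
  "cogenerated R M X \<longleftrightarrow> (\<forall>x\<in>carrier X. x \<noteq> \<zero>\<^bsub>X\<^esub> \<longrightarrow> (\<exists>f. lin R X M f \<and> f x \<noteq> \<zero>\<^bsub>M\<^esub>))"

context fg_hom_functor
begin

lemma gl_dim_End_le_2:
  assumes fl: "fin_len E (eval_module M) (carrier M)"
    and cog: "\<And>Q :: 'r fgmod. fg_module R Q \<Longrightarrow> cogenerated R M Q \<Longrightarrow> addc R {M} Q"
  shows "gl_dim E \<le> 2"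
  unfolding gl_dim_le_2_iff
proof (intro allI impI exI[of _ 2] conjI order_refl)
  fix N :: "((nat \<Rightarrow> 'r) set \<Rightarrow> (nat \<Rightarrow> 'r) set) fgmod"
  assume N: "fg_module E N"
  have Nl: "left_module E N" using N by (rule fg_left_module)
  obtain X\<^sub>0 :: "'r fgmod" and \<epsilon> where X0: "fg_module R X\<^sub>0" "addc R {M} X\<^sub>0" "lin E (H X\<^sub>0) N \<epsilon>" "\<epsilon> ` carrier (H X\<^sub>0) = carrier N"
    using H_cover[OF N] .
  have X0l: "left_module R X\<^sub>0" "left_module E (H X\<^sub>0)" using X0(1) fg_left_module left_module_H by blast+
  let ?K = "{x \<in> carrier (H X\<^sub>0). \<epsilon> x = \<zero>\<^bsub>N\<^esub>}"
  have K: "submodule ?K E (H X\<^sub>0)" using submodule_kernel[OF X0l(2) Nl X0(3) submodule_carrier[OF X0l(2)]] .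
  \<comment> \<open>Finite length over \<open>E\<close> makes the kernel finitely generated, so that
    it can be covered once more.\<close>
  have fgK: "fg_module E (H X\<^sub>0\<lparr>carrier := ?K\<rparr>)" using fg_of_fin_len'[OF X0l(2) K fin_len_H[OF X0(1) fl]] .
  obtain X\<^sub>1 :: "'r fgmod" and p where X1: "fg_module R X\<^sub>1" "addc R {M} X\<^sub>1" "lin E (H X\<^sub>1) (H X\<^sub>0\<lparr>carrier := ?K\<rparr>) p"
    "p ` carrier (H X\<^sub>1) = carrier (H X\<^sub>0\<lparr>carrier := ?K\<rparr>)" using H_cover[OF fgK] .
  have X1l: "left_module R X\<^sub>1" "left_module E (H X\<^sub>1)" using X1(1) fg_left_module left_module_H by blast+
  have p: "lin E (H X\<^sub>1) (H X\<^sub>0) p" using lin_of_sub_cod[OF X1(3) K] .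
  obtain h where h: "lin R X\<^sub>0 X\<^sub>1 h" "\<And>g. g \<in> mod_hom R X\<^sub>1 M \<Longrightarrow> p g = compose (carrier X\<^sub>0) g h"
    using H_full[OF X1l(1) X0l(1) X1(2) p] by blast
  let ?T = "{g \<in> mod_hom R X\<^sub>1 M. \<forall>x\<in>carrier X\<^sub>0. g (h x) = \<zero>\<^bsub>M\<^esub>}"
  \<comment> \<open>The maps to \<open>M\<close> need not separate the points of the cokernel of
    \<open>h\<close>. Every map to \<open>M\<close> that kills the image of \<open>h\<close> kills
    \<open>t\<close> by construction, so dividing by \<open>t\<close> loses none of these
    maps.\<close>
  define t where "t = carrier X\<^sub>1 \<inter> \<Inter>((\<lambda>g. {x \<in> carrier X\<^sub>1. g x = \<zero>\<^bsub>M\<^esub>}) ` ?T)"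
  have t: "submodule t R X\<^sub>1"
    unfolding t_def
  proof (rule submodule_Inter[OF X1l(1)])
    fix B assume "B \<in> (\<lambda>g. {x \<in> carrier X\<^sub>1. g x = \<zero>\<^bsub>M\<^esub>}) ` ?T"
    then obtain g where "lin R X\<^sub>1 M g" "B = {x \<in> carrier X\<^sub>1. g x = \<zero>\<^bsub>M\<^esub>}" using mod_hom_lin by blast
    then show "submodule B R X\<^sub>1" using submodule_kernel[OF X1l(1) M _ submodule_carrier[OF X1l(1)]] by simp
  qed
  obtain Q :: "'r fgmod" and q where Q: "left_module R Q" "lin R X\<^sub>1 Q q" "q ` carrier X\<^sub>1 = carrier Q"
    "\<And>x. x \<in> carrier X\<^sub>1 \<Longrightarrow> q x = \<zero>\<^bsub>Q\<^esub> \<longleftrightarrow> x \<in> t" using quotient_exists[OF X1l(1) t] by blast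
  have factor: "\<exists>g'. lin R Q M g' \<and> (\<forall>x\<in>carrier X\<^sub>1. g' (q x) = g x)" if g: "g \<in> ?T" for g
  proof -
    have gl: "lin R X\<^sub>1 M g" using g mod_hom_lin by blast
    have "g x = \<zero>\<^bsub>M\<^esub>" if "x \<in> carrier X\<^sub>1" "q x = \<zero>\<^bsub>Q\<^esub>" for x using that Q(4)[OF that(1)] g unfolding t_def by blast
    then show ?thesis using lin_factor_surj[OF X1l(1) Q(1) M Q(2,3) gl] by metis
  qed
  have "cogenerated R M Q"
    unfolding cogenerated_def
  proof (intro ballI impI)
    fix y assume y: "y \<in> carrier Q" "y \<noteq> \<zero>\<^bsub>Q\<^esub>"
    then obtain x where x: "x \<in> carrier X\<^sub>1" "y = q x" unfolding Q(3)[symmetric] by blast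
    then have "x \<notin> t" using Q(4) y(2) by blast
    then obtain g where g: "g \<in> ?T" "g x \<noteq> \<zero>\<^bsub>M\<^esub>" using x(1) unfolding t_def by blast
    then show "\<exists>f. lin R Q M f \<and> f y \<noteq> \<zero>\<^bsub>M\<^esub>" using factor[OF g(1)] x by auto
  qed
  then have aQ: "addc R {M} Q" using cog fg_surj[OF X1(1) Q(1-3)] by blast
  have HQ: "left_module E (H Q)" using left_module_H[OF Q(1)] .
  let ?d = "\<lambda>g. compose (carrier X\<^sub>1) g q"
  have d: "lin E (H Q) (H X\<^sub>1) ?d" using lin_precompose[OF Q(1) X1l(1) Q(2)] .
  have pz: "p g = \<zero>\<^bsub>H X\<^sub>0\<^esub> \<longleftrightarrow> g \<in> ?T" if g: "g \<in> mod_hom R X\<^sub>1 M" for g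
    using h(2)[OF g] g by (auto simp: compose_def fun_eq_iff restrict_def)
  have im: "?d ` carrier (H Q) = {x \<in> carrier (H X\<^sub>1). p x = \<zero>\<^bsub>H X\<^sub>0\<^esub>}"
  proof
    show "?d ` carrier (H Q) \<subseteq> {x \<in> carrier (H X\<^sub>1). p x = \<zero>\<^bsub>H X\<^sub>0\<^esub>}"
    proof
      fix k assume "k \<in> ?d ` carrier (H Q)"
      then obtain g where g: "g \<in> mod_hom R Q M" "k = ?d g" by auto
      have k: "k \<in> mod_hom R X\<^sub>1 M" using mod_hom_compose[OF X1l(1) Q(2) mod_hom_lin[OF g(1)]] g(2) by simp
      have "k (h x) = \<zero>\<^bsub>M\<^esub>" if x: "x \<in> carrier X\<^sub>0" for x
      proof -
        have hx: "h x \<in> carrier X\<^sub>1" using lin_mem[OF h(1) x] .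
        then have "h x \<in> t" using x unfolding t_def by auto
        then have "q (h x) = \<zero>\<^bsub>Q\<^esub>" using Q(4)[OF hx] by simp
        then show ?thesis using lin_zero[OF Q(1) M mod_hom_lin[OF g(1)]] hx g(2) by (simp add: compose_apply)
      qed
      then show "k \<in> {x \<in> carrier (H X\<^sub>1). p x = \<zero>\<^bsub>H X\<^sub>0\<^esub>}" using k pz[OF k] by simp
    qed
    show "{x \<in> carrier (H X\<^sub>1). p x = \<zero>\<^bsub>H X\<^sub>0\<^esub>} \<subseteq> ?d ` carrier (H Q)"
    proof
      fix g assume "g \<in> {x \<in> carrier (H X\<^sub>1). p x = \<zero>\<^bsub>H X\<^sub>0\<^esub>}"
      then have g: "g \<in> mod_hom R X\<^sub>1 M" "g \<in> ?T" using pz by auto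
      obtain g' where g': "lin R Q M g'" "\<And>x. x \<in> carrier X\<^sub>1 \<Longrightarrow> g' (q x) = g x" using factor[OF g(2)] by blast
      let ?g = "restrict g' (carrier Q)"
      have "?g \<in> mod_hom R Q M" using lin_restrict[OF Q(1) g'(1)] .
      moreover have "?d ?g = g"
      proof (rule mod_hom_eqI[OF _ g(1)])
        show "?d ?g \<in> mod_hom R X\<^sub>1 M" using mod_hom_compose[OF X1l(1) Q(2) mod_hom_lin[OF \<open>?g \<in> mod_hom R Q M\<close>]] .
      qed (use g'(2) lin_mem[OF Q(2)] in \<open>simp add: compose_apply\<close>)
      ultimately show "g \<in> ?d ` carrier (H Q)" by (metis H_simps(1) image_eqI)
    qed
  qed
  have inj: "inj_on ?d (carrier (H Q))"
  proof (rule inj_onI)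
    fix f g assume fg: "f \<in> carrier (H Q)" "g \<in> carrier (H Q)" "?d f = ?d g"
    show "f = g"
    proof (rule mod_hom_eqI)
      show "f \<in> mod_hom R Q M" "g \<in> mod_hom R Q M" using fg by auto
      fix y assume "y \<in> carrier Q"
      then obtain x where x: "x \<in> carrier X\<^sub>1" "y = q x" unfolding Q(3)[symmetric] by blast
      then show "f y = g y" using fun_cong[OF fg(3), of x] by (simp add: compose_apply)
    qed
  qed
  have aH: "addc E {regular_module E} (H X\<^sub>0)" "addc E {regular_module E} (H X\<^sub>1)" "addc E {regular_module E} (H Q)"
    using addc_H[OF X0l(1) X0(2)] addc_H[OF X1l(1) X1(2)] addc_H[OF Q(1) aQ] .
  have fgH: "fg_module E (H X\<^sub>0)" "fg_module E (H X\<^sub>1)" "fg_module E (H Q)"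
    using fg_addc[OF X0l(2) _ aH(1)] fg_addc[OF X1l(2) _ aH(2)] fg_addc[OF HQ _ aH(3)] fg_regular[OF ring_E] by auto
  show "proj_resolution_of_length E N 2"
    by (rule proj_resolution_of_length_2I[OF Nl fgH aH X0(3) p d X0(4) _ im inj]) (use X1(4) in simp)
qed

lemma kernel_addc_of_gl_dim:
  fixes X P\<^sub>0 P\<^sub>1 :: "'r fgmod"
  assumes fl: "fin_len E (eval_module M) (carrier M)" and gen: "addc R {M} (regular_module R)"
    and flR: "fin_len R (regular_module R) (carrier R)" and gd: "gl_dim E \<le> 2" and X: "fg_module R X"
    and P: "left_module R P\<^sub>0" "left_module R P\<^sub>1" "addc R {M} P\<^sub>0" "addc R {M} P\<^sub>1"
    and i: "lin R X P\<^sub>0 i" "inj_on i (carrier X)" and d: "lin R P\<^sub>0 P\<^sub>1 d" "i ` carrier X = {x \<in> carrier P\<^sub>0. d x = \<zero>\<^bsub>P\<^sub>1\<^esub>}"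
  shows "addc R {M} X"
proof -
  have Xl: "left_module R X" using X by (rule fg_left_module)
  interpret X: left_module R X by fact
  have R: "ring R" ..
  note reg = left_module_regular[OF R]
  \<comment> \<open>A projective presentation \<open>B\<^sub>1 -> B\<^sub>0 -> X -> 0\<close>. Under
    \<open>H\<close> it becomes an exact sequence
    \<open>0 -> H X -> H B\<^sub>0 -> H B\<^sub>1\<close>, because a map out of
    \<open>B\<^sub>0\<close> that kills the kernel of \<open>p\<close> factors through
    \<open>p\<close>.\<close>
  obtain B\<^sub>0 :: "'r fgmod" and p where B0: "fg_module R B\<^sub>0" "addc R {regular_module R} B\<^sub>0" "lin R B\<^sub>0 X p" "p ` carrier B\<^sub>0 = carrier X"
    using projective_cover_exists[OF X] .
  have B0l: "left_module R B\<^sub>0" using B0(1) by (rule fg_left_module)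
  let ?K = "{x \<in> carrier B\<^sub>0. p x = \<zero>\<^bsub>X\<^esub>}"
  have K: "submodule ?K R B\<^sub>0" using submodule_kernel[OF B0l Xl B0(3) submodule_carrier[OF B0l]] .
  have "fin_len R B\<^sub>0 (carrier B\<^sub>0)" by (rule fin_len_addc[OF B0l _ B0(2)]) (use reg flR in auto)
  then have fgK: "fg_module R (B\<^sub>0\<lparr>carrier := ?K\<rparr>)" using fg_of_fin_len'[OF B0l K] by blast
  obtain B\<^sub>1 :: "'r fgmod" and r where B1: "fg_module R B\<^sub>1" "addc R {regular_module R} B\<^sub>1" "lin R B\<^sub>1 (B\<^sub>0\<lparr>carrier := ?K\<rparr>) r"
    "r ` carrier B\<^sub>1 = carrier (B\<^sub>0\<lparr>carrier := ?K\<rparr>)" using projective_cover_exists[OF fgK] .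
  have B1l: "left_module R B\<^sub>1" using B1(1) by (rule fg_left_module)
  have r: "lin R B\<^sub>1 B\<^sub>0 r" "r ` carrier B\<^sub>1 = ?K" using lin_of_sub_cod[OF B1(3) K] B1(4) by auto
  have aB: "addc R {M} B\<^sub>0" "addc R {M} B\<^sub>1"
    using thru_trans[OF B0l B0l _ B0(2), of "{M}"] thru_trans[OF B1l B1l _ B1(2), of "{M}"] reg gen by auto
  let ?\<delta> = "\<lambda>g. compose (carrier B\<^sub>1) g r"
  have \<delta>: "lin E (H B\<^sub>0) (H B\<^sub>1) ?\<delta>" using lin_precompose[OF B0l B1l r(1)] .
  note HB = left_module_H[OF B0l] left_module_H[OF B1l]
  have aHB: "addc E {regular_module E} (H B\<^sub>0)" "addc E {regular_module E} (H B\<^sub>1)" using addc_H[OF B0l aB(1)] addc_H[OF B1l aB(2)] .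
  \<comment> \<open>The second syzygy of the cokernel of \<open>?\<delta>\<close> is the kernel of
    \<open>?\<delta>\<close>, and this kernel is \<open>H X\<close>.\<close>
  obtain C :: "((nat \<Rightarrow> 'r) set \<Rightarrow> (nat \<Rightarrow> 'r) set, (nat \<Rightarrow> 'r) set \<Rightarrow> (nat \<Rightarrow> 'r) set) module" and c
    where C: "left_module E C" "lin E (H B\<^sub>1) C c" "c ` carrier (H B\<^sub>1) = carrier C"
      "\<And>x. x \<in> carrier (H B\<^sub>1) \<Longrightarrow> c x = \<zero>\<^bsub>C\<^esub> \<longleftrightarrow> x \<in> ?\<delta> ` carrier (H B\<^sub>0)"
    using quotient_exists[OF HB(2) submodule_image[OF HB \<delta> submodule_carrier[OF HB(1)]]] by blast
  have "fg_module E (H B\<^sub>1)" using fg_addc[OF HB(2) _ aHB(2)] fg_regular[OF ring_E] by auto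
  then have "fg_module E C" using fg_surj[OF _ C(1-3)] by blast
  then obtain N :: "((nat \<Rightarrow> 'r) set \<Rightarrow> (nat \<Rightarrow> 'r) set) fgmod" and u v where N: "fg_module E N" "isoM E C N u v"
    using universe_copy by metis
  have Nl: "left_module E N" using N(1) by (rule fg_left_module)
  obtain n where n: "proj_resolution_of_length E N n" "n \<le> 2" using gd N(1) unfolding gl_dim_le_2_iff by blast
  have u: "lin E C N u" "bij_betw u (carrier C) (carrier N)" using N(2) isoM_bij[OF N(2)] by (auto simp: isoM_def)
  have uz: "u y = \<zero>\<^bsub>N\<^esub> \<longleftrightarrow> y = \<zero>\<^bsub>C\<^esub>" if "y \<in> carrier C" for y
    using that lin_inj_iff[OF C(1) Nl u(1)] u(2) lin_zero[OF C(1) Nl u(1)] by (auto simp: bij_betw_def)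
  let ?\<epsilon> = "\<lambda>g. u (c g)" and ?L = "H B\<^sub>0\<lparr>carrier := {x \<in> carrier (H B\<^sub>0). ?\<delta> x = \<zero>\<^bsub>H B\<^sub>1\<^esub>}\<rparr>"
  have "?\<epsilon> ` carrier (H B\<^sub>1) = u ` c ` carrier (H B\<^sub>1)" by (simp add: image_image)
  then have e1: "?\<epsilon> ` carrier (H B\<^sub>1) = carrier N" using C(3) u(2) by (simp add: bij_betw_def)
  have "x \<in> ?\<delta> ` carrier (H B\<^sub>0) \<longleftrightarrow> x \<in> carrier (H B\<^sub>1) \<and> ?\<epsilon> x = \<zero>\<^bsub>N\<^esub>" for x
    using C(4)[of x] uz lin_mem[OF C(2), of x] lin_mem[OF \<delta>] by blast
  then have e2: "?\<delta> ` carrier (H B\<^sub>0) = {x \<in> carrier (H B\<^sub>1). ?\<epsilon> x = \<zero>\<^bsub>N\<^esub>}" by blast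
  have aL: "addc E {regular_module E} ?L"
    using second_syzygy_projective[OF n Nl HB(2,1) aHB(2,1) lin_comp[OF C(2) u(1)] \<delta> e1 e2] .
  have Ls: "submodule {x \<in> carrier (H B\<^sub>0). ?\<delta> x = \<zero>\<^bsub>H B\<^sub>1\<^esub>} E (H B\<^sub>0)"
    using submodule_kernel[OF HB \<delta> submodule_carrier[OF HB(1)]] .
  have Ll: "left_module E ?L" using left_module_sub[OF HB(1) Ls] .
  have HX: "left_module E (H X)" using left_module_H[OF Xl] .
  let ?j = "\<lambda>g. compose (carrier B\<^sub>0) g p"
  have jl: "lin E (H X) (H B\<^sub>0) ?j" using lin_precompose[OF Xl B0l B0(3)] .
  have dz: "?\<delta> g = \<zero>\<^bsub>H B\<^sub>1\<^esub> \<longleftrightarrow> (\<forall>x\<in>carrier B\<^sub>1. g (r x) = \<zero>\<^bsub>M\<^esub>)" for g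
    by (auto simp: compose_def fun_eq_iff restrict_def)
  have pr: "p (r x) = \<zero>\<^bsub>X\<^esub>" if "x \<in> carrier B\<^sub>1" for x using r(2) that by blast
  have j: "lin E (H X) ?L ?j"
  proof (rule lin_sub_cod[OF jl])
    fix g assume g: "g \<in> carrier (H X)"
    have "?j g (r x) = \<zero>\<^bsub>M\<^esub>" if x: "x \<in> carrier B\<^sub>1" for x
      using g pr[OF x] lin_mem[OF r(1) x] lin_zero[OF Xl M mod_hom_lin[of g]] by (simp add: compose_apply)
    then show "?j g \<in> {x \<in> carrier (H B\<^sub>0). ?\<delta> x = \<zero>\<^bsub>H B\<^sub>1\<^esub>}" using lin_mem[OF jl g] dz by blast
  qed
  have jb: "bij_betw ?j (carrier (H X)) (carrier ?L)"
    unfolding bij_betw_def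
  proof
    show "inj_on ?j (carrier (H X))"
    proof (rule inj_onI)
      fix f g assume fg: "f \<in> carrier (H X)" "g \<in> carrier (H X)" "?j f = ?j g"
      show "f = g"
      proof (rule mod_hom_eqI)
        show "f \<in> mod_hom R X M" "g \<in> mod_hom R X M" using fg by auto
        fix y assume "y \<in> carrier X"
        then obtain x where x: "x \<in> carrier B\<^sub>0" "y = p x" unfolding B0(4)[symmetric] by blast
        then show "f y = g y" using fun_cong[OF fg(3), of x] by (simp add: compose_apply)
      qed
    qed
    have "g \<in> ?j ` carrier (H X)" if g: "g \<in> carrier ?L" for g
    proof -
      have g': "g \<in> mod_hom R B\<^sub>0 M" "\<And>x. x \<in> carrier B\<^sub>1 \<Longrightarrow> g (r x) = \<zero>\<^bsub>M\<^esub>" using g dz[of g] by auto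
      have "g x = \<zero>\<^bsub>M\<^esub>" if x: "x \<in> carrier B\<^sub>0" "p x = \<zero>\<^bsub>X\<^esub>" for x
      proof -
        have "x \<in> r ` carrier B\<^sub>1" using x r(2) by blast
        then show ?thesis using g'(2) by blast
      qed
      then obtain k where k: "lin R X M k" "\<And>x. x \<in> carrier B\<^sub>0 \<Longrightarrow> k (p x) = g x"
        using lin_factor_surj[OF B0l Xl M B0(3,4) mod_hom_lin[OF g'(1)]] by metis
      let ?k = "restrict k (carrier X)"
      have kk: "?k \<in> mod_hom R X M" using lin_restrict[OF Xl k(1)] .
      have "?j ?k = g"
      proof (rule mod_hom_eqI[OF _ g'(1)])
        show "?j ?k \<in> mod_hom R B\<^sub>0 M" using mod_hom_compose[OF B0l B0(3) mod_hom_lin[OF kk]] .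
      qed (use k(2) lin_mem[OF B0(3)] in \<open>simp add: compose_apply\<close>)
      then show ?thesis using kk by (metis H_simps(1) image_eqI)
    qed
    then show "?j ` carrier (H X) = carrier ?L" using lin_mem[OF j] by blast
  qed
  obtain j' where j': "isoM E (H X) ?L ?j j'" using isoMI_bij[OF HX Ll j jb] .
  have aHX: "addc E {regular_module E} (H X)" using addc_iso[OF Ll HX isoM_sym[OF j'] aL] .
  obtain Y :: "'r fgmod" and a b where Y: "fg_module R Y" "addc R {M} Y" "lin E (H X) (H Y) a" "lin E (H Y) (H X) b"
    "\<And>g. g \<in> carrier (H X) \<Longrightarrow> b (a g) = g" using thru_E_factors[OF HX HX aHX] by auto
  have Yl: "left_module R Y" using Y(1) by (rule fg_left_module)
  interpret Y: left_module R Y by fact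
  obtain \<beta> where \<beta>: "lin R X Y \<beta>" "\<And>g. g \<in> mod_hom R Y M \<Longrightarrow> b g = compose (carrier X) g \<beta>"
    using H_full[OF Yl Xl Y(2) Y(4)] by blast
  obtain e where e: "lin R Y Y e" "\<And>g. g \<in> mod_hom R Y M \<Longrightarrow> a (b g) = compose (carrier Y) g e"
    using H_full[OF Yl Yl Y(2) lin_comp[OF Y(4,3)]] by blast
  \<comment> \<open>\<open>a (b g)\<close> vanishes as soon as \<open>b g\<close>, the composite of
    \<open>g\<close> with \<open>\<beta>\<close>, does. So a map to \<open>M\<close> that kills the
    image of \<open>\<beta>\<close> kills the image of \<open>e\<close>.\<close>
  have ker: "g (e y) = \<zero>\<^bsub>M\<^esub>" if g: "lin R Y M g" "\<And>x. x \<in> carrier X \<Longrightarrow> g (\<beta> x) = \<zero>\<^bsub>M\<^esub>" and y: "y \<in> carrier Y" for g y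
  proof -
    let ?g = "restrict g (carrier Y)"
    have g': "?g \<in> mod_hom R Y M" using lin_restrict[OF Yl g(1)] .
    have "b ?g = \<zero>\<^bsub>H X\<^esub>" using \<beta>(2)[OF g'] g(2) lin_mem[OF \<beta>(1)] by (auto simp: compose_def fun_eq_iff)
    then have "a (b ?g) = \<zero>\<^bsub>H Y\<^esub>" using lin_zero[OF HX left_module_H[OF Yl] Y(3)] by simp
    then have "compose (carrier Y) ?g e y = \<zero>\<^bsub>M\<^esub>" using e(2)[OF g'] y by simp
    then show ?thesis using y lin_mem[OF e(1) y] by (simp add: compose_apply)
  qed
  \<comment> \<open>By \<open>b a b = b\<close> the maps to \<open>M\<close> cannot distinguish
    \<open>e (\<beta> x)\<close> from \<open>\<beta> x\<close>, and they separate the points of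
    \<open>Y\<close>.\<close>
  have e\<beta>: "e (\<beta> x) = \<beta> x" if x: "x \<in> carrier X" for x
  proof -
    have bx: "\<beta> x \<in> carrier Y" "e (\<beta> x) \<in> carrier Y" using lin_mem[OF \<beta>(1) x] lin_mem[OF e(1)] by auto
    have "g (e (\<beta> x) \<ominus>\<^bsub>Y\<^esub> \<beta> x) = \<zero>\<^bsub>M\<^esub>" if g: "lin R Y M g" for g
    proof -
      interpret M: left_module R M by (rule M)
      let ?g = "restrict g (carrier Y)"
      have g': "?g \<in> mod_hom R Y M" using lin_restrict[OF Yl g] .
      have "b (a (b ?g)) = b ?g" using Y(5) lin_mem[OF Y(4), of ?g] g' by simp
      moreover have "a (b ?g) \<in> mod_hom R Y M" using lin_mem[OF lin_comp[OF Y(4,3)], of ?g] g' by simp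
      ultimately have "compose (carrier X) (compose (carrier Y) ?g e) \<beta> = compose (carrier X) ?g \<beta>"
        using \<beta>(2) g' e(2)[OF g'] by simp
      from fun_cong[OF this, of x] have "g (e (\<beta> x)) = g (\<beta> x)" using x bx by (simp add: compose_apply)
      then show ?thesis using bx lin_mem[OF g] by (simp add: lin_minus[OF Yl M g] M.diff_eq_zero_iff)
    qed
    then have "e (\<beta> x) \<ominus>\<^bsub>Y\<^esub> \<beta> x = \<zero>\<^bsub>Y\<^esub>"
      using thru_separate[OF Yl _ _ _ Y(2), of "e (\<beta> x) \<ominus>\<^bsub>Y\<^esub> \<beta> x"] M bx by auto
    then show ?thesis using bx by (simp add: Y.diff_eq_zero_iff)
  qed
  \<comment> \<open>The equation \<open>b (a f) = f\<close> says that \<open>a f\<close> extends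
    \<open>f\<close> along \<open>\<beta>\<close>.\<close>
  have ext: "\<exists>k. lin R Y N k \<and> (\<forall>x\<in>carrier X. k (\<beta> x) = f x)" if "N \<in> {M}" "lin R X N f" for N f
  proof -
    let ?f = "restrict f (carrier X)"
    have f': "?f \<in> mod_hom R X M" using that lin_restrict[OF Xl, of M f] by simp
    have af: "a ?f \<in> mod_hom R Y M" using lin_mem[OF Y(3), of ?f] f' by simp
    have eq: "compose (carrier X) (a ?f) \<beta> = ?f" using Y(5)[of ?f] f' \<beta>(2)[OF af] by simp
    have "a ?f (\<beta> x) = f x" if x: "x \<in> carrier X" for x
    proof -
      have "compose (carrier X) (a ?f) \<beta> x = f x" unfolding eq using x by simp
      then show ?thesis by (simp only: compose_apply[OF x])
    qed
    moreover have "lin R Y N (a ?f)" using mod_hom_lin[OF af] that(1) by simp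
    ultimately show ?thesis by blast
  qed
  have "thru R {M} X P\<^sub>0 i" using thru_comp_right[OF i(1) P(3)] by simp
  from thru_extend[OF Xl Yl P(1) \<beta>(1) _ this] have "\<exists>\<psi>. thru R {M} Y P\<^sub>0 \<psi> \<and> (\<forall>x\<in>carrier X. \<psi> (\<beta> x) = i x)"
    using ext by simp
  then obtain \<psi> where \<psi>: "thru R {M} Y P\<^sub>0 \<psi>" "\<And>x. x \<in> carrier X \<Longrightarrow> \<psi> (\<beta> x) = i x" by blast
  have \<psi>l: "lin R Y P\<^sub>0 \<psi>" using thru_lin[OF Yl P(1) \<psi>(1)] .
  \<comment> \<open>Since \<open>\<psi> \<beta> = i\<close>, the map \<open>d \<psi>\<close> kills
    the image of \<open>\<beta>\<close>. Followed by any map to \<open>M\<close> it therefore kills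
    the image of \<open>e\<close>, and such maps separate the points of
    \<open>P\<^sub>1\<close>.\<close>
  have "d (\<psi> (e y)) = \<zero>\<^bsub>P\<^sub>1\<^esub>" if y: "y \<in> carrier Y" for y
  proof (rule thru_separate[OF P(2) _ _ _ P(4)])
    show "d (\<psi> (e y)) \<in> carrier P\<^sub>1" using lin_mem[OF lin_comp[OF lin_comp[OF e(1) \<psi>l] d(1)] y] .
    fix N k assume N: "N \<in> {M}" and k: "lin R P\<^sub>1 N k"
    have "k (d (\<psi> (\<beta> x))) = \<zero>\<^bsub>M\<^esub>" if x: "x \<in> carrier X" for x
    proof -
      have "d (i x) = \<zero>\<^bsub>P\<^sub>1\<^esub>" using d(2) x by blast
      then show ?thesis using \<psi>(2)[OF x] lin_zero[OF P(2) M, of k] k N by simp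
    qed
    then show "k (d (\<psi> (e y))) = \<zero>\<^bsub>N\<^esub>" using ker[OF lin_comp[OF lin_comp[OF \<psi>l d(1)], of M k] _ y] k N by simp
  qed (use M in simp)
  then have im: "\<psi> (e y) \<in> i ` carrier X" if "y \<in> carrier Y" for y
    unfolding d(2) using that lin_mem[OF lin_comp[OF e(1) \<psi>l] that] by simp
  \<comment> \<open>The retraction: \<open>\<psi> e\<close> takes values in the image of
    \<open>i\<close>, so \<open>i\<close> can be undone.\<close>
  obtain \<rho> where \<rho>: "lin R Y X \<rho>" "\<And>y. y \<in> carrier Y \<Longrightarrow> i (\<rho> y) = \<psi> (e y)"
  proof (rule lin_factor_inj[OF Xl P(1) i Yl lin_comp[OF e(1) \<psi>l] im])
    fix g assume "lin R Y X g" "\<And>y. y \<in> carrier Y \<Longrightarrow> i (g y) = \<psi> (e y)"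
    then show thesis by (rule that)
  qed
  have \<rho>\<beta>: "\<rho> (\<beta> x) = x" if x: "x \<in> carrier X" for x
  proof (rule inj_onD[OF i(2) _ _ x])
    show "i (\<rho> (\<beta> x)) = i x" unfolding \<rho>(2)[OF lin_mem[OF \<beta>(1) x]] e\<beta>[OF x] \<psi>(2)[OF x] ..
  qed (rule lin_mem[OF \<rho>(1) lin_mem[OF \<beta>(1) x]])
  show ?thesis by (rule addc_retract[OF Xl Yl \<beta>(1) \<rho>(1) \<rho>\<beta> Y(2)])
qed

end

section \<open>The equivalence when Gorenstein-projective means torsionless\<close>

abbreviation torsionless where "torsionless R X \<equiv> cogenerated R (regular_module R) X"

lemma cogenerated_sub:
  assumes "submodule N R X" "cogenerated R M X" shows "cogenerated R M (X\<lparr>carrier := N\<rparr>)"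
  using assms lin_sub_dom[OF assms(1)] submoduleD(2)[OF assms(1)] unfolding cogenerated_def by fastforce

lemma cogenerated_inj:
  assumes "left_module R X" "left_module R Y" "lin R X Y i" "inj_on i (carrier X)" "cogenerated R M Y"
  shows "cogenerated R M X"
  unfolding cogenerated_def
proof (intro ballI impI)
  fix x assume x: "x \<in> carrier X" "x \<noteq> \<zero>\<^bsub>X\<^esub>"
  then have "i x \<in> carrier Y" "i x \<noteq> \<zero>\<^bsub>Y\<^esub>" using lin_mem[OF assms(3)] lin_inj_iff[OF assms(1-3)] assms(4) by auto
  then obtain f where "lin R Y M f" "f (i x) \<noteq> \<zero>\<^bsub>M\<^esub>" using assms(5) unfolding cogenerated_def by blast
  then show "\<exists>f. lin R X M f \<and> f x \<noteq> \<zero>\<^bsub>M\<^esub>" using lin_comp[OF assms(3)] by blast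
qed

lemma cogenerated_trans:
  assumes "cogenerated R M X" "cogenerated R N M" shows "cogenerated R N X"
  unfolding cogenerated_def
proof (intro ballI impI)
  fix x assume x: "x \<in> carrier X" "x \<noteq> \<zero>\<^bsub>X\<^esub>"
  then obtain f where f: "lin R X M f" "f x \<noteq> \<zero>\<^bsub>M\<^esub>" using assms(1) unfolding cogenerated_def by blast
  then obtain g where "lin R M N g" "g (f x) \<noteq> \<zero>\<^bsub>N\<^esub>" using assms(2) lin_mem[OF f(1) x(1)] unfolding cogenerated_def by blast
  then show "\<exists>f. lin R X N f \<and> f x \<noteq> \<zero>\<^bsub>N\<^esub>" using lin_comp[OF f(1)] by blast
qed

lemma cogenerated_addc:
  assumes "left_module R X" "\<And>N. N \<in> \<N> \<Longrightarrow> left_module R N \<and> cogenerated R M N" "addc R \<N> X"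
  shows "cogenerated R M X"
  unfolding cogenerated_def
proof (intro ballI impI)
  fix x assume x: "x \<in> carrier X" "x \<noteq> \<zero>\<^bsub>X\<^esub>"
  then obtain N i where N: "N \<in> \<N>" "lin R X N i" "i x \<noteq> \<zero>\<^bsub>N\<^esub>"
    using thru_separate[OF assms(1) _ x(1) _ assms(3)] assms(2) by metis
  then obtain g where "lin R N M g" "g (i x) \<noteq> \<zero>\<^bsub>M\<^esub>"
    using assms(2)[OF N(1)] lin_mem[OF N(2) x(1)] unfolding cogenerated_def by blast
  then show "\<exists>f. lin R X M f \<and> f x \<noteq> \<zero>\<^bsub>M\<^esub>" using lin_comp[OF N(2)] by blast
qed

lemma cogenerated_biprod:
  assumes "left_module R X" "left_module R Y" "left_module R Z" "biprod R X Y Z i\<^sub>1 i\<^sub>2 p\<^sub>1 p\<^sub>2"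
    and "cogenerated R M X" "cogenerated R M Y"
  shows "cogenerated R M Z"
  unfolding cogenerated_def
proof (intro ballI impI)
  fix z assume z: "z \<in> carrier Z" "z \<noteq> \<zero>\<^bsub>Z\<^esub>"
  interpret Z: left_module R Z by fact
  have l: "lin R X Z i\<^sub>1" "lin R Y Z i\<^sub>2" "lin R Z X p\<^sub>1" "lin R Z Y p\<^sub>2" using assms(4) by (auto simp: biprod_def)
  have "i\<^sub>1 (p\<^sub>1 z) \<oplus>\<^bsub>Z\<^esub> i\<^sub>2 (p\<^sub>2 z) = z" using assms(4) z(1) by (simp add: biprod_def)
  then have "p\<^sub>1 z \<noteq> \<zero>\<^bsub>X\<^esub> \<or> p\<^sub>2 z \<noteq> \<zero>\<^bsub>Y\<^esub>" using z(2) lin_zero[OF assms(1,3) l(1)] lin_zero[OF assms(2,3) l(2)] by auto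
  then show "\<exists>f. lin R Z M f \<and> f z \<noteq> \<zero>\<^bsub>M\<^esub>"
    using lin_comp[OF l(3)] lin_comp[OF l(4)] lin_mem[OF l(3) z(1)] lin_mem[OF l(4) z(1)] assms(5,6)
    unfolding cogenerated_def by metis
qed

lemma torsionless_regular: "ring R \<Longrightarrow> torsionless R (regular_module R)"
  unfolding cogenerated_def using lin_id by blast

text \<open>Starting the sum with a copy of \<open>R\<close> makes \<open>M\<close> a generator,
  also when the given set is empty.\<close>

lemma finite_sum_module:
  fixes \<M> :: "'r fgmod set"
  assumes "ring R" "finite \<M>" "\<And>G. G \<in> \<M> \<Longrightarrow> fg_module R G \<and> torsionless R G"
  shows "\<exists>M :: 'r fgmod. fg_module R M \<and> torsionless R M \<and> addc R {M} (regular_module R) \<and> (\<forall>G\<in>\<M>. addc R {M} G)"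
  using assms(2,3)
proof (induction \<M> rule: finite_induct)
  case empty
  note reg = left_module_regular[OF assms(1)]
  obtain F :: "'r fgmod" and a b where F: "fg_module R F" "isoM R (regular_module R) F a b"
    using universe_copy[OF fg_regular[OF assms(1)]] .
  have Fl: "left_module R F" using F(1) by (rule fg_left_module)
  have "addc R {F} (regular_module R)" using addc_iso[OF Fl reg isoM_sym[OF F(2)] addc_self[OF Fl]] by simp
  moreover have "torsionless R F"
    using cogenerated_inj[OF Fl reg _ _ torsionless_regular[OF assms(1)], of b] isoM_bij[OF isoM_sym[OF F(2)]] F(2)
    by (auto simp: isoM_def bij_betw_def)
  ultimately show ?case using F(1) by blast
next
  case (insert G \<M>)
  then obtain M :: "'r fgmod" where M: "fg_module R M" "torsionless R M" "addc R {M} (regular_module R)" "\<forall>G\<in>\<M>. addc R {M} G" by auto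
  have G: "fg_module R G" "torsionless R G" using insert.prems by auto
  obtain Z :: "'r fgmod" and i\<^sub>1 i\<^sub>2 p\<^sub>1 p\<^sub>2 where Z: "fg_module R Z" "biprod R M G Z i\<^sub>1 i\<^sub>2 p\<^sub>1 p\<^sub>2"
    using biprod_exists[OF M(1) G(1)] .
  have l: "left_module R M" "left_module R G" "left_module R Z" using M(1) G(1) Z(1) by (auto intro: fg_left_module)
  have b: "lin R M Z i\<^sub>1" "lin R G Z i\<^sub>2" "lin R Z M p\<^sub>1" "lin R Z G p\<^sub>2" using Z(2) by (auto simp: biprod_def)
  have aM: "addc R {Z} M" by (rule addc_retract[OF l(1,3) b(1,3) _ addc_self[OF l(3)]]) (use Z(2) in \<open>auto simp: biprod_def\<close>)
  have aG: "addc R {Z} G" by (rule addc_retract[OF l(2,3) b(2,4) _ addc_self[OF l(3)]]) (use Z(2) in \<open>auto simp: biprod_def\<close>)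
  have tr: "addc R {Z} X" if "left_module R X" "addc R {M} X" for X :: "'r fgmod"
    by (rule thru_trans[OF that(1,1) _ that(2)]) (use aM l(1) in simp)
  have "addc R {Z} (regular_module R)"
    by (rule thru_trans[OF left_module_regular[OF assms(1)] left_module_regular[OF assms(1)] _ M(3)]) (use aM l(1) in simp)
  moreover have "torsionless R Z" using cogenerated_biprod[OF l Z(2) M(2) G(2)] .
  moreover have "\<forall>H\<in>insert G \<M>. addc R {Z} H" using aG tr M(4) insert.prems fg_left_module by blast
  ultimately show ?case using Z(1) by blast
qed

lemma gorenstein_projective_kernelE:
  fixes G :: "'r fgmod"
  assumes "gorenstein_projective R G"
  obtains P\<^sub>0 P\<^sub>1 :: "'r fgmod" and i d where "left_module R P\<^sub>0" "left_module R P\<^sub>1"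
    "addc R {regular_module R} P\<^sub>0" "addc R {regular_module R} P\<^sub>1" "lin R G P\<^sub>0 i" "inj_on i (carrier G)"
    "lin R P\<^sub>0 P\<^sub>1 d" "i ` carrier G = {x \<in> carrier P\<^sub>0. d x = \<zero>\<^bsub>P\<^sub>1\<^esub>}"
proof -
  have Gl: "left_module R G" using assms by (auto simp: gorenstein_projective_def intro: fg_left_module)
  obtain P d where P: "complete_proj_resolution R P d"
    and iso: "mod_isomorphic R G ((P 0)\<lparr>carrier := mod_ker (P 0) (P 1) (d 0)\<rparr>)"
    using assms unfolding gorenstein_projective_def by blast
  have p: "fg_module R (P k)" "addc R {regular_module R} (P k)" for k
    using P unfolding complete_proj_resolution_def proj_module_iff by auto
  have pl: "left_module R (P k)" for k using p(1) by (rule fg_left_module)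
  have "d 0 \<in> mod_hom R (P 0) (P (0 + 1))" using P unfolding complete_proj_resolution_def by blast
  then have d: "lin R (P 0) (P 1) (d 0)" using mod_hom_lin by simp
  have K: "submodule (mod_ker (P 0) (P 1) (d 0)) R (P 0)"
    unfolding mod_ker_def using submodule_kernel[OF pl pl d submodule_carrier[OF pl]] .
  obtain f g where fg: "isoM R G ((P 0)\<lparr>carrier := mod_ker (P 0) (P 1) (d 0)\<rparr>) f g"
    using iso mod_isomorphic_iff[OF Gl left_module_sub[OF pl K]] by blast
  then have f: "lin R G (P 0) f" "inj_on f (carrier G)" "f ` carrier G = {x \<in> carrier (P 0). d 0 x = \<zero>\<^bsub>P 1\<^esub>}"
    using lin_of_sub_cod[OF _ K] isoM_bij[OF fg] by (auto simp: isoM_def bij_betw_def mod_ker_def)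
  show thesis by (rule that[OF pl pl p(2) p(2) f(1,2) d f(3)])
qed

text \<open>The argument on global dimension works over any ring with these finiteness properties;
  triangular matrices come in through the hypothesis \<open>GP\<close>.\<close>

theorem CM_finite_iff_of_torsionless:
  fixes R :: "('r, 'a) ring_scheme"
  assumes R: "ring R" and flR: "fin_len R (regular_module R) (carrier R)"
    and flE: "\<And>M :: 'r fgmod. fg_module R M \<Longrightarrow> fin_len (End_ring R M) (eval_module M) (carrier M)"
    and GP: "\<And>G :: 'r fgmod. gorenstein_projective R G \<longleftrightarrow> fg_module R G \<and> torsionless R G"
  shows "CM_finite R \<longleftrightarrow> (\<exists>M. mod_generator R M \<and> gorenstein_projective R M \<and> gl_dim (End_ring R M) \<le> 2)"
proof -
  note reg = left_module_regular[OF R]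
  define \<G> where "\<G> = {G :: 'r fgmod. gorenstein_projective R G \<and> indecomposable_module R G}"
  define r where "r = {(G, H). G \<in> \<G> \<and> H \<in> \<G> \<and> mod_isomorphic R G H}"
  have CM: "CM_finite R \<longleftrightarrow> finite (\<G> // r)" unfolding CM_finite_def \<G>_def r_def Let_def ..
  have fl: "fin_len R X (carrier X)" if X: "fg_module R X" for X :: "'r fgmod"
  proof -
    obtain P :: "'r fgmod" and g where P: "fg_module R P" "addc R {regular_module R} P" "lin R P X g" "g ` carrier P = carrier X"
      using projective_cover_exists[OF X] .
    have "fin_len R P (carrier P)" by (rule fin_len_addc[OF fg_left_module[OF P(1)] _ P(2)]) (use reg flR in auto)
    then show ?thesis using fin_len_surj[OF fg_left_module[OF P(1)] fg_left_module[OF X] P(3,4)] by blast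
  qed
  have G: "left_module R G" "fg_module R G" "torsionless R G" "indecomposable_module R G" if "G \<in> \<G>" for G
    using that GP by (auto simp: \<G>_def intro: fg_left_module)
  have refl: "mod_isomorphic R G G" if "left_module R G" for G :: "'r fgmod"
    using mod_isomorphic_iff[OF that that] lin_id[of R G] unfolding isoM_def by auto
  show ?thesis
  proof
    assume "CM_finite R"
    then have fin: "finite (\<G> // r)" using CM by simp
    \<comment> \<open>One representative of each class; their sum with a copy of \<open>R\<close>
      will be the generator.\<close>
    define \<M> where "\<M> = (\<lambda>C. SOME G. G \<in> C) ` (\<G> // r)"
    have rep: "\<exists>N\<in>\<M>. N \<in> \<G> \<and> mod_isomorphic R G N" if "G \<in> \<G>" for G
    proof -
      let ?N = "SOME H. H \<in> r `` {G}"
      have "G \<in> r `` {G}" using that refl[OF G(1)] by (auto simp: r_def)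
      then have "?N \<in> r `` {G}" by (rule someI)
      then have "?N \<in> \<G>" "mod_isomorphic R G ?N" by (auto simp: r_def)
      moreover have "?N \<in> \<M>" unfolding \<M>_def by (rule imageI) (rule quotientI[OF that])
      ultimately show ?thesis by blast
    qed
    have "fg_module R N \<and> torsionless R N" if "N \<in> \<M>" for N
    proof -
      obtain G0 where "G0 \<in> \<G>" "N = (SOME H. H \<in> r `` {G0})" using \<open>N \<in> \<M>\<close> unfolding \<M>_def quotient_def by blast
      moreover have "G0 \<in> r `` {G0}" using \<open>G0 \<in> \<G>\<close> refl[OF G(1)] by (auto simp: r_def)
      ultimately have "N \<in> r `` {G0}" using someI[of "\<lambda>H. H \<in> r `` {G0}" G0] by simp
      then show ?thesis using G(2,3) by (auto simp: r_def)
    qed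
    moreover have "finite \<M>" using fin by (simp add: \<M>_def)
    ultimately obtain M :: "'r fgmod" where M: "fg_module R M" "torsionless R M" "addc R {M} (regular_module R)" "\<forall>G\<in>\<M>. addc R {M} G"
      using finite_sum_module[OF R, of \<M>] by blast
    have Ml: "left_module R M" using M(1) by (rule fg_left_module)
    interpret hf: fg_hom_functor R M by (simp add: fg_hom_functor_def hom_functor_def fg_hom_functor_axioms_def Ml M(1))
    have "gl_dim (End_ring R M) \<le> 2"
    proof (rule hf.gl_dim_End_le_2[OF flE[OF M(1)]])
      fix Q :: "'r fgmod" assume Q: "fg_module R Q" "cogenerated R M Q"
      have Ql: "left_module R Q" using Q(1) by (rule fg_left_module)
      have Qt: "torsionless R Q" using cogenerated_trans[OF Q(2) M(2)] .
      obtain \<N> where \<N>: "finite \<N>" "\<And>N. N \<in> \<N> \<Longrightarrow> indecomposable_module R N \<and> (\<exists>H. submodule H R Q \<and> N = Q\<lparr>carrier := H\<rparr>)" "addc R \<N> Q"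
        using decomposition_exists[OF Ql fl[OF Q(1)]] by metis
      have "left_module R N \<and> addc R {M} N" if "N \<in> \<N>" for N
      proof -
        obtain H where H: "submodule H R Q" "N = Q\<lparr>carrier := H\<rparr>" using \<N>(2)[OF \<open>N \<in> \<N>\<close>] by blast
        have Nl: "left_module R N" using left_module_sub[OF Ql H(1)] H(2) by simp
        have "fg_module R N" "torsionless R N"
          using fg_of_fin_len'[OF Ql H(1) fl[OF Q(1)]] cogenerated_sub[OF H(1) Qt] H(2) by auto
        \<comment> \<open>A summand of \<open>Q\<close> is a submodule of a torsionless module,
          hence torsionless itself and isomorphic to one of the representatives.\<close>
        then have "N \<in> \<G>" using GP \<N>(2)[OF \<open>N \<in> \<N>\<close>] by (auto simp: \<G>_def)
        then obtain N' where N': "N' \<in> \<M>" "N' \<in> \<G>" "mod_isomorphic R N N'" using rep by blast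
        then obtain f g where fg: "isoM R N N' f g" using mod_isomorphic_iff[OF Nl G(1)] by blast
        have "addc R {M} N" using addc_iso[OF G(1)[OF N'(2)] Nl isoM_sym[OF fg]] M(4) N'(1) by blast
        then show ?thesis using Nl by blast
      qed
      then show "addc R {M} Q" by (rule thru_trans[OF Ql Ql _ \<N>(3)])
    qed
    then show "\<exists>M. mod_generator R M \<and> gorenstein_projective R M \<and> gl_dim (End_ring R M) \<le> 2"
      using mod_generator_iff GP M by blast
  next
    assume "\<exists>M. mod_generator R M \<and> gorenstein_projective R M \<and> gl_dim (End_ring R M) \<le> 2"
    then obtain M where M: "mod_generator R M" "gl_dim (End_ring R M) \<le> 2" by blast
    then have Mf: "fg_module R M" and gen: "addc R {M} (regular_module R)" using mod_generator_iff by auto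
    have Ml: "left_module R M" using Mf by (rule fg_left_module)
    interpret hf: fg_hom_functor R M by (simp add: fg_hom_functor_def hom_functor_def fg_hom_functor_axioms_def Ml Mf)
    obtain \<N> where \<N>: "finite \<N>" "\<And>N. N \<in> \<N> \<Longrightarrow> indecomposable_module R N \<and> (\<exists>H. submodule H R M \<and> N = M\<lparr>carrier := H\<rparr>)" "addc R \<N> M"
      using decomposition_exists[OF Ml fl[OF Mf]] by metis
    have Nl: "left_module R N" if "N \<in> \<N>" for N using \<N>(2)[OF that] by (auto simp: indecomposable_module_def)
    have iso: "\<exists>N\<in>\<N>. mod_isomorphic R G N" if GG: "G \<in> \<G>" for G
    proof -
      have "gorenstein_projective R G" using GG by (simp add: \<G>_def)
      then obtain P\<^sub>0 P\<^sub>1 :: "'r fgmod" and i d where P: "left_module R P\<^sub>0" "left_module R P\<^sub>1"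
        and a: "addc R {regular_module R} P\<^sub>0" "addc R {regular_module R} P\<^sub>1"
        and f: "lin R G P\<^sub>0 i" "inj_on i (carrier G)" "lin R P\<^sub>0 P\<^sub>1 d" "i ` carrier G = {x \<in> carrier P\<^sub>0. d x = \<zero>\<^bsub>P\<^sub>1\<^esub>}"
        by (rule gorenstein_projective_kernelE)
      have aM: "addc R {M} P\<^sub>0" "addc R {M} P\<^sub>1"
        by (rule thru_trans[OF P(1,1) _ a(1)], use reg gen in auto)
          (rule thru_trans[OF P(2,2) _ a(2)], use reg gen in auto)
      have "addc R {M} G" using hf.kernel_addc_of_gl_dim[OF flE[OF Mf] gen flR M(2) G(2)[OF GG] P aM f] .
      then have "addc R \<N> G" by (rule thru_trans[OF G(1)[OF GG] G(1)[OF GG], rotated]) (use \<N>(3) Ml in simp)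
      then obtain N f g where "N \<in> \<N>" "isoM R G N f g"
        using indecomposable_addc_iso[OF G(4)[OF GG] fl[OF G(2)[OF GG]]] \<N>(2) by metis
      then show ?thesis using mod_isomorphic_iff[OF G(1)[OF GG] Nl] by blast
    qed
    \<comment> \<open>A class is recovered from the indecomposable summand of \<open>M\<close> to
      which its members are isomorphic, so there are at most as many classes as elements of
      \<open>\<N>\<close>.\<close>
    have "\<G> // r \<subseteq> (\<lambda>N. {H \<in> \<G>. mod_isomorphic R N H}) ` \<N>"
    proof
      fix C assume "C \<in> \<G> // r"
      then obtain G0 where G0: "G0 \<in> \<G>" "C = r `` {G0}" by (rule quotientE)
      obtain N where N: "N \<in> \<N>" "mod_isomorphic R G0 N" using iso[OF G0(1)] by blast
      obtain f g where fg: "isoM R G0 N f g" using N(2) mod_isomorphic_iff[OF G(1)[OF G0(1)] Nl[OF N(1)]] by blast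
      have "mod_isomorphic R G0 H \<longleftrightarrow> mod_isomorphic R N H" if H: "H \<in> \<G>" for H
        unfolding mod_isomorphic_iff[OF G(1)[OF G0(1)] G(1)[OF H]] mod_isomorphic_iff[OF Nl[OF N(1)] G(1)[OF H]]
        using isoM_trans[OF fg] isoM_trans[OF isoM_sym[OF fg]] by blast
      then have "C = {H \<in> \<G>. mod_isomorphic R N H}" using G0 by (auto simp: r_def)
      then show "C \<in> (\<lambda>N. {H \<in> \<G>. mod_isomorphic R N H}) ` \<N>" using N(1) by blast
    qed
    then have "finite (\<G> // r)" using \<N>(1) finite_surj by blast
    then show "CM_finite R" using CM by simp
  qed
qed

section \<open>Restriction of scalars\<close>

definition restrict_scalars :: "('k \<Rightarrow> 'r) \<Rightarrow> ('r, 'm, 'b) module_scheme \<Rightarrow> ('k, 'm) module" where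
  "restrict_scalars \<phi> M = \<lparr>carrier = carrier M, mult = undefined, one = undefined, zero = zero M, add = add M,
     smult = (\<lambda>k x. \<phi> k \<odot>\<^bsub>M\<^esub> x)\<rparr>"

lemma restrict_scalars_simps [simp]:
  "carrier (restrict_scalars \<phi> M) = carrier M" "zero (restrict_scalars \<phi> M) = zero M"
  "add (restrict_scalars \<phi> M) = add M" "smult (restrict_scalars \<phi> M) = (\<lambda>k x. \<phi> k \<odot>\<^bsub>M\<^esub> x)"
  by (simp_all add: restrict_scalars_def)

text \<open>Three uses: the base ring acting on \<open>A\<close> and on \<open>T\<close>, and
  \<open>A\<close> acting on \<open>T\<close> through scalar matrices. For the last one
  \<open>K\<close> is an arbitrary ring.\<close>

locale scalars =
  fixes K :: "('k, 'a) ring_scheme" and R :: "('r, 'b) ring_scheme" and \<phi>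
  assumes K: "ring K" and R: "ring R" and hom: "\<phi> \<in> ring_hom K R"
begin

abbreviation "rs \<equiv> restrict_scalars \<phi>"

lemma left_module_rs:
  assumes "left_module R M" shows "left_module K (rs M)"
proof -
  interpret K: ring K by (rule K)
  interpret M: left_module R M by fact
  have "abelian_group (rs M)"
    by (rule abelian_groupI) (auto simp: M.M.a_ac intro: exI[of _ "\<ominus>\<^bsub>M\<^esub> _"] M.M.l_neg)
  then interpret G: abelian_group "rs M" .
  show ?thesis
    using ring_hom_closed[OF hom] ring_hom_add[OF hom] ring_hom_mult[OF hom] ring_hom_one[OF hom]
    by unfold_locales (auto simp: M.smult_l_distr M.smult_r_distr M.smult_assoc1)
qed

lemma lin_rs: "lin R X Y f \<Longrightarrow> lin K (rs X) (rs Y) f"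
  using ring_hom_closed[OF hom] by (auto simp: lin_def)

lemma submodule_rs:
  assumes "left_module R M" "submodule N R M" shows "submodule N K (rs M)"
proof -
  interpret left_module K "rs M" using left_module_rs[OF assms(1)] .
  show ?thesis using submoduleD[OF assms(2)] ring_hom_closed[OF hom] by (intro submoduleI) auto
qed

lemma fin_len_of_rs:
  assumes "left_module R M" "fin_len K (rs M) D" shows "fin_len R M D"
proof -
  obtain \<rho> :: "_ \<Rightarrow> nat" where \<rho>: "\<And>C C'. submodule C K (rs M) \<Longrightarrow> submodule C' K (rs M) \<Longrightarrow> C \<subset> C' \<Longrightarrow> C' \<subseteq> D \<Longrightarrow> \<rho> C < \<rho> C'"
    using that by (rule fin_lenE[OF assms(2)])
  show ?thesis by (rule fin_lenI[of _ _ _ \<rho>], rule \<rho>) (use submodule_rs[OF assms(1)] in auto)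
qed

lemma thru_rs: "thru R \<N> X Y f \<Longrightarrow> thru K (rs ` \<N>) (rs X) (rs Y) f"
proof (induction rule: thru.induct)
  case (zero f)
  show ?case by (rule thru.zero) (use zero in simp)
next
  case (step f N i p g)
  show ?case by (rule thru.step[OF step.IH imageI[OF step.hyps(2)] lin_rs[OF step.hyps(3)] lin_rs[OF step.hyps(4)]]) (use step in simp)
qed

lemma fin_len_rs:
  fixes M :: "('r, 'm, 'c) module_scheme"
  assumes "fg_module R M" "fin_len K (rs (regular_module R)) (carrier R)"
  shows "fin_len K (rs M) (carrier M)"
proof -
  obtain P :: "'r fgmod" and g where P: "fg_module R P" "addc R {regular_module R} P" "lin R P M g" "g ` carrier P = carrier M"
    using projective_cover_exists[OF assms(1)] .
  have l: "left_module K (rs P)" "left_module K (rs M)" using left_module_rs[OF fg_left_module] P(1) assms(1) by auto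
  have "addc K {rs (regular_module R)} (rs P)" using thru_rs[OF P(2)] by simp
  then have "fin_len K (rs P) (carrier (rs P))"
    by (rule fin_len_addc[OF l(1), rotated]) (use assms(2) left_module_rs[OF left_module_regular[OF R]] in auto)
  then show ?thesis using fin_len_surj[OF l lin_rs[OF P(3)]] P(4) by simp
qed

text \<open>Multiplication by a central scalar is an endomorphism of \<open>M\<close>, so every
  \<open>End(M)\<close>-submodule of \<open>M\<close> is a \<open>K\<close>-submodule.\<close>

lemma fin_len_eval:
  assumes "left_module R M" "fin_len K (rs M) (carrier M)"
    and central: "\<And>k r. k \<in> carrier K \<Longrightarrow> r \<in> carrier R \<Longrightarrow> \<phi> k \<otimes>\<^bsub>R\<^esub> r = r \<otimes>\<^bsub>R\<^esub> \<phi> k"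
  shows "fin_len (End_ring R M) (eval_module M) (carrier M)"
proof -
  interpret M: left_module R M by fact
  interpret rM: left_module K "rs M" using left_module_rs[OF assms(1)] .
  obtain \<rho> :: "_ \<Rightarrow> nat" where \<rho>: "\<And>C C'. submodule C K (rs M) \<Longrightarrow> submodule C' K (rs M) \<Longrightarrow> C \<subset> C' \<Longrightarrow> C' \<subseteq> carrier M \<Longrightarrow> \<rho> C < \<rho> C'"
    using that by (rule fin_lenE[OF assms(2)])
  have "submodule C K (rs M)" if C: "submodule C (End_ring R M) (eval_module M)" for C
  proof -
    note Cs = submoduleD[OF C]
    have sub: "x \<in> carrier M" if "x \<in> C" for x using Cs(2)[OF that] by (simp add: eval_module_def)
    show ?thesis
    proof (intro rM.submoduleI)
      fix k x assume k: "k \<in> carrier K" and x: "x \<in> C"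
      have \<phi>k: "\<phi> k \<in> carrier R" using ring_hom_closed[OF hom k] .
      have "lin R M M (\<lambda>x. \<phi> k \<odot>\<^bsub>M\<^esub> x)"
        unfolding lin_def using \<phi>k central[OF k] by (auto simp: M.smult_r_distr M.smult_assoc1[symmetric])
      then have e: "restrict (\<lambda>x. \<phi> k \<odot>\<^bsub>M\<^esub> x) (carrier M) \<in> mod_hom R M M" using lin_restrict[OF assms(1)] by blast
      show "k \<odot>\<^bsub>rs M\<^esub> x \<in> C"
        using Cs(6)[of "restrict (\<lambda>x. \<phi> k \<odot>\<^bsub>M\<^esub> x) (carrier M)", OF _ x] sub[OF x] e by (simp add: eval_module_def End_ring_def)
    qed (use Cs(3,4) sub in \<open>auto simp: eval_module_def\<close>)
  qed
  then show ?thesis by (intro fin_lenI[of _ _ _ \<rho>], intro \<rho>) auto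
qed

end

section \<open>Artinian commutative rings have finite length\<close>

text \<open>Commutativity identifies the submodules of the regular module with ideals, and the chain
  condition for sequences makes strict inclusion well-founded on the family.\<close>

lemma artinian_minimal_submodule:
  fixes K :: "('k, 'a) ring_scheme"
  assumes "artinian_cring K" "S B\<^sub>0" "\<And>B. S B \<Longrightarrow> submodule B K (regular_module K)"
  obtains B where "S B" "\<And>C. S C \<Longrightarrow> C \<subseteq> B \<Longrightarrow> C = B"
proof -
  have K: "cring K" and dcc: "\<And>I :: nat \<Rightarrow> 'k set. (\<And>i. ideal (I i) K \<and> I (Suc i) \<subseteq> I i) \<Longrightarrow> \<exists>m. \<forall>i\<ge>m. I i = I m"
    using assms(1) unfolding artinian_cring_def by blast+
  interpret cring K by (rule K)
  have ideal: "ideal I K" if "submodule I K (regular_module K)" for I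
  proof (rule idealI)
    note I = submoduleD[OF that, simplified]
    show "subgroup I (add_monoid K)" by (rule subgroup.intro) (use I(1,3,4,5) in \<open>auto simp: a_inv_def[symmetric]\<close>)
    show "x \<otimes>\<^bsub>K\<^esub> a \<in> I" if "a \<in> I" "x \<in> carrier K" for a x using I(6)[OF that(2,1)] .
    then show "a \<otimes>\<^bsub>K\<^esub> x \<in> I" if "a \<in> I" "x \<in> carrier K" for a x using that I(2)[OF that(1)] m_comm[of a x] by simp
  qed (rule ring_axioms)
  let ?r = "{(C, B). S C \<and> S B \<and> C \<subset> B}"
  have "wf ?r"
  proof (rule ccontr)
    assume "\<not> wf ?r"
    then obtain f where f: "\<And>i. (f (Suc i), f i) \<in> ?r" unfolding wf_iff_no_infinite_down_chain by blast
    have "\<exists>m. \<forall>i\<ge>m. f i = f m" using f ideal assms(3) by (intro dcc) blast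
    then obtain m where "\<forall>i\<ge>m. f i = f m" by blast
    then have "f (Suc m) = f m" using le_SucI[OF order_refl] by blast
    then show False using f[of m] by auto
  qed
  then obtain B where "B \<in> Collect S" "\<And>C. (C, B) \<in> ?r \<Longrightarrow> C \<notin> Collect S" using wfE_min[of ?r B\<^sub>0 "Collect S"] assms(2) by blast
  then show ?thesis using that[of B] by blast
qed

text \<open>Let \<open>B\<close> be minimal among the ideals without finite length. Multiplication
  by any \<open>a\<close> maps \<open>B\<close> onto \<open>B\<close> or is zero on it; otherwise
  its image and its kernel are both smaller than \<open>B\<close>, and \<open>fin_len_ext\<close>
  gives \<open>B\<close> finite length. So \<open>B\<close> behaves like a vector space, and a
  hyperplane \<open>C\<close> in it has finite length and a simple quotient, a
  contradiction.\<close>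

lemma artinian_cring_fin_len:
  fixes K :: "('k, 'a) ring_scheme"
  assumes "artinian_cring K" shows "fin_len K (regular_module K) (carrier K)"
proof (rule ccontr)
  assume no: "\<not> ?thesis"
  let ?M = "regular_module K"
  have "cring K" using assms by (simp add: artinian_cring_def)
  then interpret cring K .
  have M: "left_module K ?M" using left_module_regular[OF ring_axioms] .
  interpret M: left_module K ?M by (rule M)
  obtain B where B: "submodule B K ?M" "\<not> fin_len K ?M B"
    and min: "\<And>C. submodule C K ?M \<Longrightarrow> C \<subset> B \<Longrightarrow> fin_len K ?M C"
  proof (rule artinian_minimal_submodule[OF assms, of "\<lambda>B. submodule B K ?M \<and> \<not> fin_len K ?M B" "carrier K"])
    show "submodule (carrier K) K ?M \<and> \<not> fin_len K ?M (carrier K)" using submodule_carrier[OF M] no by simp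
  qed auto
  note Bs = submoduleD[OF B(1), simplified]
  have lin_mult: "lin K ?M ?M (\<lambda>x. a \<otimes>\<^bsub>K\<^esub> x)" if "a \<in> carrier K" for a
    using that by (auto simp: lin_def r_distr m_lcomm)
  have dichotomy: "(\<lambda>x. a \<otimes>\<^bsub>K\<^esub> x) ` B = B \<or> (\<forall>x\<in>B. a \<otimes>\<^bsub>K\<^esub> x = \<zero>\<^bsub>K\<^esub>)" if a: "a \<in> carrier K" for a
  proof (rule ccontr)
    assume *: "\<not> ?thesis"
    have I: "submodule ((\<lambda>x. a \<otimes>\<^bsub>K\<^esub> x) ` B) K ?M" using submodule_image[OF M M lin_mult[OF a] B(1)] .
    have N: "submodule {x \<in> B. a \<otimes>\<^bsub>K\<^esub> x = \<zero>\<^bsub>?M\<^esub>} K ?M" using submodule_kernel[OF M M lin_mult[OF a] B(1)] .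
    have "fin_len K ?M ((\<lambda>x. a \<otimes>\<^bsub>K\<^esub> x) ` B)" using * Bs(6)[OF a] by (intro min[OF I]) auto
    moreover have "fin_len K ?M {x \<in> B. a \<otimes>\<^bsub>K\<^esub> x = \<zero>\<^bsub>?M\<^esub>}" using * by (intro min[OF N]) auto
    ultimately show False using fin_len_ext[OF M M lin_mult[OF a] B(1)] B(2) by blast
  qed
  \<comment> \<open>So the annihilator of \<open>B\<close> is prime, hence maximal, and \<open>B\<close> is a vector space.\<close>
  have inverse: "\<exists>c\<in>carrier K. \<forall>x\<in>B. c \<otimes>\<^bsub>K\<^esub> (a \<otimes>\<^bsub>K\<^esub> x) = x"
    if a: "a \<in> carrier K" and x0: "x0 \<in> B" "a \<otimes>\<^bsub>K\<^esub> x0 \<noteq> \<zero>\<^bsub>K\<^esub>" for a x0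
  proof -
    have aB: "(\<lambda>x. a \<otimes>\<^bsub>K\<^esub> x) ` B = B" using dichotomy[OF a] x0 by blast
    have apB: "(\<lambda>x. a [^]\<^bsub>K\<^esub> m \<otimes>\<^bsub>K\<^esub> x) ` B = B" for m :: nat
    proof (induction m)
      case 0 then show ?case using Bs(2) by force
    next
      case (Suc m)
      have "(\<lambda>x. a [^]\<^bsub>K\<^esub> Suc m \<otimes>\<^bsub>K\<^esub> x) ` B = (\<lambda>x. a [^]\<^bsub>K\<^esub> m \<otimes>\<^bsub>K\<^esub> x) ` (\<lambda>x. a \<otimes>\<^bsub>K\<^esub> x) ` B"
        unfolding image_image using a Bs(2) by (intro image_cong) (auto simp: m_assoc)
      then show ?case using Suc aB by simp
    qed
    \<comment> \<open>The chain of ideals generated by the powers of \<open>a\<close> becomes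
      stable, so \<open>a^m = c a^(m+1)\<close> for some \<open>m\<close> and \<open>c\<close>. As
      every element of \<open>B\<close> has the form \<open>a^m y\<close>, this \<open>c\<close>
      inverts \<open>a\<close> on \<open>B\<close>.\<close>
    define I where "I m = (\<lambda>c. c \<otimes>\<^bsub>K\<^esub> a [^]\<^bsub>K\<^esub> (m::nat)) ` carrier K" for m
    have sub: "submodule (I m) K ?M" for m
      unfolding I_def using submodule_image[OF M M lin_from_regular[OF M, of "a [^]\<^bsub>K\<^esub> m"] submodule_carrier[OF M]] a by simp
    obtain J where J: "J \<in> range I" "\<And>C. C \<in> range I \<Longrightarrow> C \<subseteq> J \<Longrightarrow> C = J"
      by (rule artinian_minimal_submodule[OF assms, of "\<lambda>J. J \<in> range I" "I 0"]) (use sub in auto)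
    obtain m where "J = I m" using J(1) by (elim rangeE) (rule that)
    then have m: "I (Suc m) \<subseteq> I m \<Longrightarrow> I (Suc m) = I m" using J(2)[of "I (Suc m)"] by simp
    have "I (Suc m) \<subseteq> I m"
    proof
      fix x assume "x \<in> I (Suc m)"
      then obtain c where c: "c \<in> carrier K" "x = c \<otimes>\<^bsub>K\<^esub> a [^]\<^bsub>K\<^esub> Suc m" unfolding I_def by (elim imageE) (rule that)
      then have "x = (c \<otimes>\<^bsub>K\<^esub> a) \<otimes>\<^bsub>K\<^esub> a [^]\<^bsub>K\<^esub> m" using a by (simp add: m_ac)
      then show "x \<in> I m" unfolding I_def using c a by blast
    qed
    then have "I (Suc m) = I m" by (rule m)
    moreover have "a [^]\<^bsub>K\<^esub> m \<in> I m" unfolding I_def using a by (intro image_eqI[of _ _ "\<one>\<^bsub>K\<^esub>"]) auto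
    ultimately obtain c where c: "c \<in> carrier K" "a [^]\<^bsub>K\<^esub> m = c \<otimes>\<^bsub>K\<^esub> a [^]\<^bsub>K\<^esub> Suc m" unfolding I_def by blast
    have gen: "c \<otimes>\<^bsub>K\<^esub> (a \<otimes>\<^bsub>K\<^esub> (q \<otimes>\<^bsub>K\<^esub> y)) = (c \<otimes>\<^bsub>K\<^esub> (q \<otimes>\<^bsub>K\<^esub> a)) \<otimes>\<^bsub>K\<^esub> y" if "q \<in> carrier K" "y \<in> carrier K" for q y
      using that c(1) a by (simp add: m_ac)
    have "c \<otimes>\<^bsub>K\<^esub> (a \<otimes>\<^bsub>K\<^esub> x) = x" if x: "x \<in> B" for x
    proof -
      obtain y where y: "y \<in> B" "x = a [^]\<^bsub>K\<^esub> m \<otimes>\<^bsub>K\<^esub> y" using apB[of m] x by blast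
      have "c \<otimes>\<^bsub>K\<^esub> (a \<otimes>\<^bsub>K\<^esub> (a [^]\<^bsub>K\<^esub> m \<otimes>\<^bsub>K\<^esub> y)) = (c \<otimes>\<^bsub>K\<^esub> a [^]\<^bsub>K\<^esub> Suc m) \<otimes>\<^bsub>K\<^esub> y"
        using gen[OF nat_pow_closed[OF a] Bs(2)[OF y(1)]] by simp
      then show ?thesis unfolding c(2)[symmetric] y(2)[symmetric] .
    qed
    then show ?thesis using c(1) by blast
  qed
  have "B \<noteq> {\<zero>\<^bsub>K\<^esub>}" using B(2) fin_len_zero[of B ?M K] by auto
  then obtain b where b: "b \<in> B" "b \<noteq> \<zero>\<^bsub>K\<^esub>" using Bs(3) by blast
  have bc: "b \<in> carrier K" using b Bs(2) by blast
  \<comment> \<open>A submodule maximal among those missing \<open>b\<close> is a hyperplane,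
    \<open>B = C + K b\<close>. Zorn's lemma is used because no ascending chain condition is known
    for \<open>B\<close>.\<close>
  let ?\<A> = "{C. submodule C K ?M \<and> C \<subseteq> B \<and> b \<notin> C}"
  have "\<exists>C\<in>?\<A>. \<forall>X\<in>?\<A>. C \<subseteq> X \<longrightarrow> X = C"
  proof (rule subset_Zorn_nonempty)
    show "?\<A> \<noteq> {}" using submodule_zero[OF M] b Bs(3) by auto
    fix \<C> assume ne: "\<C> \<noteq> {}" and ch: "subset.chain ?\<A> \<C>"
    have el: "submodule C K ?M" "C \<subseteq> B" "b \<notin> C" if "C \<in> \<C>" for C using ch that unfolding subset.chain_def by auto
    have "submodule (\<Union>\<C>) K ?M"
    proof (intro M.submoduleI)
      show "\<Union>\<C> \<subseteq> carrier ?M" using submoduleD(1)[OF el(1)] by blast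
      show "\<zero>\<^bsub>?M\<^esub> \<in> \<Union>\<C>" using ne submoduleD(3)[OF el(1)] by blast
      fix x y assume "x \<in> \<Union>\<C>" "y \<in> \<Union>\<C>"
      then obtain C D where CD: "C \<in> \<C>" "D \<in> \<C>" "x \<in> C" "y \<in> D" by blast
      then have "C \<subseteq> D \<or> D \<subseteq> C" using ch unfolding subset.chain_def by blast
      then show "x \<oplus>\<^bsub>?M\<^esub> y \<in> \<Union>\<C>" using CD submoduleD(4)[OF el(1)] by blast
    next
      fix a x assume "a \<in> carrier K" "x \<in> \<Union>\<C>"
      then show "a \<odot>\<^bsub>?M\<^esub> x \<in> \<Union>\<C>" using submoduleD(6)[OF el(1)] by blast
    qed
    then show "\<Union>\<C> \<in> ?\<A>" using el by blast
  qed
  then obtain C where C0: "C \<in> ?\<A>" and Cm: "\<forall>X\<in>?\<A>. C \<subseteq> X \<longrightarrow> X = C" by (elim bexE) (rule that)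
  from C0 have C: "submodule C K ?M" "C \<subseteq> B" "b \<notin> C" by auto
  have Cmax: "X = C" if "X \<in> ?\<A>" "C \<subseteq> X" for X by (rule Cm[rule_format, OF that])
  note Cs = submoduleD[OF C(1), simplified]
  have span: "\<exists>k\<in>carrier K. v \<ominus>\<^bsub>K\<^esub> k \<otimes>\<^bsub>K\<^esub> b \<in> C" if v: "v \<in> B" for v
  proof (cases "v \<in> C")
    case True
    have "v \<ominus>\<^bsub>K\<^esub> \<zero>\<^bsub>K\<^esub> \<otimes>\<^bsub>K\<^esub> b = v" using True Cs(2) bc by (simp add: minus_eq)
    then show ?thesis using True by (intro bexI[of _ "\<zero>\<^bsub>K\<^esub>"]) auto
  next
    case False
    have vc: "v \<in> carrier K" using v Bs(2) by blast
    let ?V = "(\<lambda>k. k \<otimes>\<^bsub>K\<^esub> v) ` carrier K"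
    have V: "submodule ?V K ?M" using submodule_image[OF M M lin_from_regular[OF M] submodule_carrier[OF M], of v] vc by simp
    have S: "submodule (set_add ?M C ?V) K ?M" using submodule_set_add[OF M C(1) V] .
    have "C \<subseteq> set_add ?M C ?V"
    proof
      fix x assume x: "x \<in> C"
      have "x = x \<oplus>\<^bsub>?M\<^esub> \<zero>\<^bsub>?M\<^esub>" using x Cs(2) by simp
      then show "x \<in> set_add ?M C ?V" unfolding set_add_iff using x submoduleD(3)[OF V] by blast
    qed
    moreover have "v \<in> set_add ?M C ?V"
    proof -
      have "v = \<zero>\<^bsub>?M\<^esub> \<oplus>\<^bsub>?M\<^esub> \<one>\<^bsub>K\<^esub> \<otimes>\<^bsub>K\<^esub> v" using vc by simp
      then show ?thesis unfolding set_add_iff using Cs(3) one_closed by (metis imageI regular_simps(2))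
    qed
    moreover have "set_add ?M C ?V \<subseteq> B" using subsetD[OF C(2)] Bs(4,6) v by (auto simp: set_add_iff)
    \<comment> \<open>By maximality \<open>C + K v\<close> contains \<open>b\<close>; solving
      \<open>b = c + k v\<close> for \<open>v\<close> uses the inverse of \<open>k\<close> on
      \<open>B\<close>.\<close>
    ultimately have "b \<in> set_add ?M C ?V" using Cmax[of "set_add ?M C ?V"] S False by blast
    then obtain c k where ck: "c \<in> C" "k \<in> carrier K" "b = c \<oplus>\<^bsub>K\<^esub> k \<otimes>\<^bsub>K\<^esub> v" unfolding set_add_iff by auto
    have "k \<otimes>\<^bsub>K\<^esub> v \<noteq> \<zero>\<^bsub>K\<^esub>" using ck C(3) Cs(2) by auto
    then obtain k' where k': "k' \<in> carrier K" "k' \<otimes>\<^bsub>K\<^esub> (k \<otimes>\<^bsub>K\<^esub> v) = v" using inverse[OF ck(2) v] v by blast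
    have cc: "c \<in> carrier K" using ck Cs(2) by blast
    have "k' \<otimes>\<^bsub>K\<^esub> b = k' \<otimes>\<^bsub>K\<^esub> c \<oplus>\<^bsub>K\<^esub> v" using ck k' cc vc by (simp add: r_distr)
    then have "v \<ominus>\<^bsub>K\<^esub> k' \<otimes>\<^bsub>K\<^esub> b = \<ominus>\<^bsub>K\<^esub> (k' \<otimes>\<^bsub>K\<^esub> c)" using k' cc vc by (simp add: minus_eq minus_add a_ac r_neg1 r_neg2)
    also have "\<dots> \<in> C" using Cs(5,6) k' ck(1) by blast
    finally show ?thesis using k'(1) by blast
  qed
  obtain Q :: "('k, 'k) module" and p where Q: "left_module K Q" "lin K ?M Q p" "\<And>x. x \<in> carrier ?M \<Longrightarrow> p x = \<zero>\<^bsub>Q\<^esub> \<longleftrightarrow> x \<in> C"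
    using quotient_exists[OF M C(1)] by metis
  interpret Q: left_module K Q by (rule Q(1))
  have pB: "\<exists>k\<in>carrier K. p v = k \<odot>\<^bsub>Q\<^esub> p b" if v: "v \<in> B" for v
  proof -
    obtain k where k: "k \<in> carrier K" "v \<ominus>\<^bsub>K\<^esub> k \<otimes>\<^bsub>K\<^esub> b \<in> C" using span[OF v] by blast
    have vc: "v \<in> carrier K" using v Bs(2) by blast
    have "p (v \<ominus>\<^bsub>K\<^esub> k \<otimes>\<^bsub>K\<^esub> b) = \<zero>\<^bsub>Q\<^esub>" using Q(3) k Cs(2) by simp
    then have "p v \<ominus>\<^bsub>Q\<^esub> p (k \<otimes>\<^bsub>K\<^esub> b) = \<zero>\<^bsub>Q\<^esub>" using lin_minus[OF M Q(1,2), of v "k \<otimes>\<^bsub>K\<^esub> b"] vc k bc by simp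
    then have "p v = p (k \<otimes>\<^bsub>K\<^esub> b)" using lin_mem[OF Q(2)] vc k bc by (simp add: Q.diff_eq_zero_iff)
    then show ?thesis using lin_smult[OF Q(2) k(1), of b] k(1) bc by auto
  qed
  \<comment> \<open>Any nonzero element of \<open>p B\<close> is a multiple \<open>k p(b)\<close>,
    and \<open>k\<close> can be inverted on \<open>B\<close>, so the element generates
    \<open>p B\<close>.\<close>
  have simple: "p ` B \<subseteq> D" if D: "submodule D K Q" "D \<subseteq> p ` B" "D \<noteq> {\<zero>\<^bsub>Q\<^esub>}" for D
  proof -
    note Ds = submoduleD[OF D(1)]
    obtain y where y: "y \<in> D" "y \<noteq> \<zero>\<^bsub>Q\<^esub>" using D(3) Ds(3) by blast
    then obtain v where v: "v \<in> B" "y = p v" using D(2) by blast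
    obtain k where k: "k \<in> carrier K" "p v = k \<odot>\<^bsub>Q\<^esub> p b" using pB[OF v(1)] by blast
    then have kb: "p v = p (k \<otimes>\<^bsub>K\<^esub> b)" using lin_smult[OF Q(2) k(1), of b] bc by simp
    then have "k \<otimes>\<^bsub>K\<^esub> b \<noteq> \<zero>\<^bsub>K\<^esub>" using y v lin_zero[OF M Q(1,2)] by auto
    then obtain k' where k': "k' \<in> carrier K" "k' \<otimes>\<^bsub>K\<^esub> (k \<otimes>\<^bsub>K\<^esub> b) = b" using inverse[OF k(1) b(1)] b(1) by blast
    have "k' \<odot>\<^bsub>Q\<^esub> y = p (k' \<otimes>\<^bsub>K\<^esub> (k \<otimes>\<^bsub>K\<^esub> b))" using lin_smult[OF Q(2) k'(1), of "k \<otimes>\<^bsub>K\<^esub> b"] kb v k bc by simp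
    then have "p b \<in> D" using Ds(6)[OF k'(1) y(1)] k'(2) by simp
    then show ?thesis using pB Ds(6) by force
  qed
  have "fin_len K Q (p ` B)"
  proof (rule fin_lenI[of _ _ _ "\<lambda>D. if D = {\<zero>\<^bsub>Q\<^esub>} then 0 else 1"])
    fix D D' assume D: "submodule D K Q" "submodule D' K Q" "D \<subset> D'" "D' \<subseteq> p ` B"
    have "D = {\<zero>\<^bsub>Q\<^esub>}" using simple[OF D(1)] D(3,4) by blast
    then show "(if D = {\<zero>\<^bsub>Q\<^esub>} then 0 else 1) < (if D' = {\<zero>\<^bsub>Q\<^esub>} then 0 else (1::nat))" using D(3) by auto
  qed
  moreover have "{x \<in> B. p x = \<zero>\<^bsub>Q\<^esub>} = C" using Q(3) Bs(2) C(2) by auto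
  moreover have "fin_len K ?M C" using C b(1) by (intro min) auto
  ultimately show False using fin_len_ext[OF M Q(1,2) B(1)] B(2) by simp
qed

section \<open>Self-injective rings cogenerate their modules\<close>

text \<open>\<open>\<theta>\<close> descends to the image of \<open>N\<close> in the quotient of
  \<open>W\<close> by \<open>N\<^sub>0\<close>, and injectivity extends it from there to the whole
  quotient. Since injectivity is formulated for modules of the fixed carrier type, the extension is
  made between the copies \<open>X\<close> and \<open>Y\<close>.\<close>

lemma self_injective_extend:
  fixes A :: "('r, 'a) ring_scheme" and W :: "('r, 'm) module"
  assumes si: "self_injective A" and W: "left_module A W" "fin_len A W (carrier W)"
    and N: "submodule N A W" "submodule N\<^sub>0 A W" and l: "lin A (W\<lparr>carrier := N\<rparr>) (regular_module A) \<theta>"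
    and van: "\<And>x. x \<in> N \<Longrightarrow> x \<in> N\<^sub>0 \<Longrightarrow> \<theta> x = \<zero>\<^bsub>A\<^esub>"
  obtains \<mu> where "lin A W (regular_module A) \<mu>" "\<And>x. x \<in> N \<Longrightarrow> \<mu> x = \<theta> x" "\<And>x. x \<in> N\<^sub>0 \<Longrightarrow> \<mu> x = \<zero>\<^bsub>A\<^esub>"
proof -
  let ?F = "regular_module A"
  interpret W: left_module A W by fact
  have F: "left_module A ?F" using left_module_regular[OF W.ring_axioms] .
  obtain Q :: "('r, 'm) module" and p where Q: "left_module A Q" "lin A W Q p" "p ` carrier W = carrier Q"
    "\<And>x. x \<in> carrier W \<Longrightarrow> p x = \<zero>\<^bsub>Q\<^esub> \<longleftrightarrow> x \<in> N\<^sub>0"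
    using quotient_exists[OF W(1) N(2)] by metis
  let ?N = "W\<lparr>carrier := N\<rparr>" and ?I = "Q\<lparr>carrier := p ` N\<rparr>"
  have Nl: "left_module A ?N" using left_module_sub[OF W(1) N(1)] .
  have I: "submodule (p ` N) A Q" using submodule_image[OF W(1) Q(1,2) N(1)] .
  have Il: "left_module A ?I" using left_module_sub[OF Q(1) I] .
  have pI: "lin A ?N ?I p" using lin_sub_cod[OF lin_sub_dom[OF N(1) Q(2)]] by simp
  have pIs: "p ` carrier ?N = carrier ?I" by simp
  have kerl: "\<theta> x = \<zero>\<^bsub>?F\<^esub>" if "x \<in> carrier ?N" "p x = \<zero>\<^bsub>?I\<^esub>" for x
    using that van[of x] Q(4)[of x] submoduleD(2)[OF N(1), of x] by simp
  obtain g where g: "lin A ?I ?F g" "\<And>x. x \<in> carrier ?N \<Longrightarrow> g (p x) = \<theta> x"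
    using lin_factor_surj[OF Nl Il F pI pIs l kerl] by metis
  have fgW: "fg_module A W" using fg_of_fin_len'[OF W(1) submodule_carrier[OF W(1)] W(2)] by simp
  have fgQ: "fg_module A Q" using fg_surj[OF fgW Q(1,2,3)] .
  have fgI: "fg_module A ?I" using fg_surj[OF fg_of_fin_len'[OF W(1) N(1) W(2)] Il pI pIs] .
  obtain X :: "'r fgmod" and f\<^sub>1 g\<^sub>1 where X: "fg_module A X" "isoM A ?I X f\<^sub>1 g\<^sub>1" using universe_copy[OF fgI] .
  obtain Y :: "'r fgmod" and f\<^sub>2 g\<^sub>2 where Y: "fg_module A Y" "isoM A Q Y f\<^sub>2 g\<^sub>2" using universe_copy[OF fgQ] .
  have Xl: "left_module A X" and Yl: "left_module A Y" using X(1) Y(1) by (auto intro: fg_left_module)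
  have m: "lin A ?I X f\<^sub>1" "lin A X ?I g\<^sub>1" "lin A Q Y f\<^sub>2" "\<And>u. u \<in> p ` N \<Longrightarrow> g\<^sub>1 (f\<^sub>1 u) = u"
    using X(2) Y(2) by (auto simp: isoM_def)
  let ?i = "restrict (\<lambda>x. f\<^sub>2 (g\<^sub>1 x)) (carrier X)" and ?f = "restrict (\<lambda>x. g (g\<^sub>1 x)) (carrier X)"
  have il: "lin A X Y (\<lambda>x. f\<^sub>2 (g\<^sub>1 x))" using lin_comp[OF lin_of_sub_cod[OF m(2) I] m(3)] .
  have i: "?i \<in> mod_hom A X Y" using lin_restrict[OF Xl il] .
  have inj: "inj_on ?i (carrier X)"
  proof (rule inj_onI)
    fix x y assume xy: "x \<in> carrier X" "y \<in> carrier X" "?i x = ?i y"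
    have gc: "g\<^sub>1 x \<in> carrier Q" "g\<^sub>1 y \<in> carrier Q" using lin_mem[OF lin_of_sub_cod[OF m(2) I]] xy by auto
    have "g\<^sub>1 x = g\<^sub>1 y" using xy gc isoM_bij[OF Y(2)] by (auto simp: bij_betw_def dest: inj_onD)
    then show "x = y" using xy isoM_bij[OF isoM_sym[OF X(2)]] by (auto simp: bij_betw_def dest: inj_onD)
  qed
  have f: "?f \<in> mod_hom A X ?F" using lin_restrict[OF Xl lin_comp[OF m(2) g(1)]] .
  have "\<exists>h\<in>mod_hom A Y ?F. \<forall>x\<in>carrier X. h (?i x) = ?f x"
    by (rule si[unfolded self_injective_def inj_module_def, THEN conjunct2, rule_format, of X Y]) (use X(1) Y(1) i inj f in blast)
  then obtain h where h: "h \<in> mod_hom A Y ?F" "\<And>x. x \<in> carrier X \<Longrightarrow> h (?i x) = ?f x" by blast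
  have hl: "lin A Q ?F (\<lambda>u. h (f\<^sub>2 u))" using lin_comp[OF m(3) mod_hom_lin[OF h(1)]] .
  show ?thesis
  proof (rule that[of "\<lambda>x. h (f\<^sub>2 (p x))"])
    show "lin A W ?F (\<lambda>x. h (f\<^sub>2 (p x)))" using lin_comp[OF Q(2) hl] .
    show "h (f\<^sub>2 (p x)) = \<theta> x" if x: "x \<in> N" for x
    proof -
      have px: "p x \<in> p ` N" using x by blast
      have fx: "f\<^sub>1 (p x) \<in> carrier X" using lin_mem[OF m(1)] px by simp
      show ?thesis using h(2)[OF fx] fx m(4)[OF px] g(2)[of x] x by simp
    qed
    show "h (f\<^sub>2 (p x)) = \<zero>\<^bsub>A\<^esub>" if x: "x \<in> N\<^sub>0" for x
    proof -
      have "p x = \<zero>\<^bsub>Q\<^esub>" using Q(4)[of x] x submoduleD(2)[OF N(2)] by blast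
      then show ?thesis using lin_zero[OF Q(1) F hl] by simp
    qed
  qed
qed

locale selfinj_ring = ring A for A (structure) +
  assumes fl: "fin_len A (regular_module A) (carrier A)" and si: "self_injective A"
begin

abbreviation "reg \<equiv> regular_module A"
abbreviation "lideal I \<equiv> submodule I A reg"

lemma regl: "left_module A reg" using left_module_regular[OF ring_axioms] .

lemmas lidealD = submoduleD[of _ A reg, simplified]

text \<open>Simple modules are handled through maximal left ideals: \<open>A/L\<close> and \<open>A/L'\<close> are isomorphic iff
  \<open>L' = (L : y)\<close> for some \<open>y\<close>, the annihilator of \<open>A/L\<close> is \<open>core L\<close>, and \<open>A/L\<close> embeds into \<open>A\<close> iff
  \<open>L\<close> is the left annihilator of an element.\<close>

definition mx :: "'a set \<Rightarrow> bool" where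
  "mx L \<longleftrightarrow> lideal L \<and> \<one> \<notin> L \<and> (\<forall>b\<in>carrier A - L. \<exists>c\<in>carrier A. \<one> \<ominus> c \<otimes> b \<in> L)"

definition col :: "'a set \<Rightarrow> 'a \<Rightarrow> 'a set" where
  "col L y = {a \<in> carrier A. a \<otimes> y \<in> L}"

definition sim :: "'a set \<Rightarrow> 'a set \<Rightarrow> bool" where
  "sim L L' \<longleftrightarrow> (\<exists>y\<in>carrier A. L' = col L y)"

definition core :: "'a set \<Rightarrow> 'a set" where
  "core L = {a \<in> carrier A. \<forall>b\<in>carrier A. a \<otimes> b \<in> L}"

definition lann :: "'a \<Rightarrow> 'a set" where
  "lann s = {a \<in> carrier A. a \<otimes> s = \<zero>}"

section \<open>Similarity of maximal left ideals\<close>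

lemma lin_rmult: "y \<in> carrier A \<Longrightarrow> lin A reg reg (\<lambda>a. a \<otimes> y)"
  using lin_from_regular[OF regl, of y] by simp

lemma lideal_col: "lideal L \<Longrightarrow> y \<in> carrier A \<Longrightarrow> lideal (col L y)"
  using submodule_preimage[OF regl regl lin_rmult _ submodule_carrier[OF regl]] by (simp add: col_def)

lemma lideal_lann: "s \<in> carrier A \<Longrightarrow> lideal (lann s)"
  using submodule_kernel[OF regl regl lin_rmult submodule_carrier[OF regl]] by (simp add: lann_def)

lemma lideal_principal: "s \<in> carrier A \<Longrightarrow> lideal ((\<lambda>a. a \<otimes> s) ` carrier A)"
  using submodule_image[OF regl regl lin_rmult submodule_carrier[OF regl]] by simp

lemma mx_lideal: "mx L \<Longrightarrow> lideal L"
  by (simp add: mx_def)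

lemma one_diff_cancel:
  assumes "lideal L" "x \<in> carrier A" "\<one> \<ominus> x \<in> L" "x \<in> L" shows "\<one> \<in> L"
proof -
  have "\<one> \<ominus> x \<oplus> x \<in> L" using lidealD(4)[OF assms(1,3,4)] .
  then show ?thesis using assms(2) by (simp add: minus_eq a_assoc l_neg)
qed

lemma mx_eq:
  assumes "mx L" "L \<subseteq> L'" "lideal L'" "\<one> \<notin> L'" shows "L = L'"
proof (rule ccontr)
  assume "L \<noteq> L'"
  then obtain b where b: "b \<in> L'" "b \<notin> L" using assms(2) by blast
  have bc: "b \<in> carrier A" using lidealD(2)[OF assms(3) b(1)] .
  obtain c where c: "c \<in> carrier A" "\<one> \<ominus> c \<otimes> b \<in> L" using assms(1) b bc unfolding mx_def by blast
  then show False using one_diff_cancel[OF assms(3), of "c \<otimes> b"] assms(2,4) bc lidealD(6)[OF assms(3) c(1) b(1)] by auto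
qed

text \<open>\<open>y\<close> generates \<open>A/L\<close>, so right multiplication by
  \<open>y\<close> identifies \<open>A/(L : y)\<close> with \<open>A/L\<close>.\<close>

lemma mx_col:
  assumes "mx L" "y \<in> carrier A" "y \<notin> L" shows "mx (col L y)"
  unfolding mx_def
proof (intro conjI ballI)
  note L = mx_lideal[OF assms(1)]
  show "lideal (col L y)" using lideal_col[OF L assms(2)] .
  show "\<one> \<notin> col L y" using assms(2,3) by (simp add: col_def)
  fix b assume "b \<in> carrier A - col L y"
  then have b: "b \<in> carrier A" "b \<otimes> y \<notin> L" by (auto simp: col_def)
  then obtain c where c: "c \<in> carrier A" "\<one> \<ominus> c \<otimes> (b \<otimes> y) \<in> L" using assms(1,2) unfolding mx_def by blast
  have "y \<otimes> (\<one> \<ominus> c \<otimes> (b \<otimes> y)) \<in> L" using lidealD(6)[OF L assms(2) c(2)] .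
  also have "y \<otimes> (\<one> \<ominus> c \<otimes> (b \<otimes> y)) = (\<one> \<ominus> (y \<otimes> c) \<otimes> b) \<otimes> y"
    using assms(2) b c by (simp add: minus_eq l_distr r_distr l_minus r_minus m_assoc)
  finally show "\<exists>c\<in>carrier A. \<one> \<ominus> c \<otimes> b \<in> col L y" using assms(2) b c by (intro bexI[of _ "y \<otimes> c"]) (auto simp: col_def)
qed

lemma col_col:
  assumes "lideal L" "y \<in> carrier A" "z \<in> carrier A" shows "col (col L y) z = col L (z \<otimes> y)"
  using assms by (auto simp: col_def m_assoc)

lemma sim_trans:
  assumes "lideal L" "sim L L'" "sim L' L''" shows "sim L L''"
  using assms col_col[OF assms(1)] unfolding sim_def by (metis m_closed)

text \<open>If \<open>c y\<close> is 1 modulo \<open>L\<close>, then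
  \<open>((L : y) : c) = (L : c y) = L\<close>.\<close>

lemma sim_sym:
  assumes "mx L" "mx L'" "sim L L'" shows "sim L' L"
proof -
  note L = mx_lideal[OF assms(1)]
  obtain y where y: "y \<in> carrier A" "L' = col L y" using assms(3) unfolding sim_def by blast
  have "\<one> \<notin> L'" using assms(2) by (simp add: mx_def)
  then have "y \<notin> L" using y by (simp add: col_def)
  then obtain c where c: "c \<in> carrier A" "\<one> \<ominus> c \<otimes> y \<in> L" using assms(1) y(1) unfolding mx_def by blast
  have cy: "col L' c = col L (c \<otimes> y)" unfolding y(2) using col_col[OF L y(1) c(1)] .
  have "a \<otimes> (c \<otimes> y) \<in> L \<longleftrightarrow> a \<in> L" if a: "a \<in> carrier A" for a
  proof -
    have "a \<otimes> (\<one> \<ominus> c \<otimes> y) \<in> L" using lidealD(6)[OF L a c(2)] .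
    moreover have "a \<otimes> (\<one> \<ominus> c \<otimes> y) = a \<ominus> a \<otimes> (c \<otimes> y)" using a c y by (simp add: minus_eq r_distr r_minus)
    ultimately have d: "a \<ominus> a \<otimes> (c \<otimes> y) \<in> L" by simp
    have "a = (a \<ominus> a \<otimes> (c \<otimes> y)) \<oplus> a \<otimes> (c \<otimes> y)" "a \<otimes> (c \<otimes> y) = a \<ominus> (a \<ominus> a \<otimes> (c \<otimes> y))"
      using a c y by (simp_all add: minus_eq minus_add a_ac l_neg r_neg r_neg2 r_neg1)
    then show ?thesis using lidealD(4)[OF L d] lidealD(7)[OF L _ d] by metis
  qed
  then have "L = col L' c" unfolding cy using lidealD(2)[OF L] by (auto simp: col_def)
  then show ?thesis unfolding sim_def using c(1) by blast
qed

text \<open>\<open>A\<close> modulo the intersection embeds into the direct sum of the simple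
  modules \<open>A/L\<close>, so its simple quotient \<open>A/L'\<close> is isomorphic to one of
  them.\<close>

lemma finite_Int_mx:
  assumes "finite \<F>" "\<And>L. L \<in> \<F> \<Longrightarrow> mx L" "carrier A \<inter> \<Inter>\<F> \<subseteq> L'" "mx L'"
  shows "\<exists>L\<in>\<F>. sim L L'"
  using assms(1-3)
proof (induction \<F> rule: finite_induct)
  case empty
  then show ?case using assms(4) by (auto simp: mx_def)
next
  case (insert L \<F>)
  note L = mx_lideal[OF insert.prems(1)[of L]] and L' = mx_lideal[OF assms(4)]
  show ?case
  proof (cases "carrier A \<inter> \<Inter>\<F> \<subseteq> L'")
    case True
    then show ?thesis using insert by auto
  next
    case False
    let ?D = "carrier A \<inter> \<Inter>\<F>"
    have D: "lideal ?D" using submodule_Inter[OF regl, of \<F>] mx_lideal insert.prems(1) by simp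
    obtain b where b: "b \<in> ?D" "b \<notin> L'" using False by blast
    then obtain c where c: "c \<in> carrier A" "\<one> \<ominus> c \<otimes> b \<in> L'" using assms(4) unfolding mx_def by blast
    \<comment> \<open>\<open>?d\<close> lies in all ideals of \<open>\<F>\<close> and is 1 modulo
      \<open>L'\<close>. If \<open>a ?d\<close> is in \<open>L\<close>, it is in the whole
      intersection, thus in \<open>L'\<close>, and then so is \<open>a\<close>. Hence
      \<open>(L : ?d)\<close> is contained in \<open>L'\<close>, and maximality gives
      equality.\<close>
    let ?d = "c \<otimes> b"
    have d: "?d \<in> ?D" using lidealD(6)[OF D c(1) b(1)] .
    then have dc: "?d \<in> carrier A" by blast
    have sub: "col L ?d \<subseteq> L'"
    proof
      fix a assume "a \<in> col L ?d"
      then have a: "a \<in> carrier A" "a \<otimes> ?d \<in> L" by (auto simp: col_def)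
      have "a \<otimes> ?d \<in> ?D" using lidealD(6)[OF D a(1) d] .
      then have "a \<otimes> ?d \<in> L'" using a(2) insert.prems(2) by auto
      moreover have "a \<otimes> (\<one> \<ominus> ?d) \<in> L'" using lidealD(6)[OF L' a(1) c(2)] .
      ultimately have "a \<otimes> (\<one> \<ominus> ?d) \<oplus> a \<otimes> ?d \<in> L'" using lidealD(4)[OF L'] by blast
      moreover have "a \<otimes> (\<one> \<ominus> ?d) \<oplus> a \<otimes> ?d = a" using a dc by (simp add: minus_eq r_distr r_minus a_assoc l_neg del: m_assoc)
      ultimately show "a \<in> L'" by simp
    qed
    have nL': "\<one> \<notin> L'" using assms(4) by (simp add: mx_def)
    have "?d \<notin> L"
    proof
      assume "?d \<in> L"
      then have "\<one> \<in> col L ?d" using dc by (simp add: col_def)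
      then show False using sub nL' by blast
    qed
    then have "col L ?d = L'" using mx_eq[OF mx_col[OF insert.prems(1)[of L] dc] sub L' nL'] by simp
    then show ?thesis unfolding sim_def using dc by blast
  qed
qed

lemma mx_exists:
  assumes "lideal I" "\<one> \<notin> I" obtains L where "mx L" "I \<subseteq> L"
proof -
  obtain L where L: "lideal L \<and> I \<subseteq> L \<and> \<one> \<notin> L" "\<And>J. lideal J \<and> I \<subseteq> J \<and> \<one> \<notin> J \<Longrightarrow> L \<subseteq> J \<Longrightarrow> J = L"
    by (rule fin_len_max[OF fl submodule_carrier[OF regl, simplified], of "\<lambda>L. lideal L \<and> I \<subseteq> L \<and> \<one> \<notin> L" I "\<lambda>L. L"])
      (use assms lidealD(1) in auto)
  have "\<exists>c\<in>carrier A. \<one> \<ominus> c \<otimes> b \<in> L" if b: "b \<in> carrier A - L" for b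
  proof -
    let ?J = "set_add reg L ((\<lambda>a. a \<otimes> b) ` carrier A)"
    have J: "lideal ?J" using submodule_set_add[OF regl _ lideal_principal] L(1) b by blast
    have "x \<in> ?J" if x: "x \<in> L" for x
    proof -
      have "x \<in> carrier A" using lidealD(2) L(1) x by blast
      then have "x = x \<oplus> \<zero> \<otimes> b" using b by simp
      then show ?thesis unfolding set_add_iff using x by auto
    qed
    then have LJ: "L \<subseteq> ?J" by blast
    have "b = \<zero> \<oplus> \<one> \<otimes> b" using b by simp
    then have "b \<in> ?J" unfolding set_add_iff using L(1) lidealD(3)[of L] by (metis imageI one_closed regular_simps(3))
    then have "?J \<noteq> L" using b by blast
    then have "\<one> \<in> ?J" using L(2)[of ?J] J LJ L(1) by blast
    then obtain x c where xc: "x \<in> L" "c \<in> carrier A" "\<one> = x \<oplus> c \<otimes> b" unfolding set_add_iff by auto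
    have "x \<in> carrier A" "b \<in> carrier A" using lidealD(2) L(1) xc(1) b by blast+
    then have "\<one> \<ominus> c \<otimes> b = x" unfolding xc(3) using xc(2) by (simp add: minus_eq a_assoc r_neg)
    then have "\<one> \<ominus> c \<otimes> b \<in> L" using xc(1) by (simp only:)
    then show ?thesis using xc(2) by blast
  qed
  then show ?thesis using that[of L] L(1) by (simp add: mx_def)
qed

lemma lideal_core:
  assumes "lideal L" shows "lideal (core L)" "core L \<subseteq> L"
proof -
  interpret M: left_module A reg by (rule regl)
  note Ls = lidealD[OF assms]
  show "lideal (core L)" using Ls(3,4,6) by (intro M.submoduleI) (auto simp: core_def l_distr m_assoc)
  show "core L \<subseteq> L" by (auto simp: core_def dest!: bspec[of _ _ \<one>])
qed

lemma core_rmult: "u \<in> core L \<Longrightarrow> a \<in> carrier A \<Longrightarrow> u \<otimes> a \<in> core L"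
  by (auto simp: core_def m_assoc)

text \<open>The annihilator of \<open>A/L\<close> is the intersection of the ideals
  \<open>(L : b)\<close> with \<open>b\<close> outside \<open>L\<close>. By finite length finitely
  many of them suffice, and \<open>finite_Int_mx\<close> applies.\<close>

lemma core_subset_imp_sim:
  assumes "mx L" "mx L'" "core L \<subseteq> L'" shows "sim L L'"
proof -
  note L = mx_lideal[OF assms(1)]
  define F where "F B = carrier A \<inter> \<Inter>(col L ` B)" for B
  have F: "lideal (F B)" if "B \<subseteq> carrier A - L" for B
    unfolding F_def using submodule_Inter[OF regl, of "col L ` B"] lideal_col[OF L] that by auto
  obtain B where B: "finite B \<and> B \<subseteq> carrier A - L" "\<And>C. finite C \<and> C \<subseteq> carrier A - L \<Longrightarrow> F C \<subseteq> F B \<Longrightarrow> F C = F B"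
    by (rule fin_len_min[OF fl, of "\<lambda>B. finite B \<and> B \<subseteq> carrier A - L" "{}" F]) (use F in \<open>auto simp: F_def\<close>)
  have "F B \<subseteq> core L"
  proof
    fix a assume a: "a \<in> F B"
    then have ac: "a \<in> carrier A" by (simp add: F_def)
    have "a \<otimes> b \<in> L" if b: "b \<in> carrier A" for b
    proof (cases "b \<in> L")
      case True then show ?thesis using lidealD(6)[OF L ac] by blast
    next
      case False
      have "F (insert b B) = F B" using B(1) b False by (intro B(2)) (auto simp: F_def)
      then have "a \<in> F (insert b B)" using a by simp
      then show ?thesis by (simp add: F_def col_def)
    qed
    then show "a \<in> core L" using ac by (simp add: core_def)
  qed
  then have "carrier A \<inter> \<Inter>(col L ` B) \<subseteq> L'" using assms(3) unfolding F_def by blast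
  then obtain M where "M \<in> col L ` B" "sim M L'"
    using finite_Int_mx[of "col L ` B" L'] B(1) mx_col[OF assms(1)] assms(2) by blast
  moreover then have "sim L M" unfolding sim_def using B(1) by blast
  ultimately show ?thesis using sim_trans[OF L] by blast
qed

text \<open>A finite intersection of maximal left ideals that is minimal among such intersections is
  contained in every maximal left ideal, so \<open>finite_Int_mx\<close> applies to all of
  them.\<close>

lemma finite_representatives:
  obtains \<F> where "finite \<F>" "\<And>L. L \<in> \<F> \<Longrightarrow> mx L" "\<And>L'. mx L' \<Longrightarrow> \<exists>L\<in>\<F>. sim L L'"
proof -
  define F where "F \<F> = carrier A \<inter> \<Inter>\<F>" for \<F> :: "'a set set"
  obtain \<F> where \<F>: "finite \<F> \<and> (\<forall>L\<in>\<F>. mx L)" "\<And>\<H>. finite \<H> \<and> (\<forall>L\<in>\<H>. mx L) \<Longrightarrow> F \<H> \<subseteq> F \<F> \<Longrightarrow> F \<H> = F \<F>"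
  proof (rule fin_len_min[OF fl, of "\<lambda>\<F>. finite \<F> \<and> (\<forall>L\<in>\<F>. mx L)" "{}" F])
    fix \<H> assume "finite \<H> \<and> (\<forall>L\<in>\<H>. mx L)"
    then show "lideal (F \<H>)" unfolding F_def using submodule_Inter[OF regl, of \<H>] mx_lideal by auto
  qed (auto simp: F_def)
  have "\<exists>L\<in>\<F>. sim L L'" if L': "mx L'" for L'
  proof (rule finite_Int_mx)
    have "F (insert L' \<F>) = F \<F>" using \<F>(1) L' by (intro \<F>(2)) (auto simp: F_def)
    then show "carrier A \<inter> \<Inter>\<F> \<subseteq> L'" unfolding F_def by blast
  qed (use \<F>(1) L' in auto)
  then show ?thesis using that \<F>(1) by blast
qed

text \<open>The map \<open>a x -> a y\<close> on \<open>A x\<close> is well defined and extends to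
  \<open>A\<close> by injectivity; a linear map from \<open>A\<close> to \<open>A\<close> is right
  multiplication by the image of 1.\<close>

lemma principal_extend:
  assumes "x \<in> carrier A" "y \<in> carrier A" "lann x \<subseteq> lann y" obtains c where "c \<in> carrier A" "y = x \<otimes> c"
proof -
  let ?N = "(\<lambda>a. a \<otimes> x) ` carrier A"
  have N: "lideal ?N" using lideal_principal[OF assms(1)] .
  have sub: "lin A reg (reg\<lparr>carrier := ?N\<rparr>) (\<lambda>a. a \<otimes> x)" using lin_sub_cod[OF lin_rmult[OF assms(1)]] by simp
  have ker: "a \<otimes> y = \<zero>\<^bsub>reg\<^esub>" if "a \<in> carrier reg" "a \<otimes> x = \<zero>\<^bsub>reg\<lparr>carrier := ?N\<rparr>\<^esub>" for a
    using that assms(3) by (auto simp: lann_def)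
  have sur: "(\<lambda>a. a \<otimes> x) ` carrier reg = carrier (reg\<lparr>carrier := ?N\<rparr>)" by simp
  obtain g where g: "lin A (reg\<lparr>carrier := ?N\<rparr>) reg g" "\<And>a. a \<in> carrier reg \<Longrightarrow> g (a \<otimes> x) = a \<otimes> y"
    using lin_factor_surj[OF regl left_module_sub[OF regl N] regl sub sur lin_rmult[OF assms(2)] ker] by metis
  have g0: "g z = \<zero>" if "z \<in> ?N" "z \<in> {\<zero>}" for z
    using lin_zero[OF left_module_sub[OF regl N] regl g(1)] that by simp
  obtain \<mu> where \<mu>: "lin A reg reg \<mu>" "\<And>z. z \<in> ?N \<Longrightarrow> \<mu> z = g z"
    using self_injective_extend[OF si regl _ N submodule_zero[OF regl] g(1)] fl g0 by (metis regular_simps(1) regular_simps(2))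
  have "x \<in> ?N" using assms(1) by (intro image_eqI[of _ _ \<one>]) auto
  then have "\<mu> x = y" using \<mu>(2) g(2)[of \<one>] assms by simp
  then have "y = x \<otimes> \<mu> \<one>" using lin_regular_eq[OF regl \<mu>(1) assms(1)] by simp
  then show ?thesis using that lin_mem[OF \<mu>(1), of \<one>] by simp
qed

text \<open>Right multiplication by \<open>z\<close> on \<open>J\<close> extends to a map on
  \<open>A\<close> that vanishes on \<open>I\<close>, and that map is multiplication by
  \<open>c\<close>. In effect an element killed by the intersection of \<open>I\<close> and
  \<open>J\<close> is a sum of \<open>c\<close>, killed by \<open>I\<close>, and
  \<open>z - c\<close>, killed by \<open>J\<close>.\<close>

lemma annihilator_Int_split:
  assumes "lideal I" "lideal J" "z \<in> carrier A" "\<And>a. a \<in> I \<Longrightarrow> a \<in> J \<Longrightarrow> a \<otimes> z = \<zero>"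
  obtains c where "c \<in> carrier A" "\<And>a. a \<in> I \<Longrightarrow> a \<otimes> c = \<zero>" "\<And>b. b \<in> J \<Longrightarrow> b \<otimes> c = b \<otimes> z"
proof -
  have l: "lin A (reg\<lparr>carrier := J\<rparr>) reg (\<lambda>b. b \<otimes> z)" using lin_sub_dom[OF assms(2) lin_rmult[OF assms(3)]] .
  obtain \<mu> where \<mu>: "lin A reg reg \<mu>" "\<And>b. b \<in> J \<Longrightarrow> \<mu> b = b \<otimes> z" "\<And>a. a \<in> I \<Longrightarrow> \<mu> a = \<zero>"
    by (rule self_injective_extend[OF si regl _ assms(2,1) l]) (use fl assms(4) in auto)
  have eq: "\<mu> a = a \<otimes> \<mu> \<one>" if "a \<in> carrier A" for a using lin_regular_eq[OF regl \<mu>(1), of a] that by simp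
  show ?thesis
  proof (rule that[of "\<mu> \<one>"])
    show "\<mu> \<one> \<in> carrier A" using lin_mem[OF \<mu>(1), of \<one>] by simp
    show "a \<otimes> \<mu> \<one> = \<zero>" if "a \<in> I" for a using eq[OF lidealD(2)[OF assms(1) that]] \<mu>(3)[OF that] by simp
    show "b \<otimes> \<mu> \<one> = b \<otimes> z" if "b \<in> J" for b using eq[OF lidealD(2)[OF assms(2) that]] \<mu>(2)[OF that] by simp
  qed
qed

text \<open>Suppose that zero alone kills \<open>core L\<close> from the left. By finite length some
  finite subset \<open>F\<close> of \<open>core L\<close> then has zero left annihilator. What is
  killed by the left annihilator of \<open>F\<close> lies in the right ideal generated by
  \<open>F\<close>, so 1 would lie in \<open>core L\<close>.\<close>

lemma core_left_annihilator:
  assumes "mx L" shows "\<exists>s\<in>carrier A. s \<noteq> \<zero> \<and> (\<forall>u\<in>core L. s \<otimes> u = \<zero>)"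
proof (rule ccontr)
  assume no: "\<not> ?thesis"
  note L = mx_lideal[OF assms]
  note C = lidealD[OF lideal_core(1)[OF L]]
  define l where "l F = carrier A \<inter> \<Inter>(lann ` F)" for F
  have l: "lideal (l F)" if "F \<subseteq> core L" for F
    unfolding l_def using submodule_Inter[OF regl, of "lann ` F"] lideal_lann that C(2) by auto
  obtain F where F: "finite F \<and> F \<subseteq> core L" "\<And>G. finite G \<and> G \<subseteq> core L \<Longrightarrow> l G \<subseteq> l F \<Longrightarrow> l G = l F"
    by (rule fin_len_min[OF fl, of "\<lambda>F. finite F \<and> F \<subseteq> core L" "{}" l]) (use l in \<open>auto simp: l_def\<close>)
  have lF: "a = \<zero>" if a: "a \<in> l F" for a
  proof -
    have "a \<otimes> u = \<zero>" if u: "u \<in> core L" for u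
    proof -
      have "l (insert u F) = l F" using F(1) u by (intro F(2)) (auto simp: l_def)
      then have "a \<in> l (insert u F)" using a by simp
      then show ?thesis by (simp add: l_def lann_def)
    qed
    then show ?thesis using no a by (auto simp: l_def)
  qed
  \<comment> \<open>Induction on the finite set: \<open>z\<close> is split as
    \<open>c + (z - c)\<close>, with \<open>c\<close> killed by the left annihilator of the smaller
    set and \<open>z - c\<close> a right multiple of the new element \<open>x\<close>.\<close>
  have "z \<in> core L" if "finite F" "F \<subseteq> core L" "z \<in> carrier A" "\<And>a. a \<in> l F \<Longrightarrow> a \<otimes> z = \<zero>" for F z
    using that
  proof (induction F arbitrary: z rule: finite_induct)
    case empty
    have "\<one> \<otimes> z = \<zero>" by (rule empty.prems(3)) (simp add: l_def)
    then show ?case using C(3) empty.prems(2) by simp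
  next
    case (insert x F)
    have x: "x \<in> core L" "x \<in> carrier A" using insert.prems(1) C(2) by auto
    obtain c where c: "c \<in> carrier A" "\<And>a. a \<in> l F \<Longrightarrow> a \<otimes> c = \<zero>" "\<And>b. b \<in> lann x \<Longrightarrow> b \<otimes> c = b \<otimes> z"
    proof (rule annihilator_Int_split[OF l lideal_lann[OF x(2)] insert.prems(2), of F])
      show "a \<otimes> z = \<zero>" if "a \<in> l F" "a \<in> lann x" for a using that by (intro insert.prems(3)) (auto simp: l_def)
    qed (use insert.prems(1) in auto)
    have c1: "c \<in> core L" using insert.IH[OF _ c(1,2)] insert.prems(1) by auto
    have zc: "z \<ominus> c \<in> carrier A" using c(1) insert.prems(2) by simp
    have "lann x \<subseteq> lann (z \<ominus> c)"
      using c(1,3) insert.prems(2) by (auto simp: lann_def minus_eq r_distr r_minus r_neg)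
    then obtain d where d: "d \<in> carrier A" "z \<ominus> c = x \<otimes> d" using principal_extend[OF x(2) zc] by blast
    have "z \<ominus> c \<oplus> c \<in> core L" unfolding d(2) using core_rmult[OF x(1) d(1)] c1 C(4) by blast
    then show ?case using c(1) insert.prems(2) by (simp add: minus_eq a_assoc l_neg)
  qed
  moreover have "a \<otimes> \<one> = \<zero>" if "a \<in> l F" for a using lF[OF that] by simp
  ultimately have "\<one> \<in> core L" using F(1) one_closed by blast
  then show False using lideal_core(2)[OF L] assms unfolding mx_def by blast
qed

text \<open>Take \<open>s\<close> with \<open>A s\<close> minimal. If \<open>b s\<close> is nonzero,
  it has the same properties, so \<open>A b s = A s\<close> and \<open>s = c b s\<close>; thus
  \<open>b\<close> has a left inverse modulo \<open>lann s\<close>.\<close>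

lemma core_simple_annihilator:
  assumes "mx L" shows "\<exists>s\<in>carrier A. s \<noteq> \<zero> \<and> (\<forall>u\<in>core L. s \<otimes> u = \<zero>) \<and> mx (lann s)"
proof -
  let ?P = "\<lambda>s. s \<in> carrier A \<and> s \<noteq> \<zero> \<and> (\<forall>u\<in>core L. s \<otimes> u = \<zero>)"
  let ?F = "\<lambda>s. (\<lambda>a. a \<otimes> s) ` carrier A"
  obtain s\<^sub>0 where s0: "?P s\<^sub>0" using core_left_annihilator[OF assms] by blast
  have cl: "u \<in> carrier A" if "u \<in> core L" for u using that by (simp add: core_def)
  obtain s where s: "?P s" and min: "\<And>t. ?P t \<Longrightarrow> ?F t \<subseteq> ?F s \<Longrightarrow> ?F t = ?F s"
    by (rule fin_len_min[OF fl, of ?P s\<^sub>0 ?F]) (use s0 lideal_principal lidealD(1) in auto)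
  have "\<exists>c\<in>carrier A. \<one> \<ominus> c \<otimes> b \<in> lann s" if b: "b \<in> carrier A - lann s" for b
  proof -
    have bs: "?P (b \<otimes> s)" using b s cl by (auto simp: lann_def m_assoc)
    have "?F (b \<otimes> s) \<subseteq> ?F s"
    proof
      fix x assume "x \<in> ?F (b \<otimes> s)"
      then obtain a where "a \<in> carrier A" "x = (a \<otimes> b) \<otimes> s" using b s by (auto simp: m_assoc)
      then show "x \<in> ?F s" using b by blast
    qed
    then have "?F (b \<otimes> s) = ?F s" by (rule min[OF bs])
    moreover have "s \<in> ?F s" using s by (intro image_eqI[of _ _ \<one>]) auto
    ultimately obtain c where c: "c \<in> carrier A" "s = c \<otimes> (b \<otimes> s)" by blast
    have "(\<one> \<ominus> c \<otimes> b) \<otimes> s = s \<ominus> c \<otimes> (b \<otimes> s)" using b c(1) s by (simp add: minus_eq l_distr l_minus m_assoc)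
    then have "(\<one> \<ominus> c \<otimes> b) \<otimes> s = \<zero>" using c(2)[symmetric] s by (simp add: minus_eq r_neg)
    then show ?thesis using b c(1) by (intro bexI[of _ c]) (auto simp: lann_def)
  qed
  then have "mx (lann s)" using s lideal_lann by (auto simp: mx_def lann_def)
  then show ?thesis using s by blast
qed

text \<open>Otherwise \<open>core L + core L'\<close> lies in no maximal left ideal, and
  \<open>1 = u + u'\<close>. The isomorphism of \<open>A s\<close> with \<open>A s'\<close> gives
  \<open>s' = x s a\<close>. Then \<open>s' u = 0\<close> because \<open>a u\<close> is in
  \<open>core L\<close>, and \<open>s' u' = 0\<close> by assumption, so
  \<open>s' = 0\<close>.\<close>

lemma sim_of_annihilators:
  assumes L: "mx L" "mx L'" and s: "s \<in> carrier A" "\<forall>u\<in>core L. s \<otimes> u = \<zero>"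
    and s': "s' \<in> carrier A" "s' \<noteq> \<zero>" "\<forall>u\<in>core L'. s' \<otimes> u = \<zero>" and sim: "sim (lann s) (lann s')"
  shows "sim L L'"
proof (rule ccontr)
  assume no: "\<not> sim L L'"
  have c: "lideal (core L)" "lideal (core L')" using lideal_core(1) mx_lideal L by auto
  let ?I = "set_add reg (core L) (core L')"
  have I: "lideal ?I" using submodule_set_add[OF regl c] .
  have cI: "core L \<subseteq> ?I" "core L' \<subseteq> ?I"
  proof -
    have "x = x \<oplus> \<zero>" "x = \<zero> \<oplus> x" if "x \<in> core L \<union> core L'" for x using that by (auto simp: core_def)
    then show "core L \<subseteq> ?I" "core L' \<subseteq> ?I" unfolding set_add_iff[abs_def] subset_iff set_add_iff
      using lidealD(3)[OF c(1)] lidealD(3)[OF c(2)] by (metis UnI1 UnI2 regular_simps(3))+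
  qed
  have "\<one> \<in> ?I"
  proof (rule ccontr)
    assume "\<one> \<notin> ?I"
    then obtain L'' where L'': "mx L''" "?I \<subseteq> L''" using mx_exists[OF I] by blast
    have "sim L L''" "sim L' L''" using core_subset_imp_sim[OF L(1) L''(1)] core_subset_imp_sim[OF L(2) L''(1)] cI L''(2) by auto
    then show False using no sim_sym[OF L(2) L''(1)] sim_trans[OF mx_lideal[OF L(1)]] by blast
  qed
  then obtain u u' where u: "u \<in> core L" "u' \<in> core L'" "\<one> = u \<oplus> u'" unfolding set_add_iff by auto
  have uc: "u \<in> carrier A" "u' \<in> carrier A" using u by (auto simp: core_def)
  obtain x where x: "x \<in> carrier A" "lann s' = col (lann s) x" using sim unfolding sim_def by blast
  have "lann (x \<otimes> s) \<subseteq> lann s'" unfolding x(2) using x(1) s(1) by (auto simp: lann_def col_def m_assoc)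
  then obtain a where a: "a \<in> carrier A" "s' = (x \<otimes> s) \<otimes> a" using principal_extend[of "x \<otimes> s" s'] x(1) s(1) s'(1) by auto
  have "s' \<otimes> u = x \<otimes> (s \<otimes> (a \<otimes> u))" unfolding a(2) using x(1) s(1) a(1) uc by (simp add: m_assoc)
  also have "\<dots> = \<zero>" using s(2) lidealD(6)[OF c(1) a(1) u(1)] x(1) by simp
  finally have "s' \<otimes> u = \<zero>" .
  moreover have "s' = s' \<otimes> u \<oplus> s' \<otimes> u'" using u(3) s'(1) uc by (metis r_distr r_one)
  ultimately show False using s'(2,3) u(2) by simp
qed

text \<open>Mapping the class of \<open>A/L\<close> to the class of a simple left ideal killed on the right by the
  annihilator of \<open>A/L\<close> is an injective map on the finite set of classes, hence surjective.\<close>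

lemma mx_is_annihilator:
  assumes "mx L" obtains s where "s \<in> carrier A" "s \<noteq> \<zero>" "L = lann s"
proof -
  obtain \<F> where \<F>: "finite \<F>" "\<And>L. L \<in> \<F> \<Longrightarrow> mx L" "\<And>L'. mx L' \<Longrightarrow> \<exists>L\<in>\<F>. sim L L'"
    using finite_representatives by metis
  \<comment> \<open>A canonical representative of each class turns classes into elements of the
    finite set \<open>\<F>\<close>.\<close>
  define rep where "rep L = (SOME L\<^sub>0. L\<^sub>0 \<in> \<F> \<and> sim L\<^sub>0 L)" for L
  have rep: "rep L \<in> \<F>" "sim (rep L) L" if "mx L" for L
    using someI_ex[of "\<lambda>L\<^sub>0. L\<^sub>0 \<in> \<F> \<and> sim L\<^sub>0 L"] \<F>(3)[OF that] unfolding rep_def by blast+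
  have rep_eq: "rep L = rep L'" if "mx L" "mx L'" "sim L L'" for L L'
  proof -
    have "(L\<^sub>0 \<in> \<F> \<and> sim L\<^sub>0 L) \<longleftrightarrow> (L\<^sub>0 \<in> \<F> \<and> sim L\<^sub>0 L')" for L\<^sub>0
      using sim_trans[OF mx_lideal[OF \<F>(2)]] that(3) sim_sym[OF that] by blast
    then show ?thesis unfolding rep_def by simp
  qed
  have rep_sim: "sim L L'" if "mx L" "mx L'" "rep L = rep L'" for L L'
    using rep[OF that(1)] rep[OF that(2)] that(3) sim_sym[OF \<F>(2)[OF rep(1)[OF that(1)]] that(1)] sim_trans[OF mx_lideal[OF that(1)]] by metis
  define \<sigma> where "\<sigma> L = (SOME s. s \<in> carrier A \<and> s \<noteq> \<zero> \<and> (\<forall>u\<in>core L. s \<otimes> u = \<zero>) \<and> mx (lann s))" for L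
  have \<sigma>: "\<sigma> L \<in> carrier A \<and> \<sigma> L \<noteq> \<zero> \<and> (\<forall>u\<in>core L. \<sigma> L \<otimes> u = \<zero>) \<and> mx (lann (\<sigma> L))" if "mx L" for L
    unfolding \<sigma>_def by (rule someI_ex) (use core_simple_annihilator[OF that] in blast)
  let ?G = "rep ` {L. mx L}" and ?f = "\<lambda>L. rep (lann (\<sigma> L))"
  have G: "mx g" "rep g = g" if "g \<in> ?G" for g
  proof -
    obtain L where "mx L" "g = rep L" using \<open>g \<in> ?G\<close> by blast
    then show "mx g" "rep g = g" using \<F>(2) rep rep_eq by auto
  qed
  have fin: "finite ?G" using \<F>(1) rep(1) by (intro finite_subset[of ?G \<F>]) auto
  have im: "?f ` ?G \<subseteq> ?G" by (rule image_subsetI) (use G(1) \<sigma> in blast)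
  have "inj_on ?f ?G"
  proof (rule inj_onI)
    fix g g' assume g: "g \<in> ?G" "g' \<in> ?G" "?f g = ?f g'"
    note \<sigma>g = \<sigma>[OF G(1)[OF g(1)]] and \<sigma>g' = \<sigma>[OF G(1)[OF g(2)]]
    have "sim (lann (\<sigma> g)) (lann (\<sigma> g'))" using rep_sim g(3) \<sigma>g \<sigma>g' by blast
    then have "sim g g'" using sim_of_annihilators[OF G(1)[OF g(1)] G(1)[OF g(2)]] \<sigma>g \<sigma>g' by blast
    then show "g = g'" using rep_eq[OF G(1)[OF g(1)] G(1)[OF g(2)]] G(2)[OF g(1)] G(2)[OF g(2)] by simp
  qed
  then have "?f ` ?G = ?G" using endo_inj_surj[OF fin im] by blast
  moreover have "rep L \<in> ?G" using assms by blast
  ultimately have "rep L \<in> ?f ` ?G" by simp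
  then obtain g where g: "g \<in> ?G" "rep L = ?f g" by (rule imageE) (rule that)
  note \<sigma>g = \<sigma>[OF G(1)[OF g(1)]]
  have "sim (lann (\<sigma> g)) L" using rep_sim[of "lann (\<sigma> g)" L] \<sigma>g assms g(2) by simp
  then obtain y where y: "y \<in> carrier A" "L = col (lann (\<sigma> g)) y" unfolding sim_def by blast
  \<comment> \<open>So \<open>A/L\<close> is isomorphic to the left ideal generated by
    \<open>y \<otimes> \<sigma> g\<close>.\<close>
  have eq: "L = lann (y \<otimes> \<sigma> g)" unfolding y(2) using y(1) \<sigma>g by (auto simp: lann_def col_def m_assoc)
  have "\<one> \<notin> L" using assms by (simp add: mx_def)
  then have "y \<otimes> \<sigma> g \<noteq> \<zero>" using y(1) \<sigma>g unfolding eq by (auto simp: lann_def)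
  then show ?thesis using that[of "y \<otimes> \<sigma> g"] eq y(1) \<sigma>g by auto
qed

text \<open>The left ideal of all \<open>a\<close> with \<open>a x\<close> in \<open>N\<close> is
  proper, hence contained in a maximal one, which is \<open>lann s\<close> for some
  \<open>s\<close>. So \<open>a x -> a s\<close> is well defined on \<open>A x\<close>; it kills the
  part inside \<open>N\<close> but not \<open>x\<close>, and it extends to \<open>W\<close> with
  value zero on \<open>N\<close>.\<close>

lemma cogenerator:
  fixes W :: "('a, 'm) module"
  assumes W: "left_module A W" "fin_len A W (carrier W)" and N: "submodule N A W" and x: "x \<in> carrier W" "x \<notin> N"
  obtains \<mu> where "lin A W reg \<mu>" "\<And>y. y \<in> N \<Longrightarrow> \<mu> y = \<zero>" "\<mu> x \<noteq> \<zero>"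
proof -
  interpret W: left_module A W by (rule W(1))
  have lx: "lin A reg W (\<lambda>a. a \<odot>\<^bsub>W\<^esub> x)" using lin_from_regular[OF W(1) x(1)] .
  let ?I = "{a \<in> carrier A. a \<odot>\<^bsub>W\<^esub> x \<in> N}" and ?X = "(\<lambda>a. a \<odot>\<^bsub>W\<^esub> x) ` carrier A"
  have I: "lideal ?I" using submodule_preimage[OF regl W(1) lx N submodule_carrier[OF regl]] by simp
  obtain L where L: "mx L" "?I \<subseteq> L" using mx_exists[OF I] x by auto
  obtain s where s: "s \<in> carrier A" "s \<noteq> \<zero>" "L = lann s" using mx_is_annihilator[OF L(1)] .
  have X: "submodule ?X A W" using submodule_image[OF regl W(1) lx submodule_carrier[OF regl]] by simp
  let ?V = "W\<lparr>carrier := ?X\<rparr>"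
  have V: "left_module A ?V" using left_module_sub[OF W(1) X] .
  have lV: "lin A reg ?V (\<lambda>a. a \<odot>\<^bsub>W\<^esub> x)" using lin_sub_cod[OF lx] by simp
  have kill: "a \<otimes> s = \<zero>" if "a \<in> carrier A" "a \<odot>\<^bsub>W\<^esub> x \<in> N" for a using that L(2) s(3) by (auto simp: lann_def)
  have ker: "a \<otimes> s = \<zero>\<^bsub>reg\<^esub>" if "a \<in> carrier reg" "a \<odot>\<^bsub>W\<^esub> x = \<zero>\<^bsub>?V\<^esub>" for a
    using that kill submoduleD(3)[OF N] by simp
  have sur: "(\<lambda>a. a \<odot>\<^bsub>W\<^esub> x) ` carrier reg = carrier ?V" by simp
  obtain g where g: "lin A ?V reg g" "\<And>a. a \<in> carrier reg \<Longrightarrow> g (a \<odot>\<^bsub>W\<^esub> x) = a \<otimes> s"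
    using lin_factor_surj[OF regl V regl lV sur lin_rmult[OF s(1)] ker] by metis
  have gN: "g y = \<zero>" if "y \<in> ?X" "y \<in> N" for y using that g(2) kill by auto
  obtain \<mu> where \<mu>: "lin A W reg \<mu>" "\<And>y. y \<in> ?X \<Longrightarrow> \<mu> y = g y" "\<And>y. y \<in> N \<Longrightarrow> \<mu> y = \<zero>"
    using self_injective_extend[OF si W X N g(1) gN] by metis
  have "x \<in> ?X" using x(1) by (intro image_eqI[of _ _ \<one>]) auto
  then have "\<mu> x = \<one> \<otimes> s" using \<mu>(2) g(2)[of \<one>] x(1) by simp
  then show ?thesis using that \<mu> s by simp
qed

end

section \<open>Upper triangular matrices\<close>

lemma (in abelian_monoid) finsum_swap:
  assumes "finite S" "finite S'" "\<And>s s'. s \<in> S \<Longrightarrow> s' \<in> S' \<Longrightarrow> f s s' \<in> carrier G"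
  shows "(\<Oplus>s\<in>S. \<Oplus>s'\<in>S'. f s s') = (\<Oplus>s'\<in>S'. \<Oplus>s\<in>S. f s s')"
  using assms(1,3)
proof (induction S rule: finite_induct)
  case (insert t S)
  have c: "(\<lambda>s. \<Oplus>s'\<in>S'. f s s') \<in> S \<rightarrow> carrier G" "(\<Oplus>s'\<in>S'. f t s') \<in> carrier G"
    using insert.prems by (auto intro!: finsum_closed)
  have "(\<Oplus>s\<in>insert t S. \<Oplus>s'\<in>S'. f s s') = (\<Oplus>s'\<in>S'. f t s') \<oplus> (\<Oplus>s'\<in>S'. \<Oplus>s\<in>S. f s s')"
    using insert c by simp
  also have "\<dots> = (\<Oplus>s'\<in>S'. f t s' \<oplus> (\<Oplus>s\<in>S. f s s'))"
    using insert.prems by (subst finsum_addf) (auto intro!: finsum_closed)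
  also have "\<dots> = (\<Oplus>s'\<in>S'. \<Oplus>s\<in>insert t S. f s s')"
    using insert.prems insert.hyps by (intro finsum_cong') (auto intro!: finsum_closed simp: Pi_iff)
  finally show ?case .
qed simp

lemma lin_finsum:
  assumes "left_module R X" "left_module R Y" "lin R X Y f" "finite S" "\<And>s. s \<in> S \<Longrightarrow> u s \<in> carrier X"
  shows "f (finsum X u S) = finsum Y (\<lambda>s. f (u s)) S"
proof -
  interpret X: left_module R X by fact
  interpret Y: left_module R Y by fact
  show ?thesis using assms(4,5)
  proof (induction S rule: finite_induct)
    case empty
    show ?case using lin_zero[OF assms(1-3)] by simp
  next
    case (insert s S)
    have "u \<in> S \<rightarrow> carrier X" "u s \<in> carrier X" "(\<lambda>s. f (u s)) \<in> S \<rightarrow> carrier Y" "f (u s) \<in> carrier Y"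
      using insert.prems lin_mem[OF assms(3)] by auto
    then show ?case using insert by (simp add: lin_add[OF assms(3)])
  qed
qed

locale tri_ring = selfinj_ring A for A (structure) +
  fixes n :: nat
  assumes n: "0 < n"
begin

abbreviation "T \<equiv> upper_triangular_ring n A"
abbreviation "regT \<equiv> regular_module T"

section \<open>Scalar matrices \<open>sc\<close> and matrix units \<open>eu\<close>\<close>

definition sc :: "'a \<Rightarrow> nat \<Rightarrow> nat \<Rightarrow> 'a" where
  "sc a = (\<lambda>i j. if i = j \<and> i < n then a else \<zero>)"

definition eu :: "nat \<Rightarrow> nat \<Rightarrow> nat \<Rightarrow> nat \<Rightarrow> 'a" where
  "eu i j = (\<lambda>k l. if k = i \<and> l = j then \<one> else \<zero>)"

lemma T_simps:
  "mult T X Y = (\<lambda>i j. \<Oplus>k\<in>{..<n}. X i k \<otimes> Y k j)" "one T = (\<lambda>i j. if i = j \<and> i < n then \<one> else \<zero>)"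
  "zero T = (\<lambda>i j. \<zero>)" "add T X Y = (\<lambda>i j. X i j \<oplus> Y i j)"
  by (simp_all add: upper_triangular_ring_def)

lemma T_iff: "X \<in> carrier T \<longleftrightarrow> (\<forall>i j. X i j \<in> carrier A) \<and> (\<forall>i j. \<not> (i \<le> j \<and> j < n) \<longrightarrow> X i j = \<zero>)"
  unfolding upper_triangular_ring_def by (auto split: if_splits) (metis zero_closed)

lemma T_entry: "X \<in> carrier T \<Longrightarrow> X i j \<in> carrier A"
  and T_entry_zero: "X \<in> carrier T \<Longrightarrow> \<not> (i \<le> j \<and> j < n) \<Longrightarrow> X i j = \<zero>"
  by (auto simp: T_iff)

lemma sum_single:
  assumes "i < n" "f i \<in> carrier A" "\<And>k. k < n \<Longrightarrow> k \<noteq> i \<Longrightarrow> f k = \<zero>"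
  shows "(\<Oplus>k\<in>{..<n}. f k) = f i"
proof -
  have c: "f k \<in> carrier A" if "k < n" for k using assms that by (cases "k = i") auto
  have "(\<Oplus>k\<in>{..<n}. f k) = (\<Oplus>k\<in>{..<n}. if i = k then f k else \<zero>)"
    using assms c by (intro finsum_cong') auto
  also have "\<dots> = f i" using assms(1) c by (intro finsum_singleton) auto
  finally show ?thesis .
qed

lemma sum_zero: "(\<And>k. k < n \<Longrightarrow> f k = \<zero>) \<Longrightarrow> (\<Oplus>k\<in>{..<n}. f k) = \<zero>"
proof -
  assume "\<And>k. k < n \<Longrightarrow> f k = \<zero>"
  then have "(\<Oplus>k\<in>{..<n}. f k) = (\<Oplus>k\<in>{..<n}. \<zero>)" by (intro finsum_cong') auto
  then show ?thesis by simp
qed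

lemma T_mult_closed: assumes "X \<in> carrier T" "Y \<in> carrier T" shows "X \<otimes>\<^bsub>T\<^esub> Y \<in> carrier T"
  unfolding T_iff T_simps
proof (intro conjI allI impI)
  fix i j
  show "(\<Oplus>k\<in>{..<n}. X i k \<otimes> Y k j) \<in> carrier A" using assms by (auto intro!: finsum_closed simp: T_entry)
  assume "\<not> (i \<le> j \<and> j < n)"
  then have "X i k \<otimes> Y k j = \<zero>" if "k < n" for k
    using T_entry[OF assms(1), of i k] T_entry[OF assms(2), of k j] T_entry_zero[OF assms(1), of i k] T_entry_zero[OF assms(2), of k j]
    by (cases "i \<le> k"; cases "k \<le> j \<and> j < n") auto
  then show "(\<Oplus>k\<in>{..<n}. X i k \<otimes> Y k j) = \<zero>" by (rule sum_zero)
qed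

lemma ring_T: "ring T"
proof (rule ringI)
  show "abelian_group T"
  proof (rule abelian_groupI)
    fix X assume X: "X \<in> carrier T"
    show "\<exists>Y\<in>carrier T. Y \<oplus>\<^bsub>T\<^esub> X = \<zero>\<^bsub>T\<^esub>"
      using X by (intro bexI[of _ "\<lambda>i j. \<ominus> X i j"]) (auto simp: T_iff T_simps l_neg)
  qed (auto simp: T_iff T_simps a_ac)
  show "monoid T"
  proof (rule monoidI)
    fix X Y Z assume X: "X \<in> carrier T" and Y: "Y \<in> carrier T" and Z: "Z \<in> carrier T"
    show "(X \<otimes>\<^bsub>T\<^esub> Y) \<otimes>\<^bsub>T\<^esub> Z = X \<otimes>\<^bsub>T\<^esub> (Y \<otimes>\<^bsub>T\<^esub> Z)"
    proof (intro ext)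
      fix i j
      note c = T_entry[OF X] T_entry[OF Y] T_entry[OF Z]
      have "(\<Oplus>k\<in>{..<n}. (\<Oplus>l\<in>{..<n}. X i l \<otimes> Y l k) \<otimes> Z k j) = (\<Oplus>k\<in>{..<n}. \<Oplus>l\<in>{..<n}. X i l \<otimes> Y l k \<otimes> Z k j)"
        using c by (intro finsum_cong') (auto simp: finsum_ldistr Pi_iff intro!: finsum_closed)
      also have "\<dots> = (\<Oplus>l\<in>{..<n}. \<Oplus>k\<in>{..<n}. X i l \<otimes> Y l k \<otimes> Z k j)"
        using c by (intro finsum_swap) auto
      also have "\<dots> = (\<Oplus>l\<in>{..<n}. X i l \<otimes> (\<Oplus>k\<in>{..<n}. Y l k \<otimes> Z k j))"
        using c by (intro finsum_cong') (auto simp: finsum_rdistr Pi_iff m_assoc intro!: finsum_closed)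
      finally show "((X \<otimes>\<^bsub>T\<^esub> Y) \<otimes>\<^bsub>T\<^esub> Z) i j = (X \<otimes>\<^bsub>T\<^esub> (Y \<otimes>\<^bsub>T\<^esub> Z)) i j" by (simp add: T_simps)
    qed
  next
    fix X assume X: "X \<in> carrier T"
    note c = T_entry[OF X]
    show "\<one>\<^bsub>T\<^esub> \<otimes>\<^bsub>T\<^esub> X = X"
    proof (intro ext)
      fix i j
      show "(\<one>\<^bsub>T\<^esub> \<otimes>\<^bsub>T\<^esub> X) i j = X i j"
      proof (cases "i < n")
        case True
        then have "(\<Oplus>k\<in>{..<n}. (if i = k \<and> i < n then \<one> else \<zero>) \<otimes> X k j) = \<one> \<otimes> X i j"
          using c by (subst sum_single[of i]) auto
        then show ?thesis using c by (simp add: T_simps)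
      next
        case False
        then show ?thesis using c T_entry_zero[OF X, of i j] by (auto simp: T_simps intro!: sum_zero)
      qed
    qed
    show "X \<otimes>\<^bsub>T\<^esub> \<one>\<^bsub>T\<^esub> = X"
    proof (intro ext)
      fix i j
      show "(X \<otimes>\<^bsub>T\<^esub> \<one>\<^bsub>T\<^esub>) i j = X i j"
      proof (cases "j < n")
        case True
        then have "(\<Oplus>k\<in>{..<n}. X i k \<otimes> (if k = j \<and> k < n then \<one> else \<zero>)) = X i j \<otimes> \<one>"
          using c by (subst sum_single[of j]) auto
        then show ?thesis using c by (simp add: T_simps)
      next
        case False
        then show ?thesis using c T_entry_zero[OF X, of i j] by (auto simp: T_simps intro!: sum_zero)
      qed
    qed
  qed (auto simp: T_mult_closed, auto simp: T_iff T_simps)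
next
  fix X Y Z assume X: "X \<in> carrier T" and Y: "Y \<in> carrier T" and Z: "Z \<in> carrier T"
  note c = T_entry[OF X] T_entry[OF Y] T_entry[OF Z]
  show "(X \<oplus>\<^bsub>T\<^esub> Y) \<otimes>\<^bsub>T\<^esub> Z = X \<otimes>\<^bsub>T\<^esub> Z \<oplus>\<^bsub>T\<^esub> Y \<otimes>\<^bsub>T\<^esub> Z"
    using c by (auto simp: T_simps l_distr finsum_addf Pi_iff)
  show "Z \<otimes>\<^bsub>T\<^esub> (X \<oplus>\<^bsub>T\<^esub> Y) = Z \<otimes>\<^bsub>T\<^esub> X \<oplus>\<^bsub>T\<^esub> Z \<otimes>\<^bsub>T\<^esub> Y"
    using c by (auto simp: T_simps r_distr finsum_addf Pi_iff)
qed

lemma sc_T: "a \<in> carrier A \<Longrightarrow> sc a \<in> carrier T"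
  by (auto simp: T_iff sc_def)

lemma eu_T: "i \<le> j \<Longrightarrow> j < n \<Longrightarrow> eu i j \<in> carrier T"
  by (auto simp: T_iff eu_def)

lemma sc_mult: assumes "a \<in> carrier A" "X \<in> carrier T" shows "(sc a \<otimes>\<^bsub>T\<^esub> X) i j = a \<otimes> X i j"
proof (cases "i < n")
  case True
  have "(\<Oplus>k\<in>{..<n}. sc a i k \<otimes> X k j) = sc a i i \<otimes> X i j"
    using True assms T_entry[OF assms(2)] by (intro sum_single) (auto simp: sc_def)
  then show ?thesis using True by (simp add: T_simps sc_def)
next
  case False
  then show ?thesis using assms T_entry[OF assms(2)] T_entry_zero[OF assms(2), of i j] by (auto simp: T_simps sc_def intro!: sum_zero)
qed

lemma mult_sc: assumes "a \<in> carrier A" "X \<in> carrier T" shows "(X \<otimes>\<^bsub>T\<^esub> sc a) i j = X i j \<otimes> a"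
proof (cases "j < n")
  case True
  have "(\<Oplus>k\<in>{..<n}. X i k \<otimes> sc a k j) = X i j \<otimes> sc a j j"
    using True assms T_entry[OF assms(2)] by (intro sum_single) (auto simp: sc_def)
  then show ?thesis using True by (simp add: T_simps sc_def)
next
  case False
  then show ?thesis using assms T_entry[OF assms(2)] T_entry_zero[OF assms(2), of i j] by (auto simp: T_simps sc_def intro!: sum_zero)
qed

lemma eu_mult: assumes "i \<le> j" "j < n" "X \<in> carrier T" shows "(eu i j \<otimes>\<^bsub>T\<^esub> X) k l = (if k = i then X j l else \<zero>)"
proof (cases "k = i")
  case True
  have "(\<Oplus>m\<in>{..<n}. eu i j k m \<otimes> X m l) = eu i j k j \<otimes> X j l"
    using True assms T_entry[OF assms(3)] by (intro sum_single) (auto simp: eu_def)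
  then show ?thesis using True assms T_entry[OF assms(3)] by (simp add: T_simps eu_def)
next
  case False
  then show ?thesis using T_entry[OF assms(3)] by (auto simp: T_simps eu_def intro!: sum_zero)
qed

lemma eu_eu: assumes "i \<le> j" "j \<le> k" "k < n" shows "eu i j \<otimes>\<^bsub>T\<^esub> eu j k = eu i k"
proof (intro ext)
  fix p q
  show "(eu i j \<otimes>\<^bsub>T\<^esub> eu j k) p q = eu i k p q" using eu_mult[of i j "eu j k" p q] eu_T[of j k] assms by (simp add: eu_def)
qed

lemma sc_eu: assumes "i \<le> j" "j < n" "a \<in> carrier A" shows "sc a \<otimes>\<^bsub>T\<^esub> eu i j = eu i j \<otimes>\<^bsub>T\<^esub> sc a"
proof (intro ext)
  fix p q
  show "(sc a \<otimes>\<^bsub>T\<^esub> eu i j) p q = (eu i j \<otimes>\<^bsub>T\<^esub> sc a) p q"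
    using assms sc_mult[OF assms(3) eu_T[OF assms(1,2)]] mult_sc[OF assms(3) eu_T[OF assms(1,2)]] by (simp add: eu_def)
qed

lemma sc_hom: "sc \<in> ring_hom A T"
proof (rule ring_hom_memI)
  fix a b assume a: "a \<in> carrier A" and b: "b \<in> carrier A"
  show "sc a \<in> carrier T" using sc_T[OF a] .
  show "sc (a \<otimes> b) = sc a \<otimes>\<^bsub>T\<^esub> sc b" using sc_mult[OF a sc_T[OF b]] a by (auto simp: sc_def fun_eq_iff)
  show "sc (a \<oplus> b) = sc a \<oplus>\<^bsub>T\<^esub> sc b" using a b by (auto simp: sc_def T_simps fun_eq_iff)
next
  show "sc \<one> = \<one>\<^bsub>T\<^esub>" by (simp add: sc_def T_simps)
qed

sublocale S: scalars A T sc
  by (rule scalars.intro[OF ring_axioms ring_T sc_hom])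

lemma finsum_T_entry:
  assumes "finite S" "\<And>s. s \<in> S \<Longrightarrow> u s \<in> carrier T" shows "finsum T u S i j = (\<Oplus>s\<in>S. u s i j)"
proof -
  interpret T: ring T by (rule ring_T)
  show ?thesis using assms
  proof (induction S rule: finite_induct)
    case empty
    show ?case by (simp add: T_simps)
  next
    case (insert s S)
    have c: "u \<in> S \<rightarrow> carrier T" "u s \<in> carrier T" using insert.prems by auto
    have e: "(\<lambda>s. u s i j) \<in> S \<rightarrow> carrier A" "u s i j \<in> carrier A" using insert.prems T_entry by auto
    have "finsum T u (insert s S) i j = u s i j \<oplus> finsum T u S i j"
      using T.finsum_insert[OF insert.hyps c] by (simp add: T_simps(4))
    then show ?case using insert.IH insert.prems finsum_insert[OF insert.hyps e] by simp
  qed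
qed

text \<open>Multiplication by \<open>eu 0 i\<close> moves row \<open>i\<close> of \<open>t\<close>
  into row 0, where its entries become coefficients. This identity underlies the
  \<open>T\<close>-linearity of maps built from functionals.\<close>

lemma eu_row:
  assumes "i < n" "t \<in> carrier T"
  shows "eu 0 i \<otimes>\<^bsub>T\<^esub> t = finsum T (\<lambda>k. sc (t i k) \<otimes>\<^bsub>T\<^esub> eu 0 k) {..<n}"
proof (intro ext)
  fix p q
  have c: "sc (t i k) \<otimes>\<^bsub>T\<^esub> eu 0 k \<in> carrier T" if "k \<in> {..<n}" for k
    using that by (intro T_mult_closed sc_T eu_T T_entry[OF assms(2)]) auto
  have e: "(sc (t i k) \<otimes>\<^bsub>T\<^esub> eu 0 k) p q = (if p = 0 \<and> k = q then t i k else \<zero>)" if "k < n" for k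
    using sc_mult[OF T_entry[OF assms(2)] eu_T[of 0 k]] that T_entry[OF assms(2)] by (simp add: eu_def)
  have "finsum T (\<lambda>k. sc (t i k) \<otimes>\<^bsub>T\<^esub> eu 0 k) {..<n} p q = (\<Oplus>k\<in>{..<n}. (sc (t i k) \<otimes>\<^bsub>T\<^esub> eu 0 k) p q)"
    using c by (intro finsum_T_entry) auto
  also have "\<dots> = (if p = 0 then t i q else \<zero>)"
  proof (cases "p = 0 \<and> q < n")
    case True
    then show ?thesis using e T_entry[OF assms(2)] by (subst sum_single[of q]) auto
  next
    case False
    then show ?thesis using e T_entry_zero[OF assms(2), of i q] by (auto intro!: sum_zero)
  qed
  also have "\<dots> = (eu 0 i \<otimes>\<^bsub>T\<^esub> t) p q" using eu_mult[of 0 i t p q] assms by simp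
  finally show "(eu 0 i \<otimes>\<^bsub>T\<^esub> t) p q = finsum T (\<lambda>k. sc (t i k) \<otimes>\<^bsub>T\<^esub> eu 0 k) {..<n} p q" ..
qed

lemma one_eq_sum_eu: "\<one>\<^bsub>T\<^esub> = finsum T (\<lambda>k. eu k k) {..<n}"
proof (intro ext)
  fix p q
  have "finsum T (\<lambda>k. eu k k) {..<n} p q = (\<Oplus>k\<in>{..<n}. eu k k p q)" using eu_T by (intro finsum_T_entry) auto
  also have "\<dots> = \<one>\<^bsub>T\<^esub> p q"
  proof (cases "p = q \<and> p < n")
    case True
    then show ?thesis by (subst sum_single[of p]) (auto simp: eu_def T_simps)
  next
    case False
    then show ?thesis by (auto simp: eu_def T_simps intro!: sum_zero)
  qed
  finally show "\<one>\<^bsub>T\<^esub> p q = finsum T (\<lambda>k. eu k k) {..<n} p q" ..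
qed

abbreviation "rsA \<equiv> restrict_scalars sc"

lemma smult_eu_eu:
  assumes "left_module T X" "x \<in> carrier X" "i \<le> j" "j \<le> k" "k < n"
  shows "eu i j \<odot>\<^bsub>X\<^esub> (eu j k \<odot>\<^bsub>X\<^esub> x) = eu i k \<odot>\<^bsub>X\<^esub> x"
  using left_module.smult_assoc1[OF assms(1) eu_T[of i j] eu_T[of j k] assms(2)] eu_eu[of i j k] assms(3-5) by simp

lemma lin_eu:
  assumes "left_module T X" "i \<le> j" "j < n" shows "lin A (rsA X) (rsA X) (\<lambda>x. eu i j \<odot>\<^bsub>X\<^esub> x)"
proof -
  interpret X: left_module T X by fact
  show ?thesis unfolding lin_def
    using eu_T[OF assms(2,3)] sc_T sc_eu[OF assms(2,3)]
    by (auto simp: X.smult_r_distr X.smult_assoc1[symmetric])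
qed

lemma lin_smult_eu:
  assumes "lin T X Y f" "x \<in> carrier X" "i \<le> j" "j < n" shows "f (eu i j \<odot>\<^bsub>X\<^esub> x) = eu i j \<odot>\<^bsub>Y\<^esub> f x"
  using lin_smult[OF assms(1) eu_T[OF assms(3,4)] assms(2)] .

lemma lin_entry: "lin A (rsA regT) reg (\<lambda>X. X i j)"
  by (auto simp: lin_def T_entry T_simps(4) sc_mult)

lemma fin_len_regT: "fin_len A (rsA regT) (carrier T)"
proof (rule fin_len_jointly_inj[of A "rsA regT" "{..<n} \<times> {..<n}" "\<lambda>_. reg" "\<lambda>(i, j) X. X i j"])
  have l: "left_module T regT" using left_module_regular[OF ring_T] .
  show "left_module A (rsA regT)" using S.left_module_rs[OF l] .
  then show "submodule (carrier T) A (rsA regT)" using submodule_carrier[of A "rsA regT"] by simp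
  fix X assume X: "X \<in> carrier T" "\<forall>s\<in>{..<n} \<times> {..<n}. (case s of (i, j) \<Rightarrow> \<lambda>X. X i j) X = \<zero>\<^bsub>reg\<^esub>"
  have "X i j = \<zero>" for i j using X T_entry_zero[OF X(1), of i j] by (cases "i < n \<and> j < n") auto
  then show "X = \<zero>\<^bsub>rsA regT\<^esub>" by (auto simp: T_simps fun_eq_iff)
qed (use regl fl lin_entry in auto)

lemma fin_len_rsA: "fg_module T X \<Longrightarrow> fin_len A (rsA X) (carrier X)"
  using S.fin_len_rs fin_len_regT by simp

text \<open>A map from a \<open>T\<close>-module \<open>X\<close> to \<open>T\<close> is determined by the first row of its values, and that row
  consists of \<open>A\<close>-linear functionals \<open>l j\<close> vanishing on \<open>eu 0 i X\<close> for \<open>i > j\<close>.\<close>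

lemma lin_of_functionals:
  assumes X: "left_module T X" and l: "\<And>j. j < n \<Longrightarrow> lin A (rsA X) reg (l j)"
    and van: "\<And>i j x. j < i \<Longrightarrow> i < n \<Longrightarrow> x \<in> carrier X \<Longrightarrow> l j (eu 0 i \<odot>\<^bsub>X\<^esub> x) = \<zero>"
  shows "lin T X regT (\<lambda>x i j. if i \<le> j \<and> j < n then l j (eu 0 i \<odot>\<^bsub>X\<^esub> x) else \<zero>)" (is "lin T X regT ?f")
proof -
  interpret X: left_module T X by fact
  have rX: "left_module A (rsA X)" using S.left_module_rs[OF X] .
  have cl: "l j (eu 0 i \<odot>\<^bsub>X\<^esub> x) \<in> carrier A" if "i < n" "j < n" "x \<in> carrier X" for i j x
    using lin_mem[OF l[OF that(2)], of "eu 0 i \<odot>\<^bsub>X\<^esub> x"] eu_T[of 0 i] that by simp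
  have fT: "?f x \<in> carrier T" if "x \<in> carrier X" for x using cl that by (auto simp: T_iff)
  show ?thesis
    unfolding lin_def
  proof (intro conjI ballI)
    fix x assume "x \<in> carrier X" then show "?f x \<in> carrier regT" using fT by simp
  next
    fix x y assume x: "x \<in> carrier X" and y: "y \<in> carrier X"
    have "l j (eu 0 i \<odot>\<^bsub>X\<^esub> (x \<oplus>\<^bsub>X\<^esub> y)) = l j (eu 0 i \<odot>\<^bsub>X\<^esub> x) \<oplus> l j (eu 0 i \<odot>\<^bsub>X\<^esub> y)" if "i < n" "j < n" for i j
      using lin_add[OF lin_comp[OF lin_eu[OF X, of 0 i] l[OF that(2)]], of x y] that x y by simp
    then show "?f (x \<oplus>\<^bsub>X\<^esub> y) = ?f x \<oplus>\<^bsub>regT\<^esub> ?f y" by (auto simp: T_simps fun_eq_iff)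
  next
    fix t x assume t: "t \<in> carrier T" and x: "x \<in> carrier X"
    have tx: "t \<odot>\<^bsub>X\<^esub> x \<in> carrier X" using t x by simp
    show "?f (t \<odot>\<^bsub>X\<^esub> x) = t \<odot>\<^bsub>regT\<^esub> ?f x"
    proof (intro ext)
      fix i j
      show "?f (t \<odot>\<^bsub>X\<^esub> x) i j = (t \<odot>\<^bsub>regT\<^esub> ?f x) i j"
      proof (cases "i \<le> j \<and> j < n")
        case False
        then show ?thesis using T_entry_zero[OF T_mult_closed[OF t fT[OF x]], of i j] by auto
      next
        case True
        have c: "sc (t i k) \<otimes>\<^bsub>T\<^esub> eu 0 k \<in> carrier T" if "k < n" for k
          using that by (intro T_mult_closed sc_T eu_T T_entry[OF t]) auto
        have e0: "eu 0 i \<odot>\<^bsub>X\<^esub> (t \<odot>\<^bsub>X\<^esub> x) = finsum T (\<lambda>k. sc (t i k) \<otimes>\<^bsub>T\<^esub> eu 0 k) {..<n} \<odot>\<^bsub>X\<^esub> x"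
          using X.smult_assoc1[OF eu_T[of 0 i] t x] eu_row[of i t] True t by simp
        also have "\<dots> = finsum X (\<lambda>k. (sc (t i k) \<otimes>\<^bsub>T\<^esub> eu 0 k) \<odot>\<^bsub>X\<^esub> x) {..<n}"
          using lin_finsum[OF left_module_regular[OF ring_T] X lin_from_regular[OF X x], of "{..<n}" "\<lambda>k. sc (t i k) \<otimes>\<^bsub>T\<^esub> eu 0 k"] c
          by (simp add: finsum_def finprod_def)
        also have "\<dots> = finsum (rsA X) (\<lambda>k. t i k \<odot>\<^bsub>rsA X\<^esub> (eu 0 k \<odot>\<^bsub>X\<^esub> x)) {..<n}"
        proof -
          interpret rX: left_module A "rsA X" by (rule rX)
          have "(sc (t i k) \<otimes>\<^bsub>T\<^esub> eu 0 k) \<odot>\<^bsub>X\<^esub> x = sc (t i k) \<odot>\<^bsub>X\<^esub> (eu 0 k \<odot>\<^bsub>X\<^esub> x)" if "k < n" for k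
            using X.smult_assoc1[OF sc_T[OF T_entry[OF t]] eu_T[of 0 k] x] that by simp
          then have "finsum X (\<lambda>k. (sc (t i k) \<otimes>\<^bsub>T\<^esub> eu 0 k) \<odot>\<^bsub>X\<^esub> x) {..<n} = finsum X (\<lambda>k. sc (t i k) \<odot>\<^bsub>X\<^esub> (eu 0 k \<odot>\<^bsub>X\<^esub> x)) {..<n}"
            using sc_T[OF T_entry[OF t]] eu_T x by (intro X.M.finsum_cong') auto
          then show ?thesis by (simp add: finsum_def finprod_def)
        qed
        finally have e: "eu 0 i \<odot>\<^bsub>X\<^esub> (t \<odot>\<^bsub>X\<^esub> x) = finsum (rsA X) (\<lambda>k. t i k \<odot>\<^bsub>rsA X\<^esub> (eu 0 k \<odot>\<^bsub>X\<^esub> x)) {..<n}" .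
        have jn: "j < n" using True by simp
        have ec: "eu 0 k \<odot>\<^bsub>X\<^esub> x \<in> carrier (rsA X)" if "k < n" for k using eu_T[of 0 k] that x by simp
        have "l j (eu 0 i \<odot>\<^bsub>X\<^esub> (t \<odot>\<^bsub>X\<^esub> x)) = finsum reg (\<lambda>k. l j (t i k \<odot>\<^bsub>rsA X\<^esub> (eu 0 k \<odot>\<^bsub>X\<^esub> x))) {..<n}"
          unfolding e by (rule lin_finsum[OF rX regl l[OF jn]]) (use ec left_module.smult_closed[OF rX] T_entry[OF t] in auto)
        also have "\<dots> = (\<Oplus>k\<in>{..<n}. t i k \<otimes> ?f x k j)"
        proof -
          \<comment> \<open>For \<open>k > j\<close> both sides are zero, the left one by
            \<open>van\<close>: this is where the vanishing condition on the functionals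
            enters.\<close>
          have "l j (t i k \<odot>\<^bsub>rsA X\<^esub> (eu 0 k \<odot>\<^bsub>X\<^esub> x)) = t i k \<otimes> ?f x k j" if k: "k < n" for k
            using lin_smult[OF l[OF jn] T_entry[OF t] ec[OF k], of i k] van[of j k x] k jn x by auto
          then have "(\<Oplus>k\<in>{..<n}. l j (t i k \<odot>\<^bsub>rsA X\<^esub> (eu 0 k \<odot>\<^bsub>X\<^esub> x))) = (\<Oplus>k\<in>{..<n}. t i k \<otimes> ?f x k j)"
            using T_entry[OF t] T_entry[OF fT[OF x]] by (intro finsum_cong') auto
          then show ?thesis by (simp add: finsum_def finprod_def)
        qed
        finally show ?thesis using True by (simp add: T_simps)
      qed
    qed
  qed
qed

text \<open>\<open>X\<close> is a chain of maps from \<open>eu i i X\<close> to the piece of index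
  \<open>i - 1\<close>. The condition says that the composites into \<open>eu 0 0 X\<close> are
  injective, which amounts to injectivity of all maps of the chain.\<close>

definition monic :: "(nat \<Rightarrow> nat \<Rightarrow> 'a, 'x, 'y) module_scheme \<Rightarrow> bool" where
  "monic X \<longleftrightarrow> (\<forall>i<n. \<forall>x\<in>carrier X. eu 0 i \<odot>\<^bsub>X\<^esub> x = \<zero>\<^bsub>X\<^esub> \<longrightarrow> eu i i \<odot>\<^bsub>X\<^esub> x = \<zero>\<^bsub>X\<^esub>)"

text \<open>In \<open>T\<close> itself \<open>eu 0 i t\<close> is row \<open>i\<close> of
  \<open>t\<close> moved to row 0, so it vanishes only if \<open>eu i i t\<close> does. Maps to
  \<open>T\<close> that separate points carry this property back to \<open>X\<close>.\<close>

lemma torsionless_imp_monic: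
  assumes X: "left_module T X" and tl: "torsionless T X" shows "monic X"
  unfolding monic_def
proof (intro allI impI ballI)
  fix i x assume i: "i < n" and x: "x \<in> carrier X" and z: "eu 0 i \<odot>\<^bsub>X\<^esub> x = \<zero>\<^bsub>X\<^esub>"
  note regT = left_module_regular[OF ring_T]
  show "eu i i \<odot>\<^bsub>X\<^esub> x = \<zero>\<^bsub>X\<^esub>"
  proof (rule ccontr)
    assume ne: "eu i i \<odot>\<^bsub>X\<^esub> x \<noteq> \<zero>\<^bsub>X\<^esub>"
    have "eu i i \<odot>\<^bsub>X\<^esub> x \<in> carrier X" using left_module.smult_closed[OF X eu_T x] i by simp
    then obtain f where f: "lin T X regT f" "f (eu i i \<odot>\<^bsub>X\<^esub> x) \<noteq> \<zero>\<^bsub>regT\<^esub>" using tl ne unfolding cogenerated_def by blast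
    have fx: "f x \<in> carrier T" using lin_mem[OF f(1) x] by simp
    have 1: "f (eu i i \<odot>\<^bsub>X\<^esub> x) = eu i i \<otimes>\<^bsub>T\<^esub> f x" and 2: "f (eu 0 i \<odot>\<^bsub>X\<^esub> x) = eu 0 i \<otimes>\<^bsub>T\<^esub> f x"
      using lin_smult_eu[OF f(1) x, of i i] lin_smult_eu[OF f(1) x, of 0 i] i by simp_all
    have "eu 0 i \<otimes>\<^bsub>T\<^esub> f x = \<zero>\<^bsub>T\<^esub>" using 2 z lin_zero[OF X regT f(1)] by simp
    then have "f x i l = \<zero>" for l using eu_mult[of 0 i "f x" 0 l] i fx by (simp add: T_simps)
    then have "eu i i \<otimes>\<^bsub>T\<^esub> f x = \<zero>\<^bsub>T\<^esub>" using eu_mult[of i i "f x"] i fx by (auto simp: T_simps(3) fun_eq_iff)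
    then show False using f(2) 1 by simp
  qed
qed

text \<open>Some \<open>eu i i x\<close> is nonzero, hence so is \<open>eu 0 i x\<close>, and a
  functional on the \<open>A\<close>-module \<open>X\<close> detects it.\<close>

lemma monic_imp_torsionless:
  fixes X :: "(nat \<Rightarrow> nat \<Rightarrow> 'a, 'x) module"
  assumes X: "fg_module T X" and m: "monic X" shows "torsionless T X"
  unfolding cogenerated_def
proof (intro ballI impI)
  fix x assume x: "x \<in> carrier X" "x \<noteq> \<zero>\<^bsub>X\<^esub>"
  have Xl: "left_module T X" using X by (rule fg_left_module)
  interpret X: left_module T X by (rule Xl)
  note regT = left_module_regular[OF ring_T]
  have rX: "left_module A (rsA X)" using S.left_module_rs[OF Xl] .
  have "\<exists>i<n. eu i i \<odot>\<^bsub>X\<^esub> x \<noteq> \<zero>\<^bsub>X\<^esub>"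
  proof (rule ccontr)
    assume "\<not> ?thesis"
    then have z: "eu i i \<odot>\<^bsub>X\<^esub> x = \<zero>\<^bsub>X\<^esub>" if "i < n" for i using that by blast
    have "x = finsum T (\<lambda>k. eu k k) {..<n} \<odot>\<^bsub>X\<^esub> x" using x one_eq_sum_eu X.smult_one by metis
    also have "\<dots> = finsum X (\<lambda>k. eu k k \<odot>\<^bsub>X\<^esub> x) {..<n}"
      using lin_finsum[OF regT Xl lin_from_regular[OF Xl x(1)], of "{..<n}" "\<lambda>k. eu k k"] eu_T by (simp add: finsum_def finprod_def)
    also have "\<dots> = finsum X (\<lambda>k. \<zero>\<^bsub>X\<^esub>) {..<n}" using z by (intro X.M.finsum_cong') auto
    finally show False using x(2) by simp
  qed
  then obtain i where i: "i < n" "eu i i \<odot>\<^bsub>X\<^esub> x \<noteq> \<zero>\<^bsub>X\<^esub>" by blast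
  then have ne: "eu 0 i \<odot>\<^bsub>X\<^esub> x \<noteq> \<zero>\<^bsub>X\<^esub>" using m x(1) unfolding monic_def by blast
  have c: "eu 0 i \<odot>\<^bsub>X\<^esub> x \<in> carrier (rsA X)" "eu 0 i \<odot>\<^bsub>X\<^esub> x \<notin> {\<zero>\<^bsub>X\<^esub>}" using eu_T[of 0 i] i(1) x(1) ne by auto
  have W: "fin_len A (rsA X) (carrier (rsA X))" "submodule {\<zero>\<^bsub>X\<^esub>} A (rsA X)"
    using fin_len_rsA[OF X] submodule_zero[OF rX] by simp_all
  obtain \<mu> where \<mu>: "lin A (rsA X) reg \<mu>" "\<mu> (eu 0 i \<odot>\<^bsub>X\<^esub> x) \<noteq> \<zero>"
    using cogenerator[OF rX W c] by metis
  \<comment> \<open>\<open>\<mu>\<close> is placed in the last column, where the vanishing condition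
    of \<open>lin_of_functionals\<close> is void.\<close>
  let ?l = "\<lambda>j. if j = n - 1 then \<mu> else (\<lambda>_. \<zero>)"
  let ?f = "\<lambda>x i j. if i \<le> j \<and> j < n then ?l j (eu 0 i \<odot>\<^bsub>X\<^esub> x) else \<zero>"
  have z: "lin A (rsA X) reg (\<lambda>_. \<zero>)" using lin_const_zero[OF regl] by simp
  have "lin T X regT ?f" by (rule lin_of_functionals[OF Xl]) (use \<mu>(1) z in auto)
  moreover have "?f x \<noteq> \<zero>\<^bsub>regT\<^esub>"
  proof
    assume eq: "?f x = \<zero>\<^bsub>regT\<^esub>"
    from fun_cong[OF fun_cong[OF eq]] have "?f x i (n - 1) = \<zero>\<^bsub>regT\<^esub> i (n - 1)" .
    then have "?f x i (n - 1) = \<zero>" by (simp add: T_simps(3))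
    moreover have "i \<le> n - 1" "n - 1 < n" using i(1) by auto
    ultimately show False using \<mu>(2) by simp
  qed
  ultimately show "\<exists>f. lin T X regT f \<and> f x \<noteq> \<zero>\<^bsub>regT\<^esub>" by blast
qed

text \<open>\<open>mono\<close> says that \<open>Q/Y\<close> is monic. The functional for column
  \<open>j\<close> must agree with \<open>f\<close> on \<open>Y\<close> and vanish on
  \<open>eu 0 i Q\<close> for \<open>i > j\<close>. These demands are compatible: if
  \<open>eu 0 i q\<close> is in \<open>Y\<close>, so is \<open>eu i i q\<close>, and the value of
  \<open>f\<close> there is upper triangular, with entry zero at \<open>(i, j)\<close>.\<close>

lemma extend_to_T:
  fixes Q :: "(nat \<Rightarrow> nat \<Rightarrow> 'a, 'x) module"
  assumes Q: "fg_module T Q" and Y: "submodule Y T Q"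
    and mono: "\<And>i q. i < n \<Longrightarrow> q \<in> carrier Q \<Longrightarrow> eu 0 i \<odot>\<^bsub>Q\<^esub> q \<in> Y \<Longrightarrow> eu i i \<odot>\<^bsub>Q\<^esub> q \<in> Y"
    and f: "lin T (Q\<lparr>carrier := Y\<rparr>) regT f"
  obtains g where "lin T Q regT g" "\<And>y. y \<in> Y \<Longrightarrow> g y = f y"
proof -
  have Ql: "left_module T Q" using Q by (rule fg_left_module)
  interpret Q: left_module T Q by (rule Ql)
  have rQ: "left_module A (rsA Q)" using S.left_module_rs[OF Ql] .
  interpret rQ: left_module A "rsA Q" by (rule rQ)
  have rY: "submodule Y A (rsA Q)" using S.submodule_rs[OF Ql Y] .
  note Ys = submoduleD[OF Y]
  have fT: "f y \<in> carrier T" if "y \<in> Y" for y using lin_mem[OF f, of y] that by simp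
  have fe: "f (eu i j \<odot>\<^bsub>Q\<^esub> y) k l = (if k = i then f y j l else \<zero>)" if "y \<in> Y" "i \<le> j" "j < n" for i j k l y
    using lin_smult_eu[OF f, of y i j] that eu_mult[of i j "f y" k l] fT[OF that(1)] by simp
  \<comment> \<open>For \<open>i > j\<close> the image of \<open>eu 0 i\<close> is contained in that
    of \<open>eu 0 (Suc j)\<close>, so one submodule carries all vanishing conditions for column
    \<open>j\<close>; the last column has none.\<close>
  define Z where "Z j = (if Suc j < n then (\<lambda>q. eu 0 (Suc j) \<odot>\<^bsub>Q\<^esub> q) ` carrier Q else {\<zero>\<^bsub>Q\<^esub>})" for j
  have Z: "submodule (Z j) A (rsA Q)" for j
    using submodule_image[OF rQ rQ lin_eu[OF Ql, of 0 "Suc j"] submodule_carrier[OF rQ]] submodule_zero[OF rQ] by (simp add: Z_def)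
  have th: "lin A ((rsA Q)\<lparr>carrier := Y\<rparr>) reg (\<lambda>y. f y 0 j)" for j
    using lin_comp[OF S.lin_rs[OF f] lin_entry[of 0 j]] by (simp add: lin_def)
  have van: "f y 0 j = \<zero>" if y: "y \<in> Y" "y \<in> Z j" and j: "j < n" for y j
  proof (cases "Suc j < n")
    case True
    then obtain q where q: "q \<in> carrier Q" "y = eu 0 (Suc j) \<odot>\<^bsub>Q\<^esub> q" using y(2) by (auto simp: Z_def)
    let ?q = "eu (Suc j) (Suc j) \<odot>\<^bsub>Q\<^esub> q"
    have qY: "?q \<in> Y" using mono[OF True q(1)] y(1) q(2) by simp
    have "y = eu 0 (Suc j) \<odot>\<^bsub>Q\<^esub> ?q" using smult_eu_eu[OF Ql q(1), of 0 "Suc j" "Suc j"] True q(2) by simp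
    then have "f y 0 j = f ?q (Suc j) j" using fe[OF qY, of 0 "Suc j" 0 j] True by simp
    then show ?thesis using T_entry_zero[OF fT[OF qY], of "Suc j" j] by simp
  next
    case False
    then have "y = \<zero>\<^bsub>Q\<^esub>" using y(2) by (simp add: Z_def)
    then have "f y = \<zero>\<^bsub>T\<^esub>" using lin_zero[OF left_module_sub[OF Ql Y] left_module_regular[OF ring_T] f] by simp
    then show ?thesis by (simp add: T_simps)
  qed
  have "\<exists>\<mu>. lin A (rsA Q) reg \<mu> \<and> (\<forall>y\<in>Y. \<mu> y = f y 0 j) \<and> (\<forall>z\<in>Z j. \<mu> z = \<zero>)" if j: "j < n" for j
  proof -
    have "fin_len A (rsA Q) (carrier (rsA Q))" using fin_len_rsA[OF Q] by simp
    from self_injective_extend[OF si rQ this rY Z th van[OF _ _ j]] show ?thesis by metis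
  qed
  then obtain \<mu> where \<mu>: "\<And>j. j < n \<Longrightarrow> lin A (rsA Q) reg (\<mu> j)" "\<And>j y. j < n \<Longrightarrow> y \<in> Y \<Longrightarrow> \<mu> j y = f y 0 j"
    "\<And>j z. j < n \<Longrightarrow> z \<in> Z j \<Longrightarrow> \<mu> j z = \<zero>" by metis
  let ?g = "\<lambda>q i j. if i \<le> j \<and> j < n then \<mu> j (eu 0 i \<odot>\<^bsub>Q\<^esub> q) else \<zero>"
  have "lin T Q regT ?g"
  proof (rule lin_of_functionals[OF Ql \<mu>(1)])
    fix i j x assume ij: "j < i" "i < n" and x: "x \<in> carrier Q"
    have "eu 0 i \<odot>\<^bsub>Q\<^esub> x = eu 0 (Suc j) \<odot>\<^bsub>Q\<^esub> (eu (Suc j) i \<odot>\<^bsub>Q\<^esub> x)" using smult_eu_eu[OF Ql x, of 0 "Suc j" i] ij by simp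
    moreover have "eu (Suc j) i \<odot>\<^bsub>Q\<^esub> x \<in> carrier Q" using eu_T[of "Suc j" i] ij x by simp
    ultimately have "eu 0 i \<odot>\<^bsub>Q\<^esub> x \<in> Z j" using ij by (auto simp: Z_def)
    then show "\<mu> j (eu 0 i \<odot>\<^bsub>Q\<^esub> x) = \<zero>" using \<mu>(3) ij by simp
  qed
  moreover have "?g y = f y" if y: "y \<in> Y" for y
  proof (intro ext)
    fix i j
    show "?g y i j = f y i j"
    proof (cases "i \<le> j \<and> j < n")
      case True
      have "eu 0 i \<odot>\<^bsub>Q\<^esub> y \<in> Y" using Ys(6)[OF eu_T[of 0 i] y] True by simp
      then show ?thesis using \<mu>(2)[of j "eu 0 i \<odot>\<^bsub>Q\<^esub> y"] fe[OF y, of 0 i 0 j] True by simp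
    next
      case False
      then show ?thesis using T_entry_zero[OF fT[OF y], of i j] by auto
    qed
  qed
  ultimately show ?thesis using that by blast
qed

end

section \<open>Gorenstein-projective modules from short exact sequences\<close>

text \<open>A short exact sequence \<open>0 -> Y -> P -> Z -> 0\<close> with \<open>P\<close>
  projective that stays exact under \<open>Hom(-, R)\<close>, which is surjectivity of
  \<open>Hom(P, R) -> Hom(Y, R)\<close>.\<close>

definition gp_step ::
    "('r, 'a) ring_scheme \<Rightarrow> 'r fgmod \<Rightarrow> 'r fgmod \<Rightarrow> 'r fgmod \<Rightarrow> ((nat \<Rightarrow> 'r) set \<Rightarrow> (nat \<Rightarrow> 'r) set) \<Rightarrow>
     ((nat \<Rightarrow> 'r) set \<Rightarrow> (nat \<Rightarrow> 'r) set) \<Rightarrow> bool" where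
  "gp_step R Y P Z i q \<longleftrightarrow> proj_module R P \<and> lin R Y P i \<and> inj_on i (carrier Y) \<and> lin R P Z q \<and> q ` carrier P = carrier Z \<and>
     i ` carrier Y = {x \<in> carrier P. q x = \<zero>\<^bsub>Z\<^esub>} \<and>
     (\<forall>f. lin R Y (regular_module R) f \<longrightarrow> (\<exists>g. lin R P (regular_module R) g \<and> (\<forall>y\<in>carrier Y. g (i y) = f y)))"

text \<open>Dependent choice is applied twice, forwards and backwards from \<open>x\<close>, and the
  two sequences are joined at 0.\<close>

lemma int_indexed_chain:
  assumes "C x" "\<And>x. C x \<Longrightarrow> \<exists>y. C y \<and> S x y" "\<And>y. C y \<Longrightarrow> \<exists>x. C x \<and> S x y"
  shows "\<exists>Z :: int \<Rightarrow> 'x. Z 0 = x \<and> (\<forall>k. C (Z k)) \<and> (\<forall>k. S (Z k) (Z (k + 1)))"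
proof -
  have "\<exists>F :: nat \<Rightarrow> 'x. \<forall>m. (C (F m) \<and> (m = 0 \<longrightarrow> F m = x)) \<and> S (F m) (F (Suc m))"
    by (rule dependent_nat_choice) (use assms(1,2) in blast)+
  then obtain F where F: "F 0 = x" "\<And>m. C (F m)" "\<And>m. S (F m) (F (Suc m))" by auto
  have "\<exists>G :: nat \<Rightarrow> 'x. \<forall>m. (C (G m) \<and> (m = 0 \<longrightarrow> G m = x)) \<and> S (G (Suc m)) (G m)"
    by (rule dependent_nat_choice) (use assms(1,3) in blast)+
  then obtain G where G: "G 0 = x" "\<And>m. C (G m)" "\<And>m. S (G (Suc m)) (G m)" by auto
  define Z where "Z k = (if 0 \<le> k then F (nat k) else G (nat (- k)))" for k :: int
  have "S (Z k) (Z (k + 1))" for k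
  proof (cases "0 \<le> k")
    case True
    then have "nat (k + 1) = Suc (nat k)" by simp
    then show ?thesis using True F(3)[of "nat k"] by (simp add: Z_def)
  next
    case False
    then have s: "nat (- k) = Suc (nat (- (k + 1)))" by simp
    have "Z (k + 1) = G (nat (- (k + 1)))" using False F(1) G(1) by (cases "k = -1") (simp_all add: Z_def)
    then show ?thesis using False G(3)[of "nat (- (k + 1))"] s by (simp add: Z_def)
  qed
  moreover have "Z 0 = x" "\<And>k. C (Z k)" using F G by (simp_all add: Z_def)
  ultimately show ?thesis by blast
qed

lemma gorenstein_projective_of_steps:
  fixes R :: "('r, 'a) ring_scheme" and X :: "'r fgmod"
  assumes X: "C X" and fg: "\<And>X :: 'r fgmod. C X \<Longrightarrow> fg_module R X"
    and right: "\<And>Y :: 'r fgmod. C Y \<Longrightarrow> \<exists>P Z i q. C Z \<and> gp_step R Y P Z i q"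
    and left: "\<And>Z :: 'r fgmod. C Z \<Longrightarrow> \<exists>Y P i q. C Y \<and> gp_step R Y P Z i q"
  shows "gorenstein_projective R X"
proof -
  have "\<exists>Z :: int \<Rightarrow> 'r fgmod. Z 0 = X \<and> (\<forall>k. C (Z k)) \<and> (\<forall>k. \<exists>P i q. gp_step R (Z k) P (Z (k + 1)) i q)"
    by (rule int_indexed_chain[of C X "\<lambda>Y Z. \<exists>P i q. gp_step R Y P Z i q", OF X]) (use right left in blast)+
  then obtain Z :: "int \<Rightarrow> 'r fgmod" where Z: "Z 0 = X" "\<And>k. C (Z k)" "\<forall>k. \<exists>P i q. gp_step R (Z k) P (Z (k + 1)) i q" by blast
  obtain P i q where s: "\<And>k. gp_step R (Z k) (P k) (Z (k + 1)) (i k) (q k)" using Z(3) by metis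
  have P: "proj_module R (P k)" and il: "lin R (Z k) (P k) (i k)" and ii: "inj_on (i k) (carrier (Z k))"
    and ql: "lin R (P k) (Z (k + 1)) (q k)" and qs: "q k ` carrier (P k) = carrier (Z (k + 1))"
    and ex: "i k ` carrier (Z k) = {x \<in> carrier (P k). q k x = \<zero>\<^bsub>Z (k + 1)\<^esub>}"
    and ext: "\<forall>f. lin R (Z k) (regular_module R) f \<longrightarrow> (\<exists>g. lin R (P k) (regular_module R) g \<and> (\<forall>y\<in>carrier (Z k). g (i k y) = f y))" for k
    using s[of k, unfolded gp_step_def] by - (elim conjE, assumption)+
  have Zl: "left_module R (Z k)" for k using fg[OF Z(2)] by (rule fg_left_module)
  have Pl: "left_module R (P k)" for k using P by (auto simp: proj_module_def intro: fg_left_module)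
  have R: "ring R" using Zl[of 0] by (simp add: left_module_def)
  note reg = left_module_regular[OF R]
  have iz: "i k z = \<zero>\<^bsub>P k\<^esub> \<longleftrightarrow> z = \<zero>\<^bsub>Z k\<^esub>" if "z \<in> carrier (Z k)" for k z
    using that lin_inj_iff[OF Zl Pl il] ii lin_zero[OF Zl Pl il] by blast
  \<comment> \<open>Splicing: the differential passes through \<open>Z (k + 1)\<close>, so its
    kernel is the image of \<open>Z k\<close> and its image is the image of
    \<open>Z (k + 1)\<close>.\<close>
  define d where "d k = restrict (\<lambda>x. i (k + 1) (q k x)) (carrier (P k))" for k
  have dl: "lin R (P k) (P (k + 1)) (\<lambda>x. i (k + 1) (q k x))" for k using lin_comp[OF ql il] .
  have dm: "d k \<in> mod_hom R (P k) (P (k + 1))" for k unfolding d_def using lin_restrict[OF Pl dl] .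
  have ker: "mod_ker (P k) (P (k + 1)) (d k) = i k ` carrier (Z k)" for k
    unfolding ex mod_ker_def using iz lin_mem[OF ql] by (auto simp: d_def)
  have im: "d k ` carrier (P k) = i (k + 1) ` carrier (Z (k + 1))" for k
    unfolding qs[symmetric] image_image by (simp add: d_def)
  have ker': "mod_ker (P (k + 1)) (P (k + 2)) (d (k + 1)) = i (k + 1) ` carrier (Z (k + 1))" for k
    using ker[of "k + 1"] by (simp add: add.assoc)
  have hom_exact: "(\<lambda>g. compose (carrier (P (k + 1))) g (d (k + 1))) ` mod_hom R (P (k + 2)) (regular_module R) =
      {f \<in> mod_hom R (P (k + 1)) (regular_module R). \<forall>x \<in> carrier (P k). f (d k x) = \<zero>\<^bsub>R\<^esub>}" (is "?L = ?R") for k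
  proof -
    let ?F = "regular_module R"
    have k2: "k + 1 + 1 = k + 2" by simp
    note d1 = mod_hom_lin[OF dm[of "k + 1", unfolded k2]]
    have dd: "d (k + 1) (d k x) = \<zero>\<^bsub>P (k + 2)\<^esub>" if "x \<in> carrier (P k)" for x
    proof -
      have "d k x \<in> mod_ker (P (k + 1)) (P (k + 2)) (d (k + 1))" unfolding ker' im[symmetric] using that by (rule imageI)
      then show ?thesis by (simp add: mod_ker_def)
    qed
    show ?thesis
    proof
      show "?L \<subseteq> ?R"
      proof
        fix f assume "f \<in> ?L"
        then obtain g where g: "g \<in> mod_hom R (P (k + 2)) ?F" "f = compose (carrier (P (k + 1))) g (d (k + 1))" by blast
        have "f \<in> mod_hom R (P (k + 1)) ?F" unfolding g(2) using mod_hom_compose[OF Pl d1 mod_hom_lin[OF g(1)]] .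
        moreover have "f (d k x) = \<zero>\<^bsub>R\<^esub>" if x: "x \<in> carrier (P k)" for x
          using mod_hom_mem[OF dm x] dd[OF x] lin_zero[OF Pl reg mod_hom_lin[OF g(1)]] by (simp add: g(2) compose_apply)
        ultimately show "f \<in> ?R" by blast
      qed
      show "?R \<subseteq> ?L"
      proof
        fix f assume "f \<in> ?R"
        then have f: "f \<in> mod_hom R (P (k + 1)) ?F" "\<And>x. x \<in> carrier (P k) \<Longrightarrow> f (d k x) = \<zero>\<^bsub>R\<^esub>" by auto
        have "f x = \<zero>\<^bsub>?F\<^esub>" if x: "x \<in> carrier (P (k + 1))" "q (k + 1) x = \<zero>\<^bsub>Z (k + 2)\<^esub>" for x
        proof -
          have "x \<in> d k ` carrier (P k)" unfolding im ex k2 using x by simp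
          then show ?thesis using f(2) by auto
        qed
        \<comment> \<open>\<open>f\<close> vanishes on the kernel of \<open>q (k + 1)\<close> and so
          descends to \<open>Z (k + 2)\<close>; the last clause of \<open>gp_step\<close> extends it
          to \<open>P (k + 2)\<close>.\<close>
        then obtain f' where f': "lin R (Z (k + 2)) ?F f'" "\<And>x. x \<in> carrier (P (k + 1)) \<Longrightarrow> f' (q (k + 1) x) = f x"
          using lin_factor_surj[OF Pl Zl reg ql[of "k + 1", unfolded k2] qs[of "k + 1", unfolded k2] mod_hom_lin[OF f(1)]] by metis
        obtain g where g: "lin R (P (k + 2)) ?F g" "\<And>y. y \<in> carrier (Z (k + 2)) \<Longrightarrow> g (i (k + 2) y) = f' y"
          using ext f'(1) by blast
        let ?g = "restrict g (carrier (P (k + 2)))"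
        have gm: "?g \<in> mod_hom R (P (k + 2)) ?F" using lin_restrict[OF Pl g(1)] .
        have "compose (carrier (P (k + 1))) ?g (d (k + 1)) = f"
        proof (rule mod_hom_eqI[OF mod_hom_compose[OF Pl d1 mod_hom_lin[OF gm]] f(1)])
          fix x assume x: "x \<in> carrier (P (k + 1))"
          have qx: "q (k + 1) x \<in> carrier (Z (k + 2))" using lin_mem[OF ql x] by (simp add: k2)
          have dx: "d (k + 1) x = i (k + 2) (q (k + 1) x)" using x by (simp add: d_def k2)
          show "compose (carrier (P (k + 1))) ?g (d (k + 1)) x = f x"
            using x dx lin_mem[OF il qx] g(2)[OF qx] f'(2)[OF x] by (simp add: compose_apply)
        qed
        then show "f \<in> ?L" using gm by blast
      qed
    qed
  qed
  have "complete_proj_resolution R P d"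
    unfolding complete_proj_resolution_def using P dm im ker' hom_exact by simp
  moreover have "mod_isomorphic R X ((P 0)\<lparr>carrier := mod_ker (P 0) (P 1) (d 0)\<rparr>)"
  proof -
    have K: "submodule (i 0 ` carrier (Z 0)) R (P 0)" using submodule_image[OF Zl Pl il submodule_carrier[OF Zl]] .
    have "lin R (Z 0) ((P 0)\<lparr>carrier := i 0 ` carrier (Z 0)\<rparr>) (i 0)" using lin_sub_cod[OF il[of 0]] by simp
    moreover have "bij_betw (i 0) (carrier (Z 0)) (carrier ((P 0)\<lparr>carrier := i 0 ` carrier (Z 0)\<rparr>))"
      using ii[of 0] by (simp add: bij_betw_def)
    ultimately have "mod_isomorphic R (Z 0) ((P 0)\<lparr>carrier := i 0 ` carrier (Z 0)\<rparr>)"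
      using isoMI_bij[OF Zl left_module_sub[OF Pl K]] mod_isomorphic_iff[OF Zl left_module_sub[OF Pl K]] by metis
    then show ?thesis using ker[of 0] Z(1) by simp
  qed
  ultimately show ?thesis using fg[OF X] unfolding gorenstein_projective_def by blast
qed

lemma gorenstein_projective_imp_torsionless:
  fixes G :: "'r fgmod"
  assumes "gorenstein_projective R G" shows "fg_module R G \<and> torsionless R G"
proof -
  have G: "fg_module R G" using assms by (simp add: gorenstein_projective_def)
  have Gl: "left_module R G" using G by (rule fg_left_module)
  have R: "ring R" using Gl by (simp add: left_module_def)
  obtain P\<^sub>0 :: "'r fgmod" and i where P: "left_module R P\<^sub>0" "addc R {regular_module R} P\<^sub>0" "lin R G P\<^sub>0 i" "inj_on i (carrier G)"
    using assms by (rule gorenstein_projective_kernelE)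
  have "torsionless R P\<^sub>0"
    by (rule cogenerated_addc[OF P(1) _ P(2)]) (use left_module_regular[OF R] torsionless_regular[OF R] in simp)
  then show ?thesis using G cogenerated_inj[OF Gl P(1,3,4)] by blast
qed

text \<open>Among the maps from \<open>Y\<close> to projective modules, one for which the maps \<open>Y \<rightarrow> R\<close> factoring through
  it form a maximal submodule of \<open>Hom(Y, R)\<close> is a left approximation.\<close>

lemma left_approximation_exists:
  fixes R :: "('r, 'a) ring_scheme" and Y :: "'r fgmod"
  assumes Y: "fg_module R Y" and flE: "fin_len (End_ring R (regular_module R)) (eval_module (regular_module R)) (carrier R)"
  obtains P :: "'r fgmod" and \<iota> where "fg_module R P" "addc R {regular_module R} P" "lin R Y P \<iota>"
    "\<And>f. lin R Y (regular_module R) f \<Longrightarrow> \<exists>g. lin R P (regular_module R) g \<and> (\<forall>y\<in>carrier Y. g (\<iota> y) = f y)"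
proof -
  have Yl: "left_module R Y" using Y by (rule fg_left_module)
  have R: "ring R" using Yl by (simp add: left_module_def)
  let ?F = "regular_module R"
  have F: "left_module R ?F" using left_module_regular[OF R] .
  interpret hf: hom_functor R ?F by (rule hom_functor.intro[OF F])
  have HY: "left_module hf.E (hf.H Y)" using hf.left_module_H[OF Yl] .
  obtain U :: "'r fgmod" and a b where U: "fg_module R U" "isoM R ?F U a b" using universe_copy[OF fg_regular[OF R]] .
  have Ul: "left_module R U" using U(1) by (rule fg_left_module)
  have aU: "addc R {?F} U" using addc_iso[OF F Ul U(2) addc_self[OF F]] by simp
  have ab: "lin R ?F U a" "lin R U ?F b" "\<And>x. x \<in> carrier R \<Longrightarrow> b (a x) = x" using U(2) by (auto simp: isoM_def)
  let ?P = "\<lambda>p :: 'r fgmod \<times> _. fg_module R (fst p) \<and> addc R {?F} (fst p) \<and> lin R Y (fst p) (snd p)"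
  let ?fac = "\<lambda>p :: 'r fgmod \<times> _. (\<lambda>g. compose (carrier Y) g (snd p)) ` mod_hom R (fst p) ?F"
  have fac: "submodule (?fac p) hf.E (hf.H Y)" if "?P p" for p
  proof -
    have l: "left_module R (fst p)" using that fg_left_module by blast
    show ?thesis
      using submodule_image[OF hf.left_module_H[OF l] HY hf.lin_precompose[OF l Yl, of "snd p"] submodule_carrier[OF hf.left_module_H[OF l]]] that by simp
  qed
  have flH: "fin_len hf.E (hf.H Y) (carrier (hf.H Y))" using hf.fin_len_H[OF Y] flE by simp
  have P0: "?P (U, \<lambda>y. \<zero>\<^bsub>U\<^esub>)" using U(1) aU lin_const_zero[OF Ul] by simp
  obtain p where p: "?P p" and max: "\<And>p'. ?P p' \<Longrightarrow> ?fac p \<subseteq> ?fac p' \<Longrightarrow> ?fac p' = ?fac p"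
    by (rule fin_len_max[OF flH submodule_carrier[OF HY], of ?P "(U, \<lambda>y. \<zero>\<^bsub>U\<^esub>)" ?fac]) (use P0 fac submoduleD(1)[OF fac] in auto)
  obtain P \<iota> where Pi: "p = (P, \<iota>)" by (cases p)
  have P: "fg_module R P" "addc R {?F} P" "lin R Y P \<iota>" using p Pi by auto
  have Pl: "left_module R P" using P(1) by (rule fg_left_module)
  have "\<exists>g. lin R P ?F g \<and> (\<forall>y\<in>carrier Y. g (\<iota> y) = f y)" if f: "lin R Y ?F f" for f
  proof -
    obtain Z :: "'r fgmod" and i\<^sub>1 i\<^sub>2 p\<^sub>1 p\<^sub>2 where Z: "fg_module R Z" "biprod R P U Z i\<^sub>1 i\<^sub>2 p\<^sub>1 p\<^sub>2"
      using biprod_exists[OF P(1) U(1)] .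
    have Zl: "left_module R Z" using Z(1) by (rule fg_left_module)
    have l: "lin R P Z i\<^sub>1" "lin R U Z i\<^sub>2" "lin R Z P p\<^sub>1" "lin R Z U p\<^sub>2" using Z(2) by (auto simp: biprod_def)
    \<comment> \<open>Adjoining \<open>f\<close> as a further component gives a map through which
      \<open>f\<close> and all the old maps factor; by maximality \<open>f\<close> factors through
      \<open>\<iota>\<close> already.\<close>
    let ?\<iota> = "\<lambda>y. i\<^sub>1 (\<iota> y) \<oplus>\<^bsub>Z\<^esub> i\<^sub>2 (a (f y))"
    have \<iota>': "lin R Y Z ?\<iota>" using lin_plus[OF Zl lin_comp[OF P(3) l(1)] lin_comp[OF lin_comp[OF f ab(1)] l(2)]] .
    have p12: "p\<^sub>1 (?\<iota> y) = \<iota> y" "p\<^sub>2 (?\<iota> y) = a (f y)" if y: "y \<in> carrier Y" for y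
    proof -
      interpret P: left_module R P by (rule Pl)
      interpret U: left_module R U by (rule Ul)
      have m: "\<iota> y \<in> carrier P" "a (f y) \<in> carrier U" using lin_mem[OF P(3) y] lin_mem[OF lin_comp[OF f ab(1)] y] by auto
      show "p\<^sub>1 (?\<iota> y) = \<iota> y" "p\<^sub>2 (?\<iota> y) = a (f y)"
        using m lin_mem[OF l(1)] lin_mem[OF l(2)] Z(2) lin_add[OF l(3)] lin_add[OF l(4)] by (simp_all add: biprod_def)
    qed
    have "?P (Z, ?\<iota>)" using Z(1) addc_biprod[OF Pl Ul Zl Z(2) P(2) aU] \<iota>' by simp
    moreover have "?fac p \<subseteq> ?fac (Z, ?\<iota>)"
    proof
      fix k assume "k \<in> ?fac p"
      then obtain g where g: "g \<in> mod_hom R P ?F" "k = compose (carrier Y) g \<iota>" using Pi by auto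
      have g': "compose (carrier Z) g p\<^sub>1 \<in> mod_hom R Z ?F" using mod_hom_compose[OF Zl l(3) mod_hom_lin[OF g(1)]] .
      have "k = compose (carrier Y) (compose (carrier Z) g p\<^sub>1) ?\<iota>"
        unfolding g(2) using p12(1) lin_mem[OF \<iota>'] by (auto simp: compose_def fun_eq_iff)
      then show "k \<in> ?fac (Z, ?\<iota>)" using g' by auto
    qed
    ultimately have eq: "?fac (Z, ?\<iota>) = ?fac p" by (rule max)
    have bp: "compose (carrier Z) b p\<^sub>2 \<in> mod_hom R Z ?F" using mod_hom_compose[OF Zl l(4) ab(2)] .
    have "restrict f (carrier Y) = compose (carrier Y) (compose (carrier Z) b p\<^sub>2) ?\<iota>"
      using p12(2) ab(3) lin_mem[OF f] lin_mem[OF \<iota>'] by (auto simp: compose_def fun_eq_iff)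
    then have "restrict f (carrier Y) \<in> ?fac (Z, ?\<iota>)" using bp by auto
    then obtain g where g: "g \<in> mod_hom R P ?F" "restrict f (carrier Y) = compose (carrier Y) g \<iota>" using eq Pi by auto
    have "g (\<iota> y) = f y" if "y \<in> carrier Y" for y using fun_cong[OF g(2), of y] that by (simp add: compose_apply)
    then show ?thesis using mod_hom_lin[OF g(1)] by blast
  qed
  then show ?thesis using that P by blast
qed

section \<open>Torsionless modules over triangular matrix rings\<close>

context tri_ring
begin

text \<open>\<open>Y\<close> is a copy of the kernel of a surjection from a projective module. That
  \<open>Z\<close> is monic is the hypothesis \<open>mono\<close> of \<open>extend_to_T\<close>,
  which supplies exactness under \<open>Hom(-, T)\<close>.\<close>

lemma torsionless_left_step:
  fixes Z :: "(nat \<Rightarrow> nat \<Rightarrow> 'a) fgmod"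
  assumes Z: "fg_module T Z" "torsionless T Z"
  shows "\<exists>Y P i q. (fg_module T Y \<and> torsionless T Y) \<and> gp_step T Y P Z i q"
proof -
  note regT = left_module_regular[OF ring_T]
  have Zl: "left_module T Z" using Z(1) by (rule fg_left_module)
  obtain P :: "(nat \<Rightarrow> nat \<Rightarrow> 'a) fgmod" and q where P: "fg_module T P" "addc T {regT} P" "lin T P Z q" "q ` carrier P = carrier Z"
    using projective_cover_exists[OF Z(1)] .
  have Pl: "left_module T P" using P(1) by (rule fg_left_module)
  interpret P: left_module T P by (rule Pl)
  have Pt: "torsionless T P" by (rule cogenerated_addc[OF Pl _ P(2)]) (use regT torsionless_regular[OF ring_T] in simp)
  let ?K = "{x \<in> carrier P. q x = \<zero>\<^bsub>Z\<^esub>}"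
  have K: "submodule ?K T P" using submodule_kernel[OF Pl Zl P(3) submodule_carrier[OF Pl]] .
  have Kl: "left_module T (P\<lparr>carrier := ?K\<rparr>)" using left_module_sub[OF Pl K] .
  have flP: "fin_len T P (carrier P)" using S.fin_len_of_rs[OF Pl fin_len_rsA[OF P(1)]] .
  obtain Y :: "(nat \<Rightarrow> nat \<Rightarrow> 'a) fgmod" and f g where Y: "fg_module T Y" "isoM T (P\<lparr>carrier := ?K\<rparr>) Y f g"
    using universe_copy[OF fg_of_fin_len'[OF Pl K flP]] .
  have Yl: "left_module T Y" using Y(1) by (rule fg_left_module)
  have fg: "lin T (P\<lparr>carrier := ?K\<rparr>) Y f" "lin T Y P g" "inj_on g (carrier Y)" "g ` carrier Y = ?K" "\<And>y. y \<in> carrier Y \<Longrightarrow> f (g y) = y"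
    using Y(2) isoM_bij[OF isoM_sym[OF Y(2)]] lin_of_sub_cod[OF _ K] by (auto simp: isoM_def bij_betw_def)
  have "torsionless T Y" using cogenerated_inj[OF Yl Pl fg(2,3) Pt] .
  moreover have "gp_step T Y P Z g q"
    unfolding gp_step_def proj_module_iff
  proof (intro conjI allI impI)
    fix h assume h: "lin T Y regT h"
    have hf: "lin T (P\<lparr>carrier := ?K\<rparr>) regT (\<lambda>x. h (f x))" using lin_comp[OF fg(1) h] .
    have mono: "eu i i \<odot>\<^bsub>P\<^esub> x \<in> ?K" if "i < n" "x \<in> carrier P" "eu 0 i \<odot>\<^bsub>P\<^esub> x \<in> ?K" for i x
    proof -
      have "eu 0 i \<odot>\<^bsub>Z\<^esub> q x = \<zero>\<^bsub>Z\<^esub>" using lin_smult_eu[OF P(3) that(2), of 0 i] that by simp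
      then have "eu i i \<odot>\<^bsub>Z\<^esub> q x = \<zero>\<^bsub>Z\<^esub>" using torsionless_imp_monic[OF Zl Z(2)] that(1) lin_mem[OF P(3) that(2)] unfolding monic_def by blast
      then show ?thesis using lin_smult_eu[OF P(3) that(2), of i i] that eu_T[of i i] by simp
    qed
    obtain e where e: "lin T P regT e" "\<And>y. y \<in> ?K \<Longrightarrow> e y = h (f y)"
    proof (rule extend_to_T[OF P(1) K mono hf])
      fix e assume "lin T P regT e" "\<And>y. y \<in> ?K \<Longrightarrow> e y = h (f y)"
      then show thesis by (rule that)
    qed
    have "e (g y) = h y" if "y \<in> carrier Y" for y
    proof -
      have "g y \<in> ?K" unfolding fg(4)[symmetric] using that by (rule imageI)
      then show ?thesis using e(2)[of "g y"] fg(5)[OF that] by simp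
    qed
    then show "\<exists>e. lin T P regT e \<and> (\<forall>y\<in>carrier Y. e (g y) = h y)" using e(1) by blast
  qed (use P fg in auto)
  ultimately show ?thesis using Y(1) by blast
qed

text \<open>The approximation is injective because \<open>Y\<close> is torsionless, and
  \<open>Z\<close> is its cokernel. For \<open>Z\<close> to be monic, let
  \<open>eu 0 i x = \<iota> y\<close>: the extension property forces \<open>y = eu 0 i y'\<close>
  for some \<open>y'\<close>, and \<open>P\<close> being monic, applied to
  \<open>x - \<iota> y'\<close>, puts \<open>eu i i x\<close> into the image of
  \<open>\<iota>\<close>.\<close>

lemma torsionless_right_step:
  fixes Y :: "(nat \<Rightarrow> nat \<Rightarrow> 'a) fgmod"
  assumes Y: "fg_module T Y" "torsionless T Y" and flE: "fin_len (End_ring T regT) (eval_module regT) (carrier T)"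
  shows "\<exists>P Z i q. (fg_module T Z \<and> torsionless T Z) \<and> gp_step T Y P Z i q"
proof -
  note regT = left_module_regular[OF ring_T]
  have Yl: "left_module T Y" using Y(1) by (rule fg_left_module)
  obtain P :: "(nat \<Rightarrow> nat \<Rightarrow> 'a) fgmod" and \<iota> where P: "fg_module T P" "addc T {regT} P" "lin T Y P \<iota>"
    and ext: "\<And>f. lin T Y regT f \<Longrightarrow> \<exists>g. lin T P regT g \<and> (\<forall>y\<in>carrier Y. g (\<iota> y) = f y)"
    using left_approximation_exists[OF Y(1) flE] by metis
  have Pl: "left_module T P" using P(1) by (rule fg_left_module)
  interpret P: left_module T P by (rule Pl)
  interpret Y: left_module T Y by (rule Yl)
  have Pt: "torsionless T P" by (rule cogenerated_addc[OF Pl _ P(2)]) (use regT torsionless_regular[OF ring_T] in simp)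
  have inj: "inj_on \<iota> (carrier Y)"
    unfolding lin_inj_iff[OF Yl Pl P(3)]
  proof (intro ballI impI, rule ccontr)
    fix y assume y: "y \<in> carrier Y" "\<iota> y = \<zero>\<^bsub>P\<^esub>" "y \<noteq> \<zero>\<^bsub>Y\<^esub>"
    obtain f where f: "lin T Y regT f" "f y \<noteq> \<zero>\<^bsub>regT\<^esub>" using Y(2) y(1,3) unfolding cogenerated_def by blast
    obtain g where "lin T P regT g" "\<forall>y\<in>carrier Y. g (\<iota> y) = f y" using ext[OF f(1)] by blast
    then show False using f(2) y lin_zero[OF Pl regT] by metis
  qed
  have I: "submodule (\<iota> ` carrier Y) T P" using submodule_image[OF Yl Pl P(3) submodule_carrier[OF Yl]] .
  obtain Z :: "(nat \<Rightarrow> nat \<Rightarrow> 'a) fgmod" and q where Z: "left_module T Z" "lin T P Z q" "q ` carrier P = carrier Z"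
    "\<And>x. x \<in> carrier P \<Longrightarrow> q x = \<zero>\<^bsub>Z\<^esub> \<longleftrightarrow> x \<in> \<iota> ` carrier Y" using quotient_exists[OF Pl I] by metis
  have fgZ: "fg_module T Z" using fg_surj[OF P(1) Z(1-3)] .
  have rY: "left_module A (rsA Y)" using S.left_module_rs[OF Yl] .
  have "monic Z"
    unfolding monic_def
  proof (intro allI impI ballI)
    fix i z assume i: "i < n" and z: "z \<in> carrier Z" "eu 0 i \<odot>\<^bsub>Z\<^esub> z = \<zero>\<^bsub>Z\<^esub>"
    obtain x where x: "x \<in> carrier P" "z = q x" using z(1) unfolding Z(3)[symmetric] by blast
    show "eu i i \<odot>\<^bsub>Z\<^esub> z = \<zero>\<^bsub>Z\<^esub>"
    proof (cases "i = 0")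
      case True
      then show ?thesis using z(2) by simp
    next
      case False
      have e0x: "eu 0 i \<odot>\<^bsub>P\<^esub> x \<in> carrier P" and eix: "eu i i \<odot>\<^bsub>P\<^esub> x \<in> carrier P" using eu_T i x(1) by simp_all
      have "q (eu 0 i \<odot>\<^bsub>P\<^esub> x) = \<zero>\<^bsub>Z\<^esub>" using lin_smult_eu[OF Z(2) x(1), of 0 i] i z(2) x(2) by simp
      then obtain y where y: "y \<in> carrier Y" "eu 0 i \<odot>\<^bsub>P\<^esub> x = \<iota> y" using Z(4)[OF e0x] by blast
      \<comment> \<open>\<open>y\<close> lies in the piece of index 0, so that \<open>?f y\<close>
        below has the value \<open>\<mu> y\<close> itself in row 0.\<close>
      have y00: "eu 0 0 \<odot>\<^bsub>Y\<^esub> y = y"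
      proof (rule inj_onD[OF inj _ _ y(1)])
        show "\<iota> (eu 0 0 \<odot>\<^bsub>Y\<^esub> y) = \<iota> y"
          using lin_smult_eu[OF P(3) y(1), of 0 0] n y(2)[symmetric] smult_eu_eu[OF Pl x(1), of 0 0 i] i by simp
        show "eu 0 0 \<odot>\<^bsub>Y\<^esub> y \<in> carrier Y" using eu_T[of 0 0] n y(1) by simp
      qed
      let ?N = "(\<lambda>y. eu 0 i \<odot>\<^bsub>Y\<^esub> y) ` carrier Y"
      have N: "submodule ?N A (rsA Y)"
        using submodule_image[OF rY rY lin_eu[OF Yl, of 0 i] submodule_carrier[OF rY]] i by simp
      have "y \<in> ?N"
      proof (rule ccontr)
        assume no: "y \<notin> ?N"
        have yr: "y \<in> carrier (rsA Y)" and flY: "fin_len A (rsA Y) (carrier (rsA Y))" using y(1) fin_len_rsA[OF Y(1)] by simp_all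
        obtain \<mu> where \<mu>: "lin A (rsA Y) reg \<mu>" "\<And>u. u \<in> ?N \<Longrightarrow> \<mu> u = \<zero>" "\<mu> y \<noteq> \<zero>"
          using cogenerator[OF rY flY N yr no] by metis
        \<comment> \<open>In column \<open>i - 1\<close> the vanishing condition concerns
          \<open>eu 0 k\<close> with \<open>k \<ge> i\<close>, whose images lie in
          \<open>?N\<close>, while the entry of that column in row \<open>i\<close> is just below
          the diagonal.\<close>
        let ?l = "\<lambda>j. if j = i - 1 then \<mu> else (\<lambda>_. \<zero>)"
        let ?f = "\<lambda>x i j. if i \<le> j \<and> j < n then ?l j (eu 0 i \<odot>\<^bsub>Y\<^esub> x) else \<zero>"
        have z0: "lin A (rsA Y) reg (\<lambda>_. \<zero>)" using lin_const_zero[OF regl] by simp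
        have f: "lin T Y regT ?f"
        proof (rule lin_of_functionals[OF Yl])
          show "lin A (rsA Y) reg (?l j)" for j using \<mu>(1) z0 by simp
          fix k j u assume kj: "j < k" "k < n" and u: "u \<in> carrier Y"
          show "?l j (eu 0 k \<odot>\<^bsub>Y\<^esub> u) = \<zero>"
          proof (cases "j = i - 1")
            case True
            then have ik: "i \<le> k" using kj by simp
            have "eu 0 k \<odot>\<^bsub>Y\<^esub> u = eu 0 i \<odot>\<^bsub>Y\<^esub> (eu i k \<odot>\<^bsub>Y\<^esub> u)" using smult_eu_eu[OF Yl u, of 0 i k] ik kj by simp
            moreover have "eu i k \<odot>\<^bsub>Y\<^esub> u \<in> carrier Y" using eu_T[OF ik kj(2)] u by simp
            ultimately have "eu 0 k \<odot>\<^bsub>Y\<^esub> u \<in> ?N" by blast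
            then show ?thesis using \<mu>(2) by simp
          qed simp
        qed
        obtain g where g: "lin T P regT g" "\<And>y. y \<in> carrier Y \<Longrightarrow> g (\<iota> y) = ?f y" using ext[OF f] by blast
        have gx: "g x \<in> carrier T" using lin_mem[OF g(1) x(1)] by simp
        \<comment> \<open>The extension \<open>g\<close> sends \<open>eu 0 i x\<close> to row
          \<open>i\<close> of \<open>g x\<close> moved to row 0, and the entry of that row in column
          \<open>i - 1\<close> is zero because \<open>g x\<close> is upper triangular.\<close>
        have "?f y 0 (i - 1) = g (eu 0 i \<odot>\<^bsub>P\<^esub> x) 0 (i - 1)" using g(2)[OF y(1)] y(2) by simp
        also have "\<dots> = (eu 0 i \<otimes>\<^bsub>T\<^esub> g x) 0 (i - 1)" using lin_smult_eu[OF g(1) x(1), of 0 i] i by simp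
        also have "\<dots> = g x i (i - 1)" using eu_mult[of 0 i "g x" 0 "i - 1"] i gx by simp
        also have "\<dots> = \<zero>" by (rule T_entry_zero[OF gx]) (use False in auto)
        finally have "?f y 0 (i - 1) = \<zero>" .
        moreover have "i - 1 < n" using i by simp
        ultimately show False using \<mu>(3) y00 by simp
      qed
      then obtain y' where y': "y' \<in> carrier Y" "y = eu 0 i \<odot>\<^bsub>Y\<^esub> y'" by blast
      let ?w = "x \<ominus>\<^bsub>P\<^esub> \<iota> y'"
      have \<iota>y': "\<iota> y' \<in> carrier P" using lin_mem[OF P(3) y'(1)] .
      have sm: "eu k i \<odot>\<^bsub>P\<^esub> ?w = eu k i \<odot>\<^bsub>P\<^esub> x \<ominus>\<^bsub>P\<^esub> eu k i \<odot>\<^bsub>P\<^esub> \<iota> y'" if "k \<le> i" for k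
        using that x(1) \<iota>y' eu_T[OF that i] by (simp add: P.M.minus_eq P.smult_r_distr P.smult_r_minus)
      have "eu 0 i \<odot>\<^bsub>P\<^esub> \<iota> y' = eu 0 i \<odot>\<^bsub>P\<^esub> x" using lin_smult_eu[OF P(3) y'(1), of 0 i] i y(2) y'(2) by simp
      then have "eu 0 i \<odot>\<^bsub>P\<^esub> ?w = \<zero>\<^bsub>P\<^esub>" using sm[of 0] e0x by (simp add: P.diff_eq_zero_iff)
      then have "eu i i \<odot>\<^bsub>P\<^esub> ?w = \<zero>\<^bsub>P\<^esub>" using torsionless_imp_monic[OF Pl Pt] i x(1) \<iota>y' unfolding monic_def by simp
      then have "eu i i \<odot>\<^bsub>P\<^esub> x = eu i i \<odot>\<^bsub>P\<^esub> \<iota> y'" using sm[of i] eix eu_T[of i i] i \<iota>y' by (simp add: P.diff_eq_zero_iff)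
      also have "\<dots> = \<iota> (eu i i \<odot>\<^bsub>Y\<^esub> y')" using lin_smult_eu[OF P(3) y'(1), of i i] i by simp
      finally have "eu i i \<odot>\<^bsub>P\<^esub> x \<in> \<iota> ` carrier Y" using eu_T[of i i] i y'(1) by simp
      then have "q (eu i i \<odot>\<^bsub>P\<^esub> x) = \<zero>\<^bsub>Z\<^esub>" using Z(4)[OF eix] by simp
      then show ?thesis using lin_smult_eu[OF Z(2) x(1), of i i] i x(2) by simp
    qed
  qed
  then have "torsionless T Z" by (rule monic_imp_torsionless[OF fgZ])
  moreover have "gp_step T Y P Z \<iota> q"
    unfolding gp_step_def proj_module_iff
  proof (intro conjI allI impI)
    show "\<iota> ` carrier Y = {x \<in> carrier P. q x = \<zero>\<^bsub>Z\<^esub>}" using Z(4) lin_mem[OF P(3)] by blast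
  qed (use P Z inj ext in auto)
  ultimately show ?thesis using fgZ by blast
qed

lemma gorenstein_projective_T_iff:
  fixes G :: "(nat \<Rightarrow> nat \<Rightarrow> 'a) fgmod"
  assumes flE: "fin_len (End_ring T regT) (eval_module regT) (carrier T)"
  shows "gorenstein_projective T G \<longleftrightarrow> fg_module T G \<and> torsionless T G"
proof
  assume "fg_module T G \<and> torsionless T G"
  then show "gorenstein_projective T G"
  proof (rule gorenstein_projective_of_steps[of "\<lambda>X. fg_module T X \<and> torsionless T X"])
    show "\<exists>P Z i q. (fg_module T Z \<and> torsionless T Z) \<and> gp_step T Y P Z i q" if "fg_module T Y \<and> torsionless T Y" for Y
      using torsionless_right_step[OF _ _ flE, of Y] that by blast
    show "\<exists>Y P i q. (fg_module T Y \<and> torsionless T Y) \<and> gp_step T Y P Z i q" if "fg_module T Z \<and> torsionless T Z" for Z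
      using torsionless_left_step[of Z] that by blast
  qed blast
qed (rule gorenstein_projective_imp_torsionless)

end

section \<open>Artin algebras\<close>

text \<open>\<open>K\<close> acts on \<open>A\<close> through the central elements
  \<open>k 1\<close>. Since \<open>K\<close> has finite length over itself, so has every finitely
  generated \<open>K\<close>-module, in particular \<open>A\<close>.\<close>

lemma artin_algebra_scalars:
  fixes K :: "'k ring" and A :: "('k, 'a) module"
  assumes "artin_algebra K A"
  defines "\<phi> \<equiv> \<lambda>k. k \<odot>\<^bsub>A\<^esub> \<one>\<^bsub>A\<^esub>"
  shows "scalars K A \<phi>" "\<And>k x. k \<in> carrier K \<Longrightarrow> x \<in> carrier A \<Longrightarrow> \<phi> k \<otimes>\<^bsub>A\<^esub> x = x \<otimes>\<^bsub>A\<^esub> \<phi> k"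
    "fin_len K (restrict_scalars \<phi> (regular_module A)) (carrier A)"
proof -
  have artK: "artinian_cring K" and A: "ring A" and m: "Module.module K A" and fg: "fin_gen K A"
    and al: "\<And>c x y. c \<in> carrier K \<Longrightarrow> x \<in> carrier A \<Longrightarrow> y \<in> carrier A \<Longrightarrow>
        (c \<odot>\<^bsub>A\<^esub> x) \<otimes>\<^bsub>A\<^esub> y = c \<odot>\<^bsub>A\<^esub> (x \<otimes>\<^bsub>A\<^esub> y) \<and> x \<otimes>\<^bsub>A\<^esub> (c \<odot>\<^bsub>A\<^esub> y) = c \<odot>\<^bsub>A\<^esub> (x \<otimes>\<^bsub>A\<^esub> y)"
    using assms(1) unfolding artin_algebra_def by auto
  interpret A: ring A by (rule A)
  interpret m: Module.module K A by (rule m)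
  have Kr: "ring K" ..
  have lK: "left_module K A"
    by unfold_locales (auto simp: m.smult_l_distr m.smult_r_distr m.smult_assoc1)
  have \<phi>m: "\<phi> k \<otimes>\<^bsub>A\<^esub> x = k \<odot>\<^bsub>A\<^esub> x" "x \<otimes>\<^bsub>A\<^esub> \<phi> k = k \<odot>\<^bsub>A\<^esub> x" if "k \<in> carrier K" "x \<in> carrier A" for k x
    using al[of k "\<one>\<^bsub>A\<^esub>" x] al[of k x "\<one>\<^bsub>A\<^esub>"] that by (simp_all add: \<phi>_def)
  have "\<phi> \<in> ring_hom K A"
  proof (rule ring_hom_memI)
    fix k l assume k: "k \<in> carrier K" and l: "l \<in> carrier K"
    show "\<phi> k \<in> carrier A" using k by (simp add: \<phi>_def)
    show "\<phi> (k \<oplus>\<^bsub>K\<^esub> l) = \<phi> k \<oplus>\<^bsub>A\<^esub> \<phi> l" using k l by (simp add: \<phi>_def m.smult_l_distr)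
    show "\<phi> (k \<otimes>\<^bsub>K\<^esub> l) = \<phi> k \<otimes>\<^bsub>A\<^esub> \<phi> l" using \<phi>m(1)[OF k, of "\<phi> l"] k l by (simp add: \<phi>_def m.smult_assoc1)
  next
    show "\<phi> \<one>\<^bsub>K\<^esub> = \<one>\<^bsub>A\<^esub>" by (simp add: \<phi>_def)
  qed
  then show sc: "scalars K A \<phi>" using scalars.intro[OF Kr A] by blast
  show "\<phi> k \<otimes>\<^bsub>A\<^esub> x = x \<otimes>\<^bsub>A\<^esub> \<phi> k" if "k \<in> carrier K" "x \<in> carrier A" for k x using \<phi>m[OF that] by simp
  interpret scalars K A \<phi> by (rule sc)
  note regA = left_module_regular[OF A]
  have fgA: "fg_module K A" using lK fg by (simp add: fg_module_def)
  obtain P :: "'k fgmod" and g where P: "fg_module K P" "addc K {regular_module K} P" "lin K P A g" "g ` carrier P = carrier A"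
    using projective_cover_exists[OF fgA] .
  have "fin_len K P (carrier P)"
    by (rule fin_len_addc[OF fg_left_module[OF P(1)] _ P(2)]) (use left_module_regular[OF Kr] artinian_cring_fin_len[OF artK] in auto)
  then have flA: "fin_len K A (carrier A)" using fin_len_surj[OF fg_left_module[OF P(1)] lK P(3,4)] by blast
  have "lin K (rs (regular_module A)) A (\<lambda>x. x)" using \<phi>m(1) by (simp add: lin_def)
  then show "fin_len K (rs (regular_module A)) (carrier A)"
    using fin_len_inj[OF left_module_rs[OF regA] lK _ _ flA] by simp
qed

theorem corollary5p2:
  fixes K :: "'k ring" and A :: "('k, 'a) module" and n :: nat
  assumes "artin_algebra K A" and "self_injective A" and "n \<ge> 2"
  shows "CM_finite (upper_triangular_ring n A) \<longleftrightarrow>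
    (\<exists>M. mod_generator (upper_triangular_ring n A) M \<and>
         gorenstein_projective (upper_triangular_ring n A) M \<and>
         gl_dim (End_ring (upper_triangular_ring n A) M) \<le> 2)"
proof -
  define \<phi> where "\<phi> = (\<lambda>k. k \<odot>\<^bsub>A\<^esub> \<one>\<^bsub>A\<^esub>)"
  note art = artin_algebra_scalars[OF assms(1), folded \<phi>_def]
  interpret KA: scalars K A \<phi> by (rule art(1))
  have flA: "fin_len A (regular_module A) (carrier A)"
    using KA.fin_len_of_rs[OF left_module_regular[OF KA.R] art(3)] .
  interpret tri_ring A n
    using assms(2,3) flA by (simp add: tri_ring_def selfinj_ring_def selfinj_ring_axioms_def tri_ring_axioms_def KA.R)
  note regTl = left_module_regular[OF ring_T]
  \<comment> \<open>Length is measured over \<open>K\<close> rather than over \<open>A\<close>: the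
    scalar matrices coming from \<open>K\<close> are central in \<open>T\<close>, as required for
    passing to endomorphism rings, whereas \<open>A\<close> may be noncommutative.\<close>
  interpret KT: scalars K T "\<lambda>k. sc (\<phi> k)"
    by (rule scalars.intro[OF KA.K ring_T])
      (use ring_hom_trans[OF KA.hom sc_hom] in \<open>simp add: comp_def\<close>)
  have central: "sc (\<phi> k) \<otimes>\<^bsub>T\<^esub> X = X \<otimes>\<^bsub>T\<^esub> sc (\<phi> k)" if k: "k \<in> carrier K" and X: "X \<in> carrier T" for k X
    using sc_mult[OF ring_hom_closed[OF KA.hom k] X] mult_sc[OF ring_hom_closed[OF KA.hom k] X] art(2)[OF k T_entry[OF X]]
    by (intro ext) (simp add: \<phi>_def)
  have flKT: "fin_len K (KT.rs regT) (carrier T)"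
  proof (rule fin_len_jointly_inj[of K "KT.rs regT" "{..<n} \<times> {..<n}" "\<lambda>_. KA.rs reg" "\<lambda>(i, j) X. X i j"])
    show l: "left_module K (KT.rs regT)" using KT.left_module_rs[OF regTl] .
    show "submodule (carrier T) K (KT.rs regT)" using submodule_carrier[OF l] by simp
    have "lin K (KT.rs regT) (KA.rs reg) (\<lambda>X. X i j)" for i j
      using sc_mult[OF ring_hom_closed[OF KA.hom]] by (auto simp: lin_def T_entry T_simps(4))
    then show "left_module K (KA.rs reg) \<and> lin K (KT.rs regT) (KA.rs reg) (case s of (i, j) \<Rightarrow> \<lambda>X. X i j) \<and>
        fin_len K (KA.rs reg) (carrier (KA.rs reg))" for s
      using KA.left_module_rs[OF regl] art(3) by (cases s) simp
    fix X assume X: "X \<in> carrier T" "\<forall>s\<in>{..<n} \<times> {..<n}. (case s of (i, j) \<Rightarrow> \<lambda>X. X i j) X = \<zero>\<^bsub>KA.rs reg\<^esub>"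
    have "X i j = \<zero>\<^bsub>A\<^esub>" for i j using X T_entry_zero[OF X(1), of i j] by (cases "i < n \<and> j < n") auto
    then show "X = \<zero>\<^bsub>KT.rs regT\<^esub>" by (auto simp: T_simps fun_eq_iff)
  qed simp
  have flE: "fin_len (End_ring T regT) (eval_module regT) (carrier T)"
    using KT.fin_len_eval[OF regTl _ central] flKT by simp
  have flM: "fin_len (End_ring T M) (eval_module M) (carrier M)" if "fg_module T M" for M :: "(nat \<Rightarrow> nat \<Rightarrow> 'a) fgmod"
    using KT.fin_len_eval[OF fg_left_module[OF that] KT.fin_len_rs[OF that flKT] central] by blast
  have flT: "fin_len T regT (carrier T)" using KT.fin_len_of_rs[OF regTl flKT] .
  show ?thesis
    by (rule CM_finite_iff_of_torsionless[OF ring_T flT flM gorenstein_projective_T_iff[OF flE]])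
qed

end
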